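(* Let $(\mathcal F,\mathcal D,U,\Omega)$ be a (potentially non-unitary) Möbius-covariant Wightman CFT on $S^1$ with invariant nondegenerate Hermitian form and antiunitary PCT operator $\theta$ (an involutive Wightman CFT). Then the algebras $\mathcal Q(I)=\mathcal P(I)''$ (double commutant in $\operatorname{End}_*(\mathcal D)$), indexed by intervals $I\subset S^1$, form a Haag dual Möbius-covariant net of subalgebras of $\operatorname{End}_*(\mathcal D)$. That is, they form a Möbius-covariant net of algebras and $\mathcal Q(I')=\mathcal Q(I)'$ for every interval $I$.
   Context: **Wightman CFTs.** $S^1\subset\mathbb C$ is the unit circle and $C^\infty(S^1)$ is the space of complex-valued smooth functions, with the Fréchet topology of the norms $\|f\|_{C^N}=\sum_{j=0}^N\|\frac{d^j}{d\theta^j}f\|_\infty$. An interval is an open, connected, nonempty, non-dense subset of $S^1$; $I'$ denotes the interior of the complement of $I$. $\mathrm{Mob}=\mathrm{PSU}(1,1)$ is the group of holomorphic automorphisms of the unit disk (acting on $S^1$), and $r_\theta\in\mathrm{Mob}$ is rotation by $\theta$. For $\gamma\in\mathrm{Mob}$ put $X_\gamma(e^{i\theta})=-i\frac{d}{d\theta}\log\gamma(e^{i\theta})$, and for $d\in\mathbb Z_{\ge0}$ put $(\beta_d(\gamma)f)(z)=X_\gamma(\gamma^{-1}(z))^{d-1}f(\gamma^{-1}(z))$. Let $\mathcal D$ be a complex vector space. An operator-valued distribution with domain $\mathcal D$ is a linear map $\varphi$ from $C^\infty(S^1)$ to the linear operators on $\mathcal D$. Let $\mathcal F$ be a set of these.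 A linear functional $\lambda:\mathcal D\to\mathbb C$ is compatible with $\mathcal F$ if $(f_1,\dots,f_k)\mapsto\lambda(\varphi_1(f_1)\cdots\varphi_k(f_k)\Phi)$ is jointly continuous on $C^\infty(S^1)^k$ for all $k$, $\varphi_j\in\mathcal F$, $\Phi\in\mathcal D$; $\mathcal D_{\mathcal F}^*$ is the space of such functionals. $\mathcal F$ acts regularly if $\mathcal D_{\mathcal F}^*$ separates points of $\mathcal D$. The $\mathcal F$-strong topology on $\mathcal D$ is the finest locally convex topology for which all maps $(f_1,\dots,f_k)\mapsto\varphi_1(f_1)\cdots\varphi_k(f_k)\Phi$ are jointly continuous. $\mathcal D$ carries this topology, and $\operatorname{End}(\mathcal D)$ denotes the continuous linear operators on $\mathcal D$. A Möbius-covariant Wightman CFT on $S^1$ is $(\mathcal F,\mathcal D,U,\Omega)$ with $\mathcal F$ acting regularly on $\mathcal D$, $U:\mathrm{Mob}\to\operatorname{End}(\mathcal D)$ a representation, $0\ne\Omega\in\mathcal D$, such that: (W1) each $\varphi\in\mathcal F$ has a conformal dimension $d_\varphi\in\mathbb Z_{\ge0}$ with $U(\gamma)\varphi(f)U(\gamma)^{-1}=\varphi(\beta_{d_\varphi}(\gamma)f)$ for all $\gamma,f$; (W2) $\varphi_1(f),\varphi_2(g)$ commute if $f,g$ have disjoint supports, $\varphi_1,\varphi_2\in\mathcal F$; (W3) if $d\in\mathbb Z$, $d<0$ and $U(r_\theta)\Phi=e^{id\theta}\Phi$ for all $\theta$, then $\Phi=0$; (W4) $\Omega$ is $U$-invariant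 and $\mathcal D$ is algebraically spanned by the vectors $\varphi_1(f_1)\cdots\varphi_k(f_k)\Omega$. For an interval $I$, $\mathcal P(I)\subset\operatorname{End}(\mathcal D)$ is the unital algebra generated by the $\varphi(f)$ with $\varphi\in\mathcal F$, $\operatorname{supp}f\subset I$. **Involutive theories.** The CFT is involutive if it is equipped with a nondegenerate, jointly $\mathcal F$-strongly continuous Hermitian form $\langle\cdot,\cdot\rangle$ on $\mathcal D$ (linear in the first variable) and a PCT operator $\theta$, i.e. an antiunitary involution $\theta:\mathcal D\to\mathcal D$ (antilinear, $\theta^2=1$, $\langle\theta\Phi,\theta\Psi\rangle=\overline{\langle\Phi,\Psi\rangle}$) with $\theta\Omega=\Omega$, such that the form is invariant: $\langle\varphi(f)\Phi,\Psi\rangle=\langle\Phi,\varphi^\dagger(\overline f)\Psi\rangle$ for all $\Phi,\Psi\in\mathcal D$, $\varphi\in\mathcal F$, $f\in C^\infty(S^1)$, where $\varphi^\dagger(f):=(-1)^{d_\varphi}\theta\varphi(\overline f\circ z^{-1})\theta$ (with $f\circ z^{-1}$ the function $z\mapsto f(z^{-1})$) and $(-1)^{d_\varphi}\varphi^\dagger\in\mathcal F$; and $\langle U(\gamma)\Phi,U(\gamma)\Psi\rangle=\langle\Phi,\Psi\rangle$ for all $\gamma\in\mathrm{Mob}$. $\operatorname{End}_*(\mathcal D)$ is the $*$-algebra of $x\in\operatorname{End}(\mathcal D)$ having an adjoint $x^*\in\operatorname{End}(\mathcal D)$, $\langle x\Phi,\Psi\rangle=\langle\Phi,x^*\Psi\rangle$.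 Each $\mathcal P(I)$ is a $*$-subalgebra of $\operatorname{End}_*(\mathcal D)$. For $S\subset\operatorname{End}_*(\mathcal D)$, $S'$ denotes the commutant of $S$ in $\operatorname{End}_*(\mathcal D)$. **Nets.** A Möbius-covariant net of algebras (with respect to $\mathcal D,U,\Omega$) is a family of unital $*$-subalgebras $\mathcal Q(I)\subset\operatorname{End}_*(\mathcal D)$, $I$ ranging over intervals, with: isotony ($I_1\subseteq I_2\Rightarrow\mathcal Q(I_1)\subseteq\mathcal Q(I_2)$); Möbius covariance ($U(\gamma)\mathcal Q(I)U(\gamma)^{-1}=\mathcal Q(\gamma(I))$); locality ($\mathcal Q(I)$ and $\mathcal Q(I')$ commute); vacuum ($\Omega$ is fixed by $\mathrm{Mob}$ and $\mathcal Q(I)\Omega$ is dense in $\mathcal D$ for each $I$). It is Haag dual if $\mathcal Q(I)'=\mathcal Q(I')$ for all $I$. *)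

theory Defs
  imports "HOL-Analysis.Analysis"
begin

section \<open>The unit circle\<close>

typedef circle = "sphere (0::complex) 1"
  morphisms of_circle Circle
  by (rule exI[of _ 1]) simp

instantiation circle :: metric_space
begin

definition dist_circle :: "circle \<Rightarrow> circle \<Rightarrow> real"
  where "dist_circle z w = dist (of_circle z) (of_circle w)"

definition uniformity_circle :: "(circle \<times> circle) filter"
  where "uniformity_circle = (INF e\<in>{0<..}. principal {(x, y). dist x y < e})"

definition open_circle :: "circle set \<Rightarrow> bool"
  where "open_circle U \<longleftrightarrow> (\<forall>x\<in>U. \<forall>\<^sub>F (x', y) in uniformity. x' = x \<longrightarrow> y \<in> U)"

instance
  by standard
    (auto simp: dist_circle_def uniformity_circle_def open_circle_def of_circle_inject
      intro: dist_triangle2)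

end

definition circ :: "real \<Rightarrow> circle"
  where "circ t = Circle (cis t)"

lemma of_circle_circ [simp]: "of_circle (circ t) = cis t"
  by (simp add: circ_def Circle_inverse)

definition circle_inv :: "circle \<Rightarrow> circle"
  where "circle_inv z = Circle (inverse (of_circle z))"

lemma of_circle_inv [simp]: "of_circle (circle_inv z) = inverse (of_circle z)"
  using of_circle[of z] by (simp add: circle_inv_def Circle_inverse norm_inverse)

definition interval :: "circle set \<Rightarrow> bool"
  where "interval I \<longleftrightarrow> open I \<and> connected I \<and> I \<noteq> {} \<and> closure I \<noteq> UNIV"

definition compl_interval :: "circle set \<Rightarrow> circle set"
  where "compl_interval I = interior (- I)"


section \<open>Smooth functions on the circle\<close>

definition theta_deriv :: "nat \<Rightarrow> (circle \<Rightarrow> complex) \<Rightarrow> real \<Rightarrow> complex"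
  where "theta_deriv j f = ((\<lambda>g t. vector_derivative g (at t)) ^^ j) (\<lambda>t. f (circ t))"

definition smooth_functions :: "(circle \<Rightarrow> complex) set"
  where "smooth_functions = {f. \<forall>j t. theta_deriv j f differentiable at t}"

definition C_norm :: "nat \<Rightarrow> (circle \<Rightarrow> complex) \<Rightarrow> real"
  where "C_norm N f = (\<Sum>j\<le>N. SUP t. norm (theta_deriv j f t))"

definition smooth_topology :: "(circle \<Rightarrow> complex) topology"
  where "smooth_topology = topology_generated_by
    {{g \<in> smooth_functions. C_norm N (\<lambda>z. g z - f z) < e} |f N e. f \<in> smooth_functions \<and> e > 0}"

lemma topspace_smooth_topology [simp]: "topspace smooth_topology = smooth_functions"
proof -
  have "C_norm 0 (\<lambda>z. f z - f z) < 1" for f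
    by (simp add: C_norm_def theta_deriv_def)
  then have "f \<in> {g \<in> smooth_functions. C_norm 0 (\<lambda>z. g z - f z) < 1}"
    if "f \<in> smooth_functions" for f
    using that by simp
  then show ?thesis
    unfolding smooth_topology_def topology_generated_by_topspace
    using zero_less_one by blast
qed

definition supp :: "(circle \<Rightarrow> complex) \<Rightarrow> circle set"
  where "supp f = closure {z. f z \<noteq> 0}"


section \<open>The Moebius group\<close>

definition Mob :: "(circle \<Rightarrow> circle) set"
  where "Mob = {\<gamma>. \<exists>a b. (cmod a)\<^sup>2 - (cmod b)\<^sup>2 = 1 \<and>
    (\<forall>z. of_circle (\<gamma> z) = (a * of_circle z + b) / (cnj b * of_circle z + cnj a))}"

definition rot :: "real \<Rightarrow> circle \<Rightarrow> circle"
  where "rot t z = Circle (cis t * of_circle z)"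

text \<open>
  The derivative of \<open>log \<gamma>(e\<^sup>i\<^sup>t)\<close> is the logarithmic derivative, which needs no choice of a
  branch; by periodicity it depends on \<open>t\<close> only through the point \<open>e\<^sup>i\<^sup>t\<close>, so that evaluating
  at the principal argument is no restriction.
\<close>

definition X_mob :: "(circle \<Rightarrow> circle) \<Rightarrow> circle \<Rightarrow> complex"
  where "X_mob \<gamma> z =
    - \<i> * (vector_derivative (\<lambda>t. of_circle (\<gamma> (circ t))) (at (Arg (of_circle z)))
            / of_circle (\<gamma> z))"

definition beta :: "nat \<Rightarrow> (circle \<Rightarrow> circle) \<Rightarrow> (circle \<Rightarrow> complex) \<Rightarrow> circle \<Rightarrow> complex"
  where "beta d \<gamma> f z = X_mob \<gamma> (inv \<gamma> z) powi (int d - 1) * f (inv \<gamma> z)"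


section \<open>Operator-valued distributions and the strong topology\<close>

text \<open>
  The complex vector space is a type \<open>'v\<close> together with a scalar multiplication \<open>s\<close> satisfying
  \<open>vector_space s\<close>.  A distribution is a function on the set of smooth functions; extensionality
  fixes its irrelevant values elsewhere, so that equality of distributions is equality on
  smooth functions.
\<close>

type_synonym 'v distribution = "(circle \<Rightarrow> complex) \<Rightarrow> 'v \<Rightarrow> 'v"

definition op_distribution ::
    "(complex \<Rightarrow> 'v \<Rightarrow> 'v) \<Rightarrow> 'v::ab_group_add distribution \<Rightarrow> bool"
  where "op_distribution s \<phi> \<longleftrightarrow>
    \<phi> \<in> extensional smooth_functions \<and>
    (\<forall>f\<in>smooth_functions. Vector_Spaces.linear s s (\<phi> f)) \<and>
    (\<forall>f\<in>smooth_functions. \<forall>g\<in>smooth_functions. \<forall>v. \<phi> (\<lambda>z. f z + g z) v = \<phi> f v + \<phi> g v) \<and>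
    (\<forall>c. \<forall>f\<in>smooth_functions. \<forall>v. \<phi> (\<lambda>z. c * f z) v = s c (\<phi> f v))"

text \<open>
  \<open>apply_fields [\<phi>\<^sub>0, \<dots>, \<phi>\<^sub>k] f v\<close> is \<open>\<phi>\<^sub>0(f 0) (\<dots> (\<phi>\<^sub>k(f k) v))\<close>; the tuple of test functions
  ranges over the product of \<open>length \<phi>s\<close> copies of the space of smooth functions.
\<close>

definition apply_fields ::
    "'v distribution list \<Rightarrow> (nat \<Rightarrow> circle \<Rightarrow> complex) \<Rightarrow> 'v \<Rightarrow> 'v"
  where "apply_fields \<phi>s f v = foldr (\<lambda>i. (\<phi>s ! i) (f i)) [0..<length \<phi>s] v"

abbreviation tuple_topology :: "nat \<Rightarrow> (nat \<Rightarrow> circle \<Rightarrow> complex) topology"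
  where "tuple_topology k \<equiv> product_topology (\<lambda>_. smooth_topology) {..<k}"

definition compatible_functionals ::
    "(complex \<Rightarrow> 'v \<Rightarrow> 'v) \<Rightarrow> 'v::ab_group_add distribution set \<Rightarrow> ('v \<Rightarrow> complex) set"
  where "compatible_functionals s F =
    {l. Vector_Spaces.linear s (*) l \<and>
      (\<forall>\<phi>s v. set \<phi>s \<subseteq> F \<longrightarrow>
        continuous_map (tuple_topology (length \<phi>s)) euclidean (\<lambda>f. l (apply_fields \<phi>s f v)))}"

definition acts_regularly ::
    "(complex \<Rightarrow> 'v \<Rightarrow> 'v) \<Rightarrow> 'v::ab_group_add distribution set \<Rightarrow> bool"
  where "acts_regularly s F \<longleftrightarrow>
    (\<forall>v w. v \<noteq> w \<longrightarrow> (\<exists>l\<in>compatible_functionals s F. l v \<noteq> l w))"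

definition locally_convex_topology ::
    "(complex \<Rightarrow> 'v \<Rightarrow> 'v) \<Rightarrow> 'v::ab_group_add topology \<Rightarrow> bool"
  where "locally_convex_topology s T \<longleftrightarrow>
    topspace T = UNIV \<and>
    continuous_map (prod_topology T T) T (\<lambda>(v, w). v + w) \<and>
    continuous_map (prod_topology euclidean T) T (\<lambda>(c, v). s c v) \<and>
    (\<forall>W. openin T W \<and> 0 \<in> W \<longrightarrow>
      (\<exists>V\<subseteq>W. openin T V \<and> 0 \<in> V \<and>
        (\<forall>v\<in>V. \<forall>w\<in>V. \<forall>u\<in>{0..1::real}. s (of_real u) v + s (of_real (1 - u)) w \<in> V)))"

definition fields_continuous :: "'v distribution set \<Rightarrow> 'v topology \<Rightarrow> bool"
  where "fields_continuous F T \<longleftrightarrow>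
    (\<forall>\<phi>s v. set \<phi>s \<subseteq> F \<longrightarrow>
      continuous_map (tuple_topology (length \<phi>s)) T (\<lambda>f. apply_fields \<phi>s f v))"

text \<open>
  The finest locally convex topology making the fields continuous is constructed as the supremum
  of all such topologies; lemma \<open>strong_topology_finest\<close> confirms that it is one of them.
\<close>

definition strong_topology ::
    "(complex \<Rightarrow> 'v \<Rightarrow> 'v) \<Rightarrow> 'v::ab_group_add distribution set \<Rightarrow> 'v topology"
  where "strong_topology s F = topology_generated_by
    {W. \<exists>T. locally_convex_topology s T \<and> fields_continuous F T \<and> openin T W}"

lemma topspace_strong_topology [simp]: "topspace (strong_topology s F) = UNIV"
proof -
  define Ind where "Ind = topology (\<lambda>W::'a set. W = {} \<or> W = UNIV)"
  have "istopology (\<lambda>W::'a set. W = {} \<or> W = UNIV)"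
    unfolding istopology_def by blast
  then have openin_Ind: "openin Ind W \<longleftrightarrow> W = {} \<or> W = UNIV" for W
    by (simp add: Ind_def topology_inverse')
  have top_Ind: "topspace Ind = UNIV"
    using openin_subset[of Ind UNIV] by (simp add: openin_Ind top.extremum_unique)
  have cont: "continuous_map X Ind h \<longleftrightarrow> True" for X h
    by (auto simp: continuous_map_def top_Ind openin_Ind)
  have cont2: "continuous_map X Ind h \<longleftrightarrow> True" for X :: "('a \<times> 'a) topology" and h
    by (auto simp: continuous_map_def top_Ind openin_Ind)
  have cont3: "continuous_map X Ind h \<longleftrightarrow> True" for X :: "(complex \<times> 'a) topology" and h
    by (auto simp: continuous_map_def top_Ind openin_Ind)
  have "locally_convex_topology s Ind"
    unfolding locally_convex_topology_def cont2 cont3 by (auto simp: top_Ind openin_Ind)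
  moreover have "fields_continuous F Ind"
    unfolding fields_continuous_def by (simp add: cont)
  ultimately have "\<exists>T. locally_convex_topology s T \<and> fields_continuous F T \<and> openin T UNIV"
    using openin_Ind by blast
  then show ?thesis
    unfolding strong_topology_def topology_generated_by_topspace by blast
qed

lemma continuous_map_into_strong_topology:
  assumes "\<And>T. locally_convex_topology s T \<Longrightarrow> fields_continuous F T \<Longrightarrow> continuous_map X T h"
  shows "continuous_map X (strong_topology s F) h"
  unfolding strong_topology_def
proof (rule continuous_on_generated_topo)
  show "h ` topspace X \<subseteq>
      \<Union>{W. \<exists>T. locally_convex_topology s T \<and> fields_continuous F T \<and> openin T W}"
    using topspace_strong_topology[of s F]
    unfolding strong_topology_def topology_generated_by_topspace by simp
  fix W assume "W \<in> {W. \<exists>T. locally_convex_topology s T \<and> fields_continuous F T \<and> openin T W}"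
  then obtain T where T: "locally_convex_topology s T" "fields_continuous F T" "openin T W"
    by blast
  then show "openin X (h -` W \<inter> topspace X)"
    using assms[OF T(1,2)] by (simp add: continuous_map_alt)
qed

lemma strong_topology_finest:
  shows "locally_convex_topology s (strong_topology s F)"
    and "fields_continuous F (strong_topology s F)"
    and "\<And>T W. locally_convex_topology s T \<Longrightarrow> fields_continuous F T \<Longrightarrow> openin T W
      \<Longrightarrow> openin (strong_topology s F) W"
proof -
  let ?S = "{W. \<exists>T. locally_convex_topology s T \<and> fields_continuous F T \<and> openin T W}"
  let ?T = "strong_topology s F"
  let ?conv = "\<lambda>V. \<forall>v\<in>V. \<forall>w\<in>V. \<forall>u\<in>{0..1::real}. s (of_real u) v + s (of_real (1 - u)) w \<in> V"
  show finer: "openin ?T W"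
    if "locally_convex_topology s T" "fields_continuous F T" "openin T W" for T W
    unfolding strong_topology_def using that by (intro topology_generated_by_Basis) blast
  have id_cont: "continuous_map ?T T id"
    if "locally_convex_topology s T" "fields_continuous F T" for T
    using finer[OF that] that(1) by (auto simp: continuous_map_def locally_convex_topology_def)
  show "fields_continuous F ?T"
    unfolding fields_continuous_def
    by (intro allI impI continuous_map_into_strong_topology) (simp add: fields_continuous_def)
  have add: "continuous_map (prod_topology ?T ?T) ?T (\<lambda>(v, w). v + w)"
  proof (rule continuous_map_into_strong_topology)
    fix T assume T: "locally_convex_topology s T" "fields_continuous F T"
    have "continuous_map (prod_topology ?T ?T) (prod_topology T T) (\<lambda>(v, w). (id v, id w))"
      by (rule continuous_map_prod_top[THEN iffD2]) (use id_cont[OF T] in blast)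
    moreover have "continuous_map (prod_topology T T) T (\<lambda>(v, w). v + w)"
      using T(1) by (simp add: locally_convex_topology_def)
    ultimately have "continuous_map (prod_topology ?T ?T) T
        ((\<lambda>(v, w). v + w) \<circ> (\<lambda>(v, w). (id v, id w)))"
      by (rule continuous_map_compose)
    then show "continuous_map (prod_topology ?T ?T) T (\<lambda>(v, w). v + w)"
      by (simp add: comp_def case_prod_unfold)
  qed
  have mult: "continuous_map (prod_topology euclidean ?T) ?T (\<lambda>(c, v). s c v)"
  proof (rule continuous_map_into_strong_topology)
    fix T assume T: "locally_convex_topology s T" "fields_continuous F T"
    have "continuous_map (prod_topology euclidean ?T) (prod_topology euclidean T)
        (\<lambda>(c, v). (id c, id v))"
      by (rule continuous_map_prod_top[THEN iffD2]) (use id_cont[OF T] continuous_map_id in blast)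
    moreover have "continuous_map (prod_topology euclidean T) T (\<lambda>(c, v). s c v)"
      using T(1) by (simp add: locally_convex_topology_def)
    ultimately have "continuous_map (prod_topology euclidean ?T) T
        ((\<lambda>(c, v). s c v) \<circ> (\<lambda>(c, v). (id c, id v)))"
      by (rule continuous_map_compose)
    then show "continuous_map (prod_topology euclidean ?T) T (\<lambda>(c, v). s c v)"
      by (simp add: comp_def case_prod_unfold)
  qed
  have "\<exists>V\<subseteq>W. openin ?T V \<and> 0 \<in> V \<and> ?conv V" if "generate_topology_on ?S W" "0 \<in> W" for W
    using that
  proof (induction rule: generate_topology_on.induct)
    case Empty
    then show ?case by simp
  next
    case (Int a b)
    then obtain V V' where "V \<subseteq> a" "openin ?T V" "0 \<in> V" "?conv V"
      and "V' \<subseteq> b" "openin ?T V'" "0 \<in> V'" "?conv V'" by auto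
    then show ?case by (intro exI[of _ "V \<inter> V'"]) auto
  next
    case (UN K)
    then obtain k where k: "k \<in> K" "0 \<in> k" by blast
    with UN.IH obtain V where "V \<subseteq> k" "openin ?T V" "0 \<in> V" "?conv V" by meson
    with k show ?case by (intro exI[of _ V]) auto
  next
    case (Basis W)
    then obtain T where T: "locally_convex_topology s T" "fields_continuous F T" "openin T W"
      by blast
    then obtain V where "V \<subseteq> W" "openin T V" "0 \<in> V" "?conv V"
      using Basis.prems unfolding locally_convex_topology_def by meson
    with finer[OF T(1,2)] show ?case by (intro exI[of _ V]) auto
  qed
  then have "\<exists>V\<subseteq>W. openin ?T V \<and> 0 \<in> V \<and> ?conv V" if "openin ?T W" "0 \<in> W" for W
    using that openin_topology_generated_by[of ?S W] unfolding strong_topology_def by blast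
  then show "locally_convex_topology s ?T"
    unfolding locally_convex_topology_def by (intro conjI add mult topspace_strong_topology) blast
qed


section \<open>Wightman conformal field theories\<close>

definition continuous_endos ::
    "(complex \<Rightarrow> 'v \<Rightarrow> 'v) \<Rightarrow> 'v::ab_group_add topology \<Rightarrow> ('v \<Rightarrow> 'v) set"
  where "continuous_endos s T = {x. Vector_Spaces.linear s s x \<and> continuous_map T T x}"

locale wightman_cft = vector_space s
  for s :: "complex \<Rightarrow> 'v::ab_group_add \<Rightarrow> 'v" +
  fixes F :: "'v distribution set"
    and cdim :: "'v distribution \<Rightarrow> nat"
    and U :: "(circle \<Rightarrow> circle) \<Rightarrow> 'v \<Rightarrow> 'v"
    and \<Omega> :: 'v
  assumes distributions: "\<phi> \<in> F \<Longrightarrow> op_distribution s \<phi>"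
    and regular: "acts_regularly s F"
    and U_endo: "\<gamma> \<in> Mob \<Longrightarrow> U \<gamma> \<in> continuous_endos s (strong_topology s F)"
    and U_id: "U id = id"
    and U_comp: "\<gamma> \<in> Mob \<Longrightarrow> \<delta> \<in> Mob \<Longrightarrow> U (\<gamma> \<circ> \<delta>) = U \<gamma> \<circ> U \<delta>"
    and vacuum_nonzero: "\<Omega> \<noteq> 0"
    and covariance: "\<gamma> \<in> Mob \<Longrightarrow> \<phi> \<in> F \<Longrightarrow> f \<in> smooth_functions
      \<Longrightarrow> U \<gamma> \<circ> \<phi> f \<circ> inv (U \<gamma>) = \<phi> (beta (cdim \<phi>) \<gamma> f)"
    and locality: "\<phi> \<in> F \<Longrightarrow> \<psi> \<in> F \<Longrightarrow> f \<in> smooth_functions \<Longrightarrow> g \<in> smooth_functions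
      \<Longrightarrow> supp f \<inter> supp g = {} \<Longrightarrow> \<phi> f \<circ> \<psi> g = \<psi> g \<circ> \<phi> f"
    and spectrum: "(d::int) < 0 \<Longrightarrow> (\<And>t. U (rot t) v = s (cis (of_int d * t)) v) \<Longrightarrow> v = 0"
    and vacuum_invariant: "\<gamma> \<in> Mob \<Longrightarrow> U \<gamma> \<Omega> = \<Omega>"
    and vacuum_cyclic: "span {apply_fields \<phi>s f \<Omega> |\<phi>s f.
      set \<phi>s \<subseteq> F \<and> (\<forall>i<length \<phi>s. f i \<in> smooth_functions)} = UNIV"

text \<open>The unital algebra generated by the fields smeared with test functions supported in \<open>I\<close>.\<close>

inductive_set local_algebra ::
    "(complex \<Rightarrow> 'v \<Rightarrow> 'v) \<Rightarrow> 'v::ab_group_add distribution set \<Rightarrow> circle set \<Rightarrow> ('v \<Rightarrow> 'v) set"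
  for s F I where
    field: "\<phi> \<in> F \<Longrightarrow> f \<in> smooth_functions \<Longrightarrow> supp f \<subseteq> I \<Longrightarrow> \<phi> f \<in> local_algebra s F I"
  | unit: "id \<in> local_algebra s F I"
  | add: "x \<in> local_algebra s F I \<Longrightarrow> y \<in> local_algebra s F I
      \<Longrightarrow> (\<lambda>v. x v + y v) \<in> local_algebra s F I"
  | scale: "x \<in> local_algebra s F I \<Longrightarrow> (\<lambda>v. s c (x v)) \<in> local_algebra s F I"
  | mult: "x \<in> local_algebra s F I \<Longrightarrow> y \<in> local_algebra s F I
      \<Longrightarrow> x \<circ> y \<in> local_algebra s F I"


section \<open>Involutive theories\<close>

text \<open>
  \<open>pct_adjoint s \<theta> d \<phi>\<close> is \<open>\<phi>\<^sup>\<dagger>\<close> for a field \<open>\<phi>\<close> of conformal dimension \<open>d\<close>.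
\<close>

definition pct_adjoint ::
    "(complex \<Rightarrow> 'v \<Rightarrow> 'v) \<Rightarrow> ('v \<Rightarrow> 'v) \<Rightarrow> nat \<Rightarrow> 'v distribution \<Rightarrow> 'v distribution"
  where "pct_adjoint s \<theta> d \<phi> =
    (\<lambda>f\<in>smooth_functions. \<lambda>v. s ((- 1) ^ d) (\<theta> (\<phi> (\<lambda>z. cnj (f (circle_inv z))) (\<theta> v))))"

locale involutive_wightman_cft = wightman_cft s F cdim U \<Omega>
  for s :: "complex \<Rightarrow> 'v::ab_group_add \<Rightarrow> 'v"
    and F :: "'v distribution set"
    and cdim :: "'v distribution \<Rightarrow> nat"
    and U :: "(circle \<Rightarrow> circle) \<Rightarrow> 'v \<Rightarrow> 'v"
    and \<Omega> :: 'v +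
  fixes B :: "'v \<Rightarrow> 'v \<Rightarrow> complex"
    and \<theta> :: "'v \<Rightarrow> 'v"
  assumes form_linear: "Vector_Spaces.linear s (*) (\<lambda>v. B v w)"
    and form_hermitian: "B w v = cnj (B v w)"
    and form_nondegenerate: "(\<And>w. B v w = 0) \<Longrightarrow> v = 0"
    and form_continuous: "continuous_map (prod_topology (strong_topology s F) (strong_topology s F))
      euclidean (\<lambda>(v, w). B v w)"
    and pct_add: "\<theta> (v + w) = \<theta> v + \<theta> w"
    and pct_scale: "\<theta> (s c v) = s (cnj c) (\<theta> v)"
    and pct_involution: "\<theta> (\<theta> v) = v"
    and pct_antiunitary: "B (\<theta> v) (\<theta> w) = cnj (B v w)"
    and pct_vacuum: "\<theta> \<Omega> = \<Omega>"
    and form_field_invariant: "\<phi> \<in> F \<Longrightarrow> f \<in> smooth_functions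
      \<Longrightarrow> B (\<phi> f v) w = B v (pct_adjoint s \<theta> (cdim \<phi>) \<phi> (\<lambda>z. cnj (f z)) w)"
    and pct_field: "\<phi> \<in> F \<Longrightarrow>
      (\<lambda>f\<in>smooth_functions. \<lambda>v. s ((- 1) ^ cdim \<phi>) (pct_adjoint s \<theta> (cdim \<phi>) \<phi> f v)) \<in> F"
    and form_Mob_invariant: "\<gamma> \<in> Mob \<Longrightarrow> B (U \<gamma> v) (U \<gamma> w) = B v w"


section \<open>Nets of algebras\<close>

definition is_adjoint :: "('v \<Rightarrow> 'v \<Rightarrow> complex) \<Rightarrow> ('v \<Rightarrow> 'v) \<Rightarrow> ('v \<Rightarrow> 'v) \<Rightarrow> bool"
  where "is_adjoint B x y \<longleftrightarrow> (\<forall>v w. B (x v) w = B v (y w))"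

definition star_endos ::
    "(complex \<Rightarrow> 'v \<Rightarrow> 'v) \<Rightarrow> 'v::ab_group_add topology \<Rightarrow> ('v \<Rightarrow> 'v \<Rightarrow> complex) \<Rightarrow> ('v \<Rightarrow> 'v) set"
  where "star_endos s T B =
    {x \<in> continuous_endos s T. \<exists>y\<in>continuous_endos s T. is_adjoint B x y}"

definition commutant :: "('v \<Rightarrow> 'v) set \<Rightarrow> ('v \<Rightarrow> 'v) set \<Rightarrow> ('v \<Rightarrow> 'v) set"
  where "commutant A S = {x \<in> A. \<forall>y\<in>S. x \<circ> y = y \<circ> x}"

text \<open>
  Adjoints are unique when the form is nondegenerate, so the last condition says that the algebra
  is closed under the adjoint operation.
\<close>

definition unital_star_subalgebra ::
    "(complex \<Rightarrow> 'v \<Rightarrow> 'v) \<Rightarrow> 'v::ab_group_add topology \<Rightarrow> ('v \<Rightarrow> 'v \<Rightarrow> complex)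
      \<Rightarrow> ('v \<Rightarrow> 'v) set \<Rightarrow> bool"
  where "unital_star_subalgebra s T B A \<longleftrightarrow>
    A \<subseteq> star_endos s T B \<and>
    id \<in> A \<and>
    (\<forall>x\<in>A. \<forall>y\<in>A. (\<lambda>v. x v + y v) \<in> A) \<and>
    (\<forall>c. \<forall>x\<in>A. (\<lambda>v. s c (x v)) \<in> A) \<and>
    (\<forall>x\<in>A. \<forall>y\<in>A. x \<circ> y \<in> A) \<and>
    (\<forall>x\<in>A. \<exists>y\<in>A. is_adjoint B x y)"

definition mobius_covariant_net ::
    "(complex \<Rightarrow> 'v \<Rightarrow> 'v) \<Rightarrow> 'v::ab_group_add topology \<Rightarrow> ('v \<Rightarrow> 'v \<Rightarrow> complex)
      \<Rightarrow> ((circle \<Rightarrow> circle) \<Rightarrow> 'v \<Rightarrow> 'v) \<Rightarrow> 'v \<Rightarrow> (circle set \<Rightarrow> ('v \<Rightarrow> 'v) set) \<Rightarrow> bool"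
  where "mobius_covariant_net s T B U \<Omega> Q \<longleftrightarrow>
    (\<forall>I. interval I \<longrightarrow> unital_star_subalgebra s T B (Q I)) \<and>
    (\<forall>I J. interval I \<and> interval J \<and> I \<subseteq> J \<longrightarrow> Q I \<subseteq> Q J) \<and>
    (\<forall>I. \<forall>\<gamma>\<in>Mob. interval I \<longrightarrow> (\<lambda>x. U \<gamma> \<circ> x \<circ> inv (U \<gamma>)) ` Q I = Q (\<gamma> ` I)) \<and>
    (\<forall>I. interval I \<longrightarrow> (\<forall>x\<in>Q I. \<forall>y\<in>Q (compl_interval I). x \<circ> y = y \<circ> x)) \<and>
    (\<forall>\<gamma>\<in>Mob. U \<gamma> \<Omega> = \<Omega>) \<and>
    (\<forall>I. interval I \<longrightarrow> T closure_of ((\<lambda>x. x \<Omega>) ` Q I) = UNIV)"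

definition haag_dual ::
    "(complex \<Rightarrow> 'v \<Rightarrow> 'v) \<Rightarrow> 'v::ab_group_add topology \<Rightarrow> ('v \<Rightarrow> 'v \<Rightarrow> complex)
      \<Rightarrow> (circle set \<Rightarrow> ('v \<Rightarrow> 'v) set) \<Rightarrow> bool"
  where "haag_dual s T B Q \<longleftrightarrow>
    (\<forall>I. interval I \<longrightarrow> commutant (star_endos s T B) (Q I) = Q (compl_interval I))"

definition bicommutant_net ::
    "(complex \<Rightarrow> 'v \<Rightarrow> 'v) \<Rightarrow> 'v::ab_group_add distribution set \<Rightarrow> ('v \<Rightarrow> 'v \<Rightarrow> complex)
      \<Rightarrow> circle set \<Rightarrow> ('v \<Rightarrow> 'v) set"
  where "bicommutant_net s F B I =
    (let E = star_endos s (strong_topology s F) B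
     in commutant E (commutant E (local_algebra s F I)))"

end

theory Submission
 imports Defs "HOL-Complex_Analysis.Complex_Analysis" "HOL-Probability.Probability"
begin

text \<open>Every interval is a Moebius image of the upper half circle \<open>I\<close>, so by covariance it suffices that the
 commutants of \<open>\<P>(I)\<close> and \<open>\<P>(I')\<close> commute with each other; duality is then formal. Let \<open>x\<close> and \<open>y\<close> commute
 with \<open>\<P>(I)\<close> and with \<open>\<P>(I')\<close>, respectively. In the coordinate of \<open>I\<close> in which the dilations are translations,
 take test functions that are entire. By positivity of the energy, a field so smeared and applied to the vacuum
 equals the field smeared with the reflection of the function shifted by \<open>i\<pi>\<close>. For a product \<open>a\<close> of such fields,
 locality and the PCT operator give \<open>\<langle>a\<Omega>, y\<Omega>\<rangle> = \<plusminus>\<langle>a'\<Omega>, \<theta>y\<^sup>*\<Omega>\<rangle>\<close> with all functions in \<open>a'\<close> shifted by \<open>i\<pi>\<close>, and the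
 same relation for \<open>x\<close> with the shift \<open>-i\<pi>\<close>. Smeared along the dilation orbit with a Gaussian \<open>g\<close>, the shift moves
 from \<open>a\<close> to \<open>g\<close>, and the relations extend to all vectors by the Reeh-Schlieder property. Applying the one for \<open>x\<close>
 to the vector \<open>y\<Omega>\<close> and then the one for \<open>y\<close>, the shifts cancel; letting \<open>g\<close> concentrate at 0 gives
 \<open>\<langle>y\<Omega>, x\<Omega>\<rangle> = \<langle>x\<^sup>*\<Omega>, y\<^sup>*\<Omega>\<rangle>\<close>. With \<open>xa\<close> and \<open>yb\<close> in place of \<open>x\<close> and \<open>y\<close>, where \<open>a \<in> \<P>(I')\<close> and \<open>b \<in> \<P>(I)\<close>, this says
 that \<open>x\<close> and \<open>y\<^sup>*\<close> commute.\<close>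

section \<open>Calculus on the circle\<close>

text \<open>The form may be indefinite, so there is no Hilbert space and no spectral calculus of a
  modular operator; contour integrals of the scalar functions \<open>l (U (dil t) v)\<close>, for
  functionals \<open>l\<close> in \<open>Lf\<close>, take their place. Vectors such as
  \<open>y \<Omega>\<close> need not have orbits that continue analytically. This is why smearing is
  used: for products of entire test functions the orbit is entire in \<open>t\<close>, the contour
  can be moved, and what remains is an identity of two functionals with the shift sitting in the
  kernel \<open>g\<close>. Such an identity extends to every vector by cyclicity. The weight -1 in
  \<open>he (-1) \<tau>\<close> comes from \<open>dt = Im z dx\<close>: integration over the half
  circle becomes integration of \<open>\<tau>\<close> over the line, whatever the conformal
  dimension \<open>d\<close>. Dilations act with weight \<open>d - 1\<close>, which costs a factor
  \<open>cosh \<zeta> ^ d\<close>; under the shift by \<open>\<i> * pi\<close> it yields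
  \<open>(- 1) ^ d\<close>, the very sign in the definition of
  \<open>\<phi>\<^sup>\<dagger>\<close>, so that all signs cancel.\<close>

abbreviation smooth :: "(circle \<Rightarrow> complex) set"
 where "smooth \<equiv> smooth_functions"

section \<open>Points of the unit circle and their angles\<close>

lemma norm_of_circle [simp]: "cmod (of_circle z) = 1"
 using of_circle[of z] by simp

lemma of_circle_nonzero [simp]: "of_circle z \<noteq> 0"
 using norm_of_circle[of z] by (metis norm_zero zero_neq_one)

lemma inverse_of_circle: "inverse (of_circle z) = cnj (of_circle z)"
 by (simp add: inverse_eq_divide complex_div_cnj[of 1])

lemma of_circle_mult_cnj [simp]: "of_circle z * cnj (of_circle z) = 1"
  "cnj (of_circle z) * of_circle z = 1" using complex_norm_square[of "of_circle z"] by (auto simp: mult.commute)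

lemma of_circle_Circle [simp]: "cmod w = 1 \<Longrightarrow> of_circle (Circle w) = w"
 by (simp add: Circle_inverse)

lemma circle_eqI: "of_circle z = of_circle w \<Longrightarrow> z = w"
 by (simp add: of_circle_inject)

lemma circ_Arg [simp]: "circ (Arg (of_circle z)) = z"
 by (rule circle_eqI) (simp add: cis_Arg sgn_div_norm)

lemma circ_surj: "\<exists>t. z = circ t"
 by (metis circ_Arg)

lemma circ_eq_iff: "circ t = circ s \<longleftrightarrow> cis t = cis s"
 by (metis of_circle_circ of_circle_inject)

lemma circ_2pi [simp]: "circ (t + 2 * pi) = circ t"
 by (simp add: circ_eq_iff flip: cis_mult)

lemma circ_eq_obtain:
 assumes "circ t = circ s" obtains k :: int where "t = s + 2 * pi * k"
proof -
 have "cos t = cos s \<and> sin t = sin s" using assms by (simp add: circ_eq_iff complex_eq_iff)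
 then have "sin t = sin s \<and> cos t = cos s" by simp
 then obtain n :: int where "t = s + 2 * pi * n" using sin_cos_eq_iff by metis
 then show ?thesis using that by blast
qed

lemma dist_circ: "dist (circ s) (circ t) = dist (cis s) (cis t)"
 by (simp add: dist_circle_def)

lemma continuous_of_circle: "continuous_on A of_circle"
 by (auto simp: continuous_on_iff dist_circle_def)

lemma continuous_on_circle_iff:
 fixes f :: "'a::metric_space \<Rightarrow> circle"
 shows "continuous_on A f \<longleftrightarrow> continuous_on A (\<lambda>z. of_circle (f z))"
 by (simp only: continuous_on_iff dist_circle_def)

lemma continuous_circ: "continuous_on A circ"
 unfolding continuous_on_circle_iff by (auto intro!: continuous_intros)

section \<open>Angular derivatives and smooth functions\<close>

definition has_dth :: "(circle \<Rightarrow> complex) \<Rightarrow> (circle \<Rightarrow> complex) \<Rightarrow> bool"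
 where "has_dth f f' \<longleftrightarrow> (\<forall>t. ((\<lambda>t. f (circ t)) has_vector_derivative f' (circ t)) (at t))"

text \<open>The derivative is again a function on the circle, not on the line of angles, so that it
  can be iterated. The principal argument only picks one lift; \<open>vector_derivative_circ\<close>
  shows that every other angle gives the same value.\<close>

definition dth :: "(circle \<Rightarrow> complex) \<Rightarrow> circle \<Rightarrow> complex"
 where "dth f z = vector_derivative (\<lambda>t. f (circ t)) (at (Arg (of_circle z)))"

lemma has_dth_imp_dth: "has_dth f f' \<Longrightarrow> dth f = f'"
 by (auto simp: has_dth_def dth_def fun_eq_iff intro!: vector_derivative_at)
  (metis circ_Arg)

lemma circ_has_vector_derivative_shift:
 assumes "((\<lambda>t. f (circ t)) has_vector_derivative D) (at s)" "circ t = circ s"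
 shows "((\<lambda>t. f (circ t)) has_vector_derivative D) (at t)"
proof -
 obtain k :: int where k: "s = t + 2 * pi * k" using circ_eq_obtain[of s t] assms(2) by metis
 have eq: "circ (u + 2 * pi * k) = circ u" for u by (rule circle_eqI) (simp flip: cis_mult)
 have "((\<lambda>u. f (circ (u + 2 * pi * k))) has_vector_derivative D) (at t)"
  using vector_diff_chain_at[of "\<lambda>u. u + 2 * pi * k" 1 t "\<lambda>t. f (circ t)" D] assms(1)
  by (simp add: k o_def has_vector_derivative_add_const)
 then show ?thesis by (simp add: eq)
qed

lemma vector_derivative_circ:
 "vector_derivative (\<lambda>t. f (circ t)) (at t) = dth f (circ t)"
proof -
 have "circ t = circ (Arg (of_circle (circ t)))" by (rule circ_Arg[symmetric])
 then have "((\<lambda>t. f (circ t)) has_vector_derivative D) (at t) \<longleftrightarrow>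
   ((\<lambda>t. f (circ t)) has_vector_derivative D) (at (Arg (of_circle (circ t))))" for D
  using circ_has_vector_derivative_shift by metis
 then show ?thesis unfolding vector_derivative_def dth_def by simp
qed

lemma theta_deriv_0: "theta_deriv 0 f t = f (circ t)"
 by (simp add: theta_deriv_def)

lemma theta_deriv_Suc: "theta_deriv (Suc j) f = theta_deriv j (dth f)"
 unfolding theta_deriv_def funpow_Suc_right o_def by (simp add: vector_derivative_circ)

lemma has_dth_dth: "(\<And>t. (\<lambda>t. f (circ t)) differentiable (at t)) \<Longrightarrow> has_dth f (dth f)"
 unfolding has_dth_def by (metis vector_derivative_works vector_derivative_circ)

text \<open>Differentiability \<open>n\<close> times as a recursion over an existing derivative.
  Closure properties become single inductions in which the functions stay general, without formulas
  for higher derivatives.\<close>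

fun csm :: "nat \<Rightarrow> (circle \<Rightarrow> complex) \<Rightarrow> bool" where
 "csm 0 f = True"
| "csm (Suc n) f = (\<exists>f'. has_dth f f' \<and> csm n f')"

lemma csm_differentiable: "csm (Suc j) f \<Longrightarrow> theta_deriv j f differentiable (at t)"
proof (induction j arbitrary: f)
 case 0
 then obtain f' where "has_dth f f'" by auto
 then have "(\<lambda>t. f (circ t)) differentiable (at t)" unfolding has_dth_def by (metis differentiableI_vector)
 then show ?case by (simp add: theta_deriv_def)
next
 case (Suc j)
 then obtain f' where "has_dth f f'" "csm (Suc j) f'" by auto
 then show ?case using Suc.IH by (simp add: theta_deriv_Suc has_dth_imp_dth)
qed

lemma smooth_has_dth: "f \<in> smooth \<Longrightarrow> has_dth f (dth f)"
 using has_dth_dth[of f] by (simp add: smooth_functions_def) (metis theta_deriv_0 ext)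

lemma smooth_dth: "f \<in> smooth \<Longrightarrow> dth f \<in> smooth"
 by (simp add: smooth_functions_def) (metis theta_deriv_Suc)

lemma smooth_csm: "f \<in> smooth \<Longrightarrow> csm n f"
proof (induction n arbitrary: f)
 case (Suc n)
 then show ?case using smooth_has_dth smooth_dth by auto
qed simp

lemma smooth_iff: "f \<in> smooth \<longleftrightarrow> (\<forall>n. csm n f)"
proof
 assume "\<forall>n. csm n f"
 then show "f \<in> smooth" unfolding smooth_functions_def using csm_differentiable by (auto simp del: csm.simps)
qed (auto simp: smooth_csm)

lemma csm_Suc_lower: "csm (Suc n) f \<Longrightarrow> csm n f"
 by (induction n arbitrary: f) auto

lemma has_dth_const: "has_dth (\<lambda>z. c) (\<lambda>z. 0)"
 by (simp add: has_dth_def)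

lemma has_dth_add: "has_dth f f' \<Longrightarrow> has_dth g g' \<Longrightarrow> has_dth (\<lambda>z. f z + g z) (\<lambda>z. f' z + g' z)"
 by (auto simp: has_dth_def intro!: derivative_intros)

lemma has_dth_diff: "has_dth f f' \<Longrightarrow> has_dth g g' \<Longrightarrow> has_dth (\<lambda>z. f z - g z) (\<lambda>z. f' z - g' z)"
 by (auto simp: has_dth_def intro!: derivative_intros)

lemma has_dth_cmult: "has_dth f f' \<Longrightarrow> has_dth (\<lambda>z. c * f z) (\<lambda>z. c * f' z)"
 by (auto simp: has_dth_def intro!: derivative_intros)

lemma has_dth_mult: "has_dth f f' \<Longrightarrow> has_dth g g' \<Longrightarrow>
  has_dth (\<lambda>z. f z * g z) (\<lambda>z. f z * g' z + f' z * g z)"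
 by (auto simp: has_dth_def intro!: has_vector_derivative_mult)

lemma has_dth_cnj: "has_dth f f' \<Longrightarrow> has_dth (\<lambda>z. cnj (f z)) (\<lambda>z. cnj (f' z))"
 by (auto simp: has_dth_def intro!: has_vector_derivative_cnj)

lemma circle_inv_circ [simp]: "circle_inv (circ t) = circ (- t)"
 by (rule circle_eqI) (simp add: cis_inverse)

lemma circle_inv_inv [simp]: "circle_inv (circle_inv z) = z"
 by (rule circle_eqI) simp

lemma of_circle_inv_cnj: "of_circle (circle_inv z) = cnj (of_circle z)"
 by (simp add: inverse_of_circle)

lemma has_dth_inv: "has_dth f f' \<Longrightarrow> has_dth (\<lambda>z. f (circle_inv z)) (\<lambda>z. - f' (circle_inv z))"
proof -
 assume f: "has_dth f f'"
 have "((\<lambda>t. f (circ (- t))) has_vector_derivative - f' (circ (- t))) (at t)" for t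
  using vector_diff_chain_at[OF has_vector_derivative_minus[OF has_vector_derivative_id], of "\<lambda>t. f (circ t)" "f' (circ (- t))" t] f
  by (auto simp: has_dth_def o_def)
 then show ?thesis by (simp add: has_dth_def)
qed

lemma has_dth_of_circle: "has_dth of_circle (\<lambda>z. \<i> * of_circle z)"
proof -
 have "((\<lambda>t. cis t) has_vector_derivative \<i> * cis t) (at t)" for t
  unfolding has_vector_derivative_def by (auto intro!: derivative_eq_intros)
 then show ?thesis by (simp add: has_dth_def)
qed

lemma csm_const: "csm n (\<lambda>z. c)"
proof (induction n arbitrary: c)
 case (Suc n)
 then show ?case using has_dth_const by auto
qed simp

lemma csm_add: "csm n f \<Longrightarrow> csm n g \<Longrightarrow> csm n (\<lambda>z. f z + g z)"
 by (induction n arbitrary: f g) (auto intro: has_dth_add)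

lemma csm_cmult: "csm n f \<Longrightarrow> csm n (\<lambda>z. c * f z)"
 by (induction n arbitrary: f) (auto intro: has_dth_cmult)

lemma csm_mult: "csm n f \<Longrightarrow> csm n g \<Longrightarrow> csm n (\<lambda>z. f z * g z)"
proof (induction n arbitrary: f g)
 case (Suc n)
 obtain f' g' where *: "has_dth f f'" "has_dth g g'" "csm n f'" "csm n g'" using Suc.prems by auto
 \<comment> \<open>The product rule keeps the undifferentiated factors, so the hypothesis of order
   \<open>Suc n\<close> has to be lowered for them.\<close>
 have "csm n f" "csm n g" using Suc.prems csm_Suc_lower by blast+
 then have "csm n (\<lambda>z. f z * g' z + f' z * g z)" using * Suc.IH by (intro csm_add) auto
 then show ?case using has_dth_mult[OF *(1,2)] by auto
qed simp

lemma csm_cnj: "csm n f \<Longrightarrow> csm n (\<lambda>z. cnj (f z))"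
 by (induction n arbitrary: f) (auto intro: has_dth_cnj)

lemma csm_inv: "csm n f \<Longrightarrow> csm n (\<lambda>z. f (circle_inv z))"
proof (induction n arbitrary: f)
 case (Suc n)
 then obtain f' where f': "has_dth f f'" "csm n f'" by auto
 have "csm n (\<lambda>z. - 1 * f' (circle_inv z))" using f' Suc.IH by (intro csm_cmult) auto
 then show ?case using has_dth_inv[OF f'(1)] by auto
qed simp

lemma csm_of_circle: "csm n of_circle"
proof (induction n)
 case (Suc n)
 then show ?case using has_dth_of_circle csm_cmult by auto
qed simp

lemma smooth_const [simp]: "(\<lambda>z. c) \<in> smooth"
 and smooth_add: "f \<in> smooth \<Longrightarrow> g \<in> smooth \<Longrightarrow> (\<lambda>z. f z + g z) \<in> smooth"
 and smooth_cmult: "f \<in> smooth \<Longrightarrow> (\<lambda>z. c * f z) \<in> smooth"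
 and smooth_mult: "f \<in> smooth \<Longrightarrow> g \<in> smooth \<Longrightarrow> (\<lambda>z. f z * g z) \<in> smooth"
 and smooth_cnj: "f \<in> smooth \<Longrightarrow> (\<lambda>z. cnj (f z)) \<in> smooth"
 and smooth_inv: "f \<in> smooth \<Longrightarrow> (\<lambda>z. f (circle_inv z)) \<in> smooth"
 and smooth_of_circle [simp]: "of_circle \<in> smooth"
 by (simp_all add: smooth_iff csm_const csm_add csm_cmult csm_mult csm_cnj csm_inv csm_of_circle)

lemma smooth_uminus: "f \<in> smooth \<Longrightarrow> (\<lambda>z. - f z) \<in> smooth"
 using smooth_cmult[of f "-1"] by simp

lemma smooth_diff: "f \<in> smooth \<Longrightarrow> g \<in> smooth \<Longrightarrow> (\<lambda>z. f z - g z) \<in> smooth"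
 using smooth_add[OF _ smooth_uminus[of g], of f] by simp

lemma smooth_sum: "(\<And>i. i \<in> A \<Longrightarrow> f i \<in> smooth) \<Longrightarrow> (\<lambda>z. \<Sum>i\<in>A. f i z) \<in> smooth"
 by (induction A rule: infinite_finite_induct) (auto intro: smooth_add)

lemma smooth_power: "f \<in> smooth \<Longrightarrow> (\<lambda>z. f z ^ n) \<in> smooth"
 by (induction n) (auto intro: smooth_mult)

lemma smooth_cnj_of_circle [simp]: "(\<lambda>z. cnj (of_circle z)) \<in> smooth"
 by (simp add: smooth_cnj)

lemmas smooth_intros = smooth_add smooth_cmult smooth_mult smooth_cnj smooth_uminus
 smooth_diff smooth_power

lemma smooth_continuous_circ: "f \<in> smooth \<Longrightarrow> continuous_on A (\<lambda>t. f (circ t))"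
 using smooth_has_dth[of f] unfolding has_dth_def
 by (meson continuous_at_imp_continuous_on has_vector_derivative_continuous)

lemma smooth_bounded:
 assumes "f \<in> smooth" shows "bounded (range (\<lambda>t. f (circ t)))"
proof -
 have "compact ((\<lambda>t. f (circ t)) ` {-pi..pi})"
  by (intro compact_continuous_image smooth_continuous_circ assms) simp
 moreover have "range (\<lambda>t. f (circ t)) \<subseteq> (\<lambda>t. f (circ t)) ` {-pi..pi}"
 proof
  fix y assume "y \<in> range (\<lambda>t. f (circ t))"
  then obtain t where "y = f (circ t)" by auto
  then have "y = f (circ (Arg (of_circle (circ t))))" by (simp only: circ_Arg)
  moreover have "Arg (of_circle (circ t)) \<in> {-pi..pi}" using Arg_bounded[of "of_circle (circ t)"] by auto
  ultimately show "y \<in> (\<lambda>t. f (circ t)) ` {-pi..pi}" by blast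
 qed
 ultimately show ?thesis using compact_imp_bounded bounded_subset by blast
qed

section \<open>Estimates for the norms \<open>C_norm\<close>\<close>

lemma C_norm_0: "C_norm 0 f = (SUP t. norm (f (circ t)))"
 by (simp add: C_norm_def theta_deriv_0)

lemma C_norm_Suc: "C_norm (Suc N) f = C_norm 0 f + C_norm N (dth f)"
 unfolding C_norm_def sum.atMost_Suc_shift by (simp add: theta_deriv_Suc)

text \<open>A real supremum is meaningful only for bounded sets; this bound is what makes
  \<open>C_norm\<close> behave as a norm on smooth functions.\<close>

lemma smooth_bdd_above: "f \<in> smooth \<Longrightarrow> bdd_above (range (\<lambda>t. norm (f (circ t))))"
 using smooth_bounded[of f] unfolding bounded_iff bdd_above_def by auto

lemma norm_le_C_norm_0: "f \<in> smooth \<Longrightarrow> norm (f z) \<le> C_norm 0 f"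
proof -
 assume f: "f \<in> smooth"
 have "norm (f (circ (Arg (of_circle z)))) \<le> C_norm 0 f"
  unfolding C_norm_0 by (rule cSUP_upper[OF _ smooth_bdd_above[OF f]]) simp
 then show ?thesis by simp
qed

lemma C_norm_0_le: "(\<And>z. norm (f z) \<le> B) \<Longrightarrow> C_norm 0 f \<le> B"
 unfolding C_norm_0 by (rule cSUP_least) auto

lemma C_norm_0_nonneg: "f \<in> smooth \<Longrightarrow> 0 \<le> C_norm 0 f"
 by (rule order_trans[OF norm_ge_zero norm_le_C_norm_0])

lemma C_norm_nonneg: "f \<in> smooth \<Longrightarrow> 0 \<le> C_norm N f"
proof (induction N arbitrary: f)
 case (Suc N)
 then show ?case using C_norm_0_nonneg smooth_dth by (simp add: C_norm_Suc)
qed (rule C_norm_0_nonneg)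

lemma C_norm_Suc_ge: "f \<in> smooth \<Longrightarrow> C_norm N f \<le> C_norm (Suc N) f"
 by (induction N arbitrary: f) (auto simp: C_norm_Suc smooth_dth C_norm_nonneg)

lemma C_norm_mono: "f \<in> smooth \<Longrightarrow> M \<le> N \<Longrightarrow> C_norm M f \<le> C_norm N f"
 by (rule lift_Suc_mono_le[of "\<lambda>N. C_norm N f"]) (auto simp: C_norm_Suc_ge)

lemma C_norm_dth_le: "f \<in> smooth \<Longrightarrow> C_norm N (dth f) \<le> C_norm (Suc N) f"
 by (simp add: C_norm_Suc C_norm_0_nonneg)

lemma norm_le_C_norm: "f \<in> smooth \<Longrightarrow> norm (f z) \<le> C_norm N f"
 using norm_le_C_norm_0 C_norm_mono[of f 0 N] by (meson le0 order_trans)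

lemma dth_add: "f \<in> smooth \<Longrightarrow> g \<in> smooth \<Longrightarrow>
  dth (\<lambda>z. f z + g z) = (\<lambda>z. dth f z + dth g z)"
 and dth_diff: "f \<in> smooth \<Longrightarrow> g \<in> smooth \<Longrightarrow>
  dth (\<lambda>z. f z - g z) = (\<lambda>z. dth f z - dth g z)"
 and dth_cmult: "f \<in> smooth \<Longrightarrow> dth (\<lambda>z. c * f z) = (\<lambda>z. c * dth f z)"
 and dth_mult: "f \<in> smooth \<Longrightarrow> g \<in> smooth \<Longrightarrow>
  dth (\<lambda>z. f z * g z) = (\<lambda>z. f z * dth g z + dth f z * g z)"
 by (intro has_dth_imp_dth has_dth_add has_dth_diff has_dth_cmult has_dth_mult smooth_has_dth; assumption)+

lemma C_norm_add: "f \<in> smooth \<Longrightarrow> g \<in> smooth \<Longrightarrow>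
  C_norm N (\<lambda>z. f z + g z) \<le> C_norm N f + C_norm N g"
proof (induction N arbitrary: f g)
 case 0
 show ?case by (rule C_norm_0_le) (intro norm_triangle_le add_mono norm_le_C_norm_0 0)
next
 case (Suc N)
 have "C_norm 0 (\<lambda>z. f z + g z) \<le> C_norm 0 f + C_norm 0 g"
  by (rule C_norm_0_le) (intro norm_triangle_le add_mono norm_le_C_norm_0 Suc.prems)
 then show ?case using Suc.IH[of "dth f" "dth g"] Suc.prems by (simp add: C_norm_Suc dth_add smooth_dth)
qed

lemma C_norm_0_cmult: "f \<in> smooth \<Longrightarrow> C_norm 0 (\<lambda>z. c * f z) \<le> norm c * C_norm 0 f"
 by (rule C_norm_0_le) (auto simp: norm_mult intro!: mult_left_mono norm_le_C_norm_0)

lemma C_norm_cmult_le: "f \<in> smooth \<Longrightarrow> C_norm N (\<lambda>z. c * f z) \<le> norm c * C_norm N f"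
proof (induction N arbitrary: f)
 case (Suc N)
 then show ?case using C_norm_0_cmult[of f c] Suc.IH[OF smooth_dth[OF Suc.prems]]
  by (simp add: C_norm_Suc dth_cmult distrib_left)
qed (rule C_norm_0_cmult)

text \<open>For \<open>c \<noteq> 0\<close> the inequality \<open>C_norm_cmult_le\<close>, used a
  second time with the factor \<open>inverse c\<close>, gives the reverse estimate.\<close>

lemma C_norm_cmult: "f \<in> smooth \<Longrightarrow> C_norm N (\<lambda>z. c * f z) = norm c * C_norm N f"
proof (cases "c = 0")
 case True
 assume f: "f \<in> smooth"
 show ?thesis using C_norm_cmult_le[OF f, of N c] C_norm_nonneg[OF smooth_cmult[OF f], of N c] True by simp
next
 case False
 assume f: "f \<in> smooth"
 have "C_norm N (\<lambda>z. inverse c * (c * f z)) \<le> norm (inverse c) * C_norm N (\<lambda>z. c * f z)"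
  by (rule C_norm_cmult_le[OF smooth_cmult[OF f]])
 then have "C_norm N f \<le> C_norm N (\<lambda>z. c * f z) / norm c"
  using False by (simp add: norm_inverse divide_inverse mult.commute flip: mult.assoc)
 then have "norm c * C_norm N f \<le> C_norm N (\<lambda>z. c * f z)" using False by (simp add: field_simps)
 then show ?thesis using C_norm_cmult_le[OF f, of N c] by simp
qed

lemma C_norm_zero [simp]: "C_norm N (\<lambda>z. 0) = 0"
 using C_norm_cmult[of "\<lambda>z. 0" N 0] by simp

lemma C_norm_diff: "f \<in> smooth \<Longrightarrow> g \<in> smooth \<Longrightarrow>
  C_norm N (\<lambda>z. f z - g z) \<le> C_norm N f + C_norm N g"
 using C_norm_add[of f "\<lambda>z. -1 * g z" N] C_norm_cmult[of g N "-1"] smooth_cmult[of g "-1"] by simp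

text \<open>The constants obey \<open>K (Suc N) = 1 + 2 * K N\<close>: one term for the supremum of
  the product and two from the Leibniz rule.\<close>

lemma C_norm_mult: "\<exists>K\<ge>0. \<forall>f\<in>smooth. \<forall>g\<in>smooth.
  C_norm N (\<lambda>z. f z * g z) \<le> K * C_norm N f * C_norm N g"
proof (induction N)
 case 0
 have "C_norm 0 (\<lambda>z. f z * g z) \<le> 1 * C_norm 0 f * C_norm 0 g"
  if "f \<in> smooth" "g \<in> smooth" for f g by (rule C_norm_0_le)
   (auto simp: norm_mult that intro!: mult_mono norm_le_C_norm_0 C_norm_0_nonneg)
 then show ?case by (intro exI[of _ 1]) auto
next
 case (Suc N)
 then obtain K where K: "K \<ge> 0" "\<And>f g. f\<in>smooth \<Longrightarrow> g\<in>smooth \<Longrightarrow>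
  C_norm N (\<lambda>z. f z * g z) \<le> K * C_norm N f * C_norm N g" by blast
 have "C_norm (Suc N) (\<lambda>z. f z * g z) \<le> (1 + 2 * K) * C_norm (Suc N) f * C_norm (Suc N) g"
  if f: "f \<in> smooth" and g: "g \<in> smooth" for f g
 proof -
  let ?P = "C_norm (Suc N) f * C_norm (Suc N) g"
  have le: "C_norm N f \<le> C_norm (Suc N) f" "C_norm N g \<le> C_norm (Suc N) g"
   "C_norm N (dth f) \<le> C_norm (Suc N) f" "C_norm N (dth g) \<le> C_norm (Suc N) g"
   using f g C_norm_Suc_ge C_norm_dth_le by auto
  have nn: "0 \<le> C_norm M f" "0 \<le> C_norm M g" "0 \<le> C_norm M (dth f)" "0 \<le> C_norm M (dth g)" for M
   using f g C_norm_nonneg smooth_dth by auto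
  have 1: "C_norm 0 (\<lambda>z. f z * g z) \<le> ?P"
   by (rule C_norm_0_le) (auto simp: norm_mult f g nn intro!: mult_mono norm_le_C_norm)
  have "C_norm N (\<lambda>z. f z * dth g z) \<le> K * C_norm N f * C_norm N (dth g)"
   using K f g smooth_dth by blast
  also have "\<dots> \<le> K * ?P" using K(1) le nn by (auto simp: mult.assoc intro!: mult_left_mono mult_mono)
  finally have 2: "C_norm N (\<lambda>z. f z * dth g z) \<le> K * ?P" .
  have "C_norm N (\<lambda>z. dth f z * g z) \<le> K * C_norm N (dth f) * C_norm N g"
   using K f g smooth_dth by blast
  also have "\<dots> \<le> K * ?P" using K(1) le nn by (auto simp: mult.assoc intro!: mult_left_mono mult_mono)
  finally have 3: "C_norm N (\<lambda>z. dth f z * g z) \<le> K * ?P" .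
  have "C_norm N (dth (\<lambda>z. f z * g z)) \<le> K * ?P + K * ?P" unfolding dth_mult[OF f g]
   by (rule order_trans[OF C_norm_add]) (use 2 3 f g smooth_dth in \<open>auto intro: smooth_mult\<close>)
  with 1 show ?thesis by (simp add: C_norm_Suc[of N "\<lambda>z. f z * g z"] algebra_simps)
 qed
 then show ?case using K(1) by (intro exI[of _ "1 + 2 * K"]) auto
qed

lemma smooth_eq_zero: "f \<in> smooth \<Longrightarrow> C_norm N f = 0 \<Longrightarrow> f z = 0"
 using norm_le_C_norm[of f z N] by simp

section \<open>Compactness and Lipschitz bounds in the chordal metric\<close>

lemma compact_circle: "compact (UNIV :: circle set)"
proof -
 have "(UNIV :: circle set) = circ ` {-pi..pi}"
 proof -
  have "z \<in> circ ` {-pi..pi}" for z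
   using Arg_bounded[of "of_circle z"] by (intro image_eqI[of _ _ "Arg (of_circle z)"]) auto
  then show ?thesis by blast
 qed
 then show ?thesis by (metis compact_continuous_image continuous_circ compact_Icc)
qed

text \<open>The principal logarithm of the quotient is purely imaginary and measures the short way
  from \<open>w\<close> to \<open>z\<close>.\<close>

lemma circle_difference:
 obtains r where "z = circ (Arg (of_circle w) + r)" "\<bar>r\<bar> = cmod (Ln (of_circle z / of_circle w))"
proof -
 define u where "u = of_circle z / of_circle w"
 have nu: "cmod u = 1" by (simp add: u_def norm_divide)
 then have u0: "u \<noteq> 0" by auto
 have "Re (Ln u) = 0" using nu u0 by simp
 then have L: "Ln u = \<i> * Im (Ln u)" by (simp add: complex_eq_iff)
 have "of_circle z = of_circle w * u" by (simp add: u_def)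
 also have "u = cis (Im (Ln u))" by (metis L cis_conv_exp exp_Ln u0)
 also have "of_circle w = cis (Arg (of_circle w))" by (simp add: cis_Arg sgn_div_norm)
 finally have "z = circ (Arg (of_circle w) + Im (Ln u))" by (intro circle_eqI) (simp add: cis_mult)
 moreover have "\<bar>Im (Ln u)\<bar> = cmod (Ln u)" by (subst (2) L) (simp add: norm_mult)
 ultimately show ?thesis using that unfolding u_def by blast
qed

lemma smooth_line_bound:
 assumes f: "f \<in> smooth"
 shows "norm (f (circ (s + r)) - f (circ s)) \<le> C_norm 0 (dth f) * \<bar>r\<bar>"
proof -
 have "((\<lambda>t. f (circ t)) has_derivative (\<lambda>x. x *\<^sub>R dth f (circ t))) (at t within UNIV)" for t
  using smooth_has_dth[OF f] by (simp add: has_dth_def has_vector_derivative_def)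
 moreover have "onorm (\<lambda>x. x *\<^sub>R dth f (circ t)) \<le> C_norm 0 (dth f)" for t by (rule onorm_le)
   (simp add: mult.commute[of "C_norm 0 (dth f)"] mult_left_mono norm_le_C_norm_0 smooth_dth f)
 ultimately have "norm (f (circ (s + r)) - f (circ s)) \<le> C_norm 0 (dth f) * norm (s + r - s)"
  by (intro differentiable_bound[of UNIV]) auto
 then show ?thesis by simp
qed

text \<open>If \<open>z / w\<close> is within 1/2 of 1, its logarithm is at most twice the chord and
  the mean value bound applies along the arc. Otherwise the chord is at least 1/2 and twice the
  supremum is enough. The factor 4 covers both cases.\<close>

lemma smooth_lipschitz:
 assumes f: "f \<in> smooth"
 shows "norm (f z - f w) \<le> 4 * C_norm 1 f * dist z w"
proof -
 define u where "u = of_circle z / of_circle w"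
 have d: "dist z w = cmod (u - 1)"
  by (simp add: u_def dist_circle_def dist_norm norm_divide diff_divide_distrib[symmetric] divide_diff_eq_iff)
 obtain r where r: "z = circ (Arg (of_circle w) + r)" "\<bar>r\<bar> = cmod (Ln u)"
  using circle_difference u_def by metis
 have nn: "0 \<le> C_norm 1 f" "0 \<le> C_norm 0 f" "C_norm 0 f \<le> C_norm 1 f" "C_norm 0 (dth f) \<le> C_norm 1 f"
  using f C_norm_nonneg C_norm_mono[of f 0 1] C_norm_dth_le[of f 0] by auto
 show ?thesis
 proof (cases "cmod (u - 1) < 1/2")
  case True
  then have "cmod (Ln (1 + (u - 1))) \<le> 2 * cmod (u - 1)" by (intro norm_Ln_le)
  then have "\<bar>r\<bar> \<le> 2 * dist z w" using r d by simp
  have "norm (f z - f w) = norm (f (circ (Arg (of_circle w) + r)) - f (circ (Arg (of_circle w))))" using r by simp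
  also have "\<dots> \<le> C_norm 0 (dth f) * \<bar>r\<bar>" by (rule smooth_line_bound[OF f])
  also have "\<dots> \<le> C_norm 1 f * (2 * dist z w)"
   using nn \<open>\<bar>r\<bar> \<le> 2 * dist z w\<close> by (intro mult_mono) auto
  also have "\<dots> \<le> 4 * C_norm 1 f * dist z w" using nn by simp
  finally show ?thesis .
 next
  case False
  have "norm (f z - f w) \<le> norm (f z) + norm (f w)" by (rule norm_triangle_ineq4)
  also have "\<dots> \<le> 2 * C_norm 1 f" using norm_le_C_norm[OF f, of z 1] norm_le_C_norm[OF f, of w 1] by simp
  also have "\<dots> \<le> 2 * C_norm 1 f * (2 * dist z w)"
   using False d nn mult_left_mono[of 1 "2 * dist z w" "2 * C_norm 1 f"] by simp
  finally show ?thesis by simp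
 qed
qed

lemma smooth_continuous: "f \<in> smooth \<Longrightarrow> continuous_on A f"
proof -
 assume f: "f \<in> smooth"
 have "(4 * C_norm 1 f)-lipschitz_on A f"
  using smooth_lipschitz[OF f] C_norm_nonneg[OF f] by (auto intro!: lipschitz_onI simp: dist_norm)
 then show ?thesis by (rule lipschitz_on_continuous_on)
qed

section \<open>Moebius transformations acting on test functions\<close>

text \<open>The first rows \<open>(a, b)\<close> of the matrices in SU(1,1).\<close>

definition su :: "complex \<Rightarrow> complex \<Rightarrow> bool"
 where "su a b \<longleftrightarrow> (cmod a)\<^sup>2 - (cmod b)\<^sup>2 = 1"

definition mob :: "complex \<Rightarrow> complex \<Rightarrow> circle \<Rightarrow> circle"
 where "mob a b z = Circle ((a * of_circle z + b) / (cnj b * of_circle z + cnj a))"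

lemma su_gt: "su a b \<Longrightarrow> cmod b < cmod a"
 by (rule power2_less_imp_less) (auto simp: su_def)

lemma su_mult: "su a b \<Longrightarrow> a * cnj a - b * cnj b = 1"
 unfolding su_def by (metis complex_norm_square of_real_1 of_real_diff)

lemma su_inv: "su a b \<Longrightarrow> su (cnj a) (- b)"
 by (simp add: su_def)

lemma mob_den_nonzero: "su a b \<Longrightarrow> cnj b * of_circle z + cnj a \<noteq> 0"
proof
 assume *: "su a b" "cnj b * of_circle z + cnj a = 0"
 then have "cnj a = - (cnj b * of_circle z)" by (simp add: eq_neg_iff_add_eq_0 add.commute)
 then have "cmod (cnj a) = cmod (- (cnj b * of_circle z))" by (rule arg_cong)
 then show False using su_gt[OF *(1)] by (simp add: norm_mult)
qed

lemma mob_num: "a * of_circle z + b = of_circle z * cnj (cnj b * of_circle z + cnj a)"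
 by (simp add: distrib_left mult.left_commute[of _ b])

lemma of_circle_mob:
 assumes "su a b"
 shows "of_circle (mob a b z) = (a * of_circle z + b) / (cnj b * of_circle z + cnj a)"
proof -
 have "cmod ((a * of_circle z + b) / (cnj b * of_circle z + cnj a)) = 1"
  unfolding mob_num[of a z b] using mob_den_nonzero[OF assms, of z]
  by (simp only: norm_divide norm_mult norm_of_circle complex_mod_cnj) simp
 then show ?thesis by (simp add: mob_def)
qed

lemma Mob_iff: "\<gamma> \<in> Mob \<longleftrightarrow> (\<exists>a b. su a b \<and> \<gamma> = mob a b)"
proof
 assume "\<gamma> \<in> Mob"
 then obtain a b where *: "su a b" "\<And>z. of_circle (\<gamma> z) = (a * of_circle z + b) / (cnj b * of_circle z + cnj a)"
  by (auto simp: Mob_def su_def)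
 then have "\<gamma> = mob a b" by (intro ext circle_eqI) (simp add: of_circle_mob)
 then show "\<exists>a b. su a b \<and> \<gamma> = mob a b" using * by blast
next
 assume "\<exists>a b. su a b \<and> \<gamma> = mob a b"
 then show "\<gamma> \<in> Mob" by (auto simp: Mob_def of_circle_mob) (auto simp: su_def)
qed

lemma su_mob_comp:
 assumes "su a b" "su c d"
 shows "su (a * c + b * cnj d) (a * d + b * cnj c)"
  and "mob a b \<circ> mob c d = mob (a * c + b * cnj d) (a * d + b * cnj c)"
proof -
 let ?e = "a * c + b * cnj d" and ?f = "a * d + b * cnj c"
 have "?e * cnj ?e - ?f * cnj ?f = (a * cnj a - b * cnj b) * (c * cnj c - d * cnj d)" by (simp add: algebra_simps)
 then have 1: "?e * cnj ?e - ?f * cnj ?f = 1" using su_mult[OF assms(1)] su_mult[OF assms(2)] by simp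
 then show su: "su ?e ?f" unfolding su_def complex_norm_square[symmetric]
  by (metis complex_norm_square of_real_1 of_real_diff of_real_eq_iff)
 show "mob a b \<circ> mob c d = mob ?e ?f"
 proof (intro ext circle_eqI, unfold o_def)
  fix z
  let ?w = "of_circle z"
  have n: "cnj d * ?w + cnj c \<noteq> 0" by (rule mob_den_nonzero[OF assms(2)])
  have e: "x * (p / q) + y = (x * p + y * q) / q" if "q \<noteq> 0" for x y p q :: complex
   using that by (simp add: add_divide_distrib)
  have "of_circle (mob a b (mob c d z)) =
   (a * ((c * ?w + d) / (cnj d * ?w + cnj c)) + b) / (cnj b * ((c * ?w + d) / (cnj d * ?w + cnj c)) + cnj a)"
   by (simp add: of_circle_mob assms)
  also have "\<dots> = ((a * (c * ?w + d) + b * (cnj d * ?w + cnj c)) / (cnj d * ?w + cnj c)) /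
    ((cnj b * (c * ?w + d) + cnj a * (cnj d * ?w + cnj c)) / (cnj d * ?w + cnj c))" using n e by simp
  also have "\<dots> = (a * (c * ?w + d) + b * (cnj d * ?w + cnj c)) / (cnj b * (c * ?w + d) + cnj a * (cnj d * ?w + cnj c))"
   using n by simp
  also have "\<dots> = of_circle (mob ?e ?f z)" by (simp add: of_circle_mob su algebra_simps)
  finally show "of_circle (mob a b (mob c d z)) = of_circle (mob ?e ?f z)" .
 qed
qed

lemma mob_id: "mob 1 0 = id"
 by (intro ext circle_eqI) (simp add: of_circle_mob su_def)

lemma mob_inverse:
 assumes "su a b"
 shows "mob a b \<circ> mob (cnj a) (- b) = id" "mob (cnj a) (- b) \<circ> mob a b = id"
 using su_mult[OF assms] su_mob_comp[OF assms su_inv[OF assms]] su_mob_comp[OF su_inv[OF assms] assms]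
 by (simp_all add: mob_id[symmetric] algebra_simps)

lemma inv_mob: "su a b \<Longrightarrow> inv (mob a b) = mob (cnj a) (- b)"
 using mob_inverse[of a b] by (metis inv_unique_comp)

lemma bij_mob: "su a b \<Longrightarrow> bij (mob a b)"
 using mob_inverse[of a b] o_bij by metis

lemma rot_eq_mob: "rot t = mob (cis (t/2)) 0"
proof (intro ext circle_eqI)
 fix z
 have "cis (t/2) * of_circle z / cnj (cis (t/2)) = cis t * of_circle z"
  by (simp add: cis_cnj cis_divide cis_inverse field_simps flip: cis_mult) (simp add: cis_mult)
 then show "of_circle (rot t z) = of_circle (mob (cis (t/2)) 0 z)"
  by (simp add: rot_def of_circle_mob su_def norm_mult)
qed

lemma of_circle_rot: "of_circle (rot t z) = cis t * of_circle z"
 by (simp add: rot_def norm_mult)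

lemma rot_circ: "rot t (circ s) = circ (t + s)"
 by (rule circle_eqI) (simp add: of_circle_rot cis_mult)

text \<open>The squared modulus of the denominator of \<open>mob a b\<close>.\<close>

definition qf :: "complex \<Rightarrow> complex \<Rightarrow> circle \<Rightarrow> complex"
 where "qf a b z = (cnj b * of_circle z + cnj a) * (b * cnj (of_circle z) + a)"

lemma qf_eq: "qf a b z = of_real ((cmod (cnj b * of_circle z + cnj a))\<^sup>2)"
 unfolding qf_def complex_norm_square by simp

lemma qf_nonzero: "su a b \<Longrightarrow> qf a b z \<noteq> 0"
 by (simp add: qf_eq mob_den_nonzero)

text \<open>Since \<open>(cmod a - cmod b) * (cmod a + cmod b) = 1\<close>, the lower bound
  \<open>cmod a - cmod b\<close> of the denominator is the inverse of its upper bound. So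
  \<open>qf\<close> and its inverse share one bound.\<close>

lemma qf_bounds:
 assumes "su a b"
 shows "cmod (qf a b z) \<le> (cmod a + cmod b)\<^sup>2" "cmod (inverse (qf a b z)) \<le> (cmod a + cmod b)\<^sup>2"
proof -
 let ?d = "cmod (cnj b * of_circle z + cnj a)"
 have "?d \<le> cmod (cnj b * of_circle z) + cmod (cnj a)" by (rule norm_triangle_ineq)
 then have "?d \<le> cmod a + cmod b" by (simp add: norm_mult)
 then show "cmod (qf a b z) \<le> (cmod a + cmod b)\<^sup>2" by (simp add: qf_eq power_mono norm_power)
 have "cmod (cnj a) - cmod (cnj b * of_circle z) \<le> ?d" by (metis add.commute norm_diff_ineq)
 then have l: "cmod a - cmod b \<le> ?d" by (simp add: norm_mult)
 have p: "(cmod a - cmod b) * (cmod a + cmod b) = 1" using assms by (simp add: su_def power2_eq_square algebra_simps)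
 have pos: "cmod a - cmod b > 0" "cmod a + cmod b > 0" using su_gt[OF assms] norm_ge_zero[of b] by linarith+
 have "inverse ?d \<le> inverse (cmod a - cmod b)" using l pos by (intro le_imp_inverse_le)
 also have "\<dots> = cmod a + cmod b" using p pos by (simp add: field_simps)
 finally show "cmod (inverse (qf a b z)) \<le> (cmod a + cmod b)\<^sup>2"
  by (simp add: qf_eq norm_inverse norm_power power_mono flip: power_inverse)
qed

lemma su_ge_1: "su a b \<Longrightarrow> 1 \<le> cmod a + cmod b"
proof -
 assume "su a b"
 then have "1 \<le> (cmod a)\<^sup>2" unfolding su_def using zero_le_power2[of "cmod b"] by linarith
 then have "1\<^sup>2 \<le> (cmod a)\<^sup>2" by simp
 then have "1 \<le> cmod a" by (rule power2_le_imp_le) simp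
 then show ?thesis using norm_ge_zero[of b] by linarith
qed

text \<open>The angular derivative of \<open>qf a b\<close>, by \<open>has_dth_qf\<close>.\<close>

definition qd :: "complex \<Rightarrow> complex \<Rightarrow> circle \<Rightarrow> complex"
 where "qd a b z = \<i> * (a * cnj b * of_circle z - cnj a * b * cnj (of_circle z))"

lemma qf_alt: "qf a b z = (a * cnj a + b * cnj b) + (a * cnj b * of_circle z + cnj a * b * cnj (of_circle z))"
proof -
 have "qf a b z = (a * cnj a + (b * cnj b) * (of_circle z * cnj (of_circle z))) +
   (a * cnj b * of_circle z + cnj a * b * cnj (of_circle z))"
  by (simp add: qf_def algebra_simps del: of_circle_mult_cnj)
 then show ?thesis by simp
qed

lemma smooth_qf: "qf a b \<in> smooth" and smooth_qd: "qd a b \<in> smooth"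
 unfolding qf_def[abs_def] qd_def[abs_def] by (auto intro!: smooth_intros)

lemma has_dth_qf: "has_dth (qf a b) (qd a b)"
proof -
 have "has_dth (\<lambda>z. (a * cnj a + b * cnj b) + (a * cnj b * of_circle z + cnj a * b * cnj (of_circle z)))
   (\<lambda>z. 0 + (a * cnj b * (\<i> * of_circle z) + cnj a * b * cnj (\<i> * of_circle z)))"
  by (intro has_dth_add has_dth_const has_dth_cmult has_dth_cnj has_dth_of_circle)
 moreover have "(\<lambda>z. (a * cnj a + b * cnj b) + (a * cnj b * of_circle z + cnj a * b * cnj (of_circle z))) = qf a b"
  by (simp add: qf_alt fun_eq_iff)
 moreover have "(\<lambda>z. 0 + (a * cnj b * (\<i> * of_circle z) + cnj a * b * cnj (\<i> * of_circle z))) = qd a b"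
  by (simp add: qd_def fun_eq_iff algebra_simps)
 ultimately show ?thesis by (simp only:)
qed

text \<open>The map is lifted to angles: \<open>g\<close> is obtained from \<open>Ln\<close> of the
  quotient \<open>w u\<close> by the value at \<open>t\<close>. The lifting property holds for every
  \<open>u\<close>, even across the branch cut; only differentiability at \<open>t\<close> is used,
  where the quotient is 1 and \<open>Ln\<close> is holomorphic.\<close>

lemma has_vector_derivative_compose_circle:
 assumes d: "((\<lambda>t. of_circle (\<delta> (circ t))) has_vector_derivative (\<i> * of_real X * of_circle (\<delta> (circ t)))) (at t)"
  and f: "has_dth f f'"
 shows "((\<lambda>t. f (\<delta> (circ t))) has_vector_derivative of_real X * f' (\<delta> (circ t))) (at t)"
proof -
 define s0 where "s0 = Arg (of_circle (\<delta> (circ t)))"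
 define w where "w u = of_circle (\<delta> (circ u)) / of_circle (\<delta> (circ t))" for u
 define g where "g u = s0 + Im (Ln (w u))" for u
 have nw: "cmod (w u) = 1" for u by (simp add: w_def norm_divide)
 have w0: "w u \<noteq> 0" for u using nw[of u] by auto
 have g: "circ (g u) = \<delta> (circ u)" for u
 proof (rule circle_eqI)
  have "Re (Ln (w u)) = 0" using nw w0 by simp
  then have "Ln (w u) = \<i> * Im (Ln (w u))" by (simp add: complex_eq_iff)
  then have "cis (Im (Ln (w u))) = w u" by (metis cis_conv_exp exp_Ln w0)
  moreover have "cis s0 = of_circle (\<delta> (circ t))" by (simp add: s0_def cis_Arg sgn_div_norm)
  ultimately show "of_circle (circ (g u)) = of_circle (\<delta> (circ u))" by (simp add: g_def w_def flip: cis_mult)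
 qed
 have "(w has_vector_derivative (\<i> * of_real X)) (at t)"
  unfolding w_def using has_vector_derivative_mult_left[OF d, of "inverse (of_circle (\<delta> (circ t)))"]
  by (simp add: divide_inverse mult.assoc)
 moreover have "(Ln has_field_derivative 1) (at (w t))" using has_field_derivative_Ln[of 1] by (simp add: w_def)
 ultimately have "((Ln \<circ> w) has_vector_derivative (\<i> * of_real X * 1)) (at t)"
  by (rule field_vector_diff_chain_at)
 from bounded_linear.has_vector_derivative[OF bounded_linear_Im this]
 have "((\<lambda>u. Im (Ln (w u))) has_vector_derivative X) (at t)" by (simp add: o_def)
 then have gd: "(g has_vector_derivative X) (at t)"
  unfolding g_def by (simp add: add.commute[of s0] has_vector_derivative_add_const)
 have "((\<lambda>t. f (circ t)) has_vector_derivative f' (circ (g t))) (at (g t))"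
  using f by (simp add: has_dth_def)
 from vector_diff_chain_at[OF gd this] show ?thesis by (simp add: o_def g scaleR_conv_of_real)
qed

text \<open>The complex derivative is one over the square of the denominator because the determinant
  is 1; \<open>mob_num\<close> rewrites it as a positive multiple of \<open>\<i>\<close> times the
  image point, the tangent direction.\<close>

lemma mob_derivative:
 assumes "su a b"
 shows "((\<lambda>t. of_circle (mob a b (circ t))) has_vector_derivative
  (\<i> * of_real (inverse ((cmod (cnj b * cis t + cnj a))\<^sup>2)) * of_circle (mob a b (circ t)))) (at t)"
proof -
 let ?n = "cnj b * cis t + cnj a"
 have n: "?n \<noteq> 0" using mob_den_nonzero[OF assms, of "circ t"] by simp
 have c: "(cis has_vector_derivative \<i> * cis t) (at t)"
  unfolding has_vector_derivative_def by (auto intro!: derivative_eq_intros)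
 have "((\<lambda>w. (a * w + b) / (cnj b * w + cnj a)) has_field_derivative
   (a * ?n - (a * cis t + b) * cnj b) / (?n * ?n)) (at (cis t))" by (auto intro!: derivative_eq_intros simp: n)
 from field_vector_diff_chain_at[OF c this]
 have "((\<lambda>t. of_circle (mob a b (circ t))) has_vector_derivative
   (\<i> * cis t) * ((a * ?n - (a * cis t + b) * cnj b) / (?n * ?n))) (at t)"
  by (simp add: o_def of_circle_mob assms)
 moreover have "a * ?n - (a * cis t + b) * cnj b = 1" using su_mult[OF assms] by (simp add: algebra_simps)
 moreover have "of_circle (mob a b (circ t)) = cis t * cnj ?n / ?n"
  using mob_num[of a "circ t" b] by (simp add: of_circle_mob assms)
 moreover have "\<i> * cis t * (1 / (?n * ?n)) =
   \<i> * of_real (inverse ((cmod ?n)\<^sup>2)) * (cis t * cnj ?n / ?n)"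
 proof -
  have aux: "\<i> * c * (1 / (x * x)) = \<i> * inverse (x * y) * (c * y / x)" if "x \<noteq> 0" "y \<noteq> 0" for c x y :: complex
   using that by (simp add: field_simps)
  have "of_real (inverse ((cmod ?n)\<^sup>2)) = inverse (?n * cnj ?n)"
   by (simp only: of_real_inverse complex_norm_square)
  with aux[OF n, of "cnj ?n" "cis t"] n show ?thesis by (simp only: complex_cnj_zero_iff not_False_eq_True)
 qed
 ultimately show ?thesis by (simp only:)
qed

text \<open>The covariance action \<open>beta\<close> written as a pullback along the inverse transformation.\<close>

definition pb :: "complex \<Rightarrow> complex \<Rightarrow> int \<Rightarrow> (circle \<Rightarrow> complex) \<Rightarrow> circle \<Rightarrow> complex"
 where "pb a b m f z = qf a b z powi m * f (mob a b z)"

lemma X_mob_mob: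
 assumes "su a b" shows "X_mob (mob a b) z = inverse (qf a b z)"
proof -
 have "vector_derivative (\<lambda>t. of_circle (mob a b (circ t))) (at (Arg (of_circle z))) =
  \<i> * of_real (inverse ((cmod (cnj b * cis (Arg (of_circle z)) + cnj a))\<^sup>2)) * of_circle (mob a b (circ (Arg (of_circle z))))"
  by (rule vector_derivative_at[OF mob_derivative[OF assms]])
 then show ?thesis unfolding X_mob_def qf_eq by (simp add: cis_Arg sgn_div_norm)
qed

text \<open>At the inverse image of \<open>z\<close> the factor \<open>qf\<close> of a
  transformation is the inverse of \<open>qf\<close> of the inverse transformation at
  \<open>z\<close>. As \<open>X_mob\<close> is itself an inverse, the two inversions cancel and the
  exponent stays \<open>int d - 1\<close>.\<close>

lemma beta_eq_pb:
 assumes "su a b" shows "beta d (mob a b) f = pb (cnj a) (- b) (int d - 1) f"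
proof
 fix z
 have inv: "inv (mob a b) = mob (cnj a) (- b)" by (rule inv_mob[OF assms])
 have n: "- cnj b * of_circle z + a \<noteq> 0" using mob_den_nonzero[OF su_inv[OF assms], of z] by simp
 let ?y = "mob (cnj a) (- b) z"
 have y: "of_circle ?y = (cnj a * of_circle z - b) / (- cnj b * of_circle z + a)"
  by (simp add: of_circle_mob su_inv assms)
 have "cnj b * of_circle ?y + cnj a =
   (cnj b * (cnj a * of_circle z - b) + cnj a * (- cnj b * of_circle z + a)) / (- cnj b * of_circle z + a)"
  unfolding y using n by (simp add: add_divide_distrib)
 also have "\<dots> = 1 / (- cnj b * of_circle z + a)" using su_mult[OF assms] by (simp add: algebra_simps)
 finally have "inverse (qf a b ?y) = qf (cnj a) (- b) z"
  unfolding qf_eq by (simp add: norm_divide power_divide field_simps)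
 then show "beta d (mob a b) f z = pb (cnj a) (- b) (int d - 1) f z"
  by (simp add: beta_def pb_def inv X_mob_mob assms)
qed

text \<open>Differentiation yields pullbacks of weight \<open>m - 1\<close>, whether it hits the
  weight or the function. Hence \<open>pb\<close> is treated for all integers \<open>m\<close> at
  once: inductions over the order of differentiation change the weight.\<close>

lemma has_dth_pb:
 assumes "su a b" "has_dth f f'"
 shows "has_dth (pb a b m f) (\<lambda>z. of_int m * (qd a b z * pb a b (m - 1) f z) + pb a b (m - 1) f' z)"
proof -
 have "((\<lambda>t. pb a b m f (circ t)) has_vector_derivative
   of_int m * (qd a b (circ t) * pb a b (m - 1) f (circ t)) + pb a b (m - 1) f' (circ t)) (at t)" for t
 proof -
  have 1: "((\<lambda>t. f (mob a b (circ t))) has_vector_derivative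
   of_real (inverse ((cmod (cnj b * cis t + cnj a))\<^sup>2)) * f' (mob a b (circ t))) (at t)"
   by (rule has_vector_derivative_compose_circle[OF mob_derivative[OF assms(1)] assms(2)])
  have q: "((\<lambda>t. qf a b (circ t)) has_vector_derivative qd a b (circ t)) (at t)"
   using has_dth_qf by (simp add: has_dth_def)
  have "((\<lambda>w. w powi m) has_field_derivative of_int m * qf a b (circ t) powi (m - 1)) (at (qf a b (circ t)))"
   using qf_nonzero[OF assms(1)] by (auto intro!: derivative_eq_intros)
  from field_vector_diff_chain_at[OF q this]
  have 2: "((\<lambda>t. qf a b (circ t) powi m) has_vector_derivative
   qd a b (circ t) * (of_int m * qf a b (circ t) powi (m - 1))) (at t)" by (simp add: o_def)
  have X: "qf a b (circ t) powi m * of_real (inverse ((cmod (cnj b * cis t + cnj a))\<^sup>2)) = qf a b (circ t) powi (m - 1)"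
   using qf_nonzero[OF assms(1), of "circ t"] by (simp add: qf_eq power_int_diff divide_inverse)
  have "qf a b (circ t) powi m * (of_real (inverse ((cmod (cnj b * cis t + cnj a))\<^sup>2)) * f' (mob a b (circ t))) +
     qd a b (circ t) * (of_int m * qf a b (circ t) powi (m - 1)) * f (mob a b (circ t)) =
   of_int m * (qd a b (circ t) * pb a b (m - 1) f (circ t)) + pb a b (m - 1) f' (circ t)"
   unfolding mult.assoc[symmetric] X by (simp add: pb_def algebra_simps)
  then show ?thesis using has_vector_derivative_mult[OF 2 1] unfolding pb_def[of a b m] by simp
 qed
 then show ?thesis by (simp add: has_dth_def)
qed

lemma csm_pb: "su a b \<Longrightarrow> csm n f \<Longrightarrow> csm n (pb a b m f)"
proof (induction n arbitrary: f m)
 case (Suc n)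
 obtain f' where f': "has_dth f f'" "csm n f'" using Suc.prems by auto
 have "csm n f" using Suc.prems(2) by (rule csm_Suc_lower)
 then have "csm n (\<lambda>z. of_int m * (qd a b z * pb a b (m - 1) f z) + pb a b (m - 1) f' z)"
  using Suc f' by (intro csm_add csm_cmult csm_mult smooth_csm[OF smooth_qd]) auto
 then show ?case using has_dth_pb[OF Suc.prems(1) f'(1)] by auto
qed simp

lemma smooth_pb: "su a b \<Longrightarrow> f \<in> smooth \<Longrightarrow> pb a b m f \<in> smooth"
 by (simp add: smooth_iff csm_pb)

lemma dth_pb: "su a b \<Longrightarrow> f \<in> smooth \<Longrightarrow>
  dth (pb a b m f) = (\<lambda>z. of_int m * (qd a b z * pb a b (m - 1) f z) + pb a b (m - 1) (dth f) z)"
 by (intro has_dth_imp_dth has_dth_pb smooth_has_dth)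

section \<open>Growth and continuity of pullbacks in the group element\<close>

lemma pb_sup_bound:
 assumes "su a b" "f \<in> smooth"
 shows "C_norm 0 (pb a b m f) \<le> (cmod a + cmod b) ^ (2 * nat \<bar>m\<bar>) * C_norm 0 f"
proof (rule C_norm_0_le)
 fix z
 have "cmod (qf a b z powi m) \<le> ((cmod a + cmod b)\<^sup>2) ^ nat \<bar>m\<bar>"
 proof (cases "m \<ge> 0")
  case True
  then show ?thesis using power_mono[OF qf_bounds(1)[OF assms(1), of z] norm_ge_zero, of "nat m"]
   by (simp add: power_int_def norm_power)
 next
  case False
  then show ?thesis using power_mono[OF qf_bounds(2)[OF assms(1), of z] norm_ge_zero, of "nat (- m)"]
   by (simp add: power_int_def norm_power norm_inverse)
 qed
 then show "cmod (pb a b m f z) \<le> (cmod a + cmod b) ^ (2 * nat \<bar>m\<bar>) * C_norm 0 f"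
  unfolding pb_def norm_mult power_mult by (intro mult_mono norm_le_C_norm_0 assms) auto
qed

lemma qd_bound: "C_norm N (qd a b) \<le> (C_norm N of_circle + C_norm N (\<lambda>z. cnj (of_circle z))) * (cmod a + cmod b) ^ 2"
proof -
 have "C_norm N (\<lambda>z. \<i> * (a * cnj b * of_circle z - cnj a * b * cnj (of_circle z)))
   \<le> cmod \<i> * (cmod (a * cnj b) * C_norm N of_circle + cmod (cnj a * b) * C_norm N (\<lambda>z. cnj (of_circle z)))"
  by (subst C_norm_cmult)
   (auto intro!: smooth_intros order_trans[OF C_norm_diff] simp: C_norm_cmult)
 also have "\<dots> = (C_norm N of_circle + C_norm N (\<lambda>z. cnj (of_circle z))) * (cmod a * cmod b)"
  by (simp add: norm_mult algebra_simps)
 also have "\<dots> \<le> (C_norm N of_circle + C_norm N (\<lambda>z. cnj (of_circle z))) * (cmod a + cmod b) ^ 2"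
  by (intro mult_left_mono) (auto simp: C_norm_nonneg power2_eq_square algebra_simps)
 finally show ?thesis by (simp add: qd_def[abs_def])
qed

text \<open>The point is polynomial growth in \<open>cmod a + cmod b\<close>, uniformly in the
  transformation: along the dilations this becomes exponential growth in the parameter, which
  Gaussian kernels absorb.\<close>

lemma pb_bound:
 "\<exists>C\<ge>0. \<exists>K. \<forall>a b. \<forall>f\<in>smooth. su a b \<longrightarrow> C_norm N (pb a b m f) \<le> C * (cmod a + cmod b) ^ K * C_norm N f"
proof (induction N arbitrary: m)
 case 0
 show ?case using pb_sup_bound by (intro exI[of _ 1] conjI exI[of _ "2 * nat \<bar>m\<bar>"]) auto
next
 case (Suc N)
 obtain C K where CK: "C \<ge> 0" "\<And>a b f. f\<in>smooth \<Longrightarrow> su a b \<Longrightarrow>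
   C_norm N (pb a b (m - 1) f) \<le> C * (cmod a + cmod b) ^ K * C_norm N f" using Suc by blast
 obtain M where M: "M \<ge> 0" "\<And>f g. f\<in>smooth \<Longrightarrow> g\<in>smooth \<Longrightarrow>
  C_norm N (\<lambda>z. f z * g z) \<le> M * C_norm N f * C_norm N g" using C_norm_mult by blast
 define Q where "Q = C_norm N of_circle + C_norm N (\<lambda>z. cnj (of_circle z))"
 have Q: "Q \<ge> 0" by (simp add: Q_def C_norm_nonneg)
 \<comment> \<open>Exponent \<open>2 * nat \<bar>m\<bar>\<close> for the supremum, \<open>K\<close>
   for the pullbacks of weight \<open>m - 1\<close>, and 2 for the factor \<open>qd\<close>.\<close>
 define K' where "K' = 2 * nat \<bar>m\<bar> + K + 2"
 define C' where "C' = 1 + \<bar>m\<bar> * (M * Q * C) + C"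
 have "C_norm (Suc N) (pb a b m f) \<le> C' * (cmod a + cmod b) ^ K' * C_norm (Suc N) f"
  if f: "f \<in> smooth" and su: "su a b" for a b f
 proof -
  define R where "R = cmod a + cmod b"
  have R: "R \<ge> 1" using su_ge_1[OF su] by (simp add: R_def)
  define S where "S = C_norm (Suc N) f"
  have le: "C_norm 0 f \<le> S" "C_norm N f \<le> S" "C_norm N (dth f) \<le> S" "0 \<le> S" "0 \<le> C_norm N f"
   using f by (auto simp: S_def C_norm_mono C_norm_Suc_ge C_norm_dth_le C_norm_nonneg)
  have pw: "R ^ (2 * nat \<bar>m\<bar>) \<le> R ^ K'" "R ^ K \<le> R ^ K'" "R ^ 2 * R ^ K \<le> R ^ K'"
   unfolding power_add[symmetric] by (intro power_increasing; use R in \<open>simp add: K'_def\<close>)+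
  have nR: "0 \<le> R ^ j" for j using R by simp
  have 1: "C_norm 0 (pb a b m f) \<le> R ^ K' * S" by (rule order_trans[OF pb_sup_bound[OF su f]])
    (use le pw nR in \<open>auto simp: R_def[symmetric] C_norm_0_nonneg f intro!: mult_mono\<close>)
  have "C_norm N (\<lambda>z. qd a b z * pb a b (m - 1) f z) \<le> M * C_norm N (qd a b) * C_norm N (pb a b (m - 1) f)"
   by (intro M smooth_qd smooth_pb su f)
  also have "\<dots> \<le> M * (Q * R ^ 2) * (C * R ^ K * S)"
  proof (intro mult_mono mult_left_mono)
   show "C_norm N (qd a b) \<le> Q * R ^ 2" using qd_bound by (simp add: Q_def R_def)
   have "C_norm N (pb a b (m - 1) f) \<le> C * R ^ K * C_norm N f" using CK(2)[OF f su] by (simp add: R_def)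
   also have "\<dots> \<le> C * R ^ K * S" using le CK nR by (intro mult_left_mono) auto
   finally show "C_norm N (pb a b (m - 1) f) \<le> C * R ^ K * S" .
  qed (use M Q R in \<open>auto simp: C_norm_nonneg smooth_pb smooth_qd su f\<close>)
  also have "\<dots> = (M * Q * C) * (R ^ 2 * R ^ K) * S" by simp
  also have "\<dots> \<le> (M * Q * C) * R ^ K' * S"
   using pw le M Q CK by (intro mult_right_mono mult_left_mono) auto
  finally have 2: "C_norm N (\<lambda>z. qd a b z * pb a b (m - 1) f z) \<le> (M * Q * C) * R ^ K' * S" .
  have "C_norm N (pb a b (m - 1) (dth f)) \<le> C * R ^ K * C_norm N (dth f)"
   using CK(2)[OF smooth_dth[OF f] su] by (simp add: R_def)
  also have "\<dots> \<le> C * R ^ K' * S"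
   using le CK pw nR by (intro mult_mono mult_left_mono) (auto simp: C_norm_nonneg f smooth_dth)
  finally have 3: "C_norm N (pb a b (m - 1) (dth f)) \<le> C * R ^ K' * S" .
  have "C_norm N (dth (pb a b m f)) \<le>
    C_norm N (\<lambda>z. of_int m * (qd a b z * pb a b (m - 1) f z)) + C_norm N (pb a b (m - 1) (dth f))"
   unfolding dth_pb[OF su f] by (intro C_norm_add smooth_intros smooth_pb smooth_qd su f smooth_dth)
  also have "\<dots> = \<bar>m\<bar> * C_norm N (\<lambda>z. qd a b z * pb a b (m - 1) f z) + C_norm N (pb a b (m - 1) (dth f))"
   by (subst C_norm_cmult) (auto intro!: smooth_intros smooth_pb smooth_qd su f)
  also have "\<dots> \<le> \<bar>m\<bar> * ((M * Q * C) * R ^ K' * S) + C * R ^ K' * S"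
   using 2 3 by (intro add_mono mult_left_mono) auto
  finally have "C_norm (Suc N) (pb a b m f) \<le> R ^ K' * S + (\<bar>m\<bar> * ((M * Q * C) * R ^ K' * S) + C * R ^ K' * S)"
   using 1 by (simp add: C_norm_Suc)
  also have "\<dots> = C' * R ^ K' * S" by (simp add: C'_def algebra_simps)
  finally show ?thesis by (simp add: R_def S_def)
 qed
 moreover have "C' \<ge> 0" using M Q CK by (simp add: C'_def)
 ultimately show ?case by blast
qed

lemma continuous_pb:
 assumes f: "f \<in> smooth"
 shows "continuous_on ({p. su (fst p) (snd p)} \<times> UNIV) (\<lambda>(p, z). pb (fst p) (snd p) m f z)"
proof -
 let ?A = "{p. su (fst p) (snd p)} \<times> (UNIV :: circle set)"
 have o: "continuous_on ?A (\<lambda>x. of_circle (snd x))"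
  by (rule continuous_on_compose2[OF continuous_of_circle[of UNIV]]) (auto intro!: continuous_intros)
 have q: "continuous_on ?A (\<lambda>x. qf (fst (fst x)) (snd (fst x)) (snd x))"
  unfolding qf_def by (intro continuous_intros o)
 have qp: "continuous_on ?A (\<lambda>x. qf (fst (fst x)) (snd (fst x)) (snd x) powi m)"
  by (intro continuous_on_power_int q) (auto simp: qf_nonzero)
 have "continuous_on ?A (\<lambda>x. (fst (fst x) * of_circle (snd x) + snd (fst x)) /
   (cnj (snd (fst x)) * of_circle (snd x) + cnj (fst (fst x))))"
  by (intro continuous_intros o) (auto simp: mob_den_nonzero)
 then have "continuous_on ?A (\<lambda>x. of_circle (mob (fst (fst x)) (snd (fst x)) (snd x)))"
  by (rule continuous_on_eq) (auto simp: of_circle_mob)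
 then have "continuous_on ?A (\<lambda>x. mob (fst (fst x)) (snd (fst x)) (snd x))"
  by (simp add: continuous_on_circle_iff)
 then have "continuous_on ?A (\<lambda>x. f (mob (fst (fst x)) (snd (fst x)) (snd x)))"
  by (rule continuous_on_compose2[OF smooth_continuous[OF f, of UNIV]]) auto
 then have "continuous_on ?A (\<lambda>x. pb (fst (fst x)) (snd (fst x)) m f (snd x))"
  unfolding pb_def by (intro continuous_on_mult qp)
 then show ?thesis by (simp add: case_prod_unfold)
qed

lemma tendsto_zero_le:
 fixes f g :: "'i \<Rightarrow> real"
 assumes "(g \<longlongrightarrow> 0) F" "\<And>i. 0 \<le> f i" "\<And>i. f i \<le> g i"
 shows "(f \<longlongrightarrow> 0) F"
 by (rule tendsto_sandwich[of "\<lambda>_. 0" f F g]) (use assms in auto)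

lemma C_norm_mult_tendsto:
 assumes "\<And>i. f i \<in> smooth" "\<And>i. g i \<in> smooth" "f0 \<in> smooth" "g0 \<in> smooth"
  "((\<lambda>i. C_norm N (\<lambda>z. f i z - f0 z)) \<longlongrightarrow> 0) F" "((\<lambda>i. C_norm N (\<lambda>z. g i z - g0 z)) \<longlongrightarrow> 0) F"
 shows "((\<lambda>i. C_norm N (\<lambda>z. f i z * g i z - f0 z * g0 z)) \<longlongrightarrow> 0) F"
proof -
 obtain M where M: "M \<ge> 0" "\<And>f g. f\<in>smooth \<Longrightarrow> g\<in>smooth \<Longrightarrow>
  C_norm N (\<lambda>z. f z * g z) \<le> M * C_norm N f * C_norm N g" using C_norm_mult by blast
 let ?d = "\<lambda>i. C_norm N (\<lambda>z. f i z - f0 z)" and ?e = "\<lambda>i. C_norm N (\<lambda>z. g i z - g0 z)"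
 show ?thesis
 proof (rule tendsto_zero_le)
  show "((\<lambda>i. M * ?d i * ?e i + (M * ?d i * C_norm N g0 + M * C_norm N f0 * ?e i)) \<longlongrightarrow> 0) F"
   by (rule tendsto_eq_intros assms refl | simp)+
  fix i
  show "0 \<le> C_norm N (\<lambda>z. f i z * g i z - f0 z * g0 z)" by (intro C_norm_nonneg smooth_intros assms)
  have eq: "(\<lambda>z. f i z * g i z - f0 z * g0 z) = (\<lambda>z. (f i z - f0 z) * (g i z - g0 z) + ((f i z - f0 z) * g0 z + f0 z * (g i z - g0 z)))"
   by (simp add: algebra_simps)
  have "C_norm N (\<lambda>z. f i z * g i z - f0 z * g0 z) \<le> C_norm N (\<lambda>z. (f i z - f0 z) * (g i z - g0 z)) + (C_norm N (\<lambda>z. (f i z - f0 z) * g0 z) + C_norm N (\<lambda>z. f0 z * (g i z - g0 z)))"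
   unfolding eq by (intro order_trans[OF C_norm_add] add_left_mono C_norm_add smooth_intros assms)
  also have "\<dots> \<le> M * ?d i * ?e i + (M * ?d i * C_norm N g0 + M * C_norm N f0 * ?e i)"
   by (intro add_mono M smooth_intros assms)
  finally show "C_norm N (\<lambda>z. f i z * g i z - f0 z * g0 z) \<le> M * ?d i * ?e i + (M * ?d i * C_norm N g0 + M * C_norm N f0 * ?e i)" .
 qed
qed

lemma C_norm_add_tendsto:
 assumes "\<And>i. f i \<in> smooth" "\<And>i. g i \<in> smooth" "f0 \<in> smooth" "g0 \<in> smooth"
  "((\<lambda>i. C_norm N (\<lambda>z. f i z - f0 z)) \<longlongrightarrow> 0) F" "((\<lambda>i. C_norm N (\<lambda>z. g i z - g0 z)) \<longlongrightarrow> 0) F"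
 shows "((\<lambda>i. C_norm N (\<lambda>z. (f i z + g i z) - (f0 z + g0 z))) \<longlongrightarrow> 0) F"
proof (rule tendsto_zero_le)
 show "((\<lambda>i. C_norm N (\<lambda>z. f i z - f0 z) + C_norm N (\<lambda>z. g i z - g0 z)) \<longlongrightarrow> 0) F"
  using tendsto_add[OF assms(5,6)] by simp
 fix i
 show "0 \<le> C_norm N (\<lambda>z. (f i z + g i z) - (f0 z + g0 z))" by (intro C_norm_nonneg smooth_intros assms)
 have "(\<lambda>z. (f i z + g i z) - (f0 z + g0 z)) = (\<lambda>z. (f i z - f0 z) + (g i z - g0 z))" by (simp add: algebra_simps)
 then show "C_norm N (\<lambda>z. (f i z + g i z) - (f0 z + g0 z)) \<le> C_norm N (\<lambda>z. f i z - f0 z) + C_norm N (\<lambda>z. g i z - g0 z)"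
  by (simp only: C_norm_add smooth_diff assms)
qed

lemma qd_tendsto:
 assumes "(a \<longlongrightarrow> a0) F" "(b \<longlongrightarrow> b0) F"
 shows "((\<lambda>i. C_norm N (\<lambda>z. qd (a i) (b i) z - qd a0 b0 z)) \<longlongrightarrow> 0) F"
proof (rule tendsto_zero_le)
 let ?c = "\<lambda>i. a i * cnj (b i) - a0 * cnj b0" and ?d = "\<lambda>i. cnj (a i) * b i - cnj a0 * b0"
 show "((\<lambda>i. cmod (\<i> * ?c i) * C_norm N of_circle + cmod (\<i> * ?d i) * C_norm N (\<lambda>z. cnj (of_circle z))) \<longlongrightarrow> 0) F"
  by (rule tendsto_eq_intros assms refl | simp)+
 fix i
 show "0 \<le> C_norm N (\<lambda>z. qd (a i) (b i) z - qd a0 b0 z)" by (intro C_norm_nonneg smooth_intros smooth_qd)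
 have "(\<lambda>z. qd (a i) (b i) z - qd a0 b0 z) = (\<lambda>z. (\<i> * ?c i) * of_circle z - (\<i> * ?d i) * cnj (of_circle z))"
  by (simp add: qd_def algebra_simps)
 then show "C_norm N (\<lambda>z. qd (a i) (b i) z - qd a0 b0 z) \<le>
   cmod (\<i> * ?c i) * C_norm N of_circle + cmod (\<i> * ?d i) * C_norm N (\<lambda>z. cnj (of_circle z))"
  using C_norm_diff[of "\<lambda>z. (\<i> * ?c i) * of_circle z" "\<lambda>z. (\<i> * ?d i) * cnj (of_circle z)" N]
  by (simp only: C_norm_cmult smooth_of_circle smooth_cnj_of_circle smooth_cmult)
qed

text \<open>For the supremum norm, compactness of the circle makes joint continuity uniform in
  \<open>z\<close>. Each further derivative is reduced to the lower order by \<open>dth_pb\<close>,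
  with \<open>m\<close> and \<open>f\<close> general.\<close>

lemma pb_tendsto:
 assumes a: "(a \<longlongrightarrow> a0) F" and b: "(b \<longlongrightarrow> b0) F" and su: "\<And>i. su (a i) (b i)" and su0: "su a0 b0"
  and f: "f \<in> smooth"
 shows "((\<lambda>i. C_norm N (\<lambda>z. pb (a i) (b i) m f z - pb a0 b0 m f z)) \<longlongrightarrow> 0) F"
 using f
proof (induction N arbitrary: f m)
 case 0
 show ?case
 proof (rule tendstoI)
  fix e :: real assume e: "e > 0"
  obtain X0 where X0: "(a0, b0) \<in> X0" "open X0"
   "\<forall>x\<in>X0 \<inter> {p. su (fst p) (snd p)}. \<forall>t\<in>UNIV. dist (case (x, t) of (p, z) \<Rightarrow> pb (fst p) (snd p) m f z)
     (case ((a0, b0), t) of (p, z) \<Rightarrow> pb (fst p) (snd p) m f z) \<le> e / 2"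
   by (rule continuous_on_prod_compactE[OF continuous_pb[OF 0] compact_circle, of "(a0,b0)" "e/2"])
    (use e su0 in auto)
  have "\<forall>\<^sub>F i in F. (a i, b i) \<in> X0" using topological_tendstoD[OF tendsto_Pair[OF a b] X0(2,1)] .
  then show "\<forall>\<^sub>F i in F. dist (C_norm 0 (\<lambda>z. pb (a i) (b i) m f z - pb a0 b0 m f z)) 0 < e"
  proof eventually_elim
   case (elim i)
   have "C_norm 0 (\<lambda>z. pb (a i) (b i) m f z - pb a0 b0 m f z) \<le> e / 2"
    by (rule C_norm_0_le) (use bspec[OF X0(3), of "(a i, b i)"] elim su in \<open>auto simp: dist_norm\<close>)
   moreover have "0 \<le> C_norm 0 (\<lambda>z. pb (a i) (b i) m f z - pb a0 b0 m f z)"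
    by (intro C_norm_nonneg smooth_intros smooth_pb su su0 0)
   ultimately show ?case using e by simp
  qed
 qed
next
 case (Suc N)
 note sm = smooth_pb[OF su] smooth_pb[OF su0] smooth_qd Suc.prems smooth_dth[OF Suc.prems]
 have d: "dth (\<lambda>z. pb (a i) (b i) m f z - pb a0 b0 m f z) = (\<lambda>z.
   (of_int m * (qd (a i) (b i) z * pb (a i) (b i) (m - 1) f z) + pb (a i) (b i) (m - 1) (dth f) z) -
   (of_int m * (qd a0 b0 z * pb a0 b0 (m - 1) f z) + pb a0 b0 (m - 1) (dth f) z))" for i
  by (subst dth_diff) (auto simp: sm dth_pb su su0)
 have "((\<lambda>i. C_norm 0 (\<lambda>z. pb (a i) (b i) m f z - pb a0 b0 m f z)) \<longlongrightarrow> 0) F"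
 proof (rule tendsto_zero_le)
  fix i
  show "C_norm 0 (\<lambda>z. pb (a i) (b i) m f z - pb a0 b0 m f z) \<le> C_norm N (\<lambda>z. pb (a i) (b i) m f z - pb a0 b0 m f z)"
   by (intro C_norm_mono smooth_intros sm) simp
 qed (auto intro!: Suc C_norm_nonneg smooth_intros sm)
 moreover have "((\<lambda>i. C_norm N (dth (\<lambda>z. pb (a i) (b i) m f z - pb a0 b0 m f z))) \<longlongrightarrow> 0) F"
  unfolding d
 proof (intro C_norm_add_tendsto C_norm_mult_tendsto[where f = "\<lambda>i z. of_int m" and ?f0.0 = "\<lambda>z. of_int m"] C_norm_mult_tendsto[where f = "\<lambda>i. qd (a i) (b i)"] qd_tendsto a b)
 qed (auto intro!: smooth_intros sm Suc.IH)
 ultimately show ?case by (simp add: C_norm_Suc tendsto_add_zero)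
qed

section \<open>Trigonometric polynomials are dense\<close>

definition ej :: "int \<Rightarrow> circle \<Rightarrow> complex"
 where "ej j z = of_circle z powi j"

lemma cis_powi: "cis t powi j = cis (of_int j * t)"
 by (cases "j \<ge> 0") (simp_all add: power_int_def Complex.DeMoivre cis_inverse)

lemma ej_circ: "ej j (circ t) = cis (of_int j * t)"
 by (simp add: ej_def cis_powi)

lemma has_dth_ej: "has_dth (ej j) (\<lambda>z. \<i> * of_int j * ej j z)"
proof -
 have "((\<lambda>t. cis (of_int j * t)) has_vector_derivative \<i> * of_int j * cis (of_int j * t)) (at t)" for t
  unfolding has_vector_derivative_def by (auto intro!: derivative_eq_intros simp: scaleR_conv_of_real algebra_simps)
 then show ?thesis by (simp add: has_dth_def ej_circ)
qed

lemma csm_ej: "csm n (ej j)"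
proof (induction n)
 case (Suc n)
 then show ?case using has_dth_ej csm_cmult[of n "ej j" "\<i> * of_int j"] by auto
qed simp

lemma smooth_ej [simp]: "ej j \<in> smooth"
 by (simp add: smooth_iff csm_ej)

definition cmean :: "(real \<Rightarrow> complex) \<Rightarrow> complex"
 where "cmean g = integral {-pi..pi} g /\<^sub>R (2 * pi)"

definition fc :: "int \<Rightarrow> (circle \<Rightarrow> complex) \<Rightarrow> complex"
 where "fc j f = cmean (\<lambda>t. f (circ t) * cis (- of_int j * t))"

lemma cmean_sum:
 assumes "finite A" "\<And>i. i \<in> A \<Longrightarrow> continuous_on {-pi..pi} (g i)"
 shows "cmean (\<lambda>t. \<Sum>i\<in>A. g i t) = (\<Sum>i\<in>A. cmean (g i))"
 unfolding cmean_def
 by (subst integral_sum) (auto simp: assms scaleR_sum_right intro!: integrable_continuous_interval)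

lemma cmean_cmult: "cmean (\<lambda>t. c * g t) = c * cmean g"
 unfolding cmean_def by (cases "c = 0") auto

lemma cmean_diff:
 "continuous_on {-pi..pi} g \<Longrightarrow> continuous_on {-pi..pi} h \<Longrightarrow> cmean (\<lambda>t. g t - h t) = cmean g - cmean h"
 unfolding cmean_def by (subst integral_diff) (auto simp: scaleR_diff_right intro!: integrable_continuous_interval)

lemma cmean_add:
 "continuous_on {-pi..pi} g \<Longrightarrow> continuous_on {-pi..pi} h \<Longrightarrow> cmean (\<lambda>t. g t + h t) = cmean g + cmean h"
 unfolding cmean_def by (subst integral_add) (auto simp: scaleR_add_right intro!: integrable_continuous_interval)

text \<open>The majorant is complex valued and only its real part is compared, so that kernels given
  as trigonometric sums can be inserted as they are.\<close>

lemma cmean_norm_le: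
 assumes "continuous_on {-pi..pi} g" "continuous_on {-pi..pi} h" "\<And>t. norm (g t) \<le> Re (h t)"
 shows "norm (cmean g) \<le> Re (cmean h)"
proof -
 have h: "h integrable_on {-pi..pi}" by (intro integrable_continuous_interval assms)
 have "norm (integral {-pi..pi} g) \<le> integral {-pi..pi} (\<lambda>t. Re (h t))"
  using assms by (intro integral_norm_bound_integral integrable_continuous_interval continuous_intros) auto
 also have "\<dots> = Re (integral {-pi..pi} h)" using integral_linear[OF h bounded_linear_Re] by (simp add: o_def)
 finally show ?thesis by (simp add: cmean_def mult_left_mono)
qed

lemma cmean_cis: "cmean (\<lambda>t. cis (of_int j * (s - t))) = (if j = 0 then 1 else 0)"
proof (cases "j = 0")
 case True
 then show ?thesis by (simp add: cmean_def scaleR_conv_of_real)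
next
 case False
 have "((\<lambda>t. cis (of_int j * (s - t))) has_integral
   (cis (of_int j * (s - pi)) / (- \<i> * of_int j) - cis (of_int j * (s - - pi)) / (- \<i> * of_int j))) {-pi..pi}"
 proof (rule fundamental_theorem_of_calculus)
  fix t
  show "((\<lambda>t. cis (of_int j * (s - t)) / (- \<i> * of_int j)) has_vector_derivative cis (of_int j * (s - t))) (at t within {-pi..pi})"
   unfolding has_vector_derivative_def using False
   by (auto intro!: derivative_eq_intros simp: fun_eq_iff scaleR_conv_of_real field_simps)
 qed simp
 moreover have "cis (of_int j * (s - - pi)) = cis (of_int j * (s - pi))"
 proof -
  have "cis (of_int j * (s - - pi)) = cis (of_int j * (s - pi)) * cis (2 * pi * of_int j)"
   by (simp add: cis_mult algebra_simps)
  then show ?thesis by simp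
 qed
 ultimately show ?thesis using False by (simp add: cmean_def integral_unique)
qed

text \<open>Integration by parts; the boundary terms at \<open>- pi\<close> and \<open>pi\<close>
  agree by periodicity.\<close>

lemma fc_dth:
 assumes f: "f \<in> smooth" shows "fc j (dth f) = \<i> * of_int j * fc j f"
proof -
 let ?g = "\<lambda>t. f (circ t) * cis (- of_int j * t)"
 have c: "((\<lambda>t. cis (- of_int j * t)) has_vector_derivative - \<i> * of_int j * cis (- of_int j * t)) (at t)" for t
  unfolding has_vector_derivative_def by (auto intro!: derivative_eq_intros simp: scaleR_conv_of_real algebra_simps)
 have "(?g has_vector_derivative (f (circ t) * (- \<i> * of_int j * cis (- of_int j * t)) + dth f (circ t) * cis (- of_int j * t))) (at t)" for t
  using smooth_has_dth[OF f] by (intro has_vector_derivative_mult c) (simp add: has_dth_def)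
 then have "((\<lambda>t. f (circ t) * (- \<i> * of_int j * cis (- of_int j * t)) + dth f (circ t) * cis (- of_int j * t)) has_integral (?g pi - ?g (- pi))) {-pi..pi}"
  by (intro fundamental_theorem_of_calculus) (auto intro: has_vector_derivative_at_within)
 moreover have "?g pi = ?g (- pi)"
 proof -
  have "circ pi = circ (- pi)" using circ_2pi[of "- pi"] by simp
  moreover have "cis (- of_int j * pi) = cis (- of_int j * - pi)"
  proof -
   have "cis (- of_int j * - pi) = cis (- of_int j * pi) * cis (2 * pi * of_int j)"
    by (simp add: cis_mult algebra_simps)
   then show ?thesis by simp
  qed
  ultimately show ?thesis by simp
 qed
 ultimately have "integral {-pi..pi} (\<lambda>t. f (circ t) * (- \<i> * of_int j * cis (- of_int j * t)) + dth f (circ t) * cis (- of_int j * t)) = 0"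
  by (simp add: integral_unique)
 then have "0 = cmean (\<lambda>t. f (circ t) * (- \<i> * of_int j * cis (- of_int j * t)) + dth f (circ t) * cis (- of_int j * t))"
  by (simp add: cmean_def)
 also have "\<dots> = cmean (\<lambda>t. (- \<i> * of_int j) * ?g t) + fc j (dth f)" unfolding fc_def
  by (subst cmean_add[symmetric])
   (auto intro!: continuous_intros smooth_continuous_circ f smooth_dth simp: algebra_simps)
 also have "\<dots> = - \<i> * of_int j * fc j f + fc j (dth f)" by (simp only: cmean_cmult fc_def)
 finally show ?thesis by (simp add: algebra_simps eq_neg_iff_add_eq_0)
qed

section \<open>A positive summation kernel and its moments\<close>

definition fw :: "nat \<Rightarrow> int \<Rightarrow> complex"
 where "fw n j = of_nat (2 * n choose nat (int n + j)) / of_nat (2 * n choose n)"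

text \<open>Convolution of \<open>f\<close> with a multiple of the kernel \<open>(1 + cos s)^n\<close>.\<close>

definition fej :: "nat \<Rightarrow> (circle \<Rightarrow> complex) \<Rightarrow> circle \<Rightarrow> complex"
 where "fej n f z = (\<Sum>j\<in>{- int n..int n}. fw n j * fc j f * ej j z)"

definition fker :: "nat \<Rightarrow> real \<Rightarrow> complex"
 where "fker n s = (\<Sum>j\<in>{- int n..int n}. fw n j * cis (of_int j * s))"

text \<open>The binomial expansion of \<open>(cis s + 1) ^ (2 * n)\<close>, recentred by
  \<open>cis (- of_nat n * s)\<close>. The closed form shows positivity, the Fourier form gives the
  moments.\<close>

lemma fker_eq: "fker n s = of_real ((2 + 2 * cos s) ^ n / (2 * n choose n))"
proof -
 have "(\<Sum>j\<in>{- int n..int n}. of_nat (2 * n choose nat (int n + j)) * cis (of_int j * s)) =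
   (\<Sum>k\<le>2 * n. of_nat (2 * n choose k) * cis (of_int (int k - int n) * s))"
  by (rule sum.reindex_bij_witness[of _ "\<lambda>k. int k - int n" "\<lambda>j. nat (int n + j)"]) auto
 also have "\<dots> = (\<Sum>k\<le>2 * n. of_nat (2 * n choose k) * cis s ^ k * 1 ^ (2 * n - k)) * cis (- of_nat n * s)"
  unfolding sum_distrib_right by (intro sum.cong) (auto simp: Complex.DeMoivre cis_mult algebra_simps)
 also have "\<dots> = (cis s + 1) ^ (2 * n) * cis (- of_nat n * s)" by (simp only: binomial_ring)
 also have "cis (- of_nat n * s) = cis (- s) ^ n" by (simp add: Complex.DeMoivre)
 also have "(cis s + 1) ^ (2 * n) * cis (- s) ^ n = ((cis s + 1)\<^sup>2 * cis (- s)) ^ n"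
  by (simp add: power_mult power_mult_distrib)
 also have "(cis s + 1)\<^sup>2 * cis (- s) = of_real (2 + 2 * cos s)"
 proof -
  have "(cis s + 1)\<^sup>2 * cis (- s) = cis s * (cis s * cis (- s)) + 2 * (cis s * cis (- s)) + cis (- s)"
   by (simp add: power2_eq_square algebra_simps)
  also have "cis s * cis (- s) = 1" by (simp add: cis_mult)
  finally show ?thesis by (simp add: complex_eq_iff)
 qed
 finally have "(\<Sum>j\<in>{- int n..int n}. of_nat (2 * n choose nat (int n + j)) * cis (of_int j * s)) = of_real ((2 + 2 * cos s) ^ n)"
  by simp
 then show ?thesis unfolding fker_def fw_def by (simp add: sum_divide_distrib[symmetric])
qed

lemma cmean_ker:
 assumes "continuous_on UNIV (\<lambda>t. f (circ t))"
 shows "cmean (\<lambda>t. f (circ t) * fker n (s - t)) = fej n f (circ s)"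
proof -
 have "cmean (\<lambda>t. f (circ t) * fker n (s - t)) =
   cmean (\<lambda>t. \<Sum>j\<in>{- int n..int n}. (fw n j * ej j (circ s)) * (f (circ t) * cis (- of_int j * t)))"
  unfolding fker_def sum_distrib_left by (intro arg_cong[where f = cmean] ext sum.cong refl)
   (simp add: ej_circ algebra_simps flip: cis_mult, simp add: cis_mult algebra_simps)
 also have "\<dots> = (\<Sum>j\<in>{- int n..int n}. fw n j * ej j (circ s) * fc j f)" by (subst cmean_sum)
   (auto intro!: continuous_intros continuous_on_subset[OF assms] simp: cmean_cmult fc_def)
 finally show ?thesis by (simp add: fej_def mult.commute mult.left_commute)
qed

lemma fw_0: "fw n 0 = 1"
 by (simp add: fw_def)

lemma fw_1:
 assumes "n \<ge> 1" shows "fw n 1 = of_nat n / of_nat (n + 1)" "fw n (-1) = of_nat n / of_nat (n + 1)"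
proof -
 have sym: "(2 * n choose (n - 1)) = (2 * n choose (n + 1))"
  using binomial_symmetric[of "n + 1" "2 * n"] assms by simp
 have "(n + 1) * (2 * n choose (n + 1)) = n * (2 * n choose n)"
  using binomial_absorb_comp[of "2 * n" n] binomial_absorption[of n "2 * n"]
  by (metis Suc_eq_plus1 diff_add_inverse mult_2)
 then have "complex_of_nat (n + 1) * of_nat (2 * n choose (n + 1)) = of_nat n * of_nat (2 * n choose n)"
  by (metis of_nat_mult)
 then have *: "of_nat (2 * n choose (n + 1)) / of_nat (2 * n choose n) = complex_of_nat n / of_nat (n + 1)"
  by (subst frac_eq_eq) (auto simp: algebra_simps simp del: of_nat_Suc of_nat_add)
 have "nat (int n + 1) = n + 1" "nat (int n + - 1) = n - 1" using assms by auto
 then show "fw n 1 = of_nat n / of_nat (n + 1)" "fw n (-1) = of_nat n / of_nat (n + 1)"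
  unfolding fw_def using * sym by metis+
qed

lemma continuous_fker: "continuous_on A (\<lambda>t. fker n (s - t))"
 unfolding fker_def by (intro continuous_intros)

lemma cmean_fker: "cmean (\<lambda>t. fker n (s - t)) = 1"
proof -
 have "cmean (\<lambda>t. fker n (s - t)) = (\<Sum>j\<in>{- int n..int n}. fw n j * (if j = 0 then 1 else 0))"
  unfolding fker_def by (subst cmean_sum) (auto intro!: continuous_intros simp: cmean_cmult cmean_cis)
 also have "\<dots> = fw n 0" by (subst sum.remove[of _ 0]) auto
 finally show ?thesis by (simp add: fw_0)
qed

text \<open>\<open>2 - 2 * cos (s - t)\<close> is the square of the chord and contains only the
  modes 0, 1 and -1. So the integral is \<open>2 * fw n 0 - (fw n (-1) + fw n 1)\<close>, which
  \<open>fw_1\<close> evaluates.\<close>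

lemma cmean_fker_second:
 assumes "n \<ge> 1"
 shows "cmean (\<lambda>t. of_real (2 - 2 * cos (s - t)) * fker n (s - t)) = 2 / of_nat (n + 1)"
proof -
 have e: "of_real (2 - 2 * cos u) = 2 - (cis u + cis (- u))" for u by (simp add: complex_eq_iff)
 have "of_real (2 - 2 * cos u) * fker n u = (\<Sum>j\<in>{- int n..int n}.
   2 * fw n j * cis (of_int j * u) - (fw n j * cis (of_int (j + 1) * u) + fw n j * cis (of_int (j - 1) * u)))" for u
  unfolding fker_def sum_distrib_left e by (intro sum.cong) (simp_all add: algebra_simps cis_mult)
 then have "cmean (\<lambda>t. of_real (2 - 2 * cos (s - t)) * fker n (s - t)) = cmean (\<lambda>t. \<Sum>j\<in>{- int n..int n}.
   2 * fw n j * cis (of_int j * (s - t)) - (fw n j * cis (of_int (j + 1) * (s - t)) + fw n j * cis (of_int (j - 1) * (s - t))))"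
  by (simp only:)
 also have "\<dots> = (\<Sum>j\<in>{- int n..int n}. 2 * fw n j * (if j = 0 then 1 else 0)
   - (fw n j * (if j + 1 = 0 then 1 else 0) + fw n j * (if j - 1 = 0 then 1 else 0)))"
 proof -
  have "cmean (\<lambda>t. 2 * fw n j * cis (of_int j * (s - t)) - (fw n j * cis (of_int (j + 1) * (s - t)) + fw n j * cis (of_int (j - 1) * (s - t))))
   = 2 * fw n j * (if j = 0 then 1 else 0) - (fw n j * (if j + 1 = 0 then 1 else 0) + fw n j * (if j - 1 = 0 then 1 else 0))" for j
   by (subst cmean_diff, (intro continuous_intros)+, subst cmean_add, (intro continuous_intros)+)
    (simp only: cmean_cmult cmean_cis)
  then show ?thesis by (subst cmean_sum) (auto intro!: continuous_intros sum.cong)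
 qed
 also have "\<dots> = (\<Sum>j\<in>{- int n..int n}. if j = 0 then 2 * fw n j else 0) -
   ((\<Sum>j\<in>{- int n..int n}. if j = -1 then fw n j else 0) + (\<Sum>j\<in>{- int n..int n}. if j = 1 then fw n j else 0))"
  unfolding sum.distrib[symmetric] sum_subtractf[symmetric] by (intro sum.cong) auto
 also have "\<dots> = 2 * fw n 0 - (fw n (-1) + fw n 1)" using assms by (simp add: sum.delta)
 also have "\<dots> = 2 / of_nat (n + 1)"
 proof -
  have aux: "2 * 1 - (c / d + c / d) = 2 / d" if "d = c + 1" "d \<noteq> 0" for c d :: complex
   using that(2) by (simp add: eq_divide_eq left_diff_distrib distrib_right) (simp add: that(1))
  show ?thesis unfolding fw_0 fw_1[OF assms]
   by (rule aux) (simp_all add: of_nat_neq_0 del: of_nat_add of_nat_Suc flip: of_nat_Suc, simp)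
 qed
 finally show ?thesis .
qed

lemma smooth_fej: "fej n f \<in> smooth"
 unfolding fej_def[abs_def] by (intro smooth_sum smooth_cmult smooth_ej)

lemma dth_fej: "f \<in> smooth \<Longrightarrow> dth (fej n f) = fej n (dth f)"
proof (rule has_dth_imp_dth)
 assume f: "f \<in> smooth"
 have "has_dth (\<lambda>z. \<Sum>j\<in>A. fw n j * fc j f * ej j z) (\<lambda>z. \<Sum>j\<in>A. fw n j * fc j f * (\<i> * of_int j * ej j z))"
  if "finite A" for A
  using that by (induction A rule: finite_induct) (auto intro!: has_dth_const has_dth_add has_dth_cmult has_dth_ej)
 then show "has_dth (fej n f) (fej n (dth f))"
  unfolding fej_def[abs_def] fc_dth[OF f] by (simp add: mult.assoc mult.left_commute)
qed

lemma fej_sup: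
 assumes f: "f \<in> smooth" and n: "n \<ge> 1"
 shows "C_norm 0 (\<lambda>z. fej n f z - f z) \<le> 4 * C_norm 1 f * (3 / sqrt (n + 1))"
proof (rule C_norm_0_le)
 fix z
 obtain s where z: "z = circ s" using circ_surj by blast
 define L where "L = 4 * C_norm 1 f"
 have L: "L \<ge> 0" using f by (simp add: L_def C_norm_nonneg)
 \<comment> \<open>The scale of the kernel: its square is of the order of the second moment
   \<open>2 / (n + 1)\<close>, so that the two terms of the estimate below balance.\<close>
 define \<eta> where "\<eta> = 1 / sqrt (n + 1)"
 have \<eta>: "\<eta> > 0" "\<eta> * \<eta> = 1 / (n + 1)" by (auto simp: \<eta>_def)
 note cont = continuous_intros smooth_continuous_circ[OF f] continuous_fker
 have "fej n f z - f z = cmean (\<lambda>t. f (circ t) * fker n (s - t)) - cmean (\<lambda>t. f (circ s) * fker n (s - t))"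
  using cmean_ker[of f n s] f by (simp add: z cmean_cmult cmean_fker smooth_continuous_circ)
 also have "\<dots> = cmean (\<lambda>t. (f (circ t) - f (circ s)) * fker n (s - t))"
  by (subst cmean_diff[symmetric]) (auto intro!: cont simp: algebra_simps)
 also have "norm \<dots> \<le> Re (cmean (\<lambda>t. of_real (L * \<eta>) * fker n (s - t) + of_real (L / \<eta>) * (of_real (2 - 2 * cos (s - t)) * fker n (s - t))))"
 proof (rule cmean_norm_le)
  fix t
  define K where "K = (2 + 2 * cos (s - t)) ^ n / (2 * n choose n)"
  have K: "fker n (s - t) = of_real K" "K \<ge> 0"
  proof -
   have "0 \<le> 2 + 2 * cos (s - t)" using cos_ge_minus_one[of "s - t"] by linarith
   then show "K \<ge> 0" by (simp add: K_def)
  qed (simp add: K_def fker_eq)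
  define d where "d = dist (cis t) (cis s)"
  have dd: "d * d = 2 - 2 * cos (s - t)"
  proof -
   have "d\<^sup>2 = (cos t - cos s)\<^sup>2 + (sin t - sin s)\<^sup>2" by (simp add: d_def dist_norm cmod_power2)
   also have "\<dots> = ((cos t)\<^sup>2 + (sin t)\<^sup>2) + ((cos s)\<^sup>2 + (sin s)\<^sup>2) - 2 * (cos s * cos t + sin s * sin t)"
    by (simp add: power2_eq_square algebra_simps)
   also have "\<dots> = 2 - 2 * cos (s - t)" by (simp add: cos_diff)
   finally show ?thesis by (simp add: power2_eq_square)
  qed
  \<comment> \<open>The chord is bounded through its square, so that total mass and second moment of
    the kernel suffice.\<close>
  have "d \<le> \<eta> + d * d / \<eta>"
  proof (cases "d \<le> \<eta>")
   case False
   then have "d * \<eta> \<le> d * d" using \<eta> by (intro mult_left_mono) auto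
   then have "d \<le> d * d / \<eta>" using \<eta> by (simp add: field_simps)
   then show ?thesis using \<eta> by linarith
  next
   case True
   have "0 \<le> d * d / \<eta>" using \<eta> by simp
   then show ?thesis using True by linarith
  qed
  then have "L * d \<le> L * (\<eta> + d * d / \<eta>)" using L by (rule mult_left_mono)
  moreover have "norm (f (circ t) - f (circ s)) \<le> L * d"
   using smooth_lipschitz[OF f, of "circ t" "circ s"] by (simp add: L_def d_def dist_circ)
  ultimately have "norm (f (circ t) - f (circ s)) * K \<le> (L * \<eta> + L / \<eta> * (d * d)) * K"
   using K by (intro mult_right_mono) (auto simp: algebra_simps)
  then show "norm ((f (circ t) - f (circ s)) * fker n (s - t)) \<le>
   Re (of_real (L * \<eta>) * fker n (s - t) + of_real (L / \<eta>) * (of_real (2 - 2 * cos (s - t)) * fker n (s - t)))"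
   unfolding K dd norm_mult using K by (simp add: algebra_simps flip: of_real_mult of_real_add)
 qed (use \<eta>(1) in \<open>auto intro!: cont\<close>)
 also have "cmean (\<lambda>t. of_real (L * \<eta>) * fker n (s - t) + of_real (L / \<eta>) * (of_real (2 - 2 * cos (s - t)) * fker n (s - t))) =
   of_real (L * \<eta>) * 1 + of_real (L / \<eta>) * (2 / of_nat (n + 1))" using cmean_fker cmean_fker_second[OF n]
  by (subst cmean_add) (auto intro!: cont simp only: cmean_cmult)
 also have "Re \<dots> = L * \<eta> + (L / \<eta>) * (2 / (n + 1))"
 proof -
  have "2 / of_nat (n + 1) = complex_of_real (2 / real (n + 1))" by simp
  then show ?thesis by (simp only: of_real_mult[symmetric] of_real_add[symmetric] mult_1_right Re_complex_of_real)
 qed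
 also have "\<dots> = 3 * (L * \<eta>)"
 proof -
  have "(L / \<eta>) * (2 / (n + 1)) = (L / \<eta>) * (2 * (\<eta> * \<eta>))" using \<eta> by simp
  also have "\<dots> = 2 * (L * \<eta>)" using \<eta>(1) by simp
  finally show ?thesis by simp
 qed
 finally show "cmod (fej n f z - f z) \<le> 4 * C_norm 1 f * (3 / sqrt (n + 1))" by (simp add: L_def \<eta>_def)
qed

text \<open>The convolution commutes with the derivative (\<open>dth_fej\<close>), so convergence in
  the supremum norm for all smooth functions gives convergence in every
  \<open>C_norm N\<close>.\<close>

lemma fej_tendsto:
 assumes "f \<in> smooth"
 shows "(\<lambda>n. C_norm N (\<lambda>z. fej n f z - f z)) \<longlonglongrightarrow> 0"
proof -
 have 0: "(\<lambda>n. C_norm 0 (\<lambda>z. fej n f z - f z)) \<longlonglongrightarrow> 0" if f: "f \<in> smooth" for f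
 proof (rule tendsto_sandwich)
  show "\<forall>\<^sub>F n in sequentially. C_norm 0 (\<lambda>z. fej n f z - f z) \<le> 4 * C_norm 1 f * (3 / sqrt (n + 1))"
   using eventually_ge_at_top[of 1] by eventually_elim (rule fej_sup[OF f])
  show "\<forall>\<^sub>F n in sequentially. 0 \<le> C_norm 0 (\<lambda>z. fej n f z - f z)"
   by (auto intro!: always_eventually C_norm_nonneg smooth_diff smooth_fej f)
  show "(\<lambda>n. 4 * C_norm 1 f * (3 / sqrt (real (n + 1)))) \<longlonglongrightarrow> 0"
   by (intro tendsto_mult_right_zero tendsto_divide_0[OF tendsto_const])
    (intro filterlim_at_top_imp_at_infinity filterlim_compose[OF sqrt_at_top]
     filterlim_compose[OF filterlim_real_sequentially] filterlim_add_const_nat_at_top)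
 qed simp
 show ?thesis using assms
 proof (induction N arbitrary: f)
  case (Suc N)
  have "C_norm (Suc N) (\<lambda>z. fej n f z - f z) = C_norm 0 (\<lambda>z. fej n f z - f z) + C_norm N (\<lambda>z. fej n (dth f) z - dth f z)" for n
   using Suc.prems by (simp add: C_norm_Suc dth_diff smooth_fej dth_fej)
  then show ?case using tendsto_add_zero[OF 0[OF Suc.prems] Suc.IH[OF smooth_dth[OF Suc.prems]]] by simp
 qed (rule 0)
qed

section \<open>Test functions on the upper half circle\<close>

text \<open>The coordinate \<open>xc\<close> identifies the open upper half circle with the real line:
 \<open>Re z = - tanh x\<close>, \<open>Im z = 1 / cosh x\<close>; dilations fixing the end points act by translation.\<close>

definition xc :: "circle \<Rightarrow> real"
 where "xc z = arsinh (- Re (of_circle z) / Im (of_circle z))"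

definition zc :: "real \<Rightarrow> circle"
 where "zc x = Circle (Complex (- tanh x) (1 / cosh x))"

lemma Re_Im_circle: "(Re (of_circle z))\<^sup>2 + (Im (of_circle z))\<^sup>2 = 1"
 using norm_of_circle[of z] by (metis cmod_power2 one_power2)

lemma of_circle_zc: "of_circle (zc x) = Complex (- tanh x) (1 / cosh x)"
proof -
 have "(tanh x)\<^sup>2 + (1 / cosh x)\<^sup>2 = 1"
  using cosh_square_eq[of x] zero_less_power[OF cosh_real_pos[of x], of 2] by (simp add: tanh_def power_divide flip: add_divide_distrib)
 then show ?thesis by (simp add: zc_def complex_norm)
qed

lemma Im_zc: "Im (of_circle (zc x)) = 1 / cosh x" "Im (of_circle (zc x)) > 0"
 by (simp_all add: of_circle_zc)

lemma xc_zc [simp]: "xc (zc x) = x"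
proof -
 have "xc (zc x) = arsinh (tanh x * cosh x)" by (simp add: xc_def of_circle_zc)
 also have "tanh x * cosh x = sinh x" by (simp add: tanh_def)
 finally show ?thesis by (simp add: arsinh_sinh_real)
qed

lemma sinh_xc: "sinh (xc z) = - Re (of_circle z) / Im (of_circle z)"
 by (simp add: xc_def)

lemma cosh_xc: assumes "Im (of_circle z) > 0" shows "cosh (xc z) = 1 / Im (of_circle z)"
proof -
 have "(- Re (of_circle z) / Im (of_circle z))\<^sup>2 + 1 = (1 / Im (of_circle z))\<^sup>2"
  using Re_Im_circle[of z] assms by (simp add: field_simps)
 then show ?thesis using assms by (simp add: xc_def cosh_arsinh_real)
qed

lemma zc_xc: assumes "Im (of_circle z) > 0" shows "zc (xc z) = z"
 using assms by (intro circle_eqI) (simp add: of_circle_zc complex_eq_iff cosh_xc tanh_def sinh_xc)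

lemma cosh_le_exp_abs: "cosh x \<le> exp \<bar>x\<bar>" for x :: real
proof -
 have "exp x \<le> exp \<bar>x\<bar>" "exp (- x) \<le> exp \<bar>x\<bar>" by auto
 then have "(exp x + exp (- x)) / 2 \<le> (exp \<bar>x\<bar> + exp \<bar>x\<bar>) / 2" by (intro divide_right_mono add_mono) auto
 then show ?thesis unfolding cosh_field_def by simp
qed

text \<open>Through this inequality exponential decay in the coordinate \<open>xc\<close> becomes
  vanishing of finite order at the end points of the half circle.\<close>

lemma exp_abs_le_Im: assumes "Im (of_circle z) > 0" shows "exp (- \<bar>xc z\<bar>) \<le> Im (of_circle z)"
proof -
 have "1 / Im (of_circle z) \<le> exp \<bar>xc z\<bar>" using cosh_le_exp_abs[of "xc z"] cosh_xc[OF assms] by simp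
 then show ?thesis using assms by (simp add: exp_minus field_simps)
qed

lemma Im_circle_le_1: "Im (of_circle z) \<le> 1"
 using abs_Im_le_cmod[of "of_circle z"] by simp

lemma xc_derivative:
 assumes "sin t > 0" shows "((\<lambda>t. xc (circ t)) has_real_derivative inverse (sin t)) (at t)"
proof -
 have r: "sqrt ((- cos t / sin t)\<^sup>2 + 1) = inverse (sin t)"
 proof -
  have "(- cos t / sin t)\<^sup>2 + 1 = (inverse (sin t))\<^sup>2"
   using assms by (simp add: power_divide divide_simps add.commute[of "(cos t)\<^sup>2"])
  then show ?thesis using assms by simp
 qed
 have "((\<lambda>t. - cos t / sin t) has_real_derivative inverse ((sin t)\<^sup>2)) (at t)"
  using assms by (auto intro!: derivative_eq_intros simp: power2_eq_square divide_simps)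
 from DERIV_chain2[OF arsinh_real_has_field_derivative this]
 have "((\<lambda>t. arsinh (- cos t / sin t)) has_real_derivative
  1 / sqrt ((- cos t / sin t)\<^sup>2 + 1) * inverse ((sin t)\<^sup>2)) (at t)" by simp
 also have "1 / sqrt ((- cos t / sin t)\<^sup>2 + 1) * inverse ((sin t)\<^sup>2) = inverse (sin t)"
  unfolding r using assms by (simp add: power2_eq_square)
 finally show ?thesis by (simp add: xc_def)
qed

section \<open>Transport of functions from the line to the half circle\<close>

definition hf :: "int \<Rightarrow> (real \<Rightarrow> complex) \<Rightarrow> circle \<Rightarrow> complex"
 where "hf m F z = (if Im (of_circle z) > 0 then of_real (Im (of_circle z)) powi m * F (xc z) else 0)"

definition dec :: "(real \<Rightarrow> complex) \<Rightarrow> bool"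
 where "dec F \<longleftrightarrow> (\<forall>K::nat. \<exists>C. \<forall>x. norm (F x) \<le> C * exp (- real K * \<bar>x\<bar>))"

text \<open>Decay of order \<open>K\<close> supplies \<open>K\<close> powers of the height
  \<open>Im\<close>, which compensate the weight \<open>m\<close> and leave at least
  \<open>r\<close> of them.\<close>

lemma hf_bound:
 assumes "\<And>x. norm (F x) \<le> P * exp (- real K * \<bar>x\<bar>)" "int r \<le> m + int K" "Im (of_circle z) > 0"
 shows "norm (hf m F z) \<le> P * Im (of_circle z) ^ r"
proof -
 let ?y = "Im (of_circle z)"
 have P: "P \<ge> 0" using order_trans[OF norm_ge_zero assms(1)[of 0]] by simp
 have "norm (F (xc z)) \<le> P * ?y ^ K"
 proof (rule order_trans[OF assms(1)])
  have "exp (- real K * \<bar>xc z\<bar>) = exp (- \<bar>xc z\<bar>) ^ K" by (simp flip: exp_of_nat_mult)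
  also have "\<dots> \<le> ?y ^ K" by (intro power_mono exp_abs_le_Im assms) simp
  finally show "P * exp (- real K * \<bar>xc z\<bar>) \<le> P * ?y ^ K" using P by (rule mult_left_mono)
 qed
 moreover have "norm (complex_of_real ?y powi m) = ?y powi m" using assms(3) by (simp add: norm_power_int)
 ultimately have "norm (hf m F z) \<le> ?y powi m * (P * ?y ^ K)"
  using assms(3) by (simp add: hf_def norm_mult mult_left_mono)
 also have "\<dots> = P * ?y powi (m + int K)" using assms(3) by (simp add: power_int_add)
 also have "?y powi (m + int K) = ?y ^ nat (m + int K)" using assms(2) by (simp add: power_int_def)
 also have "\<dots> \<le> ?y ^ r" using assms Im_circle_le_1 by (intro power_decreasing) auto
 finally show ?thesis using P by (simp add: mult_left_mono)
qed

lemma has_vector_derivative_zero_quadratic: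
 fixes f :: "real \<Rightarrow> complex"
 assumes "f t = 0" "\<And>u. norm (f u) \<le> C * \<bar>u - t\<bar>\<^sup>2"
 shows "(f has_vector_derivative 0) (at t)"
proof -
 have "((\<lambda>u. norm (f u) / \<bar>u - t\<bar>) \<longlongrightarrow> 0) (at t)"
 proof (rule tendsto_sandwich[of "\<lambda>_. 0" _ _ "\<lambda>u. C * \<bar>u - t\<bar>"])
  show "\<forall>\<^sub>F u in at t. norm (f u) / \<bar>u - t\<bar> \<le> C * \<bar>u - t\<bar>"
   unfolding eventually_at using assms(2)
   by (intro exI[of _ 1]) (auto simp: divide_le_eq power2_eq_square mult.assoc)
  show "((\<lambda>u. C * \<bar>u - t\<bar>) \<longlongrightarrow> 0) (at t)" by (rule tendsto_eq_intros refl | simp)+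
 qed auto
 then show ?thesis unfolding has_vector_derivative_def has_derivative_at_within
  using assms(1) by (auto simp: divide_inverse mult.commute tendsto_norm_zero_iff bounded_linear_zero
    norm_mult norm_inverse intro!: tendsto_norm_zero_cancel[of "\<lambda>u. _ u *\<^sub>R _ u"])
qed

definition rec :: "circle \<Rightarrow> complex" where "rec z = of_real (Re (of_circle z))"

lemma rec_eq: "rec z = (1/2) * (of_circle z + cnj (of_circle z))"
 by (simp add: rec_def complex_eq_iff)

lemma smooth_rec [simp]: "rec \<in> smooth"
 unfolding rec_eq[abs_def] by (intro smooth_cmult smooth_add) auto

text \<open>Inside, both \<open>dx/dt = 1 / sin t\<close> and the derivative of the weight cost one
  power of the height. At the end points the decay of \<open>F\<close> makes the function
  quadratically small, so the extension by zero is differentiable there with derivative 0.\<close>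

lemma has_dth_hf:
 assumes F: "\<And>x. (F has_vector_derivative F' x) (at x)" and d: "dec F"
 shows "has_dth (hf m F) (\<lambda>z. of_int m * (rec z * hf (m - 1) F z) + hf (m - 1) F' z)"
proof -
 have "((\<lambda>t. hf m F (circ t)) has_vector_derivative
   of_int m * (rec (circ t) * hf (m - 1) F (circ t)) + hf (m - 1) F' (circ t)) (at t)" for t
 proof -
  consider "sin t > 0" | "sin t < 0" | "sin t = 0" by linarith
  then show ?thesis
  proof cases
   case 1
   have s: "((\<lambda>t. complex_of_real (sin t) powi m) has_vector_derivative of_real (cos t) * (of_int m * of_real (sin t) powi (m - 1))) (at t)"
   proof -
    have "((\<lambda>w. w powi m) has_field_derivative of_int m * complex_of_real (sin t) powi (m - 1)) (at (complex_of_real (sin t)))"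
     using 1 by (auto intro!: derivative_eq_intros)
    moreover have "((\<lambda>t. complex_of_real (sin t)) has_vector_derivative of_real (cos t)) (at t)"
     by (auto intro!: derivative_eq_intros has_vector_derivative_of_real)
    ultimately show ?thesis using field_vector_diff_chain_at by (fastforce simp: o_def)
   qed
   have x: "((\<lambda>t. xc (circ t)) has_vector_derivative inverse (sin t)) (at t)"
    using xc_derivative[OF 1] by (simp add: has_real_derivative_iff_has_vector_derivative)
   have f: "((\<lambda>t. F (xc (circ t))) has_vector_derivative inverse (sin t) *\<^sub>R F' (xc (circ t))) (at t)"
    using vector_diff_chain_at[OF x F] by (simp add: o_def)
   have "((\<lambda>t. complex_of_real (sin t) powi m * F (xc (circ t))) has_vector_derivative
    complex_of_real (sin t) powi m * (inverse (sin t) *\<^sub>R F' (xc (circ t))) +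
    (of_real (cos t) * (of_int m * of_real (sin t) powi (m - 1))) * F (xc (circ t))) (at t)"
    by (rule has_vector_derivative_mult[OF s f])
   also have "complex_of_real (sin t) powi m * (inverse (sin t) *\<^sub>R F' (xc (circ t))) +
    (of_real (cos t) * (of_int m * of_real (sin t) powi (m - 1))) * F (xc (circ t)) =
    of_int m * (rec (circ t) * hf (m - 1) F (circ t)) + hf (m - 1) F' (circ t)"
    using 1 by (simp add: hf_def rec_def power_int_diff scaleR_conv_of_real divide_inverse)
   finally have D: "((\<lambda>t. complex_of_real (sin t) powi m * F (xc (circ t))) has_vector_derivative
    of_int m * (rec (circ t) * hf (m - 1) F (circ t)) + hf (m - 1) F' (circ t)) (at t)" .
   have "open {t::real. sin t > 0}" by (intro open_Collect_less continuous_intros)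
   from has_vector_derivative_transform_within_open[OF D this]
   show ?thesis using 1 by (simp add: hf_def)
  next
   case 2
   have "open {t::real. sin t < 0}" by (intro open_Collect_less continuous_intros)
   from has_vector_derivative_transform_within_open[OF has_vector_derivative_const this, of t 0 "\<lambda>t. hf m F (circ t)"]
   show ?thesis using 2 by (simp add: hf_def)
  next
   case 3
   \<comment> \<open>Decay of order \<open>nat \<bar>m\<bar> + 2\<close> beats the weight and leaves
     two powers of the sine.\<close>
   obtain C where C: "\<And>x. norm (F x) \<le> C * exp (- real (nat \<bar>m\<bar> + 2) * \<bar>x\<bar>)"
    using d unfolding dec_def by blast
   have C0: "C \<ge> 0" using order_trans[OF norm_ge_zero C[of 0]] by simp
   have "norm (hf m F (circ u)) \<le> C * \<bar>u - t\<bar>\<^sup>2" for u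
   proof (cases "sin u > 0")
    case True
    have "norm (hf m F (circ u)) \<le> C * sin u ^ 2"
     using hf_bound[of F C "nat \<bar>m\<bar> + 2" 2 m "circ u"] C True by simp
    also have "\<dots> \<le> C * \<bar>u - t\<bar>\<^sup>2"
    proof -
     have "\<bar>sin u\<bar> = \<bar>sin (t + (u - t))\<bar>" by simp
     also have "\<dots> = \<bar>cos t\<bar> * \<bar>sin (u - t)\<bar>" unfolding sin_add 3 by (simp add: abs_mult)
     also have "\<dots> \<le> 1 * \<bar>u - t\<bar>" by (intro mult_mono abs_sin_x_le_abs_x) auto
     finally have "(sin u)\<^sup>2 \<le> \<bar>u - t\<bar>\<^sup>2" by (simp add: abs_le_square_iff)
     then show ?thesis using C0 by (intro mult_left_mono) auto
    qed
    finally show ?thesis .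
   qed (use C0 in \<open>simp add: hf_def\<close>)
   then have "((\<lambda>u. hf m F (circ u)) has_vector_derivative 0) (at t)"
    using 3 by (intro has_vector_derivative_zero_quadratic[where C = C]) (auto simp: hf_def)
   then show ?thesis using 3 by (simp add: hf_def)
  qed
 qed
 then show ?thesis by (simp add: has_dth_def)
qed

text \<open>A function together with all its derivatives as a sequence. Entire functions, compactly
  supported functions and the difference of the two fall under this one notion, each with its own
  formula for the derivatives.\<close>

definition chain :: "(nat \<Rightarrow> real \<Rightarrow> complex) \<Rightarrow> bool"
 where "chain F \<longleftrightarrow> (\<forall>i x. (F i has_vector_derivative F (Suc i) x) (at x)) \<and> (\<forall>i. dec (F i))"

lemma chain_Suc: "chain F \<Longrightarrow> chain (\<lambda>i. F (Suc i))"
 by (simp add: chain_def)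

lemma has_dth_hf_chain: "chain F \<Longrightarrow>
  has_dth (hf m (F 0)) (\<lambda>z. of_int m * (rec z * hf (m - 1) (F 0) z) + hf (m - 1) (F 1) z)"
 by (rule has_dth_hf) (auto simp: chain_def)

lemma csm_hf: "chain F \<Longrightarrow> csm n (hf m (F 0))"
proof (induction n arbitrary: F m)
 case (Suc n)
 have "csm n (\<lambda>z. of_int m * (rec z * hf (m - 1) (F 0) z) + hf (m - 1) (F 1) z)"
  using Suc.IH[OF Suc.prems] Suc.IH[OF chain_Suc[OF Suc.prems]]
  by (intro csm_add csm_cmult csm_mult smooth_csm[OF smooth_rec]) auto
 then show ?case using has_dth_hf_chain[OF Suc.prems] by auto
qed simp

lemma smooth_hf: "chain F \<Longrightarrow> hf m (F 0) \<in> smooth"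
 by (simp add: smooth_iff csm_hf)

lemma dth_hf: "chain F \<Longrightarrow>
  dth (hf m (F 0)) = (\<lambda>z. of_int m * (rec z * hf (m - 1) (F 0) z) + hf (m - 1) (F 1) z)"
 by (rule has_dth_imp_dth[OF has_dth_hf_chain])

lemma hf_sup:
 assumes "\<And>x. norm (F x) \<le> P * exp (- real K * \<bar>x\<bar>)" "0 \<le> m + int K"
 shows "C_norm 0 (hf m F) \<le> P"
proof (rule C_norm_0_le)
 fix z
 have P: "P \<ge> 0" using order_trans[OF norm_ge_zero assms(1)[of 0]] by simp
 show "norm (hf m F z) \<le> P"
 proof (cases "Im (of_circle z) > 0")
  case True
  then show ?thesis using hf_bound[of F P K 0 m z] assms by simp
 qed (simp add: hf_def P)
qed

text \<open>The norm involves derivatives up to order \<open>N\<close> and weights down to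
  \<open>m - N\<close>; decay of order \<open>N + nat \<bar>m\<bar>\<close> pays for all of them.
  The constant depends on \<open>N\<close> and \<open>m\<close> only, so that a small
  \<open>P\<close> gives a small norm.\<close>

lemma hf_norm_bound:
 "\<exists>C\<ge>0. \<forall>F P. chain F \<longrightarrow> (\<forall>i\<le>N. \<forall>x. norm (F i x) \<le> P * exp (- real (N + nat \<bar>m\<bar>) * \<bar>x\<bar>)) \<longrightarrow>
   C_norm N (hf m (F 0)) \<le> C * P"
proof (induction N arbitrary: m)
 case 0
 show ?case by (intro exI[of _ 1]) (auto intro!: hf_sup[where K = "nat \<bar>m\<bar>"])
next
 case (Suc N)
 from Suc[of "m - 1"] obtain C where C0: "C \<ge> 0" and C1: "\<forall>F P. chain F \<longrightarrow>
   (\<forall>i\<le>N. \<forall>x. norm (F i x) \<le> P * exp (- real (N + nat \<bar>m - 1\<bar>) * \<bar>x\<bar>)) \<longrightarrow> C_norm N (hf (m - 1) (F 0)) \<le> C * P"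
  by (elim exE conjE)
 have C: "C \<ge> 0" "\<And>F P. chain F \<Longrightarrow> (\<And>i x. i \<le> N \<Longrightarrow> norm (F i x) \<le> P * exp (- real (N + nat \<bar>m - 1\<bar>) * \<bar>x\<bar>)) \<Longrightarrow>
   C_norm N (hf (m - 1) (F 0)) \<le> C * P" using C0 C1 by simp_all
 obtain M where M: "M \<ge> 0" "\<And>f g. f\<in>smooth \<Longrightarrow> g\<in>smooth \<Longrightarrow>
  C_norm N (\<lambda>z. f z * g z) \<le> M * C_norm N f * C_norm N g" using C_norm_mult by blast
 define C' where "C' = 1 + \<bar>m\<bar> * (M * C_norm N rec * C) + C"
 have "C_norm (Suc N) (hf m (F 0)) \<le> C' * P"
  if F: "chain F" and b: "\<And>i x. i \<le> Suc N \<Longrightarrow> norm (F i x) \<le> P * exp (- real (Suc N + nat \<bar>m\<bar>) * \<bar>x\<bar>)" for F P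
 proof -
  have P: "P \<ge> 0" using order_trans[OF norm_ge_zero b[of 0 0]] by simp
  note sm = smooth_hf[OF F] smooth_hf[OF chain_Suc[OF F], unfolded One_nat_def[symmetric]]
  have b': "norm (F i x) \<le> P * exp (- real (N + nat \<bar>m - 1\<bar>) * \<bar>x\<bar>)" if "i \<le> Suc N" for i x
  proof (rule order_trans[OF b[OF that]])
   have "- real (Suc N + nat \<bar>m\<bar>) * \<bar>x\<bar> \<le> - real (N + nat \<bar>m - 1\<bar>) * \<bar>x\<bar>"
    by (intro mult_right_mono) auto
   then show "P * exp (- real (Suc N + nat \<bar>m\<bar>) * \<bar>x\<bar>) \<le> P * exp (- real (N + nat \<bar>m - 1\<bar>) * \<bar>x\<bar>)"
    using P by (intro mult_left_mono) (simp_all only: exp_le_cancel_iff)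
  qed
  have 0: "C_norm 0 (hf m (F 0)) \<le> P" by (rule hf_sup[of _ _ "Suc N + nat \<bar>m\<bar>"]) (use b in auto)
  have 1: "C_norm N (hf (m - 1) (F 0)) \<le> C * P" by (rule C(2)[OF F]) (use b' in auto)
  have 2: "C_norm N (hf (m - 1) (F 1)) \<le> C * P" using C(2)[OF chain_Suc[OF F], of P] b' by simp
  have "C_norm N (\<lambda>z. rec z * hf (m - 1) (F 0) z) \<le> M * C_norm N rec * C_norm N (hf (m - 1) (F 0))"
   by (intro M sm smooth_rec)
  also have "\<dots> \<le> M * C_norm N rec * (C * P)"
   using M 1 by (intro mult_left_mono) (auto simp: C_norm_nonneg)
  finally have 3: "C_norm N (\<lambda>z. rec z * hf (m - 1) (F 0) z) \<le> M * C_norm N rec * (C * P)" .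
  have "C_norm N (dth (hf m (F 0))) \<le> C_norm N (\<lambda>z. of_int m * (rec z * hf (m - 1) (F 0) z)) + C_norm N (hf (m - 1) (F 1))"
   unfolding dth_hf[OF F] by (intro C_norm_add smooth_cmult smooth_mult smooth_rec sm)
  also have "\<dots> = \<bar>m\<bar> * C_norm N (\<lambda>z. rec z * hf (m - 1) (F 0) z) + C_norm N (hf (m - 1) (F 1))"
   by (subst C_norm_cmult) (auto intro!: smooth_mult sm)
  also have "\<dots> \<le> \<bar>m\<bar> * (M * C_norm N rec * (C * P)) + C * P"
   using 2 3 by (intro add_mono mult_left_mono) auto
  finally show ?thesis using 0 by (simp add: C_norm_Suc C'_def algebra_simps)
 qed
 moreover have "C' \<ge> 0" using M C by (simp add: C'_def C_norm_nonneg)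
 ultimately show ?case by blast
qed

section \<open>Entire functions of rapid decay in horizontal strips\<close>

definition ent :: "(complex \<Rightarrow> complex) \<Rightarrow> bool"
 where "ent \<tau> \<longleftrightarrow> \<tau> holomorphic_on UNIV \<and>
  (\<forall>K R. \<exists>C. \<forall>\<zeta>. \<bar>Im \<zeta>\<bar> \<le> R \<longrightarrow> norm (\<tau> \<zeta>) \<le> C * exp (- K * \<bar>Re \<zeta>\<bar>))"

lemma entD:
 assumes "ent \<tau>"
 obtains C where "C \<ge> 0" "\<And>\<zeta>. \<bar>Im \<zeta>\<bar> \<le> R \<Longrightarrow> norm (\<tau> \<zeta>) \<le> C * exp (- K * \<bar>Re \<zeta>\<bar>)"
proof -
 obtain C where C: "\<And>\<zeta>. \<bar>Im \<zeta>\<bar> \<le> R \<Longrightarrow> norm (\<tau> \<zeta>) \<le> C * exp (- K * \<bar>Re \<zeta>\<bar>)"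
  using assms unfolding ent_def by metis
 have "norm (\<tau> \<zeta>) \<le> max C 0 * exp (- K * \<bar>Re \<zeta>\<bar>)" if "\<bar>Im \<zeta>\<bar> \<le> R" for \<zeta>
  by (rule order_trans[OF C[OF that]]) (intro mult_right_mono, auto)
 then show ?thesis using that[of "max C 0"] by auto
qed

text \<open>Cauchy's inequality on circles of radius 1: the strip shrinks by 1, and moving the
  exponential weight by at most 1 costs \<open>exp K\<close>.\<close>

lemma cauchy_strip:
 assumes h: "\<tau> holomorphic_on UNIV" and b: "\<And>\<zeta>. \<bar>Im \<zeta>\<bar> \<le> R + 1 \<Longrightarrow> norm (\<tau> \<zeta>) \<le> P * exp (- K * \<bar>Re \<zeta>\<bar>)"
  and "K \<ge> 0" "\<bar>Im \<zeta>\<bar> \<le> R" "P \<ge> 0"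
 shows "norm ((deriv ^^ i) \<tau> \<zeta>) \<le> fact i * exp K * P * exp (- K * \<bar>Re \<zeta>\<bar>)"
proof -
 have "norm ((deriv ^^ i) \<tau> \<zeta>) \<le> fact i * (exp K * P * exp (- K * \<bar>Re \<zeta>\<bar>)) / 1 ^ i"
 proof (rule Cauchy_inequality)
  show "\<tau> holomorphic_on ball \<zeta> 1" using h by (rule holomorphic_on_subset) simp
  show "continuous_on (cball \<zeta> 1) \<tau>"
   using holomorphic_on_imp_continuous_on[OF h] continuous_on_subset by blast
  fix x assume "norm (\<zeta> - x) = 1"
  then have "\<bar>Re \<zeta> - Re x\<bar> \<le> 1" "\<bar>Im \<zeta> - Im x\<bar> \<le> 1"
   using abs_Re_le_cmod[of "\<zeta> - x"] abs_Im_le_cmod[of "\<zeta> - x"] by auto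
  then have *: "\<bar>Im x\<bar> \<le> R + 1" "\<bar>Re \<zeta>\<bar> - 1 \<le> \<bar>Re x\<bar>" using assms(4) by linarith+
  have "norm (\<tau> x) \<le> P * exp (- K * \<bar>Re x\<bar>)" by (rule b[OF *(1)])
  also have "\<dots> \<le> P * exp (K - K * \<bar>Re \<zeta>\<bar>)"
   using mult_left_mono[OF *(2) assms(3)] assms(5) by (intro mult_left_mono) (auto simp: algebra_simps)
  also have "\<dots> = exp K * P * exp (- K * \<bar>Re \<zeta>\<bar>)" by (simp add: exp_diff exp_minus divide_inverse)
  finally show "norm (\<tau> x) \<le> exp K * P * exp (- K * \<bar>Re \<zeta>\<bar>)" .
 qed simp
 then show ?thesis by (simp add: mult.assoc)
qed

definition rch :: "(complex \<Rightarrow> complex) \<Rightarrow> nat \<Rightarrow> real \<Rightarrow> complex"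
 where "rch \<tau> i x = (deriv ^^ i) \<tau> (of_real x)"

lemma chain_rch: assumes "ent \<tau>" shows "chain (rch \<tau>)"
proof -
 have h: "\<tau> holomorphic_on UNIV" using assms by (simp add: ent_def)
 have "(rch \<tau> i has_vector_derivative rch \<tau> (Suc i) x) (at x)" for i x
 proof -
  have "((deriv ^^ i) \<tau> has_field_derivative deriv ((deriv ^^ i) \<tau>) (of_real x)) (at (of_real x))"
   by (rule holomorphic_derivI[OF holomorphic_higher_deriv[OF h open_UNIV] open_UNIV]) simp
  from has_vector_derivative_real_field[OF this] show ?thesis by (simp add: rch_def[abs_def])
 qed
 moreover have "dec (rch \<tau> i)" for i unfolding dec_def
 proof
  fix K :: nat
  obtain C where "C \<ge> 0" "\<And>\<zeta>. \<bar>Im \<zeta>\<bar> \<le> 1 \<Longrightarrow> norm (\<tau> \<zeta>) \<le> C * exp (- real K * \<bar>Re \<zeta>\<bar>)"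
   using entD[OF assms] by metis
  then have "norm (rch \<tau> i x) \<le> (fact i * exp (real K) * C) * exp (- real K * \<bar>x\<bar>)" for x
   unfolding rch_def using cauchy_strip[OF h, of 0 C "real K" "of_real x" i] by simp
  then show "\<exists>C. \<forall>x. norm (rch \<tau> i x) \<le> C * exp (- real K * \<bar>x\<bar>)" by blast
 qed
 ultimately show ?thesis by (simp add: chain_def)
qed

definition he :: "int \<Rightarrow> (complex \<Rightarrow> complex) \<Rightarrow> circle \<Rightarrow> complex"
 where "he m \<tau> = hf m (\<lambda>x. \<tau> (of_real x))"

lemma he_rch: "he m \<tau> = hf m (rch \<tau> 0)"
 by (simp add: he_def rch_def[abs_def])

lemma smooth_he: "ent \<tau> \<Longrightarrow> he m \<tau> \<in> smooth"
 unfolding he_rch by (rule smooth_hf[OF chain_rch])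

text \<open>Cauchy's inequality recovers the derivatives on the line from the strip of half width 1,
  so that a bound on the function alone controls \<open>C_norm N\<close>.\<close>

lemma he_norm_bound:
 "\<exists>C\<ge>0. \<exists>K\<ge>0. \<forall>\<tau> P. ent \<tau> \<longrightarrow> P \<ge> 0 \<longrightarrow> (\<forall>\<zeta>. \<bar>Im \<zeta>\<bar> \<le> 1 \<longrightarrow> norm (\<tau> \<zeta>) \<le> P * exp (- K * \<bar>Re \<zeta>\<bar>)) \<longrightarrow>
   C_norm N (he m \<tau>) \<le> C * P"
proof -
 obtain C where C: "C \<ge> 0" "\<And>F P. chain F \<Longrightarrow> (\<And>i x. i \<le> N \<Longrightarrow> norm (F i x) \<le> P * exp (- real (N + nat \<bar>m\<bar>) * \<bar>x\<bar>)) \<Longrightarrow>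
   C_norm N (hf m (F 0)) \<le> C * P" using hf_norm_bound by metis
 define K where "K = real (N + nat \<bar>m\<bar>)"
 have "C_norm N (he m \<tau>) \<le> (C * (fact N * exp K)) * P"
  if e: "ent \<tau>" and P: "P \<ge> 0" and b: "\<forall>\<zeta>. \<bar>Im \<zeta>\<bar> \<le> 1 \<longrightarrow> norm (\<tau> \<zeta>) \<le> P * exp (- K * \<bar>Re \<zeta>\<bar>)" for \<tau> P
 proof -
  have "norm (rch \<tau> i x) \<le> (fact N * exp K * P) * exp (- K * \<bar>x\<bar>)" if "i \<le> N" for i x
  proof -
   have "norm (rch \<tau> i x) \<le> fact i * exp K * P * exp (- K * \<bar>x\<bar>)"
    unfolding rch_def using cauchy_strip[of \<tau> 0 P K "of_real x" i] e b P by (simp add: ent_def K_def)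
   also have "\<dots> \<le> fact N * exp K * P * exp (- K * \<bar>x\<bar>)"
    using P that by (intro mult_right_mono fact_mono) auto
   finally show ?thesis .
  qed
  then have "C_norm N (hf m (rch \<tau> 0)) \<le> C * (fact N * exp K * P)"
   by (intro C(2) chain_rch e) (auto simp: K_def)
  then show ?thesis by (simp add: he_rch mult.assoc)
 qed
 moreover have "C * (fact N * exp K) \<ge> 0" "K \<ge> 0" using C(1) by (auto simp: K_def)
 ultimately show ?thesis by blast
qed

lemma ent_gauss: "ent (\<lambda>\<zeta>. exp (- \<zeta>\<^sup>2))"
 unfolding ent_def
proof (intro conjI allI)
 fix K R :: real
 have "norm (exp (- \<zeta>\<^sup>2)) \<le> exp (R\<^sup>2 + K\<^sup>2) * exp (- K * \<bar>Re \<zeta>\<bar>)" if "\<bar>Im \<zeta>\<bar> \<le> R" for \<zeta>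
 proof -
  have "0 \<le> (\<bar>Re \<zeta>\<bar> - \<bar>K\<bar>)\<^sup>2" by simp
  then have "2 * (\<bar>K\<bar> * \<bar>Re \<zeta>\<bar>) \<le> (Re \<zeta>)\<^sup>2 + K\<^sup>2" by (simp add: power2_diff algebra_simps)
  moreover have "K * \<bar>Re \<zeta>\<bar> \<le> \<bar>K\<bar> * \<bar>Re \<zeta>\<bar>" "0 \<le> \<bar>K\<bar> * \<bar>Re \<zeta>\<bar>" by (auto intro: mult_right_mono)
  moreover have "(Im \<zeta>)\<^sup>2 \<le> R\<^sup>2" using power_mono[OF that, of 2] by simp
  ultimately have "Re (- \<zeta>\<^sup>2) \<le> R\<^sup>2 + K\<^sup>2 + (- K * \<bar>Re \<zeta>\<bar>)"
   unfolding uminus_complex.sel Re_power2 by linarith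
  then show ?thesis by (simp add: norm_exp_eq_Re flip: exp_add)
 qed
 then show "\<exists>C. \<forall>\<zeta>. \<bar>Im \<zeta>\<bar> \<le> R \<longrightarrow> norm (exp (- \<zeta>\<^sup>2)) \<le> C * exp (- K * \<bar>Re \<zeta>\<bar>)" by blast
qed (intro holomorphic_intros)

lemma ent_translate: assumes "ent \<tau>" shows "ent (\<lambda>\<zeta>. \<tau> (\<zeta> + c))"
 unfolding ent_def
proof (intro conjI allI)
 have h: "\<tau> holomorphic_on UNIV" using assms by (simp add: ent_def)
 show "(\<lambda>\<zeta>. \<tau> (\<zeta> + c)) holomorphic_on UNIV"
 proof -
  have "(\<lambda>\<zeta>. \<zeta> + c) holomorphic_on UNIV" by (intro holomorphic_intros)
  from holomorphic_on_compose_gen[OF this h] show ?thesis by (simp add: o_def)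
 qed
 fix K R
 obtain C where C: "C \<ge> 0" "\<And>\<zeta>. \<bar>Im \<zeta>\<bar> \<le> R + \<bar>Im c\<bar> \<Longrightarrow> norm (\<tau> \<zeta>) \<le> C * exp (- \<bar>K\<bar> * \<bar>Re \<zeta>\<bar>)"
  using entD[OF assms] by metis
 have "norm (\<tau> (\<zeta> + c)) \<le> (C * exp (\<bar>K\<bar> * \<bar>Re c\<bar>)) * exp (- K * \<bar>Re \<zeta>\<bar>)" if "\<bar>Im \<zeta>\<bar> \<le> R" for \<zeta>
 proof -
  have "norm (\<tau> (\<zeta> + c)) \<le> C * exp (- \<bar>K\<bar> * \<bar>Re (\<zeta> + c)\<bar>)" using that by (intro C(2)) auto
  also have "\<dots> \<le> C * exp (\<bar>K\<bar> * \<bar>Re c\<bar> + - K * \<bar>Re \<zeta>\<bar>)"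
  proof -
   have "\<bar>Re \<zeta>\<bar> \<le> \<bar>Re (\<zeta> + c)\<bar> + \<bar>Re c\<bar>" by simp
   then have "\<bar>K\<bar> * \<bar>Re \<zeta>\<bar> \<le> \<bar>K\<bar> * (\<bar>Re (\<zeta> + c)\<bar> + \<bar>Re c\<bar>)" by (intro mult_left_mono) auto
   moreover have "K * \<bar>Re \<zeta>\<bar> \<le> \<bar>K\<bar> * \<bar>Re \<zeta>\<bar>" by (intro mult_right_mono) auto
   ultimately show ?thesis using C(1) by (intro mult_left_mono) (auto simp: algebra_simps)
  qed
  finally show ?thesis by (simp add: exp_diff exp_minus divide_inverse mult.assoc)
 qed
 then show "\<exists>C. \<forall>\<zeta>. \<bar>Im \<zeta>\<bar> \<le> R \<longrightarrow> norm (\<tau> (\<zeta> + c)) \<le> C * exp (- K * \<bar>Re \<zeta>\<bar>)" by blast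
qed

lemma ent_cmult: assumes "ent \<tau>" shows "ent (\<lambda>\<zeta>. c * \<tau> \<zeta>)"
 unfolding ent_def
proof (intro conjI allI)
 show "(\<lambda>\<zeta>. c * \<tau> \<zeta>) holomorphic_on UNIV" using assms by (auto simp: ent_def intro!: holomorphic_intros)
 fix K R
 obtain C where "C \<ge> 0" "\<And>\<zeta>. \<bar>Im \<zeta>\<bar> \<le> R \<Longrightarrow> norm (\<tau> \<zeta>) \<le> C * exp (- K * \<bar>Re \<zeta>\<bar>)"
  using entD[OF assms] by metis
 then show "\<exists>C. \<forall>\<zeta>. \<bar>Im \<zeta>\<bar> \<le> R \<longrightarrow> norm (c * \<tau> \<zeta>) \<le> C * exp (- K * \<bar>Re \<zeta>\<bar>)"
  by (intro exI[of _ "cmod c * C"]) (auto simp: norm_mult mult.assoc intro!: mult_left_mono)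
qed

lemma ent_add: assumes "ent \<tau>" "ent \<sigma>" shows "ent (\<lambda>\<zeta>. \<tau> \<zeta> + \<sigma> \<zeta>)"
 unfolding ent_def
proof (intro conjI allI)
 show "(\<lambda>\<zeta>. \<tau> \<zeta> + \<sigma> \<zeta>) holomorphic_on UNIV" using assms by (auto simp: ent_def intro!: holomorphic_intros)
 fix K R
 obtain C where "C \<ge> 0" "\<And>\<zeta>. \<bar>Im \<zeta>\<bar> \<le> R \<Longrightarrow> norm (\<tau> \<zeta>) \<le> C * exp (- K * \<bar>Re \<zeta>\<bar>)"
  using entD[OF assms(1)] by metis
 moreover obtain C' where "C' \<ge> 0" "\<And>\<zeta>. \<bar>Im \<zeta>\<bar> \<le> R \<Longrightarrow> norm (\<sigma> \<zeta>) \<le> C' * exp (- K * \<bar>Re \<zeta>\<bar>)"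
  using entD[OF assms(2)] by metis
 ultimately show "\<exists>C. \<forall>\<zeta>. \<bar>Im \<zeta>\<bar> \<le> R \<longrightarrow> norm (\<tau> \<zeta> + \<sigma> \<zeta>) \<le> C * exp (- K * \<bar>Re \<zeta>\<bar>)"
  by (intro exI[of _ "C + C'"]) (auto simp: distrib_right intro!: norm_triangle_le add_mono)
qed

lemma ent_mult_exp: assumes "ent \<tau>" shows "ent (\<lambda>\<zeta>. exp (of_real a * \<zeta>) * \<tau> \<zeta>)"
 unfolding ent_def
proof (intro conjI allI)
 show "(\<lambda>\<zeta>. exp (of_real a * \<zeta>) * \<tau> \<zeta>) holomorphic_on UNIV"
  using assms by (auto simp: ent_def intro!: holomorphic_intros)
 fix K R
 obtain C where C: "C \<ge> 0" "\<And>\<zeta>. \<bar>Im \<zeta>\<bar> \<le> R \<Longrightarrow> norm (\<tau> \<zeta>) \<le> C * exp (- (K + \<bar>a\<bar>) * \<bar>Re \<zeta>\<bar>)"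
  using entD[OF assms] by metis
 have "norm (exp (of_real a * \<zeta>) * \<tau> \<zeta>) \<le> C * exp (- K * \<bar>Re \<zeta>\<bar>)" if "\<bar>Im \<zeta>\<bar> \<le> R" for \<zeta>
 proof -
  have "norm (exp (of_real a * \<zeta>)) \<le> exp (\<bar>a\<bar> * \<bar>Re \<zeta>\<bar>)"
   by (simp add: norm_exp_eq_Re) (metis abs_ge_self abs_mult)
  then have "norm (exp (of_real a * \<zeta>) * \<tau> \<zeta>) \<le> exp (\<bar>a\<bar> * \<bar>Re \<zeta>\<bar>) * (C * exp (- (K + \<bar>a\<bar>) * \<bar>Re \<zeta>\<bar>))"
   unfolding norm_mult using C(2)[OF that] by (intro mult_mono) auto
  also have "\<dots> = C * exp (- K * \<bar>Re \<zeta>\<bar>)" by (simp add: algebra_simps flip: exp_add)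
  finally show ?thesis .
 qed
 then show "\<exists>C. \<forall>\<zeta>. \<bar>Im \<zeta>\<bar> \<le> R \<longrightarrow> norm (exp (of_real a * \<zeta>) * \<tau> \<zeta>) \<le> C * exp (- K * \<bar>Re \<zeta>\<bar>)" by blast
qed

text \<open>On the half circle \<open>cosh x = 1 / Im z\<close>, so this operation shifts the weight
  of \<open>he\<close> by one.\<close>

lemma ent_mult_cosh: assumes "ent \<tau>" shows "ent (\<lambda>\<zeta>. cosh \<zeta> * \<tau> \<zeta>)"
proof -
 have "ent (\<lambda>\<zeta>. (1/2) * (exp (of_real 1 * \<zeta>) * \<tau> \<zeta> + exp (of_real (-1) * \<zeta>) * \<tau> \<zeta>))"
  by (intro ent_cmult ent_add ent_mult_exp assms)
 moreover have "(\<lambda>\<zeta>. (1/2) * (exp (of_real 1 * \<zeta>) * \<tau> \<zeta> + exp (of_real (-1) * \<zeta>) * \<tau> \<zeta>)) = (\<lambda>\<zeta>. cosh \<zeta> * \<tau> \<zeta>)"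
  by (simp add: fun_eq_iff cosh_field_def algebra_simps)
 ultimately show ?thesis by simp
qed

lemma ent_mult_cosh_power: "ent \<tau> \<Longrightarrow> ent (\<lambda>\<zeta>. cosh \<zeta> ^ n * \<tau> \<zeta>)"
proof (induction n)
 case (Suc n)
 then show ?case using ent_mult_cosh[of "\<lambda>\<zeta>. cosh \<zeta> ^ n * \<tau> \<zeta>"] by (simp add: mult.assoc)
qed simp

section \<open>Rotations, contractions and partitions of unity\<close>

lemma rot_0 [simp]: "rot 0 z = z"
 by (rule circle_eqI) (simp add: of_circle_rot)

lemma rot_rot [simp]: "rot t (rot s z) = rot (t + s) z"
 by (rule circle_eqI) (simp add: of_circle_rot mult.assoc flip: cis_mult)

lemma dist_rot_rot [simp]: "dist (rot t z) (rot t w) = dist z w"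
 by (simp add: dist_circle_def dist_norm of_circle_rot norm_mult flip: right_diff_distrib)

lemma dist_rot_le: "dist (rot t z) z \<le> \<bar>t\<bar>"
proof -
 have "of_circle (rot t z) - of_circle z = (cis t - 1) * of_circle z" by (simp add: of_circle_rot algebra_simps)
 then have "dist (rot t z) z = cmod (cis t - 1)" by (simp add: dist_circle_def dist_norm norm_mult)
 also have "\<dots> \<le> \<bar>t\<bar>" using iexp_approx1[of t 0] by (simp add: cis_conv_exp)
 finally show ?thesis .
qed

lemma su_cis: "su (cis t) 0"
 by (simp add: su_def)

lemma rot_Mob: "rot t \<in> Mob"
 using Mob_iff rot_eq_mob su_cis by blast

lemma beta_rot: "beta d (rot t) f = (\<lambda>z. f (rot (- t) z))"
proof -
 have "beta d (rot t) f = pb (cnj (cis (t/2))) (- 0) (int d - 1) f"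
  unfolding rot_eq_mob by (rule beta_eq_pb[OF su_cis])
 also have "\<dots> = (\<lambda>z. f (rot (- t) z))"
  by (simp add: pb_def qf_def cis_cnj rot_eq_mob cis_mult fun_eq_iff)
 finally show ?thesis .
qed

lemma has_dth_rot: "has_dth f f' \<Longrightarrow> has_dth (\<lambda>z. f (rot s z)) (\<lambda>z. f' (rot s z))"
proof -
 assume f: "has_dth f f'"
 have "((\<lambda>t. f (circ (t + s))) has_vector_derivative f' (circ (t + s))) (at t)" for t
  using vector_diff_chain_at[of "\<lambda>u. u + s" 1 t "\<lambda>t. f (circ t)" "f' (circ (t + s))"] f
  by (simp add: has_dth_def o_def has_vector_derivative_add_const)
 then show ?thesis by (simp add: has_dth_def rot_circ add.commute)
qed

lemma smooth_rot: "f \<in> smooth \<Longrightarrow> (\<lambda>z. f (rot s z)) \<in> smooth"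
proof -
 have "csm n f \<Longrightarrow> csm n (\<lambda>z. f (rot s z))" for n
  by (induction n arbitrary: f) (auto intro: has_dth_rot)
 then show "f \<in> smooth \<Longrightarrow> (\<lambda>z. f (rot s z)) \<in> smooth" by (simp add: smooth_iff)
qed

lemma C_norm_rot: "f \<in> smooth \<Longrightarrow> C_norm N (\<lambda>z. f (rot s z)) \<le> C_norm N f"
proof (induction N arbitrary: f)
 case 0
 show ?case by (rule C_norm_0_le) (rule norm_le_C_norm_0[OF 0])
next
 case (Suc N)
 have "dth (\<lambda>z. f (rot s z)) = (\<lambda>z. dth f (rot s z))"
  by (rule has_dth_imp_dth[OF has_dth_rot[OF smooth_has_dth[OF Suc.prems]]])
 moreover have "C_norm 0 (\<lambda>z. f (rot s z)) \<le> C_norm 0 f"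
  by (rule C_norm_0_le) (rule norm_le_C_norm_0[OF Suc.prems])
 ultimately show ?case using Suc.IH[OF smooth_dth[OF Suc.prems]] by (simp add: C_norm_Suc)
qed

lemma csm_inverse:
 assumes "g \<in> smooth" "\<And>z. g z \<noteq> 0"
 shows "csm n (\<lambda>z. inverse (g z))"
proof (induction n)
 case (Suc n)
 have "has_dth (\<lambda>z. inverse (g z)) (\<lambda>z. (-1) * (dth g z * (inverse (g z) * inverse (g z))))"
 proof -
  have "((\<lambda>t. inverse (g (circ t))) has_vector_derivative dth g (circ t) * (- (inverse (g (circ t)) * 1 * inverse (g (circ t))))) (at t)" for t
  proof -
   have "((\<lambda>t. g (circ t)) has_vector_derivative dth g (circ t)) (at t)"
    using smooth_has_dth[OF assms(1)] by (simp add: has_dth_def)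
   moreover have "(inverse has_field_derivative - (inverse (g (circ t)) * 1 * inverse (g (circ t)))) (at (g (circ t)))"
    using assms(2) by (intro DERIV_inverse') auto
   ultimately show ?thesis using field_vector_diff_chain_at by (fastforce simp: o_def)
  qed
  then show ?thesis by (simp add: has_dth_def)
 qed
 moreover have "csm n (\<lambda>z. (-1) * (dth g z * (inverse (g z) * inverse (g z))))"
  by (intro csm_cmult csm_mult Suc smooth_csm smooth_dth assms)
 ultimately show ?case by auto
qed simp

lemma smooth_inverse: "g \<in> smooth \<Longrightarrow> (\<And>z. g z \<noteq> 0) \<Longrightarrow> (\<lambda>z. inverse (g z)) \<in> smooth"
 unfolding smooth_iff[of "\<lambda>z. inverse (g z)"] using csm_inverse by blast

text \<open>The hyperbolic transformation with fixed points \<open>\<plusminus>\<i>\<close>, which contracts the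
 closed upper half circle into itself.\<close>

definition ctr :: "real \<Rightarrow> circle \<Rightarrow> circle"
 where "ctr s = mob (of_real (cosh s)) (\<i> * of_real (sinh s))"

lemma su_ctr: "su (of_real (cosh s)) (\<i> * of_real (sinh s))" "su (of_real (cosh s)) (- (\<i> * of_real (sinh s)))"
proof -
 have "(cosh s)\<^sup>2 - (sinh s)\<^sup>2 = 1" using cosh_square_eq[of s] by simp
 then show "su (of_real (cosh s)) (\<i> * of_real (sinh s))" "su (of_real (cosh s)) (- (\<i> * of_real (sinh s)))"
  unfolding su_def norm_minus_cancel norm_mult norm_ii norm_of_real power2_abs mult_1 by simp_all
qed

lemma ctr_Mob: "ctr s \<in> Mob"
 unfolding ctr_def Mob_iff using su_ctr by blast

lemma ctr_eq: "mob (of_real (cosh s)) (- (\<i> * of_real (sinh s))) = ctr (- s)"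
 by (simp add: ctr_def)

lemma ctr_ctr: "ctr s (ctr (- s) z) = z"
proof -
 have "(mob (of_real (cosh s)) (\<i> * of_real (sinh s)) \<circ> mob (of_real (cosh s)) (- (\<i> * of_real (sinh s)))) z = z"
  using mob_inverse(1)[OF su_ctr(1)[of s]] by simp
 then show ?thesis by (simp only: ctr_eq ctr_def[symmetric] o_apply)
qed

text \<open>The height transforms by itself, following the addition law of the hyperbolic tangent
  with increment \<open>2 * s\<close>.\<close>

lemma Im_ctr:
 "Im (of_circle (ctr s z)) = (sinh (2 * s) + cosh (2 * s) * Im (of_circle z)) / (cosh (2 * s) + sinh (2 * s) * Im (of_circle z))"
proof -
 let ?x = "Re (of_circle z)" and ?y = "Im (of_circle z)" and ?c = "cosh s" and ?s = "sinh s"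
 have r: "?x\<^sup>2 = 1 - ?y\<^sup>2" using Re_Im_circle[of z] by simp
 have "Im (of_circle (ctr s z)) = ((?c * ?y + ?s) * (?c + ?s * ?y) - (?c * ?x) * (- ?s * ?x)) / ((?c + ?s * ?y)\<^sup>2 + (- ?s * ?x)\<^sup>2)"
  unfolding ctr_def of_circle_mob[OF su_ctr(1)] by (simp add: Im_divide algebra_simps)
 also have "(?c * ?y + ?s) * (?c + ?s * ?y) - (?c * ?x) * (- ?s * ?x) = 2 * ?s * ?c + (?c\<^sup>2 + ?s\<^sup>2) * ?y"
 proof -
  have "(?c * ?y + ?s) * (?c + ?s * ?y) - (?c * ?x) * (- ?s * ?x) = ?s * ?c * (?y\<^sup>2 + ?x\<^sup>2) + ?s * ?c + (?c\<^sup>2 + ?s\<^sup>2) * ?y"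
   by (simp add: power2_eq_square algebra_simps)
  then show ?thesis unfolding r by simp
 qed
 also have "(?c + ?s * ?y)\<^sup>2 + (- ?s * ?x)\<^sup>2 = ?c\<^sup>2 + ?s\<^sup>2 + 2 * ?s * ?c * ?y"
 proof -
  have "(?c + ?s * ?y)\<^sup>2 + (- ?s * ?x)\<^sup>2 = ?c\<^sup>2 + ?s\<^sup>2 * (?y\<^sup>2 + ?x\<^sup>2) + 2 * ?s * ?c * ?y"
   by (simp add: power2_eq_square algebra_simps)
  then show ?thesis unfolding r by simp
 qed
 finally show ?thesis by (simp add: sinh_double cosh_double)
qed

lemma Im_ctr_ge:
 assumes "s \<ge> 0" "Im (of_circle z) \<ge> 0"
 shows "tanh (2 * s) \<le> Im (of_circle (ctr s z))"
proof -
 let ?C = "cosh (2 * s)" and ?S = "sinh (2 * s)" and ?y = "Im (of_circle z)"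
 have S: "?S \<ge> 0" "?C > 0" "?S \<le> ?C" using assms(1) by (auto simp: sinh_le_cosh_real)
 have d: "0 < ?C + ?S * ?y" using S assms(2) by (intro add_pos_nonneg mult_nonneg_nonneg) auto
 have "?S * ?S * ?y \<le> ?C * ?C * ?y" using S assms(2) by (intro mult_right_mono mult_mono) auto
 then have "?S * (?C + ?S * ?y) \<le> (?S + ?C * ?y) * ?C" by (simp add: algebra_simps)
 then show ?thesis unfolding Im_ctr tanh_def using S(2) d by (simp add: divide_le_eq le_divide_eq pos_divide_le_eq pos_le_divide_eq)
qed

lemma tanh_near_1: "e > 0 \<Longrightarrow> \<exists>s>0. tanh (2 * s) > 1 - (e::real)"
proof -
 assume "e > 0"
 then have "\<forall>\<^sub>F x in at_top. tanh x > 1 - e"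
  using order_tendstoD(1)[OF tanh_real_at_top, of "1 - e"] by simp
 then obtain N where N: "\<And>x. x \<ge> N \<Longrightarrow> tanh x > 1 - e" by (auto simp: eventually_at_top_linorder)
 show ?thesis using N[of "2 * (max N 1)"] by (intro exI[of _ "max N 1"]) auto
qed

lemma supp_subset_closed: "closed S \<Longrightarrow> (\<And>z. f z \<noteq> 0 \<Longrightarrow> z \<in> S) \<Longrightarrow> supp f \<subseteq> S"
 unfolding supp_def by (rule closure_minimal) auto

lemma not_supp_zero: "z \<notin> supp f \<Longrightarrow> f z = 0"
 using closure_subset[of "{z. f z \<noteq> 0}"] unfolding supp_def by blast

lemma closed_supp: "closed (supp f)"
 by (simp add: supp_def)

lemma compact_supp: "compact (supp f)"
 using compact_Int_closed[OF compact_circle closed_supp[of f]] by simp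

lemma continuous_rot: "continuous_on A (rot t)"
 by (auto simp: continuous_on_iff)

lemma continuous_Im_circle: "continuous_on A (\<lambda>z. Im (of_circle z))"
 by (intro continuous_intros continuous_of_circle)

lemma smooth_mob_pullback:
 assumes "su a b" "f \<in> smooth" shows "(\<lambda>z. f (mob a b z)) \<in> smooth"
 using smooth_pb[OF assms, of 0] by (simp add: pb_def[abs_def])

text \<open>The Gaussian on the upper half circle is squeezed towards \<open>\<i>\<close> by
  \<open>ctr s\<close>, and then \<open>\<i>\<close> is rotated to \<open>p\<close>.\<close>

lemma smooth_bump:
 assumes "e > 0"
 obtains b r where "b \<in> smooth" "\<And>z. b z = of_real (r z)" "\<And>z. r z \<ge> 0" "r p > 0" "supp b \<subseteq> ball p e"
proof -
 obtain t0 where t0: "p = circ t0" using circ_surj by blast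
 define \<tau> where "\<tau> = pi / 2 - t0"
 have i: "of_circle (rot \<tau> p) = \<i>" by (simp add: \<tau>_def t0 rot_circ)
 \<comment> \<open>The squared distance from \<open>\<i>\<close> is \<open>2 - 2 * Im\<close>, so a
   height above \<open>1 - e\<^sup>2 / 2\<close> means a distance below \<open>e\<close>.\<close>
 obtain s where s: "s > 0" "tanh (2 * s) > 1 - e\<^sup>2 / 2" using tanh_near_1[of "e\<^sup>2 / 2"] assms by auto
 define r where "r z = (if Im (of_circle (ctr (- s) (rot \<tau> z))) > 0 then exp (- (xc (ctr (- s) (rot \<tau> z)))\<^sup>2) else 0)" for z
 define b where "b z = he 0 (\<lambda>\<zeta>. exp (- \<zeta>\<^sup>2)) (ctr (- s) (rot \<tau> z))" for z
 show ?thesis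
 proof
  show "b \<in> smooth" unfolding b_def[abs_def] ctr_eq[symmetric]
   by (intro smooth_rot[of "\<lambda>z. he 0 (\<lambda>\<zeta>. exp (- \<zeta>\<^sup>2)) (mob _ _ z)"] smooth_mob_pullback su_ctr smooth_he ent_gauss)
  show "b z = of_real (r z)" for z
   by (simp add: b_def r_def he_def hf_def exp_of_real flip: of_real_power of_real_minus)
  show "r z \<ge> 0" for z by (simp add: r_def)
  have "Im (of_circle (ctr (- s) (rot \<tau> p))) = 1" unfolding Im_ctr i using exp_gt_zero[of "2 * s"]
   by (simp add: cosh_minus_sinh)
  then show "r p > 0" by (simp add: r_def)
  let ?S = "{z. tanh (2 * s) \<le> Im (of_circle (rot \<tau> z))}"
  have "supp b \<subseteq> ?S"
  proof (rule supp_subset_closed)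
   show "closed ?S"
    by (intro closed_Collect_le continuous_intros continuous_on_compose2[OF continuous_Im_circle[of UNIV] continuous_rot]) auto
   fix z assume "b z \<noteq> 0"
   then have "Im (of_circle (ctr (- s) (rot \<tau> z))) \<ge> 0"
    by (auto simp: b_def he_def hf_def split: if_splits)
   from Im_ctr_ge[OF _ this, of s] s(1) show "z \<in> ?S" using ctr_ctr[of s "rot \<tau> z"] by simp
  qed
  also have "?S \<subseteq> ball p e"
  proof
   fix z assume "z \<in> ?S"
   let ?w = "of_circle (rot \<tau> z)"
   have "(dist p z)\<^sup>2 = (dist (rot \<tau> p) (rot \<tau> z))\<^sup>2" by simp
   also have "\<dots> = (cmod (\<i> - ?w))\<^sup>2" by (simp add: dist_circle_def dist_norm i)
   also have "\<dots> = (Re ?w)\<^sup>2 + (Im ?w)\<^sup>2 + 1 - 2 * Im ?w" by (simp add: cmod_power2 power2_diff)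
   also have "\<dots> = 2 - 2 * Im ?w" using Re_Im_circle[of "rot \<tau> z"] by simp
   also have "\<dots> < e\<^sup>2" using s \<open>z \<in> ?S\<close> by simp
   finally show "z \<in> ball p e" using assms by (simp add: power2_less_imp_less)
  qed
  finally show "supp b \<subseteq> ball p e" .
 qed
qed

text \<open>Rotates of one bump cover the circle by compactness. The pieces are written as rotates
  of functions supported in \<open>I\<close>, because in \<open>reeh_schlieder\<close> the rotation
  is pulled out of a whole product of fields.\<close>

lemma partition_rotations:
 assumes "open I" "I \<noteq> {}"
 obtains T :: "real set" and k where "finite T" "\<And>t. k t \<in> smooth" "\<And>t. supp (k t) \<subseteq> I"
  "\<And>z. (\<Sum>t\<in>T. k t (rot (- t) z)) = 1"
proof -
 obtain z0 e where e: "e > 0" "ball z0 e \<subseteq> I" using assms by (metis ex_in_conv open_contains_ball)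
 obtain b r where b: "b \<in> smooth" "\<And>z. b z = of_real (r z)" "\<And>z. r z \<ge> 0" "r z0 > 0" "supp b \<subseteq> ball z0 e"
  using smooth_bump[OF e(1), where p = z0] by metis
 have contr: "continuous_on UNIV r"
 proof -
  have "continuous_on UNIV (\<lambda>z. Re (b z))" by (intro continuous_intros smooth_continuous b)
  then show ?thesis by (simp add: b(2))
 qed
 define W where "W t = {z. r (rot (- t) z) > 0}" for t
 have opW: "open (W t)" for t
  unfolding W_def by (intro open_Collect_less continuous_intros continuous_on_compose2[OF contr continuous_rot]) auto
 have "z \<in> (\<Union>t. W t)" for z
 proof -
  obtain t0 t1 where "z0 = circ t0" "z = circ t1" using circ_surj by blast
  then have "rot (- (t1 - t0)) z = z0" by (simp add: rot_circ)
  then have "z \<in> W (t1 - t0)" using b(4) by (simp add: W_def)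
  then show ?thesis by blast
 qed
 then have "UNIV \<subseteq> (\<Union>t\<in>UNIV. W t)" by blast
 then obtain T where T: "finite T" "UNIV \<subseteq> (\<Union>t\<in>T. W t)"
  using compactE_image[OF compact_circle, of UNIV W] opW by metis
 define s where "s z = (\<Sum>t\<in>T. b (rot (- t) z))" for z
 have s: "s z = of_real (\<Sum>t\<in>T. r (rot (- t) z))" for z by (simp add: s_def b(2))
 have "(\<Sum>t\<in>T. r (rot (- t) z)) > 0" for z
 proof -
  obtain t where t: "t \<in> T" "z \<in> W t" using T(2) by blast
  then show ?thesis using T(1) b(3) by (intro sum_pos2[of T t]) (auto simp: W_def)
 qed
 then have s0: "s z \<noteq> 0" for z unfolding s by (metis less_irrefl of_real_eq_0_iff)
 have ss: "s \<in> smooth" unfolding s_def[abs_def] by (intro smooth_sum smooth_rot b)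
 \<comment> \<open>The normaliser is rotated along, so that \<open>k t (rot (- t) z)\<close> has the
   denominator \<open>s z\<close> for every \<open>t\<close>.\<close>
 define k where "k t z = b z * inverse (s (rot t z))" for t z
 show ?thesis
 proof (rule that[OF T(1)])
  show "k t \<in> smooth" for t
   unfolding k_def[abs_def] by (intro smooth_mult b smooth_rot[of "\<lambda>z. inverse (s z)"] smooth_inverse ss s0)
  show "supp (k t) \<subseteq> I" for t
  proof -
   have "supp (k t) \<subseteq> supp b"
    by (rule supp_subset_closed[OF closed_supp]) (use not_supp_zero[of _ b] in \<open>auto simp: k_def\<close>)
   then show ?thesis using b(5) e(2) by blast
  qed
  show "(\<Sum>t\<in>T. k t (rot (- t) z)) = 1" for z
  proof -
   have "(\<Sum>t\<in>T. k t (rot (- t) z)) = s z * inverse (s z)"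
    by (subst (1) s_def) (simp add: k_def sum_distrib_right)
   then show ?thesis using s0 by simp
  qed
 qed
qed

section \<open>The two half circles and contraction into the upper one\<close>

definition upper :: "circle set" where "upper = {z. Im (of_circle z) > 0}"
definition lower :: "circle set" where "lower = {z. Im (of_circle z) < 0}"

lemma open_upper: "open upper" and open_lower: "open lower"
 unfolding upper_def lower_def by (intro open_Collect_less continuous_intros continuous_of_circle)+

lemma circle_inv_upper: "circle_inv z \<in> upper \<longleftrightarrow> z \<in> lower" "circle_inv z \<in> lower \<longleftrightarrow> z \<in> upper"
 by (auto simp: upper_def lower_def of_circle_inv_cnj simp del: of_circle_inv)

text \<open>The function may reach the end points of the half circle; after the contraction its
  support lies at height at least \<open>tanh (2 * s)\<close>.\<close>

lemma beta_ctr_supp: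
 assumes "\<And>z. f z \<noteq> 0 \<Longrightarrow> Im (of_circle z) \<ge> 0" "s > 0"
 shows "supp (beta d (ctr s) f) \<subseteq> upper"
proof -
 let ?S = "{z. tanh (2 * s) \<le> Im (of_circle z)}"
 have "supp (beta d (ctr s) f) \<subseteq> ?S"
 proof (rule supp_subset_closed)
  show "closed ?S" by (intro closed_Collect_le continuous_intros continuous_Im_circle)
  fix z assume "beta d (ctr s) f z \<noteq> 0"
  then have "f (inv (ctr s) z) \<noteq> 0" by (auto simp: beta_def)
  moreover have "inv (ctr s) = ctr (- s)" unfolding ctr_def inv_mob[OF su_ctr(1)] by simp
  ultimately have "Im (of_circle (ctr (- s) z)) \<ge> 0" using assms(1) by simp
  from Im_ctr_ge[OF _ this, of s] show "z \<in> ?S" using assms(2) by (simp add: ctr_ctr)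
 qed
 also have "?S \<subseteq> upper" 
 proof -
  have "tanh (2 * s) > 0" using assms(2) by simp
  then show ?thesis unfolding upper_def by (auto simp del: tanh_real_pos_iff intro: less_le_trans)
 qed
 finally show ?thesis .
qed

lemma beta_ctr_tendsto:
 assumes "f \<in> smooth"
 shows "(\<lambda>n. C_norm N (\<lambda>z. beta d (ctr (1 / real (Suc n))) f z - f z)) \<longlonglongrightarrow> 0"
proof -
 have c: "(\<lambda>n. 1 / real (Suc n)) \<longlonglongrightarrow> 0" using LIMSEQ_inverse_real_of_nat by (simp add: inverse_eq_divide)
 have "(\<lambda>n. cosh (1 / real (Suc n))) \<longlonglongrightarrow> cosh 0" by (intro tendsto_intros c)
 then have a: "(\<lambda>n. complex_of_real (cosh (1 / real (Suc n)))) \<longlonglongrightarrow> 1" using tendsto_of_real by fastforce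
 have "(\<lambda>n. sinh (1 / real (Suc n))) \<longlonglongrightarrow> sinh 0" by (intro tendsto_intros c)
 then have "(\<lambda>n. - (\<i> * complex_of_real (sinh (1 / real (Suc n))))) \<longlonglongrightarrow> - (\<i> * of_real (sinh 0))"
  by (intro tendsto_intros c)
 then have b: "(\<lambda>n. - (\<i> * complex_of_real (sinh (1 / real (Suc n))))) \<longlonglongrightarrow> 0" by simp
 have "pb 1 0 m f = f" for m by (simp add: pb_def qf_def mob_id fun_eq_iff)
 then have "(\<lambda>n. C_norm N (\<lambda>z. pb (of_real (cosh (1 / real (Suc n)))) (- (\<i> * of_real (sinh (1 / real (Suc n))))) (int d - 1) f z - f z)) \<longlonglongrightarrow> 0"
  using pb_tendsto[OF a b su_ctr(2) _ assms, of N "int d - 1"] by (simp add: su_def)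
 moreover have "beta d (ctr s) f = pb (of_real (cosh s)) (- (\<i> * of_real (sinh s))) (int d - 1) f" for s
  unfolding ctr_def beta_eq_pb[OF su_ctr(1)] by simp
 ultimately show ?thesis by simp
qed

lemma smooth_beta: "\<gamma> \<in> Mob \<Longrightarrow> f \<in> smooth \<Longrightarrow> beta d \<gamma> f \<in> smooth"
 unfolding Mob_iff using beta_eq_pb smooth_pb su_inv by metis

section \<open>Gaussian regularisation\<close>

text \<open>The angle of the point \<open>zc x\<close>, a shifted Gudermannian function.\<close>

definition theta_of :: "real \<Rightarrow> real" where "theta_of x = 2 * arctan (exp x)"

lemma circ_theta_of: "circ (theta_of x) = zc x"
proof (rule circle_eqI)
 let ?u = "exp x"
 have p: "1 + ?u\<^sup>2 > 0" by (simp add: add_pos_nonneg)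
 have c: "cos (arctan ?u) = 1 / sqrt (1 + ?u\<^sup>2)" "sin (arctan ?u) = ?u / sqrt (1 + ?u\<^sup>2)"
  by (simp_all add: cos_arctan sin_arctan)
 have cc: "cos (theta_of x) = (1 - ?u\<^sup>2) / (1 + ?u\<^sup>2)"
  using p unfolding theta_of_def cos_double c by (simp add: power_divide diff_divide_distrib)
 have ss: "sin (theta_of x) = 2 * ?u / (1 + ?u\<^sup>2)" using p unfolding theta_of_def sin_double c by simp
 have u: "exp (- x) = 1 / ?u" by (simp add: exp_minus inverse_eq_divide)
 have "1 / cosh x = 2 * ?u / (1 + ?u\<^sup>2)"
  unfolding cosh_field_def u using p by (simp add: field_simps power2_eq_square)
 moreover have "- tanh x = (1 - ?u\<^sup>2) / (1 + ?u\<^sup>2)"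
 proof -
  have "tanh x = ((?u - 1 / ?u) * ?u) / ((?u + 1 / ?u) * ?u)" unfolding tanh_altdef u by simp
  also have "\<dots> = (?u\<^sup>2 - 1) / (1 + ?u\<^sup>2)" by (simp add: distrib_right left_diff_distrib power2_eq_square add.commute)
  finally show ?thesis by (simp add: minus_divide_left)
 qed
 ultimately show "of_circle (circ (theta_of x)) = of_circle (zc x)"
  unfolding of_circle_zc of_circle_circ complex_eq_iff by (simp add: cc ss)
qed

lemma theta_of_derivative: "(theta_of has_real_derivative Im (of_circle (zc x))) (at x)"
proof -
 have "(theta_of has_real_derivative 2 * (exp x / (1 + (exp x)\<^sup>2))) (at x)"
  unfolding theta_of_def[abs_def] by (auto intro!: derivative_eq_intros simp: divide_inverse)
 moreover have "2 * (exp x / (1 + (exp x)\<^sup>2)) = Im (of_circle (zc x))"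
 proof -
  have "sin (theta_of x) = Im (of_circle (zc x))" by (simp flip: circ_theta_of)
  moreover have "sin (theta_of x) = 2 * (exp x / (1 + (exp x)\<^sup>2))"
  proof -
   have "1 + (exp x)\<^sup>2 > 0" by (simp add: add_pos_nonneg)
   then show ?thesis unfolding theta_of_def sin_double by (simp add: cos_arctan sin_arctan)
  qed
  ultimately show ?thesis by simp
 qed
 ultimately show ?thesis by simp
qed

definition imc :: "circle \<Rightarrow> complex" where "imc z = of_real (Im (of_circle z))"

lemma smooth_imc [simp]: "imc \<in> smooth"
proof -
 have "imc z = (- \<i> / 2) * (of_circle z - cnj (of_circle z))" for z by (simp add: imc_def complex_eq_iff)
 then have "imc = (\<lambda>z. (- \<i> / 2) * (of_circle z - cnj (of_circle z)))" by blast
 moreover have "(\<lambda>z. (- \<i> / 2) * (of_circle z - cnj (of_circle z))) \<in> smooth"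
  by (intro smooth_cmult smooth_diff) auto
 ultimately show ?thesis by simp
qed

lemma zc_derivative:
 assumes "g \<in> smooth"
 shows "((\<lambda>x. g (zc x)) has_vector_derivative imc (zc x) * dth g (zc x)) (at x)"
proof -
 have "(theta_of has_vector_derivative Im (of_circle (zc x))) (at x)"
  using theta_of_derivative by (simp add: has_real_derivative_iff_has_vector_derivative)
 moreover have "((\<lambda>t. g (circ t)) has_vector_derivative dth g (circ (theta_of x))) (at (theta_of x))"
  using smooth_has_dth[OF assms] by (simp add: has_dth_def)
 ultimately show ?thesis using vector_diff_chain_at[of theta_of _ x "\<lambda>t. g (circ t)"]
  by (fastforce simp: o_def circ_theta_of imc_def scaleR_conv_of_real)
qed

text \<open>The iterated \<open>xc\<close>-derivatives of \<open>Im z * f z\<close>.\<close>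

definition xch :: "(circle \<Rightarrow> complex) \<Rightarrow> nat \<Rightarrow> real \<Rightarrow> complex"
 where "xch f i x = (((\<lambda>g z. imc z * dth g z) ^^ i) (\<lambda>z. imc z * f z)) (zc x)"

lemma smooth_xch: "f \<in> smooth \<Longrightarrow> ((\<lambda>g z. imc z * dth g z) ^^ i) (\<lambda>z. imc z * f z) \<in> smooth"
 by (induction i) (auto intro!: smooth_mult smooth_dth)

lemma xch_derivative:
 assumes "f \<in> smooth"
 shows "(xch f i has_vector_derivative xch f (Suc i) x) (at x)"
 using zc_derivative[OF smooth_xch[OF assms, of i], of x] by (simp add: xch_def[abs_def])

lemma xch_zero:
 assumes "f \<in> smooth" "\<And>x. \<bar>x\<bar> > X \<Longrightarrow> f (zc x) = 0" "\<bar>x\<bar> > X"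
 shows "xch f i x = 0"
 using assms(3)
proof (induction i arbitrary: x)
 case 0
 then show ?case using assms(2) by (simp add: xch_def)
next
 case (Suc i)
 have "open {x. \<bar>x\<bar> > X}" by (intro open_Collect_less continuous_intros)
 then have "(xch f i has_vector_derivative 0) (at x)"
  using has_vector_derivative_transform_within_open[OF has_vector_derivative_const, of "{x. \<bar>x\<bar> > X}" x 0 "xch f i"] Suc by auto
 then show ?case using xch_derivative[OF assms(1)] vector_derivative_unique_at by blast
qed

lemma xch_bounded: "f \<in> smooth \<Longrightarrow> \<exists>B\<ge>0. \<forall>x. norm (xch f i x) \<le> B"
 unfolding xch_def using norm_le_C_norm_0[OF smooth_xch[of f i]] C_norm_0_nonneg[OF smooth_xch[of f i]] by blast

lemma dec_compact:
 assumes "\<And>x. \<bar>x\<bar> > X \<Longrightarrow> F x = 0" "\<And>x. norm (F x) \<le> B"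
 shows "dec F"
 unfolding dec_def
proof
 fix K :: nat
 have B: "B \<ge> 0" using order_trans[OF norm_ge_zero assms(2)] .
 have "norm (F x) \<le> (B * exp (real K * \<bar>X\<bar>)) * exp (- real K * \<bar>x\<bar>)" for x
 proof (cases "\<bar>x\<bar> > X")
  case False
  have "B * 1 \<le> B * exp (real K * \<bar>X\<bar> + - real K * \<bar>x\<bar>)"
  proof (rule mult_left_mono[OF _ B])
   have "real K * \<bar>x\<bar> \<le> real K * \<bar>X\<bar>" using False by (intro mult_left_mono) auto
   then show "1 \<le> exp (real K * \<bar>X\<bar> + - real K * \<bar>x\<bar>)" by simp
  qed
  then have "norm (F x) \<le> B * exp (real K * \<bar>X\<bar> + - real K * \<bar>x\<bar>)" using assms(2)[of x] by linarith
  then show ?thesis by (simp only: exp_add mult.assoc)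
 qed (simp add: assms(1) B)
 then show "\<exists>C. \<forall>x. norm (F x) \<le> C * exp (- real K * \<bar>x\<bar>)" by blast
qed

lemma chain_xch:
 assumes "f \<in> smooth" "\<And>x. \<bar>x\<bar> > X \<Longrightarrow> f (zc x) = 0"
 shows "chain (xch f)"
 unfolding chain_def using xch_derivative[OF assms(1)] dec_compact[of X] xch_zero[OF assms] xch_bounded[OF assms(1)]
 by metis

lemma hf_xch:
 assumes "\<And>z. z \<notin> upper \<Longrightarrow> f z = 0" shows "hf (-1) (xch f 0) = f"
proof
 fix z
 show "hf (-1) (xch f 0) z = f z"
 proof (cases "Im (of_circle z) > 0")
  case True
  then show ?thesis by (simp add: hf_def xch_def zc_xc imc_def power_int_minus)
 next
  case False
  then show ?thesis using assms[of z] by (simp add: hf_def upper_def)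
 qed
qed

section \<open>Convolution with Gaussians in the line coordinate\<close>

definition gk :: "real \<Rightarrow> complex \<Rightarrow> complex"
 where "gk \<sigma> \<zeta> = of_real (1 / (\<sigma> * sqrt (2 * pi))) * exp (- (\<zeta> / of_real \<sigma>)\<^sup>2 / 2)"

definition gkd :: "real \<Rightarrow> complex \<Rightarrow> complex"
 where "gkd \<sigma> \<zeta> = gk \<sigma> \<zeta> * (- \<zeta> / (of_real \<sigma>)\<^sup>2)"

lemma gk_derivative: "\<sigma> > 0 \<Longrightarrow> (gk \<sigma> has_field_derivative gkd \<sigma> \<zeta>) (at \<zeta>)"
 unfolding gk_def[abs_def] gkd_def by (auto intro!: derivative_eq_intros simp: power2_eq_square field_simps)

text \<open>The functions \<open>F\<close> of interest vanish outside \<open>[-X, X]\<close>;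
  integrating over this compact interval makes the result entire by differentiation under the
  integral.\<close>

definition gconv :: "real \<Rightarrow> real \<Rightarrow> (real \<Rightarrow> complex) \<Rightarrow> complex \<Rightarrow> complex"
 where "gconv X \<sigma> F \<zeta> = integral (cbox (-X) X) (\<lambda>s. F s * gk \<sigma> (\<zeta> - of_real s))"

lemma continuous_gk: "\<sigma> > 0 \<Longrightarrow> continuous_on A (gk \<sigma>)" and continuous_gkd: "\<sigma> > 0 \<Longrightarrow> continuous_on A (gkd \<sigma>)"
 unfolding gkd_def[abs_def] gk_def[abs_def] by (intro continuous_intros; simp)+

lemma gconv_derivative0:
 assumes "\<sigma> > 0" "continuous_on UNIV F"
 shows "(gconv X \<sigma> F has_field_derivative integral (cbox (-X) X) (\<lambda>s. F s * gkd \<sigma> (\<zeta> - of_real s))) (at \<zeta>)"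
proof -
 note cg = continuous_gk[OF assms(1)]
 note cgd = continuous_gkd[OF assms(1)]
 have "((\<lambda>\<zeta>. integral (cbox (-X) X) (\<lambda>s. F s * gk \<sigma> (\<zeta> - of_real s))) has_field_derivative
   integral (cbox (-X) X) (\<lambda>s. F s * gkd \<sigma> (\<zeta> - of_real s))) (at \<zeta> within UNIV)"
 proof (rule leibniz_rule_field_derivative)
  fix x t
  have "((\<lambda>x. gk \<sigma> (x - of_real t)) has_field_derivative gkd \<sigma> (x - of_real t) * 1) (at x)"
   by (rule DERIV_chain2[OF gk_derivative[OF assms(1)]]) (auto intro!: derivative_eq_intros)
  then show "((\<lambda>x. F t * gk \<sigma> (x - of_real t)) has_field_derivative F t * gkd \<sigma> (x - of_real t)) (at x within UNIV)"
   by (auto intro!: DERIV_cmult)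
  show "(\<lambda>s. F s * gk \<sigma> (x - of_real s)) integrable_on cbox (- X) X"
   by (intro integrable_continuous continuous_intros continuous_on_compose2[OF cg] continuous_on_subset[OF assms(2)]) auto
  show "continuous_on (UNIV \<times> cbox (- X) X) (\<lambda>(x, t). F t * gkd \<sigma> (x - of_real t))"
   unfolding case_prod_unfold
   by (intro continuous_intros continuous_on_compose2[OF cgd[of UNIV]] continuous_on_compose2[OF assms(2)]) auto
 qed auto
 then show ?thesis by (simp add: gconv_def[abs_def])
qed

text \<open>Integration by parts moves the derivative from the kernel to \<open>F\<close>, which
  vanishes at both ends. So the derivatives of a regularised function are the regularised
  derivatives.\<close>

lemma gconv_derivative:
 assumes s: "\<sigma> > 0" and F: "\<And>x. (F has_vector_derivative F' x) (at x)" and F': "continuous_on UNIV F'"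
  and z: "F X = 0" "F (- X) = 0" and X: "X \<ge> 0"
 shows "(gconv X \<sigma> F has_field_derivative gconv X \<sigma> F' \<zeta>) (at \<zeta>)"
proof -
 have cF: "continuous_on UNIV F" using F by (meson continuous_at_imp_continuous_on has_vector_derivative_continuous)
 have d: "((\<lambda>s. F s * gk \<sigma> (\<zeta> - of_real s)) has_vector_derivative
   (F s * (- gkd \<sigma> (\<zeta> - of_real s)) + F' s * gk \<sigma> (\<zeta> - of_real s))) (at s)" for s
 proof (rule has_vector_derivative_mult[OF F])
  have "((\<lambda>w. gk \<sigma> (\<zeta> - w)) has_field_derivative gkd \<sigma> (\<zeta> - of_real s) * (-1)) (at (of_real s))"
   by (rule DERIV_chain2[OF gk_derivative[OF assms(1)]]) (auto intro!: derivative_eq_intros)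
  from has_vector_derivative_real_field[OF this]
  show "((\<lambda>s. gk \<sigma> (\<zeta> - of_real s)) has_vector_derivative - gkd \<sigma> (\<zeta> - of_real s)) (at s)" by simp
 qed
 note cg = continuous_gk[OF s]
 note cgd = continuous_gkd[OF s]
 have i1: "(\<lambda>s. F s * gkd \<sigma> (\<zeta> - of_real s)) integrable_on cbox (- X) X"
  by (intro integrable_continuous continuous_intros continuous_on_compose2[OF cgd] continuous_on_subset[OF cF]) auto
 have i2: "(\<lambda>s. F' s * gk \<sigma> (\<zeta> - of_real s)) integrable_on cbox (- X) X"
  by (intro integrable_continuous continuous_intros continuous_on_compose2[OF cg] continuous_on_subset[OF F']) auto
 have "((\<lambda>s. F s * (- gkd \<sigma> (\<zeta> - of_real s)) + F' s * gk \<sigma> (\<zeta> - of_real s)) has_integral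
   (F X * gk \<sigma> (\<zeta> - of_real X) - F (- X) * gk \<sigma> (\<zeta> - of_real (- X)))) {- X..X}"
  by (rule fundamental_theorem_of_calculus) (use X d in \<open>auto intro: has_vector_derivative_at_within\<close>)
 then have "integral (cbox (- X) X) (\<lambda>s. F' s * gk \<sigma> (\<zeta> - of_real s) - F s * gkd \<sigma> (\<zeta> - of_real s)) = 0"
  using z by (simp add: integral_unique cbox_interval)
 then have "integral (cbox (- X) X) (\<lambda>s. F s * gkd \<sigma> (\<zeta> - of_real s)) = gconv X \<sigma> F' \<zeta>"
  using i1 i2 by (subst (asm) integral_diff) (auto simp: gconv_def)
 then show ?thesis using gconv_derivative0[OF s cF, of X \<zeta>] by simp
qed

lemma gk_bound:
 assumes "\<sigma> > 0" "\<bar>Im \<zeta>\<bar> \<le> R"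
 shows "norm (gk \<sigma> \<zeta>) \<le> (1 / (\<sigma> * sqrt (2 * pi)) * exp ((R / \<sigma>)\<^sup>2 / 2 + (K * \<sigma>)\<^sup>2 / 2)) * exp (- K * \<bar>Re \<zeta>\<bar>)"
proof -
 have "norm (exp (- (\<zeta> / of_real \<sigma>)\<^sup>2 / 2)) = exp (((Im \<zeta> / \<sigma>)\<^sup>2 - (Re \<zeta> / \<sigma>)\<^sup>2) / 2)"
 proof -
  have "norm (exp (- w\<^sup>2 / 2)) = exp (((Im w)\<^sup>2 - (Re w)\<^sup>2) / 2)" for w :: complex
   by (simp add: norm_exp_eq_Re Re_power2 diff_divide_distrib)
  from this[of "\<zeta> / of_real \<sigma>"] show ?thesis by simp
 qed
 also have "\<dots> \<le> exp (((R / \<sigma>)\<^sup>2 / 2 + (K * \<sigma>)\<^sup>2 / 2) + - K * \<bar>Re \<zeta>\<bar>)"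
 proof -
  have "\<bar>Im \<zeta> / \<sigma>\<bar> \<le> R / \<sigma>" using assms by (simp add: divide_right_mono)
  from power_mono[OF this, of 2] have "(Im \<zeta> / \<sigma>)\<^sup>2 \<le> (R / \<sigma>)\<^sup>2" by (simp only: power2_abs abs_ge_zero)
  moreover have "0 \<le> (\<bar>Re \<zeta>\<bar> / \<sigma> - K * \<sigma>)\<^sup>2" by simp
  then have "2 * (K * \<bar>Re \<zeta>\<bar>) \<le> (Re \<zeta> / \<sigma>)\<^sup>2 + (K * \<sigma>)\<^sup>2"
   using assms(1) by (simp add: power2_diff power_divide algebra_simps)
  ultimately have "((Im \<zeta> / \<sigma>)\<^sup>2 - (Re \<zeta> / \<sigma>)\<^sup>2) / 2 \<le> ((R / \<sigma>)\<^sup>2 / 2 + (K * \<sigma>)\<^sup>2 / 2) + - K * \<bar>Re \<zeta>\<bar>" by simp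
  then show ?thesis by (simp only: exp_le_cancel_iff)
 qed
 finally have "norm (gk \<sigma> \<zeta>) \<le> 1 / (\<sigma> * sqrt (2 * pi)) * exp (((R / \<sigma>)\<^sup>2 / 2 + (K * \<sigma>)\<^sup>2 / 2) + - K * \<bar>Re \<zeta>\<bar>)"
 proof -
  assume *: "norm (exp (- (\<zeta> / of_real \<sigma>)\<^sup>2 / 2)) \<le> exp (((R / \<sigma>)\<^sup>2 / 2 + (K * \<sigma>)\<^sup>2 / 2) + - K * \<bar>Re \<zeta>\<bar>)"
  have c: "cmod (of_real (1 / (\<sigma> * sqrt (2 * pi)))) = 1 / (\<sigma> * sqrt (2 * pi))"
   using assms(1) by (subst norm_of_real) simp
  show ?thesis unfolding gk_def norm_mult c by (rule mult_left_mono[OF *]) (use assms(1) in simp)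
 qed
 then show ?thesis unfolding exp_add by (simp only: mult.assoc)
qed

lemma ent_gconv:
 assumes s: "\<sigma> > 0" and cF: "continuous_on UNIV F" and B: "\<And>x. norm (F x) \<le> B" and X: "X \<ge> 0"
 shows "ent (gconv X \<sigma> F)"
 unfolding ent_def
proof (intro conjI allI)
 show "gconv X \<sigma> F holomorphic_on UNIV"
  unfolding holomorphic_on_def field_differentiable_def using gconv_derivative0[OF s cF] by auto
 note cg = continuous_gk[OF s]
 have B0: "B \<ge> 0" using order_trans[OF norm_ge_zero B] .
 fix K R
 define c where "c = 1 / (\<sigma> * sqrt (2 * pi)) * exp ((R / \<sigma>)\<^sup>2 / 2 + (\<bar>K\<bar> * \<sigma>)\<^sup>2 / 2)"
 have c0: "c \<ge> 0" using s by (simp add: c_def)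
 have "norm (gconv X \<sigma> F \<zeta>) \<le> (B * c * exp (\<bar>K\<bar> * X) * (2 * X)) * exp (- K * \<bar>Re \<zeta>\<bar>)" if "\<bar>Im \<zeta>\<bar> \<le> R" for \<zeta>
 proof -
  have "norm (gconv X \<sigma> F \<zeta>) \<le> (B * (c * exp (\<bar>K\<bar> * X) * exp (- K * \<bar>Re \<zeta>\<bar>))) * (X - (- X))"
   unfolding gconv_def cbox_interval
  proof (rule integral_bound)
   show "continuous_on {- X..X} (\<lambda>s. F s * gk \<sigma> (\<zeta> - of_real s))"
    by (intro continuous_intros continuous_on_compose2[OF cg] continuous_on_subset[OF cF]) auto
   show "- X \<le> X" using X by simp
   show "\<And>s. s \<in> {- X..X} \<Longrightarrow> norm (F s * gk \<sigma> (\<zeta> - of_real s)) \<le> B * (c * exp (\<bar>K\<bar> * X) * exp (- K * \<bar>Re \<zeta>\<bar>))"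
   proof -
    fix s assume "s \<in> {- X..X}"
    then have sX: "\<bar>s\<bar> \<le> X" by auto
    have "norm (gk \<sigma> (\<zeta> - of_real s)) \<le> c * exp (- \<bar>K\<bar> * \<bar>Re \<zeta> - s\<bar>)"
     using gk_bound[OF s, of "\<zeta> - of_real s" R "\<bar>K\<bar>"] that by (simp add: c_def)
    also have "\<dots> \<le> c * exp (\<bar>K\<bar> * X + - K * \<bar>Re \<zeta>\<bar>)"
    proof -
     have "\<bar>K\<bar> * \<bar>Re \<zeta>\<bar> \<le> \<bar>K\<bar> * (\<bar>Re \<zeta> - s\<bar> + X)" using sX by (intro mult_left_mono) auto
     moreover have "K * \<bar>Re \<zeta>\<bar> \<le> \<bar>K\<bar> * \<bar>Re \<zeta>\<bar>" by (intro mult_right_mono) auto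
     ultimately show ?thesis using c0 by (intro mult_left_mono) (auto simp: algebra_simps)
    qed
    also have "\<dots> = c * exp (\<bar>K\<bar> * X) * exp (- K * \<bar>Re \<zeta>\<bar>)" by (simp only: exp_add mult.assoc)
    finally show "norm (F s * gk \<sigma> (\<zeta> - of_real s)) \<le> B * (c * exp (\<bar>K\<bar> * X) * exp (- K * \<bar>Re \<zeta>\<bar>))"
     unfolding norm_mult using B B0 by (intro mult_mono) auto
   qed
  qed
  also have "X - (- X) = 2 * X" by simp
  finally show ?thesis by (simp only: mult_ac)
 qed
 then show "\<exists>C. \<forall>\<zeta>. \<bar>Im \<zeta>\<bar> \<le> R \<longrightarrow> norm (gconv X \<sigma> F \<zeta>) \<le> C * exp (- K * \<bar>Re \<zeta>\<bar>)" by blast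
qed

text \<open>Substituting \<open>s = x - \<sigma> * w\<close> puts the dependence on
  \<open>\<sigma>\<close> into the argument of \<open>F\<close>, against a fixed normal
  weight.\<close>

lemma gconv_real:
 assumes s: "\<sigma> > 0" and cF: "continuous_on UNIV F" and z: "\<And>x. \<bar>x\<bar> > X \<Longrightarrow> F x = 0"
 shows "gconv X \<sigma> F (of_real x) = (LINT w|lborel. std_normal_density w *\<^sub>R F (x - \<sigma> * w))"
proof -
 note cg = continuous_gk[OF s]
 have "set_integrable lborel {-X..X} (\<lambda>s. F s * gk \<sigma> (of_real x - of_real s))"
  by (intro borel_integrable_atLeastAtMost' continuous_intros continuous_on_compose2[OF cg] continuous_on_subset[OF cF]) auto
 then have "gconv X \<sigma> F (of_real x) = (LINT s:{-X..X}|lborel. F s * gk \<sigma> (of_real x - of_real s))"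
  unfolding gconv_def by (simp add: set_borel_integral_eq_integral(2))
 also have "\<dots> = (LINT s|lborel. F s * gk \<sigma> (of_real x - of_real s))" unfolding set_lebesgue_integral_def
  by (intro Bochner_Integration.integral_cong) (auto simp: indicator_def z)
 also have "\<dots> = \<bar>- \<sigma>\<bar> *\<^sub>R (LINT w|lborel. F (x + - \<sigma> * w) * gk \<sigma> (of_real x - of_real (x + - \<sigma> * w)))"
  using s by (intro lborel_integral_real_affine) auto
 also have "\<dots> = (LINT w|lborel. std_normal_density w *\<^sub>R F (x - \<sigma> * w))"
  using s by (subst integral_scaleR_right[symmetric])
   (auto intro!: Bochner_Integration.integral_cong simp: gk_def std_normal_density_def scaleR_conv_of_real exp_of_real[symmetric] field_simps)
 finally show ?thesis .
qed

lemma integrable_exp_abs: "integrable lborel (\<lambda>x::real. exp (- \<bar>x\<bar>))"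
proof -
 have "integrable lborel (\<lambda>x::real. 2 * inverse (1 + x^2))"
  using integrable_inverse_1_plus_square by (simp add: set_integrable_def)
 then show ?thesis
 proof (rule Bochner_Integration.integrable_bound)
  show "AE x in lborel. norm (exp (- \<bar>x\<bar>)) \<le> norm (2 * inverse (1 + (x::real)\<^sup>2))"
  proof (rule AE_I2)
   fix x :: real
   have "1 + \<bar>x\<bar> + \<bar>x\<bar>\<^sup>2 / 2 \<le> exp \<bar>x\<bar>" by (rule exp_lower_Taylor_quadratic) simp
   then have "1 + x\<^sup>2 \<le> 2 * exp \<bar>x\<bar>" by simp
   moreover have "0 < 1 + x\<^sup>2" by (simp add: add_pos_nonneg)
   ultimately show "norm (exp (- \<bar>x\<bar>)) \<le> norm (2 * inverse (1 + x\<^sup>2))"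
    by (simp add: exp_minus field_simps)
  qed
 qed measurable
qed

lemma integrable_normal_exp:
 "integrable lborel (\<lambda>w. std_normal_density w * (\<bar>w\<bar> * exp (K * \<bar>w\<bar>)))"
proof -
 let ?k = "\<bar>K\<bar> + 2"
 have "integrable lborel (\<lambda>w::real. exp (?k\<^sup>2 / 2) * exp (- \<bar>w\<bar>))"
  by (intro integrable_mult_right integrable_exp_abs)
 then show ?thesis
 proof (rule Bochner_Integration.integrable_bound)
  show "AE w in lborel. norm (std_normal_density w * (\<bar>w\<bar> * exp (K * \<bar>w\<bar>))) \<le> norm (exp (?k\<^sup>2 / 2) * exp (- \<bar>w\<bar>))"
  proof (rule AE_I2)
   fix w :: real
   have "0 \<le> (\<bar>w\<bar> - ?k)\<^sup>2" "K * \<bar>w\<bar> \<le> \<bar>K\<bar> * \<bar>w\<bar>" by (auto intro: mult_right_mono)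
   then have e: "- w\<^sup>2 / 2 + (\<bar>w\<bar> + K * \<bar>w\<bar>) \<le> ?k\<^sup>2 / 2 + - \<bar>w\<bar>" by (simp add: power2_diff algebra_simps)
   have w: "\<bar>w\<bar> \<le> exp \<bar>w\<bar>" using exp_ge_add_one_self[of "\<bar>w\<bar>"] by linarith
   have "1 \<le> sqrt (2 * pi)" using pi_gt3 by simp
   then have "std_normal_density w \<le> exp (- w\<^sup>2 / 2)" by (simp add: std_normal_density_def divide_le_eq mult_le_cancel_left1)
   then have "std_normal_density w * (\<bar>w\<bar> * exp (K * \<bar>w\<bar>)) \<le> exp (- w\<^sup>2 / 2) * (exp \<bar>w\<bar> * exp (K * \<bar>w\<bar>))"
    using w by (intro mult_mono) auto
   also have "\<dots> \<le> exp (?k\<^sup>2 / 2) * exp (- \<bar>w\<bar>)" unfolding exp_add[symmetric] using e by simp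
   finally show "norm (std_normal_density w * (\<bar>w\<bar> * exp (K * \<bar>w\<bar>))) \<le> norm (exp (?k\<^sup>2 / 2) * exp (- \<bar>w\<bar>))" by simp
  qed
 qed measurable
qed

text \<open>\<open>F\<close> is Lipschitz, which gives the factor \<open>\<sigma>\<close>. If
  \<open>\<bar>x\<bar> > X + \<bar>w\<bar>\<close> both values vanish; otherwise the weight
  \<open>exp (K * \<bar>x\<bar>)\<close> is at most \<open>exp (K * X + K * \<bar>w\<bar>)\<close>,
  which is integrable against the normal density.\<close>

lemma gconv_error:
 assumes F: "\<And>x. (F has_vector_derivative F' x) (at x)" and L: "\<And>x. norm (F' x) \<le> L" and z: "\<And>x. \<bar>x\<bar> > X \<Longrightarrow> F x = 0"
  and B: "\<And>x. norm (F x) \<le> B" and K: "K \<ge> 0" and X: "X \<ge> 0"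
 shows "\<exists>M\<ge>0. \<forall>\<sigma> x. 0 < \<sigma> \<longrightarrow> \<sigma> \<le> 1 \<longrightarrow> norm (gconv X \<sigma> F (of_real x) - F x) \<le> \<sigma> * M * exp (- K * \<bar>x\<bar>)"
proof -
 define J where "J = (LINT w|lborel. std_normal_density w * (\<bar>w\<bar> * exp (K * \<bar>w\<bar>)))"
 have J: "J \<ge> 0" unfolding J_def by (intro Bochner_Integration.integral_nonneg) auto
 have L0: "L \<ge> 0" using order_trans[OF norm_ge_zero L] .
 have cF: "continuous_on UNIV F" using F by (meson continuous_at_imp_continuous_on has_vector_derivative_continuous)
 have lip: "norm (F y - F x) \<le> L * \<bar>y - x\<bar>" for x y
 proof -
  have "norm (F y - F x) \<le> L * norm (y - x)"
  proof (rule differentiable_bound[of UNIV _ "\<lambda>x h. h *\<^sub>R F' x"])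
   show "(F has_derivative (\<lambda>h. h *\<^sub>R F' x)) (at x within UNIV)" for x
    using F by (simp add: has_vector_derivative_def)
   show "onorm (\<lambda>h. h *\<^sub>R F' x) \<le> L" for x
    by (rule onorm_le) (simp add: mult.commute[of L] mult_left_mono L)
  qed auto
  then show ?thesis by simp
 qed
 have "norm (gconv X \<sigma> F (of_real x) - F x) \<le> \<sigma> * (L * exp (K * X) * J) * exp (- K * \<bar>x\<bar>)"
  if s: "0 < \<sigma>" "\<sigma> \<le> 1" for \<sigma> x
 proof -
  have mF: "F \<in> borel_measurable borel" using cF by (rule borel_measurable_continuous_onI)
  have i1: "integrable lborel (\<lambda>w. std_normal_density w *\<^sub>R F (x - \<sigma> * w))"
  proof (rule Bochner_Integration.integrable_bound[of _ "\<lambda>w. B * std_normal_density w"])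
   show "AE w in lborel. norm (std_normal_density w *\<^sub>R F (x - \<sigma> * w)) \<le> norm (B * std_normal_density w)"
    using B order_trans[OF norm_ge_zero B] by (auto simp: mult.commute[of B] mult_left_mono)
  qed (use mF in auto)
  have i2: "integrable lborel (\<lambda>w. std_normal_density w *\<^sub>R F x)" by auto
  have "gconv X \<sigma> F (of_real x) - F x = (LINT w|lborel. std_normal_density w *\<^sub>R F (x - \<sigma> * w)) - (LINT w|lborel. std_normal_density w *\<^sub>R F x)"
   by (simp add: gconv_real[OF s(1) cF z])
  also have "\<dots> = (LINT w|lborel. std_normal_density w *\<^sub>R (F (x - \<sigma> * w) - F x))"
   using i1 i2 by (simp add: scaleR_diff_right)
  finally have eq: "gconv X \<sigma> F (of_real x) - F x = (LINT w|lborel. std_normal_density w *\<^sub>R (F (x - \<sigma> * w) - F x))" .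
  have "norm (LINT w|lborel. std_normal_density w *\<^sub>R (F (x - \<sigma> * w) - F x)) \<le> (LINT w|lborel. (\<sigma> * L * exp (K * X) * exp (- K * \<bar>x\<bar>)) * (std_normal_density w * (\<bar>w\<bar> * exp (K * \<bar>w\<bar>))))"
  proof (rule Bochner_Integration.integral_norm_bound_integral)
   show "integrable lborel (\<lambda>w. std_normal_density w *\<^sub>R (F (x - \<sigma> * w) - F x))"
    using i1 i2 by (simp add: scaleR_diff_right)
   show "integrable lborel (\<lambda>w. (\<sigma> * L * exp (K * X) * exp (- K * \<bar>x\<bar>)) * (std_normal_density w * (\<bar>w\<bar> * exp (K * \<bar>w\<bar>))))"
    by (intro integrable_mult_right integrable_normal_exp)
   fix w
   have "norm (F (x - \<sigma> * w) - F x) \<le> (\<sigma> * L * exp (K * X) * exp (- K * \<bar>x\<bar>)) * (\<bar>w\<bar> * exp (K * \<bar>w\<bar>))"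
   proof (cases "\<bar>x\<bar> > X + \<bar>w\<bar>")
    case True
    \<comment> \<open>Here \<open>\<sigma> \<le> 1\<close> keeps the displaced argument outside the
      support as well.\<close>
    have "\<bar>\<sigma> * w\<bar> \<le> 1 * \<bar>w\<bar>" unfolding abs_mult using s by (intro mult_right_mono) auto
    then have "\<bar>x - \<sigma> * w\<bar> > X" "\<bar>x\<bar> > X" using True by linarith+
    then show ?thesis using z s L0 by simp
   next
    case False
    have 1: "norm (F (x - \<sigma> * w) - F x) \<le> \<sigma> * L * \<bar>w\<bar>"
     using lip[of "x - \<sigma> * w" x] s by (simp add: abs_mult mult_ac)
    have "K * \<bar>x\<bar> \<le> K * (X + \<bar>w\<bar>)" using False K by (intro mult_left_mono) auto
    then have "1 \<le> exp (K * X + - K * \<bar>x\<bar> + K * \<bar>w\<bar>)" by (simp add: algebra_simps)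
    then have "\<sigma> * L * \<bar>w\<bar> * 1 \<le> \<sigma> * L * \<bar>w\<bar> * exp (K * X + - K * \<bar>x\<bar> + K * \<bar>w\<bar>)"
     by (rule mult_left_mono) (use s L0 in auto)
    with 1 have "norm (F (x - \<sigma> * w) - F x) \<le> \<sigma> * L * \<bar>w\<bar> * exp (K * X + - K * \<bar>x\<bar> + K * \<bar>w\<bar>)" by linarith
    then show ?thesis by (simp only: exp_add mult_ac)
   qed
   then show "norm (std_normal_density w *\<^sub>R (F (x - \<sigma> * w) - F x)) \<le> (\<sigma> * L * exp (K * X) * exp (- K * \<bar>x\<bar>)) * (std_normal_density w * (\<bar>w\<bar> * exp (K * \<bar>w\<bar>)))"
    using mult_left_mono[of _ _ "std_normal_density w"] by (simp add: mult.left_commute[of _ "std_normal_density w"])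
  qed
  also have "\<dots> = (\<sigma> * L * exp (K * X) * exp (- K * \<bar>x\<bar>)) * J" by (simp add: J_def)
  finally show ?thesis unfolding eq by (simp only: mult_ac)
 qed
 moreover have "L * exp (K * X) * J \<ge> 0" using L0 J by simp
 ultimately show ?thesis by blast
qed

lemma C_norm_le_tendsto_zero:
 fixes a :: "nat \<Rightarrow> real"
 assumes "\<And>n. 0 \<le> a n" "\<And>n. a n \<le> M * (1 / real (Suc n))"
 shows "a \<longlonglongrightarrow> 0"
proof (rule tendsto_zero_le)
 show "(\<lambda>n. M * (1 / real (Suc n))) \<longlonglongrightarrow> 0"
  using tendsto_mult_right[OF LIMSEQ_inverse_real_of_nat, of M] by (simp add: inverse_eq_divide)
qed (use assms in auto)

text \<open>The support is compact, hence at positive height, so \<open>f\<close> has compact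
  support in the coordinate \<open>xc\<close>. Gaussian regularisation approximates all derivatives
  in all exponential weights, and \<open>hf_norm_bound\<close> turns this into convergence of
  norms.\<close>

lemma upper_density:
 assumes f: "f \<in> smooth" and S: "supp f \<subseteq> upper"
 obtains \<tau> where "\<And>n. ent (\<tau> n)" "\<And>N. (\<lambda>n::nat. C_norm N (\<lambda>z. he (-1) (\<tau> n) z - f z)) \<longlonglongrightarrow> 0"
proof -
 have "\<exists>\<eta>>0. \<forall>z\<in>supp f. \<eta> \<le> Im (of_circle z)"
 proof (cases "supp f = {}")
  case False
  obtain z0 where "z0 \<in> supp f" "\<And>z. z \<in> supp f \<Longrightarrow> Im (of_circle z0) \<le> Im (of_circle z)"
   using continuous_attains_inf[OF compact_supp False continuous_Im_circle] by blast
  then show ?thesis using S by (intro exI[of _ "Im (of_circle z0)"]) (auto simp: upper_def)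
 qed (auto intro: exI[of _ 1])
 then obtain \<eta> where \<eta>: "\<eta> > 0" "\<And>z. z \<in> supp f \<Longrightarrow> \<eta> \<le> Im (of_circle z)" by blast
 \<comment> \<open>\<open>\<eta> \<le> 1 / cosh x\<close> and
   \<open>cosh x \<ge> \<bar>x\<bar> / 2\<close> confine the support to
   \<open>\<bar>x\<bar> \<le> 2 / \<eta>\<close>; the extra 1 makes every \<open>xch f i\<close>
   vanish at \<open>X\<close> and \<open>- X\<close> themselves.\<close>
 define X where "X = 2 / \<eta> + 1"
 have X: "X \<ge> 0" using \<eta> by (simp add: X_def)
 have fz: "f (zc x) = 0" if "\<bar>x\<bar> > X - 1" for x
 proof (rule ccontr)
  assume "f (zc x) \<noteq> 0"
  then have "\<eta> \<le> 1 / cosh x" using \<eta>(2)[of "zc x"] not_supp_zero[of "zc x" f] by (auto simp: Im_zc)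
  then have "\<eta> * cosh x \<le> 1" by (simp add: le_divide_eq)
  moreover have "\<bar>x\<bar> / 2 \<le> cosh x"
  proof -
   have "exp \<bar>x\<bar> / 2 \<le> cosh \<bar>x\<bar>" unfolding cosh_field_def by simp
   then have "exp \<bar>x\<bar> / 2 \<le> cosh x" by simp
   then show ?thesis using exp_ge_add_one_self[of "\<bar>x\<bar>"] by linarith
  qed
  ultimately have "\<eta> * (\<bar>x\<bar> / 2) \<le> 1" using \<eta>(1) by (meson mult_left_mono order_less_imp_le order_trans)
  moreover have "\<eta> * (\<bar>x\<bar> / 2) > \<eta> * ((2 / \<eta>) / 2)" using that \<eta>(1) by (intro mult_strict_left_mono) (auto simp: X_def)
  ultimately show False using \<eta>(1) by simp
 qed
 have Fz: "xch f i x = 0" if "\<bar>x\<bar> > X - 1" for i x by (rule xch_zero[OF f fz that])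
 have ch: "chain (xch f)" by (rule chain_xch[OF f fz])
 have cont: "continuous_on UNIV (xch f i)" for i
  using xch_derivative[OF f] by (meson continuous_at_imp_continuous_on has_vector_derivative_continuous)
 define \<sigma> where "\<sigma> n = 1 / real (Suc n)" for n :: nat
 have \<sigma>: "\<sigma> n > 0" "\<sigma> n \<le> 1" for n by (auto simp: \<sigma>_def)
 define \<tau> where "\<tau> n = gconv X (\<sigma> n) (xch f 0)" for n
 have ent: "ent (gconv X (\<sigma> n) (xch f i))" for n i
  using xch_bounded[OF f, of i] ent_gconv[OF \<sigma>(1) cont _ X] by blast
 have der: "(gconv X (\<sigma> n) (xch f i) has_field_derivative gconv X (\<sigma> n) (xch f (Suc i)) \<zeta>) (at \<zeta>)" for n i \<zeta>
  by (rule gconv_derivative[OF \<sigma>(1) xch_derivative[OF f] cont]) (use Fz[of X] Fz[of "- X"] X \<eta> in \<open>auto simp: X_def\<close>)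
 define D where "D n i x = gconv X (\<sigma> n) (xch f i) (of_real x) - xch f i x" for n i and x :: real
 have chD: "chain (D n)" for n unfolding chain_def
 proof (intro conjI allI)
  fix i x
  show "(D n i has_vector_derivative D n (Suc i) x) (at x)" unfolding D_def[abs_def]
   by (intro has_vector_derivative_diff has_vector_derivative_real_field der xch_derivative[OF f])
  show "dec (D n i)" unfolding dec_def
  proof
   fix K :: nat
   obtain C where C: "C \<ge> 0" "\<And>\<zeta>. \<bar>Im \<zeta>\<bar> \<le> 0 \<Longrightarrow> norm (gconv X (\<sigma> n) (xch f i) \<zeta>) \<le> C * exp (- real K * \<bar>Re \<zeta>\<bar>)"
    using entD[OF ent[of n i]] by metis
   obtain C' where C': "\<And>x. norm (xch f i x) \<le> C' * exp (- real K * \<bar>x\<bar>)" using ch unfolding chain_def dec_def by blast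
   have "norm (D n i x) \<le> (C + C') * exp (- real K * \<bar>x\<bar>)" for x unfolding D_def distrib_right
    by (intro order_trans[OF norm_triangle_ineq4] add_mono C' order_trans[OF C(2)]) auto
   then show "\<exists>C. \<forall>x. norm (D n i x) \<le> C * exp (- real K * \<bar>x\<bar>)" by blast
  qed
 qed
 have eq: "(\<lambda>z. he (-1) (\<tau> n) z - f z) = hf (-1) (D n 0)" for n
 proof -
  have "f z = hf (-1) (xch f 0) z" for z using hf_xch[of f] S not_supp_zero[of _ f] by (metis subsetD)
  then show ?thesis by (auto simp: fun_eq_iff he_def hf_def D_def \<tau>_def algebra_simps)
 qed
 show ?thesis
 proof (rule that)
  show "ent (\<tau> n)" for n unfolding \<tau>_def by (rule ent)
  fix N
  obtain C where C: "C \<ge> 0" "\<And>F P. chain F \<Longrightarrow> (\<forall>i\<le>N. \<forall>x. norm (F i x) \<le> P * exp (- real (N + nat \<bar>-1\<bar>) * \<bar>x\<bar>)) \<Longrightarrow>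
    C_norm N (hf (-1) (F 0)) \<le> C * P" using hf_norm_bound[of N "-1"] by metis
  have "\<exists>M\<ge>0. \<forall>\<sigma> x. 0 < \<sigma> \<longrightarrow> \<sigma> \<le> 1 \<longrightarrow> norm (gconv X \<sigma> (xch f i) (of_real x) - xch f i x) \<le> \<sigma> * M * exp (- real (N + nat \<bar>-1\<bar>) * \<bar>x\<bar>)" for i
  proof -
   obtain B B' where B: "\<And>x. norm (xch f i x) \<le> B" "\<And>x. norm (xch f (Suc i) x) \<le> B'"
    using xch_bounded[OF f, of i] xch_bounded[OF f, of "Suc i"] by blast
   show ?thesis by (rule gconv_error[OF xch_derivative[OF f] B(2) Fz B(1) _ X]) auto
  qed
  then obtain M where M: "\<And>i. M i \<ge> 0" "\<And>i \<sigma> x. 0 < \<sigma> \<Longrightarrow> \<sigma> \<le> 1 \<Longrightarrow>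
    norm (gconv X \<sigma> (xch f i) (of_real x) - xch f i x) \<le> \<sigma> * M i * exp (- real (N + nat \<bar>-1\<bar>) * \<bar>x\<bar>)" by metis
  define M0 where "M0 = (\<Sum>i\<le>N. M i)"
  have "C_norm N (hf (-1) (D n 0)) \<le> C * (\<sigma> n * M0)" for n
  proof (rule C(2)[OF chD], intro allI impI)
   fix i x assume "i \<le> N"
   then have "M i \<le> M0" unfolding M0_def by (intro member_le_sum) (use M in auto)
   have "norm (D n i x) \<le> \<sigma> n * M i * exp (- real (N + nat \<bar>-1\<bar>) * \<bar>x\<bar>)"
    unfolding D_def by (rule M(2)[OF \<sigma>])
   also have "\<dots> \<le> \<sigma> n * M0 * exp (- real (N + nat \<bar>-1\<bar>) * \<bar>x\<bar>)"
    using \<open>M i \<le> M0\<close> \<sigma>(1)[of n] by (intro mult_right_mono mult_left_mono) auto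
   finally show "norm (D n i x) \<le> \<sigma> n * M0 * exp (- real (N + nat \<bar>-1\<bar>) * \<bar>x\<bar>)" .
  qed
  then show "(\<lambda>n. C_norm N (\<lambda>z. he (-1) (\<tau> n) z - f z)) \<longlonglongrightarrow> 0"
   unfolding eq
   by (intro C_norm_le_tendsto_zero[where M = "C * M0"]) (auto simp: \<sigma>_def mult_ac intro!: C_norm_nonneg smooth_hf chD)
 qed
qed

section \<open>Positive energy and boundary uniqueness\<close>

text \<open>In the coordinate \<open>w = exp (\<i> * \<tau>)\<close> the arc becomes a real
  interval, across which \<open>G\<close> is continued by zero. The pasted function is holomorphic
  and vanishes below the line, hence vanishes; the identity theorem and continuity spread this over
  the closed disc.\<close>

lemma disc_boundary_unique:
 assumes cont: "continuous_on (cball 0 1) G" and hol: "G holomorphic_on ball 0 1"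
  and e: "e > 0" and z: "\<And>t. \<bar>t\<bar> < e \<Longrightarrow> G (cis t) = 0" and w: "cmod w \<le> 1"
 shows "G w = 0"
proof -
 define K where "K \<tau> = (if Im \<tau> \<ge> 0 then G (exp (\<i> * \<tau>)) else 0)" for \<tau>
 let ?B = "ball (0::complex) e"
 have n: "cmod (exp (\<i> * \<tau>)) = exp (- Im \<tau>)" for \<tau> by (simp add: norm_exp_eq_Re)
 have cK: "continuous_on ?B K"
 proof -
  have "continuous_on (?B \<inter> {\<tau>. Im \<tau> \<ge> 0} \<union> ?B \<inter> {\<tau>. Im \<tau> \<le> 0}) (\<lambda>\<tau>. if Im \<tau> \<ge> 0 then G (exp (\<i> * \<tau>)) else 0)"
  proof (rule continuous_on_cases_local)
   show "closedin (top_of_set (?B \<inter> {\<tau>. 0 \<le> Im \<tau>} \<union> ?B \<inter> {\<tau>. Im \<tau> \<le> 0})) (?B \<inter> {\<tau>. 0 \<le> Im \<tau>})"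
    "closedin (top_of_set (?B \<inter> {\<tau>. 0 \<le> Im \<tau>} \<union> ?B \<inter> {\<tau>. Im \<tau> \<le> 0})) (?B \<inter> {\<tau>. Im \<tau> \<le> 0})"
   proof -
    have eq: "?B \<inter> {\<tau>. 0 \<le> Im \<tau>} \<union> ?B \<inter> {\<tau>. Im \<tau> \<le> 0} = ?B" by auto
    show "closedin (top_of_set (?B \<inter> {\<tau>. 0 \<le> Im \<tau>} \<union> ?B \<inter> {\<tau>. Im \<tau> \<le> 0})) (?B \<inter> {\<tau>. 0 \<le> Im \<tau>})"
     "closedin (top_of_set (?B \<inter> {\<tau>. 0 \<le> Im \<tau>} \<union> ?B \<inter> {\<tau>. Im \<tau> \<le> 0})) (?B \<inter> {\<tau>. Im \<tau> \<le> 0})"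
     unfolding eq by (auto simp: closedin_closed_Int closed_halfspace_Im_ge closed_halfspace_Im_le)
   qed
   show "continuous_on (?B \<inter> {\<tau>. 0 \<le> Im \<tau>}) (\<lambda>\<tau>. G (exp (\<i> * \<tau>)))"
    by (intro continuous_on_compose2[OF cont] continuous_intros) (auto simp: n)
   show "G (exp (\<i> * \<tau>)) = 0" if "(\<tau> \<in> ?B \<inter> {\<tau>. 0 \<le> Im \<tau>} \<and> \<not> 0 \<le> Im \<tau>) \<or> (\<tau> \<in> ?B \<inter> {\<tau>. Im \<tau> \<le> 0} \<and> 0 \<le> Im \<tau>)" for \<tau>
   proof -
    have "Im \<tau> = 0" "cmod \<tau> < e" using that by auto
    then have "\<tau> = of_real (Re \<tau>)" by (simp add: complex_eq_iff)
    then have "exp (\<i> * \<tau>) = cis (Re \<tau>)" by (simp add: cis_conv_exp)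
    moreover have "\<bar>Re \<tau>\<bar> < e" using abs_Re_le_cmod[of \<tau>] \<open>cmod \<tau> < e\<close> by linarith
    ultimately show ?thesis using z by simp
   qed
  qed auto
  moreover have "?B \<inter> {\<tau>. Im \<tau> \<ge> 0} \<union> ?B \<inter> {\<tau>. Im \<tau> \<le> 0} = ?B" by auto
  ultimately show ?thesis by (simp add: K_def[abs_def])
 qed
 have "K holomorphic_on ?B"
 proof (rule holomorphic_on_paste_across_line[where d = \<i> and k = 0])
  have "(\<lambda>_. 0) holomorphic_on ?B \<inter> {z. \<i> \<bullet> z < 0}" by simp
  then show "K holomorphic_on ?B \<inter> {z. \<i> \<bullet> z < 0}"
   by (rule holomorphic_transform) (auto simp: K_def)
  have "G \<circ> (\<lambda>\<tau>. exp (\<i> * \<tau>)) holomorphic_on ?B \<inter> {z. 0 < \<i> \<bullet> z}"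
   by (rule holomorphic_on_compose_gen[OF _ hol]) (auto intro!: holomorphic_intros simp: n)
  then show "K holomorphic_on ?B \<inter> {z. 0 < \<i> \<bullet> z}"
   by (rule holomorphic_transform) (auto simp: K_def)
 qed (auto simp: cK)
 moreover have "(\<lambda>_. 0) holomorphic_on ?B" by simp
 moreover have "open (?B \<inter> {\<tau>. Im \<tau> < 0})" by (intro open_Int open_ball open_halfspace_Im_lt)
 moreover have "?B \<inter> {\<tau>. Im \<tau> < 0} \<noteq> {}"
 proof -
  have "- \<i> * of_real (e / 2) \<in> ?B \<inter> {\<tau>. Im \<tau> < 0}" using e by (simp add: norm_mult)
  then show ?thesis by blast
 qed
 ultimately have K0: "K \<tau> = 0" if "\<tau> \<in> ?B" for \<tau>
  using analytic_continuation_open[of "?B \<inter> {\<tau>. Im \<tau> < 0}" ?B K "\<lambda>_. 0"] that by (force simp: K_def)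
 \<comment> \<open>The points \<open>exp (- y)\<close> with \<open>0 < y < e\<close>: images of
   points on the imaginary axis where \<open>K\<close> is already known to vanish.\<close>
 let ?U = "(of_real :: real \<Rightarrow> complex) ` {exp (- e)<..<1}"
 have U0: "G u = 0" if u: "u \<in> ?U" for u
 proof -
  obtain r where r: "u = of_real r" "exp (- e) < r" "r < 1" using u by auto
  have r0: "r > 0" using r(2) exp_gt_zero[of "- e"] by linarith
  define y where "y = - ln r"
  have y: "0 < y" "y < e" using r r0 by (auto simp: y_def ln_less_zero) (metis exp_gt_zero exp_ln ln_less_cancel_iff ln_exp minus_less_iff)
  then have "K (\<i> * of_real y) = 0" by (intro K0) (simp add: norm_mult)
  then have "G (exp (- of_real y)) = 0" using y by (simp add: K_def flip: mult.assoc)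
  moreover have "exp (- of_real y) = u" using r r0 by (simp add: y_def exp_of_real)
  ultimately show ?thesis by simp
 qed
 have Gb: "G u = 0" if "u \<in> ball 0 1" for u
 proof (rule analytic_continuation[OF hol, of ?U "of_real (exp (- e / 2))"])
  show "?U \<subseteq> ball 0 1" by (auto simp: abs_if dest!: less_trans[OF exp_gt_zero[of "- e"]])
  show "of_real (exp (- e / 2)) \<in> ball (0::complex) 1" using e by simp
  have "exp (- e / 2) islimpt {exp (- e)<..<1}" using e by (intro open_imp_islimpt) auto
  then show "of_real (exp (- e / 2)) islimpt ?U"
   using islimpt_isCont_image[of "exp (- e / 2)" "{exp (- e)<..<1}" "of_real :: real \<Rightarrow> complex"]
   by (auto simp: eventually_at_filter)
 qed (use that U0 in auto)
 have "closure (ball (0::complex) 1) = cball 0 1" by simp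
 then show ?thesis using continuous_constant_on_closure[of "ball 0 1" G 0 w] cont Gb w by simp
qed

text \<open>By the maximum principle polynomials that approximate \<open>H\<close> uniformly on the
  circle converge uniformly on the closed disc, so \<open>H\<close> is the boundary value of a
  function holomorphic inside.\<close>

lemma boundary_unique:
 fixes H :: "real \<Rightarrow> complex"
 assumes approx: "\<And>e. e > 0 \<Longrightarrow> \<exists>p. \<forall>t. norm (H t - poly p (cis t)) < e"
  and e: "e > 0" and z: "\<And>t. \<bar>t\<bar> < e \<Longrightarrow> H t = 0"
 shows "H t = 0"
proof -
 have "\<exists>p. \<forall>n t. norm (H t - poly (p n) (cis t)) < 1 / real (Suc n)"
  using approx[of "1 / real (Suc _)"] by (intro choice) simp
 then obtain p where p: "\<And>n t. norm (H t - poly (p n) (cis t)) < 1 / real (Suc n)" by blast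
 have max: "norm (poly (p m) w - poly (p n) w) \<le> 1 / real (Suc m) + 1 / real (Suc n)" if "w \<in> cball 0 1" for m n w
 proof (rule maximum_modulus_frontier[of "\<lambda>w. poly (p m) w - poly (p n) w" "cball 0 1"])
  fix u :: complex assume "u \<in> frontier (cball 0 1)"
  then have "cmod u = 1" by (simp add: frontier_cball)
  then have u: "u = cis (Arg u)" by (metis cis_Arg div_by_1 norm_zero of_real_1 sgn_eq zero_neq_one)
  have "norm (poly (p m) u - poly (p n) u) = norm ((H (Arg u) - poly (p n) (cis (Arg u))) - (H (Arg u) - poly (p m) (cis (Arg u))))"
   using u by simp
  also have "\<dots> \<le> 1 / real (Suc n) + 1 / real (Suc m)"
   by (intro order_trans[OF norm_triangle_ineq4] add_mono less_imp_le p)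
  finally show "norm (poly (p m) u - poly (p n) u) \<le> 1 / real (Suc m) + 1 / real (Suc n)" by simp
 qed (use that in \<open>auto intro!: holomorphic_intros continuous_intros\<close>)
 have "\<exists>G. uniform_limit (cball 0 1) (\<lambda>n. poly (p n)) G sequentially"
 proof -
  have "\<forall>e>0. \<exists>N. \<forall>m n x. N \<le> m \<and> N \<le> n \<and> x \<in> cball 0 1 \<longrightarrow> dist (poly (p m) x) (poly (p n) x) < e"
  proof (intro allI impI)
   fix e :: real assume "e > 0"
   then obtain N where N: "1 / real (Suc N) < e / 2" using nat_approx_posE[of "e / 2"] by auto
   have "dist (poly (p m) x) (poly (p n) x) < e" if "N \<le> m" "N \<le> n" "x \<in> cball 0 1" for m n x
   proof -
    have "1 / real (Suc m) \<le> 1 / real (Suc N)" "1 / real (Suc n) \<le> 1 / real (Suc N)"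
     using that by (auto simp: frac_le)
    then show ?thesis using max[OF that(3), of m n] N unfolding dist_norm by linarith
   qed
   then show "\<exists>N. \<forall>m n x. N \<le> m \<and> N \<le> n \<and> x \<in> cball 0 1 \<longrightarrow> dist (poly (p m) x) (poly (p n) x) < e" by blast
  qed
  then obtain G where "\<forall>e>0. \<exists>N. \<forall>n x. N \<le> n \<and> x \<in> cball 0 1 \<longrightarrow> dist (poly (p n) x) (G x) < e"
   using uniformly_convergent_eq_cauchy[of "\<lambda>x. x \<in> cball 0 1" "\<lambda>n. poly (p n)"] by blast
  then show ?thesis unfolding uniform_limit_sequentially_iff by blast
 qed
 then obtain G where G: "uniform_limit (cball 0 1) (\<lambda>n. poly (p n)) G sequentially" by blast
 have cont: "continuous_on (cball 0 1) G"
  by (rule uniform_limit_theorem[OF _ G]) (auto intro!: always_eventually continuous_intros)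
 have hol: "G holomorphic_on ball 0 1"
 proof -
  have "\<forall>\<^sub>F n in sequentially. continuous_on (cball 0 1) (poly (p n)) \<and> poly (p n) holomorphic_on ball 0 1"
   by (auto intro!: always_eventually holomorphic_intros continuous_intros)
  from holomorphic_uniform_limit[OF this G trivial_limit_sequentially] show ?thesis by blast
 qed
 have GH: "G (cis t) = H t" for t
 proof -
  have "(\<lambda>n. poly (p n) (cis t)) \<longlonglongrightarrow> G (cis t)"
   by (rule tendsto_uniform_limitI[OF G]) simp
  moreover have "(\<lambda>n. H t - poly (p n) (cis t)) \<longlonglongrightarrow> 0"
   by (rule Lim_null_comparison[of _ "\<lambda>n. 1 / real (Suc n)"])
    (use p less_imp_le LIMSEQ_inverse_real_of_nat[unfolded inverse_eq_divide] in \<open>blast intro: always_eventually\<close>)+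
  then have "(\<lambda>n. H t - (H t - poly (p n) (cis t))) \<longlonglongrightarrow> H t - 0" by (intro tendsto_intros)
  then have "(\<lambda>n. poly (p n) (cis t)) \<longlonglongrightarrow> H t" by simp
  ultimately show ?thesis by (rule LIMSEQ_unique)
 qed
 show ?thesis using disc_boundary_unique[OF cont hol e, of "cis t"] z by (simp add: GH)
qed

section \<open>Integrals over the line and shift of the contour\<close>

lemma integrable_exp_bound:
 fixes f :: "real \<Rightarrow> complex"
 assumes "continuous_on UNIV f" "\<And>x. norm (f x) \<le> C * exp (- \<bar>x\<bar>)"
 shows "integrable lborel f"
proof (rule Bochner_Integration.integrable_bound[of lborel "\<lambda>x. C * exp (- \<bar>x\<bar>)" f])
 show "integrable lborel (\<lambda>x. C * exp (- \<bar>x\<bar>))" by (intro integrable_mult_right integrable_exp_abs)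
 show "f \<in> borel_measurable lborel" using borel_measurable_continuous_onI[OF assms(1)] by simp
 show "AE x in lborel. norm (f x) \<le> norm (C * exp (- \<bar>x\<bar>))"
  using assms(2) by (intro AE_I2) (metis abs_ge_self order_trans real_norm_def)
qed

lemma integral_truncate:
 fixes f :: "real \<Rightarrow> complex"
 assumes "continuous_on UNIV f" "\<And>x. norm (f x) \<le> C * exp (- \<bar>x\<bar>)"
 shows "(\<lambda>n. integral {- real n..real n} f) \<longlonglongrightarrow> (LINT x|lborel. f x)"
proof -
 have "(\<lambda>n. LINT x|lborel. indicator {- real n..real n} x *\<^sub>R f x) \<longlonglongrightarrow> (LINT x|lborel. f x)"
 proof (rule integral_dominated_convergence)
  show "f \<in> borel_measurable lborel" using borel_measurable_continuous_onI[OF assms(1)] by simp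
  then show "(\<lambda>x. indicator {- real n..real n} x *\<^sub>R f x) \<in> borel_measurable lborel" for n by auto
  show "integrable lborel (\<lambda>x. C * exp (- \<bar>x\<bar>))" by (intro integrable_mult_right integrable_exp_abs)
  show "AE x in lborel. (\<lambda>n. indicator {- real n..real n} x *\<^sub>R f x) \<longlonglongrightarrow> f x"
  proof (rule AE_I2)
   fix x :: real
   have "\<forall>\<^sub>F n in sequentially. indicator {- real n..real n} x *\<^sub>R f x = f x"
    using eventually_ge_at_top[of "nat \<lceil>\<bar>x\<bar>\<rceil>"]
    by eventually_elim (auto simp: indicator_def)
   then show "(\<lambda>n. indicator {- real n..real n} x *\<^sub>R f x) \<longlonglongrightarrow> f x" by (rule tendsto_eventually)
  qed
  have "0 \<le> C * exp (- \<bar>x\<bar>)" for x by (rule order_trans[OF norm_ge_zero assms(2)])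
  then show "AE x in lborel. norm (indicator {- real n..real n} x *\<^sub>R f x) \<le> C * exp (- \<bar>x\<bar>)" for n
   using assms(2) by (intro AE_I2) (auto simp: indicator_def)
 qed
 moreover have "(LINT x|lborel. indicator {- real n..real n} x *\<^sub>R f x) = integral {- real n..real n} f" for n
  using set_borel_integral_eq_integral(2)[OF borel_integrable_atLeastAtMost'[OF continuous_on_subset[OF assms(1)]], of "- real n" "real n"]
  by (simp add: set_lebesgue_integral_def)
 ultimately show ?thesis by simp
qed

text \<open>The truncated integral \<open>I v\<close> at height \<open>v\<close> is differentiated
  in \<open>v\<close>: the derivative is \<open>\<i>\<close> times the difference of the values at
  the two ends, which are exponentially small. The margin 1 of the open strip allows differentiation
  on its edges.\<close>

lemma contour_shift:
 assumes hol: "H holomorphic_on {\<zeta>. -1 < Im \<zeta> \<and> Im \<zeta> < pi + 1}"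
  and b: "\<And>\<zeta>. 0 \<le> Im \<zeta> \<Longrightarrow> Im \<zeta> \<le> pi \<Longrightarrow> norm (H \<zeta>) \<le> C * exp (- \<bar>Re \<zeta>\<bar>)"
 shows "(LINT x|lborel. H (of_real x)) = (LINT x|lborel. H (of_real x + \<i> * of_real pi))"
proof -
 let ?S = "{\<zeta>. -1 < Im \<zeta> \<and> Im \<zeta> < pi + 1}"
 have op: "open ?S" by (intro open_Collect_conj open_halfspace_Im_lt open_halfspace_Im_gt)
 have cH: "continuous_on ?S H" using hol by (rule holomorphic_on_imp_continuous_on)
 have cH': "continuous_on ?S (deriv H)" by (rule holomorphic_on_imp_continuous_on[OF holomorphic_deriv[OF hol op]])
 have d: "(H has_field_derivative deriv H \<zeta>) (at \<zeta>)" if "\<zeta> \<in> ?S" for \<zeta>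
  by (rule holomorphic_derivI[OF hol op that])
 have pis: "- 1 < pi" "0 < pi + 1" using pi_gt_zero by linarith+
 have diff: "norm (integral {- real n..real n} (\<lambda>x. H (of_real x + \<i> * of_real pi)) - integral {- real n..real n} (\<lambda>x. H (of_real x)))
   \<le> 2 * C * exp (- real n) * pi" for n
 proof -
  define I where "I v = integral (cbox (- real n) (real n)) (\<lambda>x. H (of_real x + \<i> * of_real v))" for v
  have inS: "of_real x + \<i> * of_real v \<in> ?S" if "v \<in> {0..pi}" for x v :: real using that by auto
  have "(I has_vector_derivative integral (cbox (- real n) (real n)) (\<lambda>x. \<i> * deriv H (of_real x + \<i> * of_real v))) (at v within {0..pi})"
   if v: "v \<in> {0..pi}" for v unfolding I_def[abs_def]
  proof (rule leibniz_rule_vector_derivative)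
   fix v x assume v: "v \<in> {0..pi}"
   have "((\<lambda>w. H (of_real x + \<i> * w)) has_field_derivative deriv H (of_real x + \<i> * of_real v) * \<i>) (at (of_real v))"
    by (rule DERIV_chain2[of H _ "\<lambda>w. of_real x + \<i> * w", OF d[OF inS[OF v, of x]]]) (auto intro!: derivative_eq_intros)
   from has_vector_derivative_real_field[OF this]
   show "((\<lambda>v. H (of_real x + \<i> * of_real v)) has_vector_derivative \<i> * deriv H (of_real x + \<i> * of_real v)) (at v within {0..pi})"
    by (simp add: mult.commute has_vector_derivative_at_within)
  next
   fix v assume v: "v \<in> {0..pi}"
   show "(\<lambda>x. H (of_real x + \<i> * of_real v)) integrable_on cbox (- real n) (real n)"
    by (intro integrable_continuous continuous_on_compose2[OF cH] continuous_intros) (use inS[OF v] in auto)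
  next
   show "continuous_on ({0..pi} \<times> cbox (- real n) (real n)) (\<lambda>(v, x). \<i> * deriv H (of_real x + \<i> * of_real v))"
    unfolding case_prod_unfold by (intro continuous_intros continuous_on_compose2[OF cH']) auto
  qed (use v in auto)
  moreover have "integral (cbox (- real n) (real n)) (\<lambda>x. \<i> * deriv H (of_real x + \<i> * of_real v)) =
    \<i> * (H (of_real (real n) + \<i> * of_real v) - H (of_real (- real n) + \<i> * of_real v))" if v: "v \<in> {0..pi}" for v
  proof -
   have "((\<lambda>x. deriv H (of_real x + \<i> * of_real v)) has_integral
     (H (of_real (real n) + \<i> * of_real v) - H (of_real (- real n) + \<i> * of_real v))) {- real n..real n}"
   proof (rule fundamental_theorem_of_calculus)
    fix x
    have "((\<lambda>w. H (w + \<i> * of_real v)) has_field_derivative deriv H (of_real x + \<i> * of_real v) * 1) (at (of_real x))"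
     by (rule DERIV_chain2[of H _ "\<lambda>w. w + \<i> * of_real v", OF d[OF inS[OF v, of x]]]) (auto intro!: derivative_eq_intros)
    from has_vector_derivative_real_field[OF this]
    show "((\<lambda>x. H (of_real x + \<i> * of_real v)) has_vector_derivative deriv H (of_real x + \<i> * of_real v)) (at x within {- real n..real n})"
     by (simp add: has_vector_derivative_at_within)
   qed simp
   then show ?thesis by (simp add: integral_unique cbox_interval)
  qed
  ultimately have D: "(I has_derivative (\<lambda>h. h *\<^sub>R (\<i> * (H (of_real (real n) + \<i> * of_real v) - H (of_real (- real n) + \<i> * of_real v))))) (at v within {0..pi})"
   if "v \<in> {0..pi}" for v using that unfolding has_vector_derivative_def by metis
  have "norm (I pi - I 0) \<le> (2 * C * exp (- real n)) * norm (pi - 0)"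
  proof (rule differentiable_bound[OF _ D])
   fix v assume v: "v \<in> {0..pi}"
   have "norm (\<i> * (H (of_real (real n) + \<i> * of_real v) - H (of_real (- real n) + \<i> * of_real v))) \<le> C * exp (- real n) + C * exp (- real n)"
    unfolding norm_mult norm_ii mult_1
    by (intro order_trans[OF norm_triangle_ineq4] add_mono order_trans[OF b]) (use v in auto)
   then show "onorm (\<lambda>h. h *\<^sub>R (\<i> * (H (of_real (real n) + \<i> * of_real v) - H (of_real (- real n) + \<i> * of_real v)))) \<le> 2 * C * exp (- real n)"
    by (intro onorm_le) (simp add: mult.commute[of _ "\<bar>_\<bar>"] mult_left_mono)
  qed auto
  then show ?thesis by (simp add: I_def cbox_interval)
 qed
 let ?f = "\<lambda>x::real. H (of_real x)" and ?g = "\<lambda>x::real. H (of_real x + \<i> * of_real pi)"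
 have f: "(\<lambda>n. integral {- real n..real n} ?f) \<longlonglongrightarrow> (LINT x|lborel. ?f x)"
  by (intro integral_truncate[where C = C] continuous_on_compose2[OF cH] continuous_intros)
   (auto intro!: order_trans[OF b] simp: pis)
 have g: "(\<lambda>n. integral {- real n..real n} ?g) \<longlonglongrightarrow> (LINT x|lborel. ?g x)"
  by (intro integral_truncate[where C = C] continuous_on_compose2[OF cH] continuous_intros)
   (auto intro!: order_trans[OF b] simp: pis)
 have e: "(\<lambda>n. exp (- real n)) \<longlonglongrightarrow> 0"
  by (intro filterlim_compose[OF exp_at_bot] filterlim_compose[OF filterlim_uminus_at_bot_at_top] filterlim_real_sequentially)
 have "(\<lambda>n. integral {- real n..real n} ?g - integral {- real n..real n} ?f) \<longlonglongrightarrow> 0"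
 proof (rule Lim_null_comparison)
  show "(\<lambda>n. 2 * C * exp (- real n) * pi) \<longlonglongrightarrow> 0" using tendsto_mult[OF tendsto_mult[OF tendsto_const[of "2 * C"] e] tendsto_const[of pi]] by simp
 qed (use diff in auto)
 then have "(LINT x|lborel. ?g x) - (LINT x|lborel. ?f x) = 0" using LIMSEQ_unique[OF tendsto_diff[OF g f]] by blast
 then show ?thesis by simp
qed

section \<open>Multilinear estimates for products of fields\<close>

text \<open>Unlike \<open>apply_fields\<close>, which is indexed by positions, lists of pairs of a
  field and a test function allow structural induction.\<close>

definition opl :: "('v distribution \<times> (circle \<Rightarrow> complex)) list \<Rightarrow> 'v \<Rightarrow> 'v"
 where "opl xs v = foldr (\<lambda>(\<phi>, f). \<phi> f) xs v"

lemma opl_Nil [simp]: "opl [] v = v" and opl_Cons [simp]: "opl ((\<phi>, f) # xs) v = \<phi> f (opl xs v)"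
 by (simp_all add: opl_def)

lemma opl_append: "opl (xs @ ys) v = opl xs (opl ys v)"
 by (simp add: opl_def)

lemma apply_fields_opl: "apply_fields \<phi>s f v = opl (zip \<phi>s (map f [0..<length \<phi>s])) v"
proof (induction \<phi>s arbitrary: f)
 case Nil
 then show ?case by (simp add: apply_fields_def)
next
 case (Cons \<phi> \<phi>s)
 have "apply_fields (\<phi> # \<phi>s) f v = \<phi> (f 0) (apply_fields \<phi>s (f \<circ> Suc) v)"
  unfolding apply_fields_def length_Cons upt_conv_Cons[OF zero_less_Suc] foldr_Cons
  by (simp add: map_Suc_upt[symmetric] foldr_map o_def del: upt_Suc)
 also have "apply_fields \<phi>s (f \<circ> Suc) v = opl (zip \<phi>s (map (f \<circ> Suc) [0..<length \<phi>s])) v" by (rule Cons.IH)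
 also have "\<phi> (f 0) \<dots> = opl (zip (\<phi> # \<phi>s) (map f [0..<length (\<phi> # \<phi>s)])) v"
  unfolding length_Cons upt_conv_Cons[OF zero_less_Suc] by (simp add: map_Suc_upt[symmetric] del: upt_Suc)
 finally show ?case .
qed

text \<open>The norms increase with \<open>N\<close>, so a finite intersection of generating balls
  contains a single ball around each of its points.\<close>

lemma smooth_topology_ball:
 assumes "openin smooth_topology W" "f \<in> W"
 shows "\<exists>N e. e > 0 \<and> {g \<in> smooth. C_norm N (\<lambda>z. g z - f z) < e} \<subseteq> W"
proof -
 let ?S = "{{g \<in> smooth. C_norm N (\<lambda>z. g z - f z) < e} |f N e. f \<in> smooth \<and> e > 0}"
 have fs: "f \<in> smooth" using openin_subset[OF assms(1)] assms(2) by auto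
 have "generate_topology_on ?S W" using assms(1) by (simp add: smooth_topology_def openin_topology_generated_by)
 then show ?thesis using assms(2)
 proof (induction rule: generate_topology_on.induct)
  case (Int a b)
  then obtain N e N' e' where *: "e > 0" "{g \<in> smooth. C_norm N (\<lambda>z. g z - f z) < e} \<subseteq> a"
   "e' > 0" "{g \<in> smooth. C_norm N' (\<lambda>z. g z - f z) < e'} \<subseteq> b" by auto
  have "{g \<in> smooth. C_norm (max N N') (\<lambda>z. g z - f z) < min e e'} \<subseteq> a \<inter> b"
  proof
   fix g assume g: "g \<in> {g \<in> smooth. C_norm (max N N') (\<lambda>z. g z - f z) < min e e'}"
   then have "C_norm N (\<lambda>z. g z - f z) \<le> C_norm (max N N') (\<lambda>z. g z - f z)"
    "C_norm N' (\<lambda>z. g z - f z) \<le> C_norm (max N N') (\<lambda>z. g z - f z)"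
    using fs by (auto intro!: C_norm_mono smooth_diff)
   then show "g \<in> a \<inter> b" using * g by auto
  qed
  then show ?case using * by (intro exI[of _ "max N N'"] exI[of _ "min e e'"]) auto
 next
  case (UN K)
  then obtain k where "k \<in> K" "f \<in> k" by blast
  with UN.IH show ?case by (meson Union_upper order_trans)
 next
  case (Basis b)
  then obtain h N e where b: "b = {g \<in> smooth. C_norm N (\<lambda>z. g z - h z) < e}" "h \<in> smooth" "e > 0" by auto
  have "{g \<in> smooth. C_norm N (\<lambda>z. g z - f z) < e - C_norm N (\<lambda>z. f z - h z)} \<subseteq> b"
  proof
   fix g assume g: "g \<in> {g \<in> smooth. C_norm N (\<lambda>z. g z - f z) < e - C_norm N (\<lambda>z. f z - h z)}"
   then have "C_norm N (\<lambda>z. (g z - f z) + (f z - h z)) \<le> C_norm N (\<lambda>z. g z - f z) + C_norm N (\<lambda>z. f z - h z)"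
    using fs b by (intro C_norm_add smooth_diff) auto
   then show "g \<in> b" using g b by auto
  qed
  then show ?case using Basis b by (intro exI[of _ N] exI[of _ "e - C_norm N (\<lambda>z. f z - h z)"]) auto
 qed auto
qed

abbreviation C_prod :: "nat \<Rightarrow> (circle \<Rightarrow> complex) list \<Rightarrow> real"
 where "C_prod N fs \<equiv> prod_list (map (C_norm N) fs)"

lemma prod_list_nonneg: "(\<And>x. x \<in> set xs \<Longrightarrow> 0 \<le> (f x :: real)) \<Longrightarrow> 0 \<le> prod_list (map f xs)"
 by (induction xs) auto

lemma C_norm_list_nonneg: "set fs \<subseteq> smooth \<Longrightarrow> 0 \<le> C_prod N fs"
 by (intro prod_list_nonneg C_norm_nonneg) auto

lemma C_norm_list_mono: "set fs \<subseteq> smooth \<Longrightarrow> M \<le> N \<Longrightarrow> C_prod M fs \<le> C_prod N fs"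
 by (induction fs) (auto intro!: mult_mono C_norm_mono C_norm_list_nonneg C_norm_nonneg)

lemma (in vector_space) linear_iff_fun:
 "Vector_Spaces.linear scale scale h \<longleftrightarrow> (\<forall>u v. h (u + v) = h u + h v) \<and> (\<forall>c v. h (scale c v) = scale c (h v))"
 by (simp add: Vector_Spaces.linear_iff vector_space_axioms)

lemma (in vector_space) linear_iff_functional:
 fixes h :: "'b \<Rightarrow> 'a"
 shows "Vector_Spaces.linear scale (*) h \<longleftrightarrow> (\<forall>u v. h (u + v) = h u + h v) \<and> (\<forall>c v. h (scale c v) = c * h v)"
 unfolding Vector_Spaces.linear_iff using vector_space_axioms
 by (auto simp: vector_space_def distrib_left distrib_right mult.assoc)

section \<open>Fields, vacuum vectors and bounded functionals\<close>

context wightman_cft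
begin

abbreviation \<T> :: "'v topology" where "\<T> \<equiv> strong_topology s F"
abbreviation \<P> :: "circle set \<Rightarrow> ('v \<Rightarrow> 'v) set" where "\<P> \<equiv> local_algebra s F"
abbreviation \<C> :: "('v \<Rightarrow> 'v) set" where "\<C> \<equiv> continuous_endos s \<T>"

lemma field_add: "\<phi> \<in> F \<Longrightarrow> f \<in> smooth \<Longrightarrow> \<phi> f (u + v) = \<phi> f u + \<phi> f v"
 and field_scale: "\<phi> \<in> F \<Longrightarrow> f \<in> smooth \<Longrightarrow> \<phi> f (s c v) = s c (\<phi> f v)"
 and field_linear: "\<phi> \<in> F \<Longrightarrow> f \<in> smooth \<Longrightarrow> Vector_Spaces.linear s s (\<phi> f)"
 and field_fadd: "\<phi> \<in> F \<Longrightarrow> f \<in> smooth \<Longrightarrow> g \<in> smooth \<Longrightarrow> \<phi> (\<lambda>z. f z + g z) v = \<phi> f v + \<phi> g v"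
 and field_fscale: "\<phi> \<in> F \<Longrightarrow> f \<in> smooth \<Longrightarrow> \<phi> (\<lambda>z. c * f z) v = s c (\<phi> f v)"
 using distributions[of \<phi>] by (simp_all add: op_distribution_def linear_iff_fun)

lemma field_fdiff: "\<phi> \<in> F \<Longrightarrow> f \<in> smooth \<Longrightarrow> g \<in> smooth \<Longrightarrow> \<phi> (\<lambda>z. f z - g z) v = \<phi> f v - \<phi> g v"
 using field_fadd[of \<phi> f "\<lambda>z. (-1) * g z" v] field_fscale[of \<phi> g "-1" v] smooth_cmult[of g "-1"] by simp

lemma field_diff: "\<phi> \<in> F \<Longrightarrow> f \<in> smooth \<Longrightarrow> \<phi> f (u - v) = \<phi> f u - \<phi> f v"
 using field_add[of \<phi> f "u - v" v] by (simp add: algebra_simps)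

lemma field_zero [simp]: "\<phi> \<in> F \<Longrightarrow> f \<in> smooth \<Longrightarrow> \<phi> f 0 = 0"
 using field_diff[of \<phi> f 0 0] by simp

lemma field_fzero: "\<phi> \<in> F \<Longrightarrow> \<phi> (\<lambda>z. 0) v = 0"
 using field_fscale[of \<phi> "\<lambda>z. 0" 0 v] by simp

lemma field_fsum:
 "finite A \<Longrightarrow> \<phi> \<in> F \<Longrightarrow> (\<And>i. i \<in> A \<Longrightarrow> f i \<in> smooth) \<Longrightarrow> \<phi> (\<lambda>z. \<Sum>i\<in>A. f i z) v = (\<Sum>i\<in>A. \<phi> (f i) v)"
proof (induction A rule: finite_induct)
 case (insert x A)
 then have "\<phi> (\<lambda>z. f x z + (\<Sum>i\<in>A. f i z)) v = \<phi> (f x) v + \<phi> (\<lambda>z. \<Sum>i\<in>A. f i z) v"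
  by (intro field_fadd smooth_sum) auto
 then show ?case using insert by simp
qed (simp add: field_fzero)

definition FS :: "('v distribution \<times> (circle \<Rightarrow> complex)) set"
 where "FS = F \<times> smooth"

lemma opl_scale: "set xs \<subseteq> FS \<Longrightarrow> opl xs (s c v) = s c (opl xs v)"
 by (induction xs) (auto simp: FS_def field_scale)

lemma set_zip_FS: "set \<phi>s \<subseteq> F \<Longrightarrow> set fs \<subseteq> smooth \<Longrightarrow> set (zip \<phi>s fs) \<subseteq> FS"
 by (auto simp: FS_def dest: set_zip_leftD set_zip_rightD)

lemma FS_unzip:
 assumes "set xs \<subseteq> FS" obtains \<phi>s fs where "xs = zip \<phi>s fs" "length fs = length \<phi>s" "set \<phi>s \<subseteq> F" "set fs \<subseteq> smooth"
 using assms by (intro that[of "map fst xs" "map snd xs"]) (auto simp: FS_def zip_map_fst_snd)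

text \<open>Cyclicity of the vacuum as an induction rule, the form in which it is used from here
  on.\<close>

lemma D_induct [case_names add scale opl]:
 assumes "\<And>u v. P u \<Longrightarrow> P v \<Longrightarrow> P (u + v)" "\<And>c v. P v \<Longrightarrow> P (s c v)" "\<And>xs. set xs \<subseteq> FS \<Longrightarrow> P (opl xs \<Omega>)"
 shows "P v"
proof -
 have "v \<in> span {apply_fields \<phi>s f \<Omega> |\<phi>s f. set \<phi>s \<subseteq> F \<and> (\<forall>i<length \<phi>s. f i \<in> smooth)}"
  using vacuum_cyclic by simp
 then show ?thesis
 proof (induction rule: span_induct_alt)
  case base
  have "P (s 0 (opl [] \<Omega>))" by (intro assms(2) assms(3)) simp
  then show ?case by simp
 next
  case (step c x y)
  then obtain \<phi>s f where "x = apply_fields \<phi>s f \<Omega>" "set \<phi>s \<subseteq> F" "\<forall>i<length \<phi>s. f i \<in> smooth" by blast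
  then have "P x" unfolding apply_fields_opl by (auto intro!: assms(3) subsetD[OF set_zip_FS])
  then show ?case using step by (intro assms)
 qed
qed

definition lin :: "('v \<Rightarrow> complex) \<Rightarrow> bool"
 where "lin l \<longleftrightarrow> (\<forall>u v. l (u + v) = l u + l v) \<and> (\<forall>c v. l (s c v) = c * l v)"

text \<open>The functionals in which all limits are taken. Bounds on products applied to
  \<open>\<Omega>\<close> suffice because such vectors span, and they survive composition with a
  field (\<open>Lf_field\<close>) and integration over an orbit (\<open>Lf_smear\<close>).\<close>

definition Lf :: "('v \<Rightarrow> complex) \<Rightarrow> bool"
 where "Lf l \<longleftrightarrow> lin l \<and> (\<forall>\<phi>s. set \<phi>s \<subseteq> F \<longrightarrow> (\<exists>C\<ge>0. \<exists>N. \<forall>fs. length fs = length \<phi>s \<longrightarrow> set fs \<subseteq> smooth \<longrightarrow>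
   norm (l (opl (zip \<phi>s fs) \<Omega>)) \<le> C * C_prod N fs))"

lemma lin_add: "lin l \<Longrightarrow> l (u + v) = l u + l v" and lin_scale: "lin l \<Longrightarrow> l (s c v) = c * l v"
 by (simp_all add: lin_def)

lemma lin_diff: "lin l \<Longrightarrow> l (u - v) = l u - l v"
 using lin_add[of l "u - v" v] by (simp add: algebra_simps)

lemma lin_zero: "lin l \<Longrightarrow> l 0 = 0"
 using lin_diff[of l 0 0] by simp

lemma lin_sum: "lin l \<Longrightarrow> l (\<Sum>i\<in>A. f i) = (\<Sum>i\<in>A. l (f i))"
 by (induction A rule: infinite_finite_induct) (auto simp: lin_zero lin_add)

lemma Lf_lin: "Lf l \<Longrightarrow> lin l" by (simp add: Lf_def)

lemma LfD:
 assumes "Lf l" "set \<phi>s \<subseteq> F"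
 obtains C N where "C \<ge> 0" "\<And>fs. length fs = length \<phi>s \<Longrightarrow> set fs \<subseteq> smooth \<Longrightarrow>
   norm (l (opl (zip \<phi>s fs) \<Omega>)) \<le> C * C_prod N fs" using assms unfolding Lf_def by blast

lemma lin_eq_zero: "lin l \<Longrightarrow> (\<And>xs. set xs \<subseteq> FS \<Longrightarrow> l (opl xs \<Omega>) = 0) \<Longrightarrow> l v = 0"
 by (rule D_induct[of "\<lambda>v. l v = 0"]) (auto simp: lin_add lin_scale)

lemma Lf_field:
 assumes l: "Lf l" and \<phi>: "\<phi> \<in> F" and f: "f \<in> smooth" shows "Lf (\<lambda>v. l (\<phi> f v))"
 unfolding Lf_def
proof (intro conjI allI impI)
 show "lin (\<lambda>v. l (\<phi> f v))" using Lf_lin[OF l] \<phi> f by (simp add: lin_def field_add field_scale)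
 fix \<phi>s assume "set \<phi>s \<subseteq> F"
 then have "set (\<phi> # \<phi>s) \<subseteq> F" using \<phi> by simp
 from LfD[OF l this] obtain C N where C: "C \<ge> 0" "\<And>fs. length fs = length (\<phi> # \<phi>s) \<Longrightarrow> set fs \<subseteq> smooth \<Longrightarrow>
   norm (l (opl (zip (\<phi> # \<phi>s) fs) \<Omega>)) \<le> C * C_prod N fs" by blast
 have "norm (l (\<phi> f (opl (zip \<phi>s fs) \<Omega>))) \<le> (C * C_norm N f) * C_prod N fs"
  if "length fs = length \<phi>s" "set fs \<subseteq> smooth" for fs
  using C(2)[of "f # fs"] that f by (simp add: mult.assoc)
 then show "\<exists>C\<ge>0. \<exists>N. \<forall>fs. length fs = length \<phi>s \<longrightarrow> set fs \<subseteq> smooth \<longrightarrow>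
   norm (l (\<phi> f (opl (zip \<phi>s fs) \<Omega>))) \<le> C * C_prod N fs"
  using C(1) C_norm_nonneg[OF f] by (intro exI[of _ "C * C_norm N f"] exI[of _ N]) auto
qed

lemma opl_scaled:
 "length fs = length \<phi>s \<Longrightarrow> set \<phi>s \<subseteq> F \<Longrightarrow> set fs \<subseteq> smooth \<Longrightarrow>
  opl (zip \<phi>s (map (\<lambda>f z. c f * f z) fs)) v = s (prod_list (map c fs)) (opl (zip \<phi>s fs) v)"
proof (induction fs arbitrary: \<phi>s)
 case (Cons f fs)
 then obtain \<phi> \<psi>s where \<phi>: "\<phi>s = \<phi> # \<psi>s" by (cases \<phi>s) auto
 then show ?case using Cons by (simp add: field_fscale field_scale set_zip_FS opl_scale)
qed simp

lemma opl_zero_factor: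
 "length fs = length \<phi>s \<Longrightarrow> set \<phi>s \<subseteq> F \<Longrightarrow> set fs \<subseteq> smooth \<Longrightarrow> (\<lambda>z. 0) \<in> set fs \<Longrightarrow> opl (zip \<phi>s fs) v = 0"
proof (induction fs arbitrary: \<phi>s)
 case (Cons f fs)
 then obtain \<phi> \<psi>s where \<phi>: "\<phi>s = \<phi> # \<psi>s" by (cases \<phi>s) auto
 then show ?case using Cons by (auto simp: field_fzero)
qed simp

text \<open>Boundedness by a product of norms, from boundedness near the zero tuple by rescaling.\<close>

lemma Lf_neighbourhood:
 assumes lin: "lin l" and W: "openin \<T> W" "0 \<in> W" "\<And>v. v \<in> W \<Longrightarrow> norm (l v) \<le> 1"
 shows "Lf l"
 unfolding Lf_def
proof (intro conjI allI impI lin)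
 fix \<phi>s assume \<phi>s: "set \<phi>s \<subseteq> F"
 let ?n = "length \<phi>s"
 show "\<exists>C\<ge>0. \<exists>N. \<forall>fs. length fs = ?n \<longrightarrow> set fs \<subseteq> smooth \<longrightarrow>
   norm (l (opl (zip \<phi>s fs) \<Omega>)) \<le> C * C_prod N fs"
 proof (cases "?n = 0")
  \<comment> \<open>Without slots there is no maximum of orders to take; the bound is the value at
    \<open>\<Omega>\<close>.\<close>
  case True
  then show ?thesis by (intro exI[of _ "norm (l \<Omega>)"]) auto
 next
  case False
  define z where "z = (\<lambda>i\<in>{..<?n}. (\<lambda>z. 0) :: circle \<Rightarrow> complex)"
  have "continuous_map (tuple_topology ?n) \<T> (\<lambda>f. apply_fields \<phi>s f \<Omega>)"
   using strong_topology_finest(2)[of F s] \<phi>s by (simp add: fields_continuous_def)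
  then have op: "openin (tuple_topology ?n) {f \<in> topspace (tuple_topology ?n). apply_fields \<phi>s f \<Omega> \<in> W}"
   using W(1) by (rule openin_continuous_map_preimage)
  have az: "apply_fields \<phi>s z \<Omega> = 0" unfolding apply_fields_opl using False \<phi>s
   by (intro opl_zero_factor) (auto simp: z_def image_iff intro!: bexI[of _ 0])
  have "z \<in> {f \<in> topspace (tuple_topology ?n). apply_fields \<phi>s f \<Omega> \<in> W}"
   using az W(2) by (auto simp: z_def)
  from product_topology_open_contains_basis[OF op this] obtain X where X: "z \<in> PiE {..<?n} X" "\<And>i. openin smooth_topology (X i)" "PiE {..<?n} X \<subseteq> {f \<in> topspace (tuple_topology ?n). apply_fields \<phi>s f \<Omega> \<in> W}"
   by (elim exE conjE) blast
  have *: "\<forall>i\<in>{..<?n}. \<exists>N e. (e::real) > 0 \<and> {g \<in> smooth. C_norm N g < e} \<subseteq> X i"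
  proof
   fix i assume i: "i \<in> {..<?n}"
   then have "(\<lambda>z. 0) \<in> X i" using X(1) by (auto simp: z_def PiE_iff)
   from smooth_topology_ball[OF X(2) this] show "\<exists>N e. e > 0 \<and> {g \<in> smooth. C_norm N g < e} \<subseteq> X i" by simp
  qed
  from bchoice[OF *] obtain Ni where "\<forall>i\<in>{..<?n}. \<exists>e>0. {g \<in> smooth. C_norm (Ni i) g < e} \<subseteq> X i" by blast
  then have "\<forall>i\<in>{..<?n}. \<exists>e. e > 0 \<and> {g \<in> smooth. C_norm (Ni i) g < e} \<subseteq> X i" by blast
  from bchoice[OF this] obtain ei where Ne: "\<And>i. i < ?n \<Longrightarrow> ei i > 0" "\<And>i. i < ?n \<Longrightarrow> {g \<in> smooth. C_norm (Ni i) g < ei i} \<subseteq> X i"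
   by auto
  define N where "N = Max (Ni ` {..<?n})"
  define e where "e = Min (ei ` {..<?n})"
  have e: "e > 0" unfolding e_def by (subst Min_gr_iff) (use False Ne(1) in auto)
  have NX: "g \<in> X i" if "i < ?n" "g \<in> smooth" "C_norm N g < e" for i g
  proof -
   have "Ni i \<le> N" "e \<le> ei i" using that(1) by (auto simp: N_def e_def)
   then have "C_norm (Ni i) g < ei i" using C_norm_mono[OF that(2), of "Ni i" N] that(3) by linarith
   then show ?thesis using Ne(2)[OF that(1)] that(2) by blast
  qed
  have "norm (l (opl (zip \<phi>s fs) \<Omega>)) \<le> (2 / e) ^ ?n * C_prod N fs"
   if fs: "length fs = ?n" "set fs \<subseteq> smooth" for fs
  proof (cases "\<exists>f\<in>set fs. C_norm N f = 0")
   case True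
   then obtain f where "f \<in> set fs" "C_norm N f = 0" by blast
   then have "(\<lambda>z. 0) = f" using smooth_eq_zero[of f N] subsetD[OF fs(2)] by (auto simp: fun_eq_iff)
   then have "opl (zip \<phi>s fs) \<Omega> = 0" using fs \<phi>s \<open>f \<in> set fs\<close> by (intro opl_zero_factor) auto
   then show ?thesis using lin_zero[OF lin] e C_norm_list_nonneg[OF fs(2)] by simp
  next
   case nz: False
   have pos: "C_norm N f > 0" if "f \<in> set fs" for f
    using nz that fs(2) C_norm_nonneg[of f N] by (metis order_le_less subsetD)
   \<comment> \<open>Each function is rescaled to norm \<open>e / 2\<close>, which places the tuple
     in the neighbourhood. Homogeneity in every slot then turns the bound 1 into a product of
     norms.\<close>
   define c where "c f = complex_of_real (e / 2 / C_norm N f)" for f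
   define gs where "gs = map (\<lambda>f z. c f * f z) fs"
   define g where "g = (\<lambda>i\<in>{..<?n}. gs ! i)"
   have gs: "set gs \<subseteq> smooth" "length gs = ?n" using fs by (auto simp: gs_def intro!: smooth_cmult)
   have "g \<in> PiE {..<?n} X"
   proof (rule PiE_I)
    fix i assume "i \<in> {..<?n}"
    then have i: "i < ?n" by simp
    have fi: "fs ! i \<in> set fs" using i fs(1) by simp
    have "C_norm N (gs ! i) = e / 2"
    proof -
     have "C_norm N (gs ! i) = norm (c (fs ! i)) * C_norm N (fs ! i)"
      using i fs(1) C_norm_cmult[OF subsetD[OF fs(2) fi]] by (simp add: gs_def)
     also have "norm (c (fs ! i)) = e / 2 / C_norm N (fs ! i)"
      unfolding c_def norm_of_real using pos[OF fi] e by simp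
     finally show ?thesis using pos[OF fi] by simp
    qed
    then have "gs ! i \<in> X i" using i gs e by (intro NX) auto
    then show "g i \<in> X i" using i by (simp add: g_def)
   qed (simp add: g_def)
   then have "apply_fields \<phi>s g \<Omega> \<in> W" using X(3) by blast
   moreover have "map g [0..<?n] = gs" by (rule nth_equalityI) (auto simp: g_def gs)
   ultimately have "opl (zip \<phi>s gs) \<Omega> \<in> W" by (simp add: apply_fields_opl)
   then have "norm (l (opl (zip \<phi>s gs) \<Omega>)) \<le> 1" by (rule W(3))
   then have le: "norm (prod_list (map c fs)) * norm (l (opl (zip \<phi>s fs) \<Omega>)) \<le> 1"
    unfolding gs_def using opl_scaled[OF fs(1) \<phi>s fs(2), of c \<Omega>] lin_scale[OF lin] by (simp add: norm_mult)
   have pc: "norm (prod_list (map c hs)) * ((2 / e) ^ length hs * C_prod N hs) = 1"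
    if "set hs \<subseteq> set fs" for hs using that
   proof (induction hs)
    case (Cons h hs)
    have nc: "norm (c h) = e / 2 / C_norm N h" unfolding c_def norm_of_real using pos[of h] Cons e by simp
    have "norm (prod_list (map c (h # hs))) * ((2 / e) ^ length (h # hs) * C_prod N (h # hs)) =
     (norm (c h) * (2 / e) * C_norm N h) * (norm (prod_list (map c hs)) * ((2 / e) ^ length hs * C_prod N hs))"
     by (simp add: norm_mult)
    also have "\<dots> = 1" using Cons pos[of h] e by (simp add: nc)
    finally show ?case .
   qed simp
   define A where "A = norm (prod_list (map c fs))"
   define M where "M = (2 / e) ^ ?n * C_prod N fs"
   have AM: "A * M = 1" using pc[of fs] fs(1) by (simp add: A_def M_def)
   have A: "A > 0" using AM by (metis A_def norm_ge_zero order_le_less mult_zero_left zero_neq_one)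
   have "A * norm (l (opl (zip \<phi>s fs) \<Omega>)) \<le> A * M" using le AM by (simp add: A_def)
   then show ?thesis using A by (simp add: M_def)
  qed
  then show ?thesis using e by (intro exI[of _ "(2 / e) ^ ?n"] exI[of _ N]) auto
 qed
qed

lemma opl_slot_diff:
 "length as < length \<phi>s \<Longrightarrow> set \<phi>s \<subseteq> F \<Longrightarrow> set (as @ f # g # bs) \<subseteq> smooth \<Longrightarrow>
  opl (zip \<phi>s (as @ (\<lambda>z. f z - g z) # bs)) v = opl (zip \<phi>s (as @ f # bs)) v - opl (zip \<phi>s (as @ g # bs)) v"
proof (induction as arbitrary: \<phi>s)
 case Nil
 then obtain \<phi> \<psi>s where "\<phi>s = \<phi> # \<psi>s" by (cases \<phi>s) auto
 then show ?case using Nil by (simp add: field_fdiff)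
next
 case (Cons a as)
 then obtain \<phi> \<psi>s where "\<phi>s = \<phi> # \<psi>s" by (cases \<phi>s) auto
 then show ?case using Cons by (simp add: field_diff)
qed

text \<open>Slots are exchanged one at a time: in the \<open>i\<close>-th term the first
  \<open>i\<close> slots already carry \<open>gs\<close> and the later ones still carry
  \<open>fs\<close>.\<close>

lemma opl_telescope:
 assumes "length fs = length \<phi>s" "length gs = length \<phi>s" "set \<phi>s \<subseteq> F" "set fs \<subseteq> smooth" "set gs \<subseteq> smooth" "lin l"
 shows "l (opl (zip \<phi>s fs) v) - l (opl (zip \<phi>s gs) v) =
  (\<Sum>i<length \<phi>s. l (opl (zip \<phi>s (take i gs @ (\<lambda>z. (fs ! i) z - (gs ! i) z) # drop (Suc i) fs)) v))"
proof -
 define P where "P i = l (opl (zip \<phi>s (take i gs @ drop i fs)) v)" for i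
 have "l (opl (zip \<phi>s (take i gs @ (\<lambda>z. (fs ! i) z - (gs ! i) z) # drop (Suc i) fs)) v) = P i - P (Suc i)"
  if i: "i < length \<phi>s" for i
 proof -
  have sub: "set (take i gs @ (fs ! i) # (gs ! i) # drop (Suc i) fs) \<subseteq> smooth"
   using assms i set_take_subset[of i gs] set_drop_subset[of "Suc i" fs] by auto
  have "drop i fs = fs ! i # drop (Suc i) fs" using i assms(1) by (simp add: Cons_nth_drop_Suc)
  moreover have "take (Suc i) gs @ drop (Suc i) fs = take i gs @ gs ! i # drop (Suc i) fs"
   using i assms(2) by (simp add: take_Suc_conv_app_nth)
  ultimately show ?thesis unfolding P_def
   using opl_slot_diff[of "take i gs" \<phi>s "fs ! i" "gs ! i" "drop (Suc i) fs" v] i assms sub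
   by (simp add: lin_diff)
 qed
 then have "(\<Sum>i<length \<phi>s. l (opl (zip \<phi>s (take i gs @ (\<lambda>z. (fs ! i) z - (gs ! i) z) # drop (Suc i) fs)) v)) = (\<Sum>i<length \<phi>s. P i - P (Suc i))"
  by (intro sum.cong) auto
 also have "\<dots> = P 0 - P (length \<phi>s)" by (rule sum_lessThan_telescope')
 finally show ?thesis using assms(1,2) by (simp add: P_def)
qed

end

section \<open>The Reeh-Schlieder property\<close>

lemma ej_rot: "ej j (rot t z) = cis (of_int j * t) * ej j z"
 by (simp add: ej_def of_circle_rot power_int_mult_distrib cis_powi)

lemma Mob_inv:
 assumes "\<gamma> \<in> Mob" shows "inv \<gamma> \<in> Mob" "\<gamma> \<circ> inv \<gamma> = id" "inv \<gamma> \<circ> \<gamma> = id" "bij \<gamma>"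
proof -
 obtain a b where ab: "su a b" "\<gamma> = mob a b" using assms Mob_iff by blast
 show "inv \<gamma> \<in> Mob" using ab su_inv[OF ab(1)] inv_mob[OF ab(1)] Mob_iff by metis
 show "\<gamma> \<circ> inv \<gamma> = id" "inv \<gamma> \<circ> \<gamma> = id" using ab inv_mob[OF ab(1)] mob_inverse[OF ab(1)] by auto
 show "bij \<gamma>" using ab bij_mob by blast
qed

lemma rot_supp_subset:
 assumes "open I" "supp h \<subseteq> I"
 obtains e where "e > 0" "\<And>t. \<bar>t\<bar> < e \<Longrightarrow> supp (\<lambda>z. h (rot (- t) z)) \<subseteq> I"
proof -
 obtain e where e: "e > 0" "(\<Union>x\<in>supp h. ball x e) \<subseteq> I"
  using compact_subset_open_imp_ball_epsilon_subset[OF compact_supp assms] by blast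
 have "supp (\<lambda>z. h (rot (- t) z)) \<subseteq> I" if t: "\<bar>t\<bar> < e" for t
 proof -
  have "supp (\<lambda>z. h (rot (- t) z)) \<subseteq> rot t ` supp h"
  proof (rule supp_subset_closed)
   show "closed (rot t ` supp h)"
    by (intro compact_imp_closed compact_continuous_image continuous_rot compact_supp)
   fix z assume "h (rot (- t) z) \<noteq> 0"
   then have "rot (- t) z \<in> supp h" using not_supp_zero by blast
   then show "z \<in> rot t ` supp h" by (rule rev_image_eqI) simp
  qed
  also have "\<dots> \<subseteq> I"
  proof
   fix w assume "w \<in> rot t ` supp h"
   then obtain z where z: "z \<in> supp h" "w = rot t z" by blast
   then have "dist z w < e" using dist_rot_le[of t z] t by (simp add: dist_commute)
   then have "w \<in> ball z e" by simp
   then show "w \<in> I" using e(2) z(1) by blast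
  qed
  finally show ?thesis .
 qed
 then show ?thesis using that e(1) by blast
qed

section \<open>Covariance, energy eigenvectors and rotation orbits\<close>

context wightman_cft
begin

lemma U_linear: "\<gamma> \<in> Mob \<Longrightarrow> U \<gamma> (u + v) = U \<gamma> u + U \<gamma> v" "\<gamma> \<in> Mob \<Longrightarrow> U \<gamma> (s c v) = s c (U \<gamma> v)"
 using U_endo[of \<gamma>] by (simp_all add: continuous_endos_def linear_iff_fun)

lemma U_inv:
 assumes "\<gamma> \<in> Mob" shows "U \<gamma> (U (inv \<gamma>) v) = v" "U (inv \<gamma>) (U \<gamma> v) = v" "inv (U \<gamma>) = U (inv \<gamma>)" "bij (U \<gamma>)"
proof -
 note m = Mob_inv[OF assms]
 have 1: "U \<gamma> \<circ> U (inv \<gamma>) = id" using U_comp[OF assms m(1)] m(2) U_id by simp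
 have 2: "U (inv \<gamma>) \<circ> U \<gamma> = id" using U_comp[OF m(1) assms] m(3) U_id by simp
 show "U \<gamma> (U (inv \<gamma>) v) = v" "U (inv \<gamma>) (U \<gamma> v) = v" using 1 2 by (simp_all add: fun_eq_iff)
 show "inv (U \<gamma>) = U (inv \<gamma>)" using inv_unique_comp[OF 1 2] .
 show "bij (U \<gamma>)" using o_bij[OF 2 1] .
qed

lemma U_field:
 assumes "\<gamma> \<in> Mob" "\<phi> \<in> F" "f \<in> smooth"
 shows "U \<gamma> (\<phi> f v) = \<phi> (beta (cdim \<phi>) \<gamma> f) (U \<gamma> v)"
 using fun_cong[OF covariance[OF assms], of "U \<gamma> v"] U_inv[OF assms(1)] by simp

definition bl :: "(circle \<Rightarrow> circle) \<Rightarrow> 'v distribution \<times> (circle \<Rightarrow> complex) \<Rightarrow> 'v distribution \<times> (circle \<Rightarrow> complex)"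
 where "bl \<gamma> = (\<lambda>(\<phi>, f). (\<phi>, beta (cdim \<phi>) \<gamma> f))"

lemma bl_FS: "\<gamma> \<in> Mob \<Longrightarrow> set xs \<subseteq> FS \<Longrightarrow> set (map (bl \<gamma>) xs) \<subseteq> FS"
 by (auto simp: bl_def FS_def smooth_beta)

lemma U_opl: "\<gamma> \<in> Mob \<Longrightarrow> set xs \<subseteq> FS \<Longrightarrow> U \<gamma> (opl xs v) = opl (map (bl \<gamma>) xs) (U \<gamma> v)"
 by (induction xs) (auto simp: FS_def bl_def U_field)

lemma U_opl_vacuum: "\<gamma> \<in> Mob \<Longrightarrow> set xs \<subseteq> FS \<Longrightarrow> U \<gamma> (opl xs \<Omega>) = opl (map (bl \<gamma>) xs) \<Omega>"
 by (simp add: U_opl vacuum_invariant)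

lemma U_rot_opl:
 assumes "set \<phi>s \<subseteq> F" "set fs \<subseteq> smooth"
 shows "U (rot t) (opl (zip \<phi>s fs) \<Omega>) = opl (zip \<phi>s (map (\<lambda>f z. f (rot (- t) z)) fs)) \<Omega>"
proof -
 have "map (bl (rot t)) (zip \<phi>s fs) = zip \<phi>s (map (\<lambda>f z. f (rot (- t) z)) fs)"
  by (simp add: bl_def beta_rot zip_map2 case_prod_unfold)
 then show ?thesis using U_opl_vacuum[OF rot_Mob set_zip_FS[OF assms]] by simp
qed

text \<open>On \<open>opl xs \<Omega>\<close> the other slots are fixed, so the bound in
  \<open>Lf\<close> is a constant times one norm of the difference; linearity gives all
  vectors.\<close>

lemma Lf_tendsto:
 assumes l: "Lf l" and \<phi>: "\<phi> \<in> F" and f: "\<And>n. f n \<in> smooth" "f0 \<in> smooth"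
  and lim: "\<And>N. ((\<lambda>n. C_norm N (\<lambda>z. f n z - f0 z)) \<longlongrightarrow> 0) G"
 shows "((\<lambda>n. l (\<phi> (f n) v)) \<longlongrightarrow> l (\<phi> f0 v)) G"
proof (induction v rule: D_induct)
 case (add u v)
 then show ?case using f \<phi> by (simp add: field_add lin_add[OF Lf_lin[OF l]] tendsto_add)
next
 case (scale c v)
 then show ?case using f \<phi> by (simp add: field_scale lin_scale[OF Lf_lin[OF l]] tendsto_mult_left)
next
 case (opl xs)
 then obtain \<phi>s fs where xs: "xs = zip \<phi>s fs" "length fs = length \<phi>s" "set \<phi>s \<subseteq> F" "set fs \<subseteq> smooth"
  using FS_unzip by blast
 have "set (\<phi> # \<phi>s) \<subseteq> F" using xs \<phi> by simp
 from LfD[OF l this] obtain C N where C: "C \<ge> 0" "\<And>fs. length fs = length (\<phi> # \<phi>s) \<Longrightarrow> set fs \<subseteq> smooth \<Longrightarrow>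
   norm (l (opl (zip (\<phi> # \<phi>s) fs) \<Omega>)) \<le> C * C_prod N fs" by blast
 have "((\<lambda>n. l (\<phi> (f n) (opl xs \<Omega>)) - l (\<phi> f0 (opl xs \<Omega>))) \<longlongrightarrow> 0) G"
 proof (rule Lim_null_comparison)
  show "\<forall>\<^sub>F n in G. norm (l (\<phi> (f n) (opl xs \<Omega>)) - l (\<phi> f0 (opl xs \<Omega>))) \<le> C * (C_norm N (\<lambda>z. f n z - f0 z) * C_prod N fs)"
  proof (rule always_eventually, rule allI)
   fix n
   have "l (\<phi> (f n) (opl xs \<Omega>)) - l (\<phi> f0 (opl xs \<Omega>)) = l (opl (zip (\<phi> # \<phi>s) ((\<lambda>z. f n z - f0 z) # fs)) \<Omega>)"
    using f \<phi> by (simp add: xs(1) field_fdiff lin_diff[OF Lf_lin[OF l]])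
   then show "norm (l (\<phi> (f n) (opl xs \<Omega>)) - l (\<phi> f0 (opl xs \<Omega>))) \<le> C * (C_norm N (\<lambda>z. f n z - f0 z) * C_prod N fs)"
    using C(2)[of "(\<lambda>z. f n z - f0 z) # fs"] xs f by (simp add: smooth_diff)
  qed
  show "((\<lambda>n. C * (C_norm N (\<lambda>z. f n z - f0 z) * C_prod N fs)) \<longlongrightarrow> 0) G"
   by (intro tendsto_mult_right_zero tendsto_mult_left_zero lim)
 qed
 then show ?case by (rule LIM_zero_cancel)
qed

definition Eig :: "int \<Rightarrow> 'v set"
 where "Eig d = {v. \<forall>t. U (rot t) v = s (cis (of_int d * t)) v}"

lemma Eig_neg: "d < 0 \<Longrightarrow> v \<in> Eig d \<Longrightarrow> v = 0"
 using spectrum[of d v] by (simp add: Eig_def)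

text \<open>The rotation by \<open>t\<close> multiplies \<open>ej j\<close> by the phase of
  \<open>- j * t\<close>; modes with \<open>j > 0\<close> therefore lower the energy.\<close>

lemma Eig_field:
 assumes "v \<in> Eig d" "\<phi> \<in> F" shows "\<phi> (ej j) v \<in> Eig (d - j)"
proof -
 have "U (rot t) (\<phi> (ej j) v) = s (cis (of_int (d - j) * t)) (\<phi> (ej j) v)" for t
 proof -
  have "beta (cdim \<phi>) (rot t) (ej j) = (\<lambda>z. cis (- (of_int j * t)) * ej j z)"
   by (simp add: beta_rot ej_rot)
  then have "U (rot t) (\<phi> (ej j) v) = s (cis (- (of_int j * t))) (s (cis (of_int d * t)) (\<phi> (ej j) v))"
   using assms by (simp add: U_field[OF rot_Mob] field_fscale field_scale Eig_def)
  then show ?thesis by (simp add: cis_mult algebra_simps)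
 qed
 then show ?thesis by (simp add: Eig_def)
qed

text \<open>The vectors of finite energy content, on which rotation orbits are trigonometric
  polynomials.\<close>

definition SP :: "'v set" where "SP = span (\<Union>d. Eig d)"

lemma SP_field_ej: assumes "\<phi> \<in> F" "v \<in> SP" shows "\<phi> (ej j) v \<in> SP"
 using assms(2) unfolding SP_def
proof (induction v rule: span_induct_alt)
 case base
 then show ?case using assms(1) by (simp add: span_zero)
next
 case (step c x y)
 then obtain d where "x \<in> Eig d" by blast
 then have "\<phi> (ej j) x \<in> span (\<Union>d. Eig d)" using Eig_field assms(1) by (blast intro: span_base)
 then show ?case using step assms(1) by (simp add: field_add field_scale span_add span_scale)
qed

lemma SP_field_fej: assumes "\<phi> \<in> F" "v \<in> SP" shows "\<phi> (fej n f) v \<in> SP"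
proof -
 have "\<phi> (fej n f) v = (\<Sum>j\<in>{- int n..int n}. s (fw n j * fc j f) (\<phi> (ej j) v))"
  unfolding fej_def[abs_def] using assms(1) by (subst field_fsum) (auto intro!: smooth_cmult simp: field_fscale)
 also have "\<dots> \<in> SP" using SP_field_ej[OF assms] unfolding SP_def by (intro span_sum span_scale)
 finally show ?thesis .
qed

lemma SP_opl: "set \<phi>s \<subseteq> F \<Longrightarrow> opl (zip \<phi>s (map (fej n) fs)) \<Omega> \<in> SP"
proof (induction \<phi>s arbitrary: fs)
 case Nil
 have "\<Omega> \<in> Eig 0" by (simp add: Eig_def vacuum_invariant rot_Mob)
 then show ?case unfolding SP_def by (auto intro: span_base)
next
 case (Cons \<phi> \<phi>s)
 show ?case
 proof (cases fs)
  case Nil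
  then show ?thesis using Cons.IH[of "[]"] Cons.prems by simp
 next
  case (Cons f gs)
  then show ?thesis using Cons.IH[of gs] Cons.prems by (simp add: SP_field_fej)
 qed
qed

text \<open>Eigenvectors of negative energy are zero, so only nonnegative powers of
  \<open>cis t\<close> occur: a polynomial rather than a Laurent polynomial. This is what lets
  rotation orbits extend into the disc.\<close>

lemma SP_poly:
 assumes "lin l" "v \<in> SP" shows "\<exists>p. \<forall>t. l (U (rot t) v) = poly p (cis t)"
 using assms(2) unfolding SP_def
proof (induction v rule: span_induct_alt)
 case base
 have "U (rot t) 0 = 0" for t using U_linear(2)[OF rot_Mob, of t 0 0] by simp
 then show ?case by (intro exI[of _ 0]) (simp add: lin_zero[OF assms(1)])
next
 case (step c x y)
 then obtain d p where d: "x \<in> Eig d" and p: "\<And>t. l (U (rot t) y) = poly p (cis t)" by blast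
 show ?case
 proof (cases "d < 0")
  case True
  then have "x = 0" using Eig_neg d by blast
  then show ?thesis using p by auto
 next
  case False
  have "l (U (rot t) (s c x + y)) = poly (monom (c * l x) (nat d) + p) (cis t)" for t
  proof -
   have "cis (of_int d * t) = cis t ^ nat d" using False by (simp add: Complex.DeMoivre)
   moreover have "U (rot t) x = s (cis (of_int d * t)) x" using d by (simp add: Eig_def)
   ultimately show ?thesis
    using p by (simp add: U_linear[OF rot_Mob] lin_add[OF assms(1)] lin_scale[OF assms(1)] poly_monom)
  qed
  then show ?thesis by blast
 qed
qed

text \<open>The base tuple \<open>M h\<close> moves with \<open>h\<close> and is merely bounded.
  With \<open>h\<close> a pair of an index and an angle this gives convergence uniform in the
  angle.\<close>

lemma Lf_multi_diff_tendsto: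
 assumes l: "Lf l" and \<phi>s: "set \<phi>s \<subseteq> F"
  and L: "\<And>h. length (L h) = length \<phi>s" "\<And>h. set (L h) \<subseteq> smooth"
  and M: "\<And>h. length (M h) = length \<phi>s" "\<And>h. set (M h) \<subseteq> smooth"
  and bound: "\<And>i N. i < length \<phi>s \<Longrightarrow> \<exists>P. \<forall>h. C_norm N (M h ! i) \<le> P"
  and lim: "\<And>i N. i < length \<phi>s \<Longrightarrow> ((\<lambda>h. C_norm N (\<lambda>z. (L h ! i) z - (M h ! i) z)) \<longlongrightarrow> 0) Fl"
 shows "((\<lambda>h. l (opl (zip \<phi>s (L h)) \<Omega>) - l (opl (zip \<phi>s (M h)) \<Omega>)) \<longlongrightarrow> 0) Fl"
proof -
 let ?n = "length \<phi>s"
 from LfD[OF l \<phi>s] obtain C N where C: "C \<ge> 0" "\<And>fs. length fs = ?n \<Longrightarrow> set fs \<subseteq> smooth \<Longrightarrow>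
   norm (l (opl (zip \<phi>s fs) \<Omega>)) \<le> C * C_prod N fs" by blast
 have "\<exists>P. \<forall>i. i < ?n \<longrightarrow> (\<forall>h. C_norm N (M h ! i) \<le> P i)" by (intro choice) (use bound in blast)
 then obtain P where P: "\<And>i h. i < ?n \<Longrightarrow> C_norm N (M h ! i) \<le> P i" by blast
 have sm: "L h ! i \<in> smooth" "M h ! i \<in> smooth" if "i < ?n" for h i
  using L M that by (metis nth_mem subsetD)+
 let ?D = "\<lambda>i h z. (L h ! i) z - (M h ! i) z"
 let ?d = "\<lambda>i h. C_norm N (?D i h)"
 have LP: "C_norm N (L h ! i) \<le> P i + ?d i h" if i: "i < ?n" for h i
  using C_norm_add[OF smooth_diff[OF sm(1)[OF i, of h] sm(2)[OF i, of h]] sm(2)[OF i, of h], of N] P[OF i, of h]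
  by simp
 have P0: "0 \<le> P i" if i: "i < ?n" for i by (rule order_trans[OF C_norm_nonneg[OF sm(2)[OF i]] P[OF i]])
 \<comment> \<open>Bound for the \<open>i\<close>-th term of the telescope: slots before
   \<open>i\<close> come from \<open>M\<close>, the slot \<open>i\<close> is the difference, and
   those after \<open>i\<close> come from \<open>L\<close>, which differs from \<open>M\<close> by
   at most \<open>?d\<close> in norm.\<close>
 let ?e = "\<lambda>i h. C * ((\<Prod>j\<in>{0..<i}. P j) * (?d i h * (\<Prod>j\<in>{0..<?n - Suc i}. P (Suc i + j) + ?d (Suc i + j) h)))"
 show ?thesis
 proof (rule Lim_null_comparison)
  show "((\<lambda>h. \<Sum>i<?n. ?e i h) \<longlongrightarrow> 0) Fl"
  proof (rule tendsto_null_sum)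
   fix i assume "i \<in> {..<?n}"
   then have "((\<lambda>h. ?e i h) \<longlongrightarrow> C * ((\<Prod>j\<in>{0..<i}. P j) * (0 * (\<Prod>j\<in>{0..<?n - Suc i}. P (Suc i + j) + 0)))) Fl"
    by (intro tendsto_mult tendsto_const tendsto_prod tendsto_add lim) auto
   then show "((\<lambda>h. ?e i h) \<longlongrightarrow> 0) Fl" by simp
  qed
  show "\<forall>\<^sub>F h in Fl. norm (l (opl (zip \<phi>s (L h)) \<Omega>) - l (opl (zip \<phi>s (M h)) \<Omega>)) \<le> (\<Sum>i<?n. ?e i h)"
  proof (rule always_eventually, rule allI)
   fix h
   let ?t = "\<lambda>i. take i (M h) @ ?D i h # drop (Suc i) (L h)"
   have "norm (l (opl (zip \<phi>s (L h)) \<Omega>) - l (opl (zip \<phi>s (M h)) \<Omega>)) \<le> (\<Sum>i<?n. norm (l (opl (zip \<phi>s (?t i)) \<Omega>)))"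
    unfolding opl_telescope[OF L(1) M(1) \<phi>s L(2) M(2) Lf_lin[OF l]] by (rule norm_sum)
   also have "\<dots> \<le> (\<Sum>i<?n. ?e i h)"
   proof (rule sum_mono)
    fix i assume "i \<in> {..<?n}"
    then have i: "i < ?n" by simp
    have "set (take i (M h)) \<subseteq> smooth" "set (drop (Suc i) (L h)) \<subseteq> smooth"
     using M(2)[of h] L(2)[of h] set_take_subset[of i "M h"] set_drop_subset[of "Suc i" "L h"] by blast+
    then have "norm (l (opl (zip \<phi>s (?t i)) \<Omega>)) \<le> C * C_prod N (?t i)"
     using i L(1) M(1) smooth_diff[OF sm[OF i]] by (intro C(2)) auto
    also have "C_prod N (?t i) = (\<Prod>j\<in>{0..<i}. C_norm N (M h ! j)) * (?d i h * (\<Prod>j\<in>{0..<?n - Suc i}. C_norm N (L h ! (Suc i + j))))"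
    (is "?a = ?b")
    proof -
     have pn: "prod_list (map g xs) = (\<Prod>j\<in>{0..<length xs}. g (xs ! j))" for g :: "(circle \<Rightarrow> complex) \<Rightarrow> real" and xs
      by (simp add: prod.list_conv_set_nth)
     have "?a = C_prod N (take i (M h)) * (?d i h * C_prod N (drop (Suc i) (L h)))" by simp
     then show ?thesis unfolding pn using i L(1) M(1) by (simp add: min_absorb2)
    qed
    also have "C * \<dots> \<le> ?e i h" using i C(1) sm C_norm_nonneg smooth_diff P0
     by (intro mult_left_mono mult_mono prod_mono conjI P LP prod_nonneg mult_nonneg_nonneg ballI) auto
    finally show "norm (l (opl (zip \<phi>s (?t i)) \<Omega>)) \<le> ?e i h" .
   qed
   finally show "norm (l (opl (zip \<phi>s (L h)) \<Omega>) - l (opl (zip \<phi>s (M h)) \<Omega>)) \<le> (\<Sum>i<?n. ?e i h)" .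
  qed
 qed
qed

lemma rot_orbit_approx:
 assumes l: "Lf l" and e: "e > 0"
 shows "\<exists>p. \<forall>t. norm (l (U (rot t) v) - poly p (cis t)) < e"
 using e
proof (induction v arbitrary: e rule: D_induct)
 case (add u v)
 obtain p q where pq: "\<And>t. norm (l (U (rot t) u) - poly p (cis t)) < e / 2" "\<And>t. norm (l (U (rot t) v) - poly q (cis t)) < e / 2"
  using add.IH(1)[of "e/2"] add.IH(2)[of "e/2"] add.prems by auto
 have "norm (l (U (rot t) (u + v)) - poly (p + q) (cis t)) < e" for t
 proof -
  have "l (U (rot t) (u + v)) - poly (p + q) (cis t) = (l (U (rot t) u) - poly p (cis t)) + (l (U (rot t) v) - poly q (cis t))"
   by (simp add: U_linear[OF rot_Mob] lin_add[OF Lf_lin[OF l]])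
  moreover have "norm \<dots> < e" by (rule norm_triangle_lt) (use pq[of t] in linarith)
  ultimately show ?thesis by (simp only:)
 qed
 then show ?case by blast
next
 case (scale c v)
 obtain p where p: "\<And>t. norm (l (U (rot t) v) - poly p (cis t)) < e / (norm c + 1)"
  using scale.IH[of "e / (norm c + 1)"] scale.prems by (auto simp: add_nonneg_pos)
 have "norm (l (U (rot t) (s c v)) - poly (smult c p) (cis t)) < e" for t
 proof -
  have "l (U (rot t) (s c v)) - poly (smult c p) (cis t) = c * (l (U (rot t) v) - poly p (cis t))"
   by (simp add: U_linear[OF rot_Mob] lin_scale[OF Lf_lin[OF l]] algebra_simps)
  then have "norm (l (U (rot t) (s c v)) - poly (smult c p) (cis t)) = norm c * norm (l (U (rot t) v) - poly p (cis t))"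
   by (simp only: norm_mult)
  also have "\<dots> \<le> norm c * (e / (norm c + 1))" by (intro mult_left_mono less_imp_le[OF p]) simp
  also have "\<dots> < e"
  proof -
   have "norm c * e < e * (norm c + 1)" using scale.prems by (simp add: algebra_simps)
   moreover have "norm c + 1 > 0" by (simp add: add_nonneg_pos)
   ultimately show ?thesis by (simp add: divide_less_eq)
  qed
  finally show ?thesis .
 qed
 then show ?case by blast
next
 case (opl xs)
 then obtain \<phi>s fs where xs: "xs = zip \<phi>s fs" "length fs = length \<phi>s" "set \<phi>s \<subseteq> F" "set fs \<subseteq> smooth"
  using FS_unzip by blast
 define R where "R t = (\<lambda>(f::circle \<Rightarrow> complex) z. f (rot (- t) z))" for t
 \<comment> \<open>The argument is a pair of degree and angle while the filter looks at the degree
   only: convergence is uniform in the angle because rotations do not increase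
   \<open>C_norm\<close>.\<close>
 define \<delta> where "\<delta> = (\<lambda>(n, t). l (opl (zip \<phi>s (map (R t) (map (fej n) fs))) \<Omega>) - l (opl (zip \<phi>s (map (R t) fs)) \<Omega>))"
 have fi: "fs ! i \<in> smooth" if "i < length \<phi>s" for i using xs that by (auto simp: subset_iff)
 have "(\<delta> \<longlongrightarrow> 0) (filtercomap fst sequentially)" unfolding \<delta>_def case_prod_unfold
 proof (rule Lf_multi_diff_tendsto[OF l xs(3)])
  fix i N assume i: "i < length \<phi>s"
  show "\<exists>P. \<forall>h. C_norm N (map (R (snd h)) fs ! i) \<le> P"
   using i xs(2) C_norm_rot[OF fi[OF i]] by (auto simp: R_def)
  let ?D = "\<lambda>n z. fej n (fs ! i) z - (fs ! i) z"
  have sD: "?D n \<in> smooth" for n by (intro smooth_diff smooth_fej fi i)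
  show "((\<lambda>h. C_norm N (\<lambda>z. (map (R (snd h)) (map (fej (fst h)) fs) ! i) z - (map (R (snd h)) fs ! i) z)) \<longlongrightarrow> 0) (filtercomap fst sequentially)"
  proof (rule Lim_null_comparison)
   show "((\<lambda>h. C_norm N (?D (fst h))) \<longlongrightarrow> 0) (filtercomap fst sequentially)"
    by (rule filterlim_compose[OF fej_tendsto[OF fi[OF i]] filterlim_filtercomap])
   show "\<forall>\<^sub>F h in filtercomap fst sequentially. norm (C_norm N (\<lambda>z. (map (R (snd h)) (map (fej (fst h)) fs) ! i) z - (map (R (snd h)) fs ! i) z)) \<le> C_norm N (?D (fst h))"
    using i xs(2) C_norm_rot[OF sD] C_norm_nonneg[OF smooth_rot[OF sD]] by (simp add: R_def)
  qed
 qed (use xs in \<open>auto simp: R_def smooth_rot smooth_fej\<close>)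
 from tendstoD[OF this opl.prems] obtain n where n: "\<And>t. norm (\<delta> (n, t)) < e"
  by (auto simp: eventually_filtercomap eventually_sequentially)
 have "l (U (rot t) (opl xs \<Omega>)) - l (U (rot t) (opl (zip \<phi>s (map (fej n) fs)) \<Omega>)) = - \<delta> (n, t)" for t
  using U_rot_opl[OF xs(3,4), of t] U_rot_opl[OF xs(3), of "map (fej n) fs" t]
  by (simp add: xs(1) R_def \<delta>_def smooth_fej image_subset_iff)
 moreover obtain p where "\<And>t. l (U (rot t) (opl (zip \<phi>s (map (fej n) fs)) \<Omega>)) = poly p (cis t)"
  using SP_poly[OF Lf_lin[OF l] SP_opl[OF xs(3)]] by blast
 ultimately have "norm (l (U (rot t) (opl xs \<Omega>)) - poly p (cis t)) < e" for t using n[of t] by (metis norm_minus_cancel)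
 then show ?case by blast
qed

lemma rot_orbit_zero:
 assumes "Lf l" "e > 0" "\<And>t. \<bar>t\<bar> < e \<Longrightarrow> l (U (rot t) v) = 0"
 shows "l (U (rot t) v) = 0"
 by (rule boundary_unique[of "\<lambda>t. l (U (rot t) v)", OF rot_orbit_approx[OF assms(1)] assms(2,3)])

definition supported :: "circle set \<Rightarrow> ('v distribution \<times> (circle \<Rightarrow> complex)) set"
 where "supported I = {(\<phi>, f). \<phi> \<in> F \<and> f \<in> smooth \<and> supp f \<subseteq> I}"

text \<open>Induction on the number of fields. If the leftmost function is supported in
  \<open>I\<close>, the hypothesis for the functional \<open>l\<close> after that field frees all
  the others. This persists under rotations by small angles, and \<open>rot_orbit_zero\<close>
  extends it to every angle, hence to every position of the leftmost support.\<close>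

theorem reeh_schlieder:
 assumes I: "open I" "I \<noteq> {}" and l: "Lf l"
  and z: "\<And>xs. set xs \<subseteq> supported I \<Longrightarrow> l (opl xs \<Omega>) = 0"
 shows "l v = 0"
proof (rule lin_eq_zero[OF Lf_lin[OF l]])
 have "l (opl xs \<Omega>) = 0" if "length xs = n" "set xs \<subseteq> FS" "Lf l" "\<And>xs. set xs \<subseteq> supported I \<Longrightarrow> l (opl xs \<Omega>) = 0" for xs n l
  using that
 proof (induction n arbitrary: xs l)
  case 0
  then show ?case using "0.prems"(4)[of "[]"] by simp
 next
  case (Suc n)
  then obtain \<phi> f ys where xs: "xs = (\<phi>, f) # ys" "length ys = n" by (cases xs) auto
  have \<phi>: "\<phi> \<in> F" and f: "f \<in> smooth" and ys: "set ys \<subseteq> FS" using Suc.prems xs by (auto simp: FS_def)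
  note lin = Lf_lin[OF Suc.prems(3)]
  have inner: "l (\<phi> h (opl ys' \<Omega>)) = 0" if "h \<in> smooth" "supp h \<subseteq> I" "length ys' = n" "set ys' \<subseteq> FS" for h ys'
  proof (rule Suc.IH[of ys' "\<lambda>v. l (\<phi> h v)"])
   show "Lf (\<lambda>v. l (\<phi> h v))" by (rule Lf_field[OF Suc.prems(3) \<phi> that(1)])
   fix zs assume "set zs \<subseteq> supported I"
   then have "l (opl ((\<phi>, h) # zs) \<Omega>) = 0" using \<phi> that by (intro Suc.prems(4)) (auto simp: supported_def)
   then show "l (\<phi> h (opl zs \<Omega>)) = 0" by simp
  qed (use that in auto)
  obtain T k where T: "finite T" "\<And>t. k t \<in> smooth" "\<And>t. supp (k t) \<subseteq> I" "\<And>z. (\<Sum>t\<in>T. k t (rot (- t) z)) = 1"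
   using partition_rotations[OF I] by metis
  define h where "h t z = f (rot t z) * k t z" for t z
  have h: "h t \<in> smooth" for t unfolding h_def[abs_def] by (intro smooth_mult smooth_rot f T(2))
  have hs: "supp (h t) \<subseteq> I" for t
  proof -
   have "supp (h t) \<subseteq> supp (k t)"
    by (rule supp_subset_closed[OF closed_supp]) (use not_supp_zero[of _ "k t"] in \<open>auto simp: h_def\<close>)
   then show ?thesis using T(3) by blast
  qed
  have piece: "l (\<phi> (\<lambda>z. h t (rot (- t) z)) (opl ys \<Omega>)) = 0" for t
  proof -
   define ys' where "ys' = map (bl (rot (- t))) ys"
   have ys': "set ys' \<subseteq> FS" "length ys' = n" unfolding ys'_def using bl_FS[OF rot_Mob ys] xs(2) by auto
   have rr: "rot t \<circ> rot (- t) = id" by (simp add: fun_eq_iff)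
   have "U (rot (- t)) (opl ys \<Omega>) = opl ys' \<Omega>" unfolding ys'_def by (rule U_opl_vacuum[OF rot_Mob ys])
   then have "U (rot t) (opl ys' \<Omega>) = opl ys \<Omega>"
    using U_comp[OF rot_Mob[of t] rot_Mob[of "- t"]] rr U_id by (metis comp_apply id_apply)
   \<comment> \<open>Pulling the rotation out of the whole product leaves a leftmost function
     supported in \<open>I\<close>; the other functions change to those of \<open>ys'\<close>, which
     are arbitrary anyway.\<close>
   then have eq: "\<phi> (\<lambda>z. h t (rot (- t) z)) (opl ys \<Omega>) = U (rot t) (\<phi> (h t) (opl ys' \<Omega>))"
    by (simp add: U_field[OF rot_Mob \<phi> h] beta_rot)
   obtain e where e: "e > 0" "\<And>\<tau>. \<bar>\<tau>\<bar> < e \<Longrightarrow> supp (\<lambda>z. h t (rot (- \<tau>) z)) \<subseteq> I"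
    using rot_supp_subset[OF I(1) hs] by metis
   have "l (U (rot \<tau>) (\<phi> (h t) (opl ys' \<Omega>))) = 0" if "\<bar>\<tau>\<bar> < e" for \<tau>
   proof -
    have "U (rot \<tau>) (\<phi> (h t) (opl ys' \<Omega>)) = \<phi> (\<lambda>z. h t (rot (- \<tau>) z)) (opl (map (bl (rot \<tau>)) ys') \<Omega>)"
     by (simp add: U_field[OF rot_Mob \<phi> h] beta_rot U_opl_vacuum[OF rot_Mob ys'(1)])
    then show ?thesis
     using inner[OF smooth_rot[OF h] e(2)[OF that], of "map (bl (rot \<tau>)) ys'"] bl_FS[OF rot_Mob ys'(1)] ys'(2) by simp
   qed
   then show ?thesis unfolding eq by (rule rot_orbit_zero[OF Suc.prems(3) e(1)])
  qed
  have "f = (\<lambda>z. \<Sum>t\<in>T. h t (rot (- t) z))"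
   using T(4) by (simp add: h_def fun_eq_iff flip: sum_distrib_left)
  then have "\<phi> f (opl ys \<Omega>) = (\<Sum>t\<in>T. \<phi> (\<lambda>z. h t (rot (- t) z)) (opl ys \<Omega>))"
   using field_fsum[OF T(1) \<phi>, of "\<lambda>t z. h t (rot (- t) z)" "opl ys \<Omega>"] smooth_rot[OF h] by simp
  then show ?case using piece by (simp add: xs(1) lin_sum[OF lin])
 qed
 then show "\<And>xs. set xs \<subseteq> FS \<Longrightarrow> l (opl xs \<Omega>) = 0" using l z by blast
qed

end

section \<open>Dilations and the vacuum\<close>

text \<open>The hyperbolic subgroup with fixed points 1 and -1. The parameter is halved so that
  \<open>dil t\<close> translates the coordinate \<open>xc\<close> by \<open>t\<close>.\<close>

definition dil :: "real \<Rightarrow> circle \<Rightarrow> circle"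
 where "dil t = mob (of_real (cosh (t / 2))) (of_real (- sinh (t / 2)))"

lemma su_dil: "su (of_real (cosh (t / 2))) (of_real (- sinh (t / 2)))"
proof -
 have "(cosh (t / 2))\<^sup>2 - (sinh (t / 2))\<^sup>2 = 1" using cosh_square_eq[of "t / 2"] by simp
 then show ?thesis unfolding su_def norm_of_real power2_abs by simp
qed

lemma su_dil': "su (of_real (cosh (t / 2))) (of_real (sinh (t / 2)))"
 using su_dil[of "- t"] by simp

lemma dil_Mob: "dil t \<in> Mob"
 unfolding dil_def Mob_iff using su_dil by blast

lemma dil_0: "dil 0 = id"
 by (simp add: dil_def mob_id)

lemma dil_add: "dil t \<circ> dil r = dil (t + r)"
proof -
 have c: "cosh (t / 2) * cosh (r / 2) + - sinh (t / 2) * - sinh (r / 2) = cosh ((t + r) / 2)"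
  by (simp add: cosh_add add_divide_distrib)
 have d: "cosh (t / 2) * - sinh (r / 2) + - sinh (t / 2) * cosh (r / 2) = - sinh ((t + r) / 2)"
  by (simp add: sinh_add add_divide_distrib)
 show ?thesis
  unfolding dil_def su_mob_comp(2)[OF su_dil su_dil] complex_cnj_complex_of_real of_real_mult[symmetric] of_real_add[symmetric] c d ..
qed

lemma dil_dil: "dil t (dil r z) = dil (t + r) z"
 using fun_cong[OF dil_add[of t r], of z] by simp

lemma inv_dil: "inv (dil t) = dil (- t)"
 by (rule inv_unique_comp) (simp_all add: dil_add dil_0)

lemma mob_real_coords:
 assumes "su (of_real a) (of_real b)"
 shows "Re (of_circle (mob (of_real a) (of_real b) z)) = (2 * a * b + (a\<^sup>2 + b\<^sup>2) * Re (of_circle z)) / (cmod (of_real b * of_circle z + of_real a))\<^sup>2"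
  and "Im (of_circle (mob (of_real a) (of_real b) z)) = Im (of_circle z) / (cmod (of_real b * of_circle z + of_real a))\<^sup>2"
proof -
 let ?x = "Re (of_circle z)" and ?y = "Im (of_circle z)"
 have r: "?x * ?x + ?y * ?y = 1" using Re_Im_circle[of z] by (simp add: power2_eq_square)
 have ab: "a * a - b * b = 1" using assms by (simp add: su_def power2_eq_square)
 have n: "(cmod (of_real b * of_circle z + of_real a))\<^sup>2 = (b * ?x + a)\<^sup>2 + (b * ?y)\<^sup>2"
  by (simp add: cmod_power2)
 have m: "of_circle (mob (of_real a) (of_real b) z) = (of_real a * of_circle z + of_real b) / (of_real b * of_circle z + of_real a)"
  using of_circle_mob[OF assms, of z] by simp
 have "(a * ?x + b) * (b * ?x + a) + (a * ?y) * (b * ?y) = a * b * (?x * ?x + ?y * ?y) + a * b + (a\<^sup>2 + b\<^sup>2) * ?x"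
  by (simp add: algebra_simps power2_eq_square)
 then show "Re (of_circle (mob (of_real a) (of_real b) z)) = (2 * a * b + (a\<^sup>2 + b\<^sup>2) * Re (of_circle z)) / (cmod (of_real b * of_circle z + of_real a))\<^sup>2"
  unfolding n m r by (simp add: Re_divide)
 have "(a * ?y) * (b * ?x + a) - (a * ?x + b) * (b * ?y) = (a * a - b * b) * ?y" by (simp add: algebra_simps)
 then show "Im (of_circle (mob (of_real a) (of_real b) z)) = Im (of_circle z) / (cmod (of_real b * of_circle z + of_real a))\<^sup>2"
  unfolding n m ab by (simp add: Im_divide)
qed

lemma dil_upper:
 "Im (of_circle (dil t z)) = Im (of_circle z) / (cmod (of_real (- sinh (t / 2)) * of_circle z + of_real (cosh (t / 2))))\<^sup>2"
 "cmod (of_real (- sinh (t / 2)) * of_circle z + of_real (cosh (t / 2))) > 0"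
proof -
 show "Im (of_circle (dil t z)) = Im (of_circle z) / (cmod (of_real (- sinh (t / 2)) * of_circle z + of_real (cosh (t / 2))))\<^sup>2"
  unfolding dil_def by (rule mob_real_coords(2)[OF su_dil])
 show "cmod (of_real (- sinh (t / 2)) * of_circle z + of_real (cosh (t / 2))) > 0"
  using mob_den_nonzero[OF su_dil, of t z] by (metis complex_cnj_complex_of_real zero_less_norm_iff)
qed

lemma dil_Im_pos: "Im (of_circle (dil t z)) > 0 \<longleftrightarrow> Im (of_circle z) > 0"
 unfolding dil_upper(1) using dil_upper(2)[of t z] by (simp add: zero_less_divide_iff)

lemma xc_dil:
 assumes "Im (of_circle z) > 0" shows "xc (dil t z) = xc z + t"
proof -
 let ?n = "(cmod (of_real (- sinh (t / 2)) * of_circle z + of_real (cosh (t / 2))))\<^sup>2"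
 let ?x = "Re (of_circle z)" and ?y = "Im (of_circle z)"
 have n: "?n > 0" using dil_upper(2)[of t z] by simp
 have R: "Re (of_circle (dil t z)) = (- sinh t + cosh t * ?x) / ?n" unfolding dil_def mob_real_coords(1)[OF su_dil]
  using sinh_double[of "t / 2"] cosh_double[of "t / 2"] by simp
 have "- Re (of_circle (dil t z)) / Im (of_circle (dil t z)) = (sinh t - cosh t * ?x) / ?y"
  unfolding R dil_upper(1) using n assms by (simp add: field_simps)
 also have "\<dots> = sinh (xc z + t)"
  unfolding sinh_add sinh_xc cosh_xc[OF assms] using assms by (simp add: field_simps)
 finally show ?thesis by (simp add: xc_def[of "dil t z"] arsinh_sinh_real)
qed

lemma beta_dil_eq: "beta d (dil t) f = pb (of_real (cosh (t / 2))) (of_real (sinh (t / 2))) (int d - 1) f"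
 unfolding dil_def beta_eq_pb[OF su_dil] by simp

text \<open>\<open>qf\<close> equals the factor by which the inverse dilation divides the height, so
  at weight \<open>d - 1\<close> the two powers cancel and only the translation of the coordinate is
  left.\<close>

lemma beta_dil_he: "beta d (dil t) (he (int d - 1) \<tau>) = he (int d - 1) (\<lambda>\<zeta>. \<tau> (\<zeta> - of_real t))"
proof
 fix z
 let ?n = "(cmod (of_real (sinh (t / 2)) * of_circle z + of_real (cosh (t / 2))))\<^sup>2"
 have m: "mob (of_real (cosh (t / 2))) (of_real (sinh (t / 2))) z = dil (- t) z" by (simp add: dil_def)
 have q: "qf (of_real (cosh (t / 2))) (of_real (sinh (t / 2))) z = of_real ?n" by (simp add: qf_eq)
 have n: "?n > 0" and I: "Im (of_circle (dil (- t) z)) = Im (of_circle z) / ?n"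
  using dil_upper[of "- t" z] by simp_all
 show "beta d (dil t) (he (int d - 1) \<tau>) z = he (int d - 1) (\<lambda>\<zeta>. \<tau> (\<zeta> - of_real t)) z"
 proof (cases "Im (of_circle z) > 0")
  case True
  have "complex_of_real ?n powi (int d - 1) * of_real (Im (of_circle z) / ?n) powi (int d - 1) = of_real (Im (of_circle z)) powi (int d - 1)"
   using n by (simp flip: power_int_mult_distrib of_real_mult)
  then show ?thesis unfolding beta_dil_eq pb_def q m he_def hf_def using True dil_Im_pos[of "- t" z]
   by (simp add: I xc_dil mult.assoc[symmetric])
 next
  case False
  then show ?thesis unfolding beta_dil_eq pb_def m he_def hf_def using dil_Im_pos[of "- t" z] by simp
 qed
qed

lemma mob_real_inv: "su (of_real a) (of_real b) \<Longrightarrow> mob (of_real a) (of_real b) (circle_inv z) = circle_inv (mob (of_real a) (of_real b) z)"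
 by (rule circle_eqI) (simp add: of_circle_mob of_circle_inv_cnj del: of_circle_inv)

lemma pb_real_inv: "su (of_real a) (of_real b) \<Longrightarrow> pb (of_real a) (of_real b) m f (circle_inv z) = pb (of_real a) (of_real b) m (\<lambda>z. f (circle_inv z)) z"
 by (simp add: pb_def mob_real_inv qf_def of_circle_inv_cnj mult.commute del: of_circle_inv)

lemma pb_cnj: "pb a b m (\<lambda>z. cnj (f z)) z = cnj (pb a b m f z)"
proof -
 have "cnj (qf a b z powi m) = qf a b z powi m" unfolding qf_eq by (simp flip: of_real_power_int of_real_power)
 then show ?thesis by (simp add: pb_def)
qed

lemma beta_cnj: "\<gamma> \<in> Mob \<Longrightarrow> beta d \<gamma> (\<lambda>z. cnj (f z)) = (\<lambda>z. cnj (beta d \<gamma> f z))"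
 unfolding Mob_iff using beta_eq_pb pb_cnj by fastforce

text \<open>Dilations have real coefficients and therefore commute with the reflection of the circle
  in the real axis.\<close>

lemma beta_dil_inv: "beta d (dil t) (\<lambda>z. f (circle_inv z)) = (\<lambda>z. beta d (dil t) f (circle_inv z))"
 unfolding beta_dil_eq using pb_real_inv[OF su_dil'[of t]] by (simp add: fun_eq_iff)

lemma smooth_he_inv: "ent \<tau> \<Longrightarrow> (\<lambda>z. he m \<tau> (circle_inv z)) \<in> smooth"
 by (intro smooth_inv smooth_he)

text \<open>The holomorphic extension of the coordinate \<open>zc\<close> to the strip.\<close>

definition Zc :: "complex \<Rightarrow> complex"
 where "Zc \<zeta> = (1 + \<i> * exp \<zeta>) / (1 - \<i> * exp \<zeta>)"

text \<open>The zeros of the denominator lie at height \<open>- pi / 2\<close> modulo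
  \<open>2 * pi\<close>, more than 1 away from the closed strip.\<close>

lemma Zc_den:
 assumes "-1 < Im \<zeta>" "Im \<zeta> < pi + 1" shows "1 - \<i> * exp \<zeta> \<noteq> 0"
proof
 assume "1 - \<i> * exp \<zeta> = 0"
 then have "\<i> * exp \<zeta> = 1" by (simp add: algebra_simps)
 then have e: "exp \<zeta> = - \<i>" by (metis i_times_eq_iff mult.right_neutral)
 have "Re (exp \<zeta>) = exp (Re \<zeta>) * cos (Im \<zeta>)" "Im (exp \<zeta>) = exp (Re \<zeta>) * sin (Im \<zeta>)" by (simp_all add: Re_exp Im_exp)
 then have c: "cos (Im \<zeta>) = 0" and s1: "exp (Re \<zeta>) * sin (Im \<zeta>) = -1" using e by auto
 have s: "sin (Im \<zeta>) < 0"
 proof (rule ccontr)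
  assume "\<not> sin (Im \<zeta>) < 0"
  then have "0 \<le> exp (Re \<zeta>) * sin (Im \<zeta>)" by simp
  then show False using s1 by simp
 qed
 have p: "pi > 2" using pi_gt3 by linarith
 show False
 proof (cases "0 \<le> Im \<zeta> \<and> Im \<zeta> \<le> pi")
  case True
  then show False using sin_ge_zero[of "Im \<zeta>"] s by linarith
 next
  case False
  then consider "-1 < Im \<zeta>" "Im \<zeta> < 0" | "pi < Im \<zeta>" "Im \<zeta> < pi + 1" using assms by linarith
  then show False
  proof cases
   case 1
   then have "0 < cos (Im \<zeta>)" using p by (intro cos_gt_zero_pi) auto
   then show False using c by simp
  next
   case 2
   then have "0 < cos (Im \<zeta> - pi)" using p by (intro cos_gt_zero_pi) auto
   then show False using c by (simp add: cos_diff)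
  qed
 qed
qed

lemma holomorphic_Zc: "Zc holomorphic_on {\<zeta>. -1 < Im \<zeta> \<and> Im \<zeta> < pi + 1}"
 unfolding Zc_def[abs_def] by (intro holomorphic_intros) (auto dest: Zc_den)

lemma Zc_bound:
 assumes "0 \<le> Im \<zeta>" "Im \<zeta> \<le> pi" shows "cmod (Zc \<zeta>) \<le> 1"
proof -
 let ?e = "exp (Re \<zeta>)"
 have s: "0 \<le> ?e * sin (Im \<zeta>)" using sin_ge_zero[OF assms] by simp
 have "(cmod (1 + \<i> * exp \<zeta>))\<^sup>2 = (1 - ?e * sin (Im \<zeta>))\<^sup>2 + (?e * cos (Im \<zeta>))\<^sup>2"
  by (simp add: cmod_power2 Re_exp Im_exp)
 also have "\<dots> \<le> (1 + ?e * sin (Im \<zeta>))\<^sup>2 + (?e * cos (Im \<zeta>))\<^sup>2"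
  using s by (intro add_right_mono) (simp add: power2_sum power2_diff)
 also have "\<dots> = (cmod (1 - \<i> * exp \<zeta>))\<^sup>2" by (simp add: cmod_power2 Re_exp Im_exp)
 finally have "cmod (1 + \<i> * exp \<zeta>) \<le> cmod (1 - \<i> * exp \<zeta>)" by (rule power2_le_imp_le) simp
 then show ?thesis by (simp add: Zc_def norm_divide divide_le_eq_1)
qed

lemma Zc_real: "Zc (of_real x) = of_circle (zc x)"
proof -
 let ?u = "exp x"
 have n: "1 - \<i> * of_real ?u \<noteq> 0" by (simp add: complex_eq_iff)
 have c: "?u * (1 / cosh x) = 1 + tanh x" and d: "1 / cosh x = ?u * (1 - tanh x)"
 proof -
  have "tanh x * cosh x = sinh x" by (simp add: tanh_def)
  moreover have "cosh x + sinh x = ?u" by (simp add: cosh_plus_sinh)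
  ultimately show "?u * (1 / cosh x) = 1 + tanh x" by (simp add: field_simps)
  have "?u * (cosh x - sinh x) = 1" by (simp add: cosh_minus_sinh flip: exp_add)
  then show "1 / cosh x = ?u * (1 - tanh x)" by (simp add: tanh_def field_simps)
 qed
 define S T where "S = 1 / cosh x" and "T = tanh x"
 have c: "?u * S = 1 + T" unfolding S_def T_def by (rule c)
 have d: "S + T * ?u = ?u" unfolding S_def T_def d by (simp add: algebra_simps)
 have "of_circle (zc x) * (1 - \<i> * of_real ?u) = Complex (?u * S - T) (S + T * ?u)"
  by (simp add: of_circle_zc complex_eq_iff S_def[symmetric] T_def[symmetric])
 also have "\<dots> = 1 + \<i> * of_real ?u" unfolding c d by (simp add: complex_eq_iff)
 finally have "of_circle (zc x) * (1 - \<i> * of_real ?u) = 1 + \<i> * of_real ?u" .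
 then have "(1 + \<i> * of_real ?u) / (1 - \<i> * of_real ?u) = of_circle (zc x)"
  using n by (metis nonzero_eq_divide_eq)
 then show ?thesis by (simp add: Zc_def exp_of_real)
qed

lemma Zc_shift: "Zc (of_real x + \<i> * of_real pi) = inverse (of_circle (zc x))"
proof -
 have "exp (of_real x + \<i> * of_real pi) = - exp (of_real x)" by (simp add: exp_add exp_pi_i' mult.commute)
 then have "Zc (of_real x + \<i> * of_real pi) = inverse (Zc (of_real x))" by (simp add: Zc_def)
 then show ?thesis by (simp add: Zc_real)
qed

text \<open>\<open>Zc\<close> maps the strip into the unit disc, so its nonnegative powers are
  bounded there and the contour may be moved from one edge to the other. On the upper edge
  \<open>Zc\<close> runs through the lower half circle.\<close>

lemma strip_integral:
 assumes "ent \<tau>"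
 shows "(LINT x|lborel. \<tau> (of_real x) * of_circle (zc x) ^ n) =
  (LINT x|lborel. \<tau> (of_real x + \<i> * of_real pi) * inverse (of_circle (zc x)) ^ n)"
proof -
 obtain C where C: "C \<ge> 0" "\<And>\<zeta>. \<bar>Im \<zeta>\<bar> \<le> pi \<Longrightarrow> norm (\<tau> \<zeta>) \<le> C * exp (- 1 * \<bar>Re \<zeta>\<bar>)"
  using entD[OF assms] by metis
 have h: "\<tau> holomorphic_on A" for A using assms holomorphic_on_subset by (auto simp: ent_def)
 have "(LINT x|lborel. (\<lambda>\<zeta>. \<tau> \<zeta> * Zc \<zeta> ^ n) (of_real x)) = (LINT x|lborel. (\<lambda>\<zeta>. \<tau> \<zeta> * Zc \<zeta> ^ n) (of_real x + \<i> * of_real pi))"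
 proof (rule contour_shift)
  show "(\<lambda>\<zeta>. \<tau> \<zeta> * Zc \<zeta> ^ n) holomorphic_on {\<zeta>. - 1 < Im \<zeta> \<and> Im \<zeta> < pi + 1}"
   by (intro holomorphic_intros h holomorphic_Zc)
  fix \<zeta> assume i: "0 \<le> Im \<zeta>" "Im \<zeta> \<le> pi"
  have "norm (\<tau> \<zeta> * Zc \<zeta> ^ n) \<le> (C * exp (- \<bar>Re \<zeta>\<bar>)) * 1 ^ n"
   unfolding norm_mult norm_power by (intro mult_mono power_mono Zc_bound i) (use C(1) C(2)[of \<zeta>] i in auto)
  then show "norm (\<tau> \<zeta> * Zc \<zeta> ^ n) \<le> C * exp (- \<bar>Re \<zeta>\<bar>)" by simp
 qed
 then show ?thesis by (simp add: Zc_real Zc_shift)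
qed

text \<open>The Jacobian of the substitution \<open>theta_of\<close> is the height
  \<open>Im\<close>, which cancels the weight -1.\<close>

lemma upper_half_integral:
 assumes "ent \<tau>"
 shows "integral {0..pi} (\<lambda>t. he (-1) \<tau> (circ t) * of_circle (circ t) powi j) =
  (LINT x|lborel. \<tau> (of_real x) * of_circle (zc x) powi j)"
proof -
 let ?f = "\<lambda>t. he (-1) \<tau> (circ t) * of_circle (circ t) powi j"
 have sm: "he (-1) \<tau> \<in> smooth" by (rule smooth_he[OF assms])
 have cf: "continuous_on A ?f" for A
  unfolding of_circle_circ cis_powi by (intro continuous_intros smooth_continuous_circ sm)
 have ht: "\<tau> holomorphic_on UNIV" using assms by (simp add: ent_def)
 have th: "Im (of_circle (zc x)) *\<^sub>R ?f (theta_of x) = \<tau> (of_real x) * of_circle (zc x) powi j" for x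
  using Im_zc(2)[of x] by (simp add: circ_theta_of he_def hf_def power_int_minus scaleR_conv_of_real del: of_circle_circ)
 have cz: "continuous_on UNIV (\<lambda>x. \<tau> (of_real x) * of_circle (zc x) powi j)"
  unfolding circ_theta_of[symmetric] of_circle_circ cis_powi theta_of_def
  by (intro continuous_intros continuous_on_compose2[OF holomorphic_on_imp_continuous_on[OF ht]]) auto
 have int: "integrable lborel (\<lambda>x. \<tau> (of_real x) * of_circle (zc x) powi j)"
 proof -
  obtain C where C: "C \<ge> 0" "\<And>\<zeta>. \<bar>Im \<zeta>\<bar> \<le> 0 \<Longrightarrow> norm (\<tau> \<zeta>) \<le> C * exp (- 1 * \<bar>Re \<zeta>\<bar>)"
   using entD[OF assms] by metis
  show ?thesis using C(2)[of "of_real _"]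
   by (intro integrable_exp_bound[where C = C] cz) (auto simp: norm_mult norm_power_int)
 qed
 have "(LBINT t=0..pi. ?f t) = (LBINT x=-\<infinity>..\<infinity>. Im (of_circle (zc x)) *\<^sub>R ?f (theta_of x))"
 proof (rule interval_integral_substitution_integrable)
  show "(theta_of has_real_derivative Im (of_circle (zc x))) (at x)" for x by (rule theta_of_derivative)
  show "isCont ?f (theta_of x)" for x using cf[of UNIV] by (simp add: continuous_on_eq_continuous_at)
  show "isCont (\<lambda>x. Im (of_circle (zc x))) x" for x unfolding Im_zc by (auto intro!: continuous_intros)
  show "0 \<le> Im (of_circle (zc x))" for x using Im_zc(2)[of x] by simp
  have bot: "((\<lambda>x. theta_of x) \<longlongrightarrow> 0) at_bot"
  proof -
   have "((\<lambda>x. 2 * arctan (exp x)) \<longlongrightarrow> 2 * arctan 0) at_bot" by (intro tendsto_intros exp_at_bot)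
   then show ?thesis by (simp add: theta_of_def[abs_def])
  qed
  have top: "((\<lambda>x. theta_of x) \<longlongrightarrow> pi) at_top"
  proof -
   have "((\<lambda>x. 2 * arctan (exp x)) \<longlongrightarrow> 2 * (pi / 2)) at_top"
    by (intro tendsto_intros filterlim_compose[OF tendsto_arctan_at_top] exp_at_top)
   then show ?thesis by (simp add: theta_of_def[abs_def])
  qed
  show "((ereal \<circ> theta_of \<circ> real_of_ereal) \<longlongrightarrow> 0) (at_right (- \<infinity>))"
   using bot by (simp add: ereal_tendsto_simps1 zero_ereal_def o_assoc ereal_tendsto_simps)
  show "((ereal \<circ> theta_of \<circ> real_of_ereal) \<longlongrightarrow> ereal pi) (at_left \<infinity>)"
   using top by (simp add: ereal_tendsto_simps1 o_assoc ereal_tendsto_simps)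
  show "set_integrable lborel (einterval (- \<infinity>) \<infinity>) (\<lambda>x. Im (of_circle (zc x)) *\<^sub>R ?f (theta_of x))"
   unfolding th using int by (simp add: set_integrable_def)
  have "set_integrable lborel {0..pi} ?f" by (intro borel_integrable_atLeastAtMost' cf)
  then show "set_integrable lborel (einterval 0 (ereal pi)) ?f"
   by (rule set_integrable_subset) (auto simp: einterval_def zero_ereal_def)
 qed auto
 moreover have "(LBINT t=0..pi. ?f t) = integral {0..pi} ?f"
  using interval_integral_eq_integral[of 0 pi ?f] borel_integrable_atLeastAtMost'[OF cf] by (simp add: zero_ereal_def)
 moreover have "(LBINT x=-\<infinity>..\<infinity>. Im (of_circle (zc x)) *\<^sub>R ?f (theta_of x)) = (LINT x|lborel. \<tau> (of_real x) * of_circle (zc x) powi j)"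
  unfolding th by (simp add: interval_lebesgue_integral_def set_lebesgue_integral_def)
 ultimately show ?thesis by simp
qed

text \<open>The function below has only positive Fourier modes: on the upper and lower half circle it
 is given by the two boundary values of one holomorphic function on the disc.\<close>

lemma fc_reflection:
 assumes e: "ent \<tau>" and j: "j \<le> 0"
 defines "f \<equiv> \<lambda>z. he (-1) \<tau> z - he (-1) (\<lambda>\<zeta>. \<tau> (\<zeta> + \<i> * of_real pi)) (circle_inv z)"
 shows "fc j f = 0"
proof -
 let ?\<sigma> = "\<lambda>\<zeta>. \<tau> (\<zeta> + \<i> * of_real pi)"
 have e': "ent ?\<sigma>" by (rule ent_translate[OF e])
 have fs: "f \<in> smooth" unfolding f_def by (intro smooth_diff smooth_he smooth_he_inv e e')
 let ?g = "\<lambda>t. f (circ t) * cis (- of_int j * t)"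
 have cg: "continuous_on A ?g" for A by (intro continuous_intros smooth_continuous_circ fs)
 have "integral {-pi..pi} ?g = integral {-pi..0} ?g + integral {0..pi} ?g"
  by (rule Henstock_Kurzweil_Integration.integral_combine[symmetric], simp, simp, intro integrable_continuous_interval cg)
 also have "integral {0..pi} ?g = integral {0..pi} (\<lambda>t. he (-1) \<tau> (circ t) * of_circle (circ t) powi (- j))"
 proof (rule integral_cong)
  fix t assume "t \<in> {0..pi}"
  then have "sin t \<ge> 0" by (intro sin_ge_zero) auto
  then show "?g t = he (-1) \<tau> (circ t) * of_circle (circ t) powi (- j)"
   by (auto simp: f_def he_def hf_def cis_powi not_less)
 qed
 also have "\<dots> = (LINT x|lborel. \<tau> (of_real x) * of_circle (zc x) powi (- j))" by (rule upper_half_integral[OF e])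
 \<comment> \<open>The exponent \<open>- j\<close> is nonnegative, as the contour shift requires;
   this is where the sign of the mode enters.\<close>
 also have "\<dots> = (LINT x|lborel. \<tau> (of_real x) * of_circle (zc x) ^ nat (- j))"
  using j by (simp add: power_int_def)
 also have "\<dots> = (LINT x|lborel. ?\<sigma> (of_real x) * inverse (of_circle (zc x)) ^ nat (- j))"
  by (rule strip_integral[OF e])
 also have "\<dots> = (LINT x|lborel. ?\<sigma> (of_real x) * of_circle (zc x) powi j)"
  using j by (intro Bochner_Integration.integral_cong) (auto simp: power_int_def)
 also have "\<dots> = integral {0..pi} (\<lambda>t. he (-1) ?\<sigma> (circ t) * of_circle (circ t) powi j)"
  by (rule upper_half_integral[OF e', symmetric])
 \<comment> \<open>Reversing the angle brings the integral to the lower half circle, where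
   \<open>f\<close> is minus the reflected function.\<close>
 also have "\<dots> = integral {-pi..0} (\<lambda>t. he (-1) ?\<sigma> (circ (- t)) * of_circle (circ (- t)) powi j)"
  using Henstock_Kurzweil_Integration.integral_reflect_real[of pi 0 "\<lambda>t. he (-1) ?\<sigma> (circ t) * of_circle (circ t) powi j"] by simp
 also have "\<dots> = integral {-pi..0} (\<lambda>t. - ?g t)"
 proof (rule integral_cong)
  fix t assume "t \<in> {-pi..0}"
  then have "sin (- t) \<ge> 0" by (intro sin_ge_zero) auto
  then show "he (-1) ?\<sigma> (circ (- t)) * of_circle (circ (- t)) powi j = - ?g t"
   by (auto simp: f_def he_def hf_def cis_powi not_less)
 qed
 also have "\<dots> = - integral {-pi..0} ?g" by simp
 finally have "integral {-pi..pi} ?g = 0" by simp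
 then show ?thesis by (simp add: fc_def cmean_def)
qed

section \<open>Involutive theories\<close>

context involutive_wightman_cft
begin

lemma B_left: "B (u + v) w = B u w + B v w" "B (s c v) w = c * B v w"
 using form_linear[of w] by (simp_all add: linear_iff_functional)

lemma B_right: "B w (u + v) = B w u + B w v" "B w (s c v) = cnj c * B w v"
 using B_left form_hermitian by (metis complex_cnj_add, metis complex_cnj_mult)

lemma lin_B: "lin (\<lambda>v. B v w)"
 by (simp add: lin_def B_left)

lemma B_zero [simp]: "B 0 w = 0" "B w 0 = 0"
 using lin_zero[OF lin_B] form_hermitian[of w 0] by auto

lemma B_diff: "B (u - v) w = B u w - B v w"
 by (rule lin_diff[OF lin_B])

lemma B_eqI: "(\<And>w. B u w = B v w) \<Longrightarrow> u = v"
 using form_nondegenerate[of "u - v"] by (simp add: B_diff)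

lemma B_eqI_right: "(\<And>w. B w u = B w v) \<Longrightarrow> u = v"
 by (rule B_eqI) (metis form_hermitian)

text \<open>Continuity of the form gives a neighbourhood of 0 on which the functional is at most 1,
  the situation of \<open>Lf_neighbourhood\<close>.\<close>

lemma Lf_B: "Lf (\<lambda>v. B v w)"
proof (rule Lf_neighbourhood[OF lin_B])
 let ?T = "\<T>"
 have "continuous_map ?T (prod_topology ?T ?T) (\<lambda>v. (v, w))" by (simp add: continuous_map_pairwise o_def)
 from continuous_map_compose[OF this form_continuous] have c: "continuous_map ?T euclidean (\<lambda>v. B v w)"
  by (simp add: o_def)
 show "openin ?T {v \<in> topspace ?T. B v w \<in> ball 0 1}" by (rule openin_continuous_map_preimage[OF c]) simp
qed auto

lemma pct_zero [simp]: "\<theta> 0 = 0"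
 using pct_add[of 0 0] by simp

lemma pct_form: "B v (\<theta> w) = B w (\<theta> v)"
 using pct_antiunitary[of "\<theta> v" w] form_hermitian[of "\<theta> v" w] by (simp add: pct_involution)

text \<open>The field \<open>\<phi>\<^sup>\<prime> = (-1)^d \<phi>\<^sup>\<dagger>\<close> of the family, that is \<open>\<phi>\<^sup>\<prime>(f) = \<theta> \<phi>(cnj f \<circ> inv) \<theta>\<close>.\<close>

definition pr :: "'v distribution \<Rightarrow> 'v distribution"
 where "pr \<phi> = (\<lambda>f\<in>smooth. \<lambda>v. s ((- 1) ^ cdim \<phi>) (pct_adjoint s \<theta> (cdim \<phi>) \<phi> f v))"

lemma pr_F: "\<phi> \<in> F \<Longrightarrow> pr \<phi> \<in> F"
 unfolding pr_def by (rule pct_field)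

lemma minus_one_square [simp]: "(- 1 :: complex) ^ n * (- 1) ^ n = 1"
 by (simp flip: power_mult_distrib)

lemma pr_eq: "f \<in> smooth \<Longrightarrow> pr \<phi> f v = \<theta> (\<phi> (\<lambda>z. cnj (f (circle_inv z))) (\<theta> v))"
 by (simp add: pr_def pct_adjoint_def)

lemma smooth_ci: "f \<in> smooth \<Longrightarrow> (\<lambda>z. cnj (f (circle_inv z))) \<in> smooth"
 by (intro smooth_cnj smooth_inv)

lemma pct_field_eq: "f \<in> smooth \<Longrightarrow> \<theta> (\<phi> f v) = pr \<phi> (\<lambda>z. cnj (f (circle_inv z))) (\<theta> v)"
 by (simp add: pr_eq smooth_ci pct_involution)

lemma field_adjoint:
 assumes "\<phi> \<in> F" "f \<in> smooth"
 shows "B (\<phi> f v) w = (- 1) ^ cdim \<phi> * B v (pr \<phi> (\<lambda>z. cnj (f z)) w)"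
proof -
 have "B (\<phi> f v) w = B v (pct_adjoint s \<theta> (cdim \<phi>) \<phi> (\<lambda>z. cnj (f z)) w)"
  by (rule form_field_invariant[OF assms])
 moreover have "pr \<phi> (\<lambda>z. cnj (f z)) w = s ((- 1) ^ cdim \<phi>) (pct_adjoint s \<theta> (cdim \<phi>) \<phi> (\<lambda>z. cnj (f z)) w)"
  using smooth_cnj[OF assms(2)] by (simp add: pr_def)
 ultimately show ?thesis by (simp add: B_right flip: mult.assoc)
qed

lemma U_form: "\<gamma> \<in> Mob \<Longrightarrow> B (U \<gamma> v) w = B v (U (inv \<gamma>) w)"
 using form_Mob_invariant[of \<gamma> v "U (inv \<gamma>) w"] U_inv(1)[of \<gamma> w] by simp

text \<open>The axioms state no relation between \<open>cdim (pr \<phi>)\<close> and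
  \<open>cdim \<phi>\<close>. The covariance of \<open>pr \<phi>\<close> with the dimension of
  \<open>\<phi>\<close> is read off from the invariance of the form.\<close>

lemma U_pr:
 assumes \<gamma>: "\<gamma> \<in> Mob" and \<phi>: "\<phi> \<in> F" and f: "f \<in> smooth"
 shows "U \<gamma> (pr \<phi> f v) = pr \<phi> (beta (cdim \<phi>) \<gamma> f) (U \<gamma> v)"
proof (rule B_eqI_right)
 fix w
 let ?d = "cdim \<phi>"
 let ?cf = "\<lambda>z. cnj (f z)"
 note m = Mob_inv[OF \<gamma>]
 have ii: "inv (inv \<gamma>) = \<gamma>" using inv_inv_eq[OF m(4)] .
 have adj: "B x (pr \<phi> g y) = (- 1) ^ ?d * B (\<phi> (\<lambda>z. cnj (g z)) x) y" if "g \<in> smooth" for x y g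
  using field_adjoint[OF \<phi> smooth_cnj[OF that], of x y] by (simp flip: mult.assoc)
 have "B w (U \<gamma> (pr \<phi> f v)) = B (U (inv \<gamma>) w) (pr \<phi> f v)"
  using U_form[OF m(1), of w] ii by simp
 also have "\<dots> = (- 1) ^ ?d * B (\<phi> ?cf (U (inv \<gamma>) w)) v" by (rule adj[OF f])
 also have "B (\<phi> ?cf (U (inv \<gamma>) w)) v = B (U \<gamma> (\<phi> ?cf (U (inv \<gamma>) w))) (U \<gamma> v)"
  by (rule form_Mob_invariant[OF \<gamma>, symmetric])
 also have "U \<gamma> (\<phi> ?cf (U (inv \<gamma>) w)) = \<phi> (\<lambda>z. cnj (beta ?d \<gamma> f z)) w"
  by (simp add: U_field[OF \<gamma> \<phi> smooth_cnj[OF f]] U_inv(1)[OF \<gamma>] beta_cnj[OF \<gamma>])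
 also have "(- 1) ^ ?d * B (\<phi> (\<lambda>z. cnj (beta ?d \<gamma> f z)) w) (U \<gamma> v) = B w (pr \<phi> (beta ?d \<gamma> f) (U \<gamma> v))"
  by (rule adj[OF smooth_beta[OF \<gamma> f], symmetric])
 finally show "B w (U \<gamma> (pr \<phi> f v)) = B w (pr \<phi> (beta ?d \<gamma> f) (U \<gamma> v))" .
qed

text \<open>Both operators fix \<open>\<Omega>\<close>, and on test functions dilations commute with
  conjugation and with the reflection; \<open>U_pr\<close> handles the conjugated field.\<close>

lemma pct_dil: "\<theta> (U (dil t) v) = U (dil t) (\<theta> v)"
proof (induction v rule: D_induct)
 case (add u v)
 then show ?case by (simp add: U_linear[OF dil_Mob] pct_add)
next
 case (scale c v)
 then show ?case by (simp add: U_linear[OF dil_Mob] pct_scale)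
next
 case (opl xs)
 then show ?case
 proof (induction xs)
  case Nil
  then show ?case by (simp add: vacuum_invariant dil_Mob pct_vacuum)
 next
  case (Cons x xs)
  obtain \<phi> f where x: "x = (\<phi>, f)" and \<phi>: "\<phi> \<in> F" and f: "f \<in> smooth" and xs: "set xs \<subseteq> FS"
   using Cons.prems by (cases x) (auto simp: FS_def)
  let ?v = "opl xs \<Omega>" and ?d = "cdim \<phi>"
  have fe: "beta ?d (dil t) f \<in> smooth" by (rule smooth_beta[OF dil_Mob f])
  have "\<theta> (U (dil t) (\<phi> f ?v)) = \<theta> (\<phi> (beta ?d (dil t) f) (U (dil t) ?v))"
   by (simp add: U_field[OF dil_Mob \<phi> f])
  also have "\<dots> = pr \<phi> (\<lambda>z. cnj (beta ?d (dil t) f (circle_inv z))) (U (dil t) (\<theta> ?v))"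
   by (simp add: pct_field_eq[OF fe] Cons.IH[OF xs])
  also have "(\<lambda>z. cnj (beta ?d (dil t) f (circle_inv z))) = beta ?d (dil t) (\<lambda>z. cnj (f (circle_inv z)))"
   using beta_cnj[OF dil_Mob, of ?d t "\<lambda>z. f (circle_inv z)"] beta_dil_inv[of ?d t f] by simp
  also have "pr \<phi> (beta ?d (dil t) (\<lambda>z. cnj (f (circle_inv z)))) (U (dil t) (\<theta> ?v)) = U (dil t) (pr \<phi> (\<lambda>z. cnj (f (circle_inv z))) (\<theta> ?v))"
   by (rule U_pr[OF dil_Mob \<phi> smooth_ci[OF f], symmetric])
  also have "\<dots> = U (dil t) (\<theta> (\<phi> f ?v))" by (simp add: pct_field_eq[OF f])
  finally show ?case by (simp add: x)
 qed
qed

lemma field_tendsto_eqI: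
 assumes "\<phi> \<in> F" "\<And>n::nat. f n \<in> smooth" "f0 \<in> smooth"
  "\<And>N. (\<lambda>n. C_norm N (\<lambda>z. f n z - f0 z)) \<longlonglongrightarrow> 0"
  and l: "Lf l" "Lf l'" and eq: "\<And>n. l (\<phi> (f n) u) = l' (\<phi> (f n) v)"
 shows "l (\<phi> f0 u) = l' (\<phi> f0 v)"
 using LIMSEQ_unique[OF Lf_tendsto[OF l(1) assms(1-4), of u]] Lf_tendsto[OF l(2) assms(1-4), of v] by (simp add: eq)

text \<open>Fields with test functions vanishing off the open upper half circle, but possibly supported up to
 its end points, are limits of fields localised in the upper half circle.\<close>

lemma commute_upper_closed:
 assumes \<phi>: "\<phi> \<in> F" and f: "f \<in> smooth" and z: "\<And>z. f z \<noteq> 0 \<Longrightarrow> Im (of_circle z) \<ge> 0"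
  and adj: "\<And>v w. B (x v) w = B v (xs w)"
  and com: "\<And>g v. g \<in> smooth \<Longrightarrow> supp g \<subseteq> upper \<Longrightarrow> x (\<phi> g v) = \<phi> g (x v)"
 shows "x (\<phi> f v) = \<phi> f (x v)"
proof (rule B_eqI)
 fix w
 \<comment> \<open>The contraction serves to approximate \<open>f\<close>, so the weight 0 may be
   taken whatever the dimension of \<open>\<phi>\<close>.\<close>
 let ?g = "\<lambda>n. beta 0 (ctr (1 / real (Suc n))) f"
 have sg: "?g n \<in> smooth" for n by (rule smooth_beta[OF ctr_Mob f])
 have "B (\<phi> f v) (xs w) = B (\<phi> f (x v)) w"
 proof (rule field_tendsto_eqI[OF \<phi> sg f beta_ctr_tendsto[OF f] Lf_B Lf_B])
  fix n
  have "supp (?g n) \<subseteq> upper" by (rule beta_ctr_supp[OF z]) auto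
  then show "B (\<phi> (?g n) v) (xs w) = B (\<phi> (?g n) (x v)) w" using com[OF sg] adj by metis
 qed
 then show "B (x (\<phi> f v)) w = B (\<phi> f (x v)) w" by (simp add: adj)
qed

lemma he_support: "he m \<tau> z \<noteq> 0 \<Longrightarrow> Im (of_circle z) > 0"
 by (auto simp: he_def hf_def split: if_splits)

text \<open>The two supports may meet at 1 and -1, so locality applies only after one function has
  been contracted; \<open>commute_upper_closed\<close> takes the limit.\<close>

lemma upper_lower_commute:
 assumes \<phi>: "\<phi> \<in> F" "\<psi> \<in> F" and f: "f \<in> smooth" "\<And>z. f z \<noteq> 0 \<Longrightarrow> Im (of_circle z) \<ge> 0"
  and g: "g \<in> smooth" "\<And>z. g z \<noteq> 0 \<Longrightarrow> Im (of_circle z) \<le> 0"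
 shows "\<psi> g (\<phi> f v) = \<phi> f (\<psi> g v)"
proof (rule commute_upper_closed[OF \<phi>(1) f])
 show "B (\<psi> g v) w = B v ((\<lambda>w. s ((- 1) ^ cdim \<psi>) (pr \<psi> (\<lambda>z. cnj (g z)) w)) w)" for v w
  by (simp add: field_adjoint[OF \<phi>(2) g(1)] B_right)
 fix h v assume h: "h \<in> smooth" "supp h \<subseteq> upper"
 have "supp g \<subseteq> {z. Im (of_circle z) \<le> 0}"
  by (rule supp_subset_closed) (auto intro!: closed_Collect_le continuous_intros continuous_Im_circle g(2))
 then have g0: "Im (of_circle z) \<le> 0" if "z \<in> supp g" for z using that by blast
 have h0: "Im (of_circle z) > 0" if "z \<in> supp h" for z using that h(2) by (auto simp: upper_def)
 have "supp g \<inter> supp h = {}" using g0 h0 by force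
 from locality[OF \<phi>(2,1) g(1) h(1) this] show "\<psi> g (\<phi> h v) = \<phi> h (\<psi> g v)"
  by (simp add: fun_eq_iff)
qed

section \<open>Reflection of vacuum vectors built from entire test functions\<close>

lemma ej_vacuum: "\<phi> \<in> F \<Longrightarrow> j > 0 \<Longrightarrow> \<phi> (ej j) \<Omega> = 0"
proof -
 assume \<phi>: "\<phi> \<in> F" "j > 0"
 have "\<Omega> \<in> Eig 0" by (simp add: Eig_def vacuum_invariant rot_Mob)
 from Eig_field[OF this \<phi>(1), of j] show ?thesis using \<phi>(2) Eig_neg by force
qed

text \<open>Each positive mode would lower the energy of the vacuum below zero and thus annihilates
  it; the approximation by \<open>fej\<close> has no other modes.\<close>

lemma vacuum_positive_modes:
 assumes \<phi>: "\<phi> \<in> F" and f: "f \<in> smooth" and j: "\<And>j. j \<le> 0 \<Longrightarrow> fc j f = 0"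
 shows "\<phi> f \<Omega> = 0"
proof (rule B_eqI)
 fix w
 have z: "\<phi> (fej n f) \<Omega> = 0" for n
 proof -
  have "\<phi> (fej n f) \<Omega> = (\<Sum>j\<in>{- int n..int n}. s (fw n j * fc j f) (\<phi> (ej j) \<Omega>))"
   unfolding fej_def[abs_def] using \<phi> by (subst field_fsum) (auto intro!: smooth_cmult simp: field_fscale)
  also have "\<dots> = 0"
  proof (rule sum.neutral, rule ballI)
   fix i
   show "s (fw n i * fc i f) (\<phi> (ej i) \<Omega>) = 0"
    using j[of i] ej_vacuum[OF \<phi>, of i] by (cases "i \<le> 0") auto
  qed
  finally show ?thesis .
 qed
 have "(\<lambda>n. B (\<phi> (fej n f) \<Omega>) w) \<longlonglongrightarrow> B (\<phi> f \<Omega>) w"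
  by (rule Lf_tendsto[OF Lf_B \<phi> smooth_fej f fej_tendsto[OF f]])
 then show "B (\<phi> f \<Omega>) w = B 0 w" by (simp add: z LIMSEQ_const_iff)
qed

definition shift :: "complex \<Rightarrow> (complex \<Rightarrow> complex) \<Rightarrow> complex \<Rightarrow> complex"
 where "shift c \<tau> = (\<lambda>\<zeta>. \<tau> (\<zeta> + c))"

lemma ent_shift: "ent \<tau> \<Longrightarrow> ent (shift c \<tau>)"
 unfolding shift_def by (rule ent_translate)

lemma vacuum_reflection:
 assumes \<phi>: "\<phi> \<in> F" and \<tau>: "ent \<tau>"
 shows "\<phi> (he (-1) \<tau>) \<Omega> = \<phi> (\<lambda>z. he (-1) (shift (\<i> * of_real pi) \<tau>) (circle_inv z)) \<Omega>"
proof -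
 let ?g = "\<lambda>z. he (-1) (shift (\<i> * of_real pi) \<tau>) (circle_inv z)"
 have sm: "he (-1) \<tau> \<in> smooth" "?g \<in> smooth" by (intro smooth_he smooth_he_inv \<tau> ent_shift)+
 have "\<phi> (\<lambda>z. he (-1) \<tau> z - ?g z) \<Omega> = 0"
  using fc_reflection[OF \<tau>] by (intro vacuum_positive_modes \<phi> smooth_diff sm) (simp add: shift_def)
 then show ?thesis by (simp add: field_fdiff[OF \<phi> sm])
qed

definition ET :: "('v distribution \<times> (complex \<Rightarrow> complex)) set"
 where "ET = {(\<phi>, \<tau>). \<phi> \<in> F \<and> ent \<tau>}"

definition up :: "('v distribution \<times> (complex \<Rightarrow> complex)) list \<Rightarrow> ('v distribution \<times> (circle \<Rightarrow> complex)) list"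
 where "up = map (\<lambda>(\<phi>, \<tau>). (\<phi>, he (-1) \<tau>))"

text \<open>The order is reversed because in \<open>up_dn\<close> every further field is moved past
  the reflected ones to reach the vacuum.\<close>

definition dn :: "('v distribution \<times> (complex \<Rightarrow> complex)) list \<Rightarrow> ('v distribution \<times> (circle \<Rightarrow> complex)) list"
 where "dn ts = rev (map (\<lambda>(\<phi>, \<tau>). (\<phi>, \<lambda>z. he (-1) \<tau> (circle_inv z))) ts)"

definition sh :: "complex \<Rightarrow> ('v distribution \<times> (complex \<Rightarrow> complex)) list \<Rightarrow> ('v distribution \<times> (complex \<Rightarrow> complex)) list"
 where "sh c = map (\<lambda>(\<phi>, \<tau>). (\<phi>, shift c \<tau>))"

text \<open>The product of the signs from \<open>field_adjoint\<close>.\<close>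

definition sgl :: "('v distribution \<times> (complex \<Rightarrow> complex)) list \<Rightarrow> complex"
 where "sgl ts = (\<Prod>(\<phi>, \<tau>)\<leftarrow>ts. (- 1) ^ cdim \<phi>)"

lemma list_simps [simp]:
 "up [] = []" "up ((\<phi>, \<tau>) # ts) = (\<phi>, he (-1) \<tau>) # up ts"
 "dn [] = []" "dn ((\<phi>, \<tau>) # ts) = dn ts @ [(\<phi>, \<lambda>z. he (-1) \<tau> (circle_inv z))]"
 "sh c [] = []" "sh c ((\<phi>, \<tau>) # ts) = (\<phi>, shift c \<tau>) # sh c ts"
 "sgl [] = 1" "sgl ((\<phi>, \<tau>) # ts) = (- 1) ^ cdim \<phi> * sgl ts"
 by (simp_all add: up_def dn_def sh_def sgl_def)

lemma sh_ET: "set ts \<subseteq> ET \<Longrightarrow> set (sh c ts) \<subseteq> ET"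
 by (auto simp: sh_def ET_def ent_shift)

lemma up_FS: "set ts \<subseteq> ET \<Longrightarrow> set (up ts) \<subseteq> FS"
 by (auto simp: up_def ET_def FS_def smooth_he)

lemma he_inv_support: "he m \<tau> (circle_inv z) \<noteq> 0 \<Longrightarrow> Im (of_circle z) < 0"
 using he_support[of m \<tau> "circle_inv z"] by (simp add: of_circle_inv_cnj del: of_circle_inv)

lemma dn_commute:
 assumes "set ts \<subseteq> ET" "\<phi> \<in> F" "ent \<tau>"
 shows "\<phi> (he (-1) \<tau>) (opl (dn ts) v) = opl (dn ts) (\<phi> (he (-1) \<tau>) v)"
 using assms(1)
proof (induction ts arbitrary: v)
 case (Cons x ts)
 obtain \<psi> \<sigma> where x: "x = (\<psi>, \<sigma>)" by (cases x)
 have \<psi>: "\<psi> \<in> F" "ent \<sigma>" "set ts \<subseteq> ET" using Cons.prems by (auto simp: x ET_def)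
 have "\<psi> (\<lambda>z. he (-1) \<sigma> (circle_inv z)) (\<phi> (he (-1) \<tau>) v) = \<phi> (he (-1) \<tau>) (\<psi> (\<lambda>z. he (-1) \<sigma> (circle_inv z)) v)"
  using he_support he_inv_support
  by (intro upper_lower_commute assms \<psi> smooth_he smooth_he_inv) (auto intro: less_imp_le)
 then show ?case using Cons.IH[OF \<psi>(3)] by (simp add: x opl_append)
qed simp

lemma up_dn: "set ts \<subseteq> ET \<Longrightarrow> opl (up ts) \<Omega> = opl (dn (sh (\<i> * of_real pi) ts)) \<Omega>"
proof (induction ts)
 case (Cons x ts)
 obtain \<phi> \<tau> where x: "x = (\<phi>, \<tau>)" by (cases x)
 have \<phi>: "\<phi> \<in> F" "ent \<tau>" "set ts \<subseteq> ET" using Cons.prems by (auto simp: x ET_def)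
 show ?case
  using Cons.IH[OF \<phi>(3)] dn_commute[OF sh_ET[OF \<phi>(3)] \<phi>(1,2)] vacuum_reflection[OF \<phi>(1,2)]
  by (simp add: x opl_append)
qed simp

text \<open>The adjoint of a field with a reflected function is, up to its sign, the field with the
  original function conjugated by \<open>\<theta>\<close>. Taking adjoints reverses the order, which
  undoes the reversal in \<open>dn\<close>.\<close>

lemma dn_adjoint: "set ts \<subseteq> ET \<Longrightarrow> B (opl (dn ts) v) w = sgl ts * B v (\<theta> (opl (up ts) (\<theta> w)))"
proof (induction ts arbitrary: v w)
 case Nil
 then show ?case by (simp add: pct_involution)
next
 case (Cons x ts)
 obtain \<phi> \<tau> where x: "x = (\<phi>, \<tau>)" by (cases x)
 have \<phi>: "\<phi> \<in> F" "ent \<tau>" "set ts \<subseteq> ET" using Cons.prems by (auto simp: x ET_def)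
 have "B (opl (dn (x # ts)) v) w = sgl ts * B (\<phi> (\<lambda>z. he (-1) \<tau> (circle_inv z)) v) (\<theta> (opl (up ts) (\<theta> w)))"
  by (simp add: x opl_append Cons.IH[OF \<phi>(3)])
 also have "\<dots> = sgl ts * ((- 1) ^ cdim \<phi> * B v (\<theta> (\<phi> (he (-1) \<tau>) (opl (up ts) (\<theta> w)))))"
  by (simp add: field_adjoint[OF \<phi>(1) smooth_he_inv[OF \<phi>(2)]] pct_field_eq[OF smooth_he[OF \<phi>(2)]])
 finally show ?case by (simp add: x)
qed

lemma sgl_square [simp]: "sgl ts * sgl ts = 1"
proof (induction ts)
 case (Cons x ts)
 obtain \<phi> \<tau> where x: "x = (\<phi>, \<tau>)" by (cases x)
 have "sgl (x # ts) * sgl (x # ts) = ((- 1) ^ cdim \<phi> * (- 1) ^ cdim \<phi>) * (sgl ts * sgl ts)"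
  by (simp only: x list_simps mult_ac)
 then show ?case using Cons by simp
qed simp

lemma up_adjoint: "set ts \<subseteq> ET \<Longrightarrow> B (opl (up ts) v) w = sgl ts * B v (\<theta> (opl (dn ts) (\<theta> w)))"
proof -
 assume ts: "set ts \<subseteq> ET"
 have "B (opl (dn ts) (\<theta> w)) (\<theta> v) = sgl ts * B (\<theta> w) (\<theta> (opl (up ts) v))"
  using dn_adjoint[OF ts, of "\<theta> w" "\<theta> v"] by (simp add: pct_involution)
 then have "sgl ts * B (opl (dn ts) (\<theta> w)) (\<theta> v) = sgl ts * sgl ts * B (\<theta> w) (\<theta> (opl (up ts) v))" by simp
 moreover have "B (\<theta> w) (\<theta> (opl (up ts) v)) = B (opl (up ts) v) w"
  using pct_antiunitary[of w "opl (up ts) v"] form_hermitian[of "opl (up ts) v" w] by simp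
 moreover have "B (opl (dn ts) (\<theta> w)) (\<theta> v) = B v (\<theta> (opl (dn ts) (\<theta> w)))" by (rule pct_form)
 ultimately show ?thesis by simp
qed

section \<open>Operators commuting with the fields of a half circle\<close>

definition loc :: "circle set \<Rightarrow> ('v \<Rightarrow> 'v) \<Rightarrow> ('v \<Rightarrow> 'v) \<Rightarrow> bool"
 where "loc I y ys \<longleftrightarrow> (\<forall>v w. B (y v) w = B v (ys w)) \<and>
  (\<forall>\<phi>\<in>F. \<forall>f\<in>smooth. supp f \<subseteq> I \<longrightarrow> (\<forall>v. y (\<phi> f v) = \<phi> f (y v)))"

text \<open>Adjoints of the fields localised in \<open>I\<close> are, up to sign, again fields of
  the family localised in \<open>I\<close>, so commutation with them passes to the adjoint
  operator.\<close>

lemma loc_adjoint: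
 assumes "loc I x xs" shows "loc I xs x"
proof -
 have adj: "B (x v) w = B v (xs w)" and com: "\<phi> \<in> F \<Longrightarrow> f \<in> smooth \<Longrightarrow> supp f \<subseteq> I \<Longrightarrow> x (\<phi> f v) = \<phi> f (x v)" for v w \<phi> f
  using assms by (auto simp: loc_def)
 have adj': "B (xs v) w = B v (x w)" for v w using adj form_hermitian by metis
 have "xs (\<phi> f v) = \<phi> f (xs v)" if "\<phi> \<in> F" "f \<in> smooth" "supp f \<subseteq> I" for \<phi> f v
 proof (rule B_eqI)
  fix w
  have sc: "supp (\<lambda>z. cnj (f z)) \<subseteq> I" using that(3) by (simp add: supp_def)
  have "B (xs (\<phi> f v)) w = (- 1) ^ cdim \<phi> * B v (x (pr \<phi> (\<lambda>z. cnj (f z)) w))"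
   by (simp add: adj' field_adjoint[OF that(1,2)] com[OF pr_F[OF that(1)] smooth_cnj[OF that(2)] sc])
  also have "\<dots> = B (\<phi> f (xs v)) w" by (simp add: field_adjoint[OF that(1,2)] adj'[symmetric])
  finally show "B (xs (\<phi> f v)) w = B (\<phi> f (xs v)) w" .
 qed
 then show ?thesis by (simp add: loc_def adj')
qed

text \<open>Operators with an adjoint commuting with all fields localised in the lower (upper) half circle:
 the relation between \<open>y \<Omega>\<close> and \<open>y\<^sup>* \<Omega>\<close> is a form of the Bisognano-Wichmann property.\<close>

lemma lower_commutant_relation:
 assumes ts: "set ts \<subseteq> ET" and adj: "\<And>v w. B (y v) w = B v (ys w)"
  and com: "\<And>\<phi> f v. \<phi> \<in> F \<Longrightarrow> f \<in> smooth \<Longrightarrow> supp f \<subseteq> lower \<Longrightarrow> y (\<phi> f v) = \<phi> f (y v)"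
 shows "B (opl (up ts) \<Omega>) (y \<Omega>) = sgl ts * B (opl (up (sh (\<i> * of_real pi) ts)) \<Omega>) (\<theta> (ys \<Omega>))"
proof -
 \<comment> \<open>Conjugation by \<open>\<theta>\<close> exchanges the half circles, so
   \<open>x\<close> commutes with the upper fields and can be moved through
   \<open>opl (up ?ts)\<close>.\<close>
 define x where "x v = \<theta> (y (\<theta> v))" for v
 have xadj: "B (x v) w = B v (\<theta> (ys (\<theta> w)))" for v w
 proof -
  have "B (x v) w = B (\<theta> (y (\<theta> v))) (\<theta> (\<theta> w))" by (simp add: x_def pct_involution)
  also have "\<dots> = cnj (B (\<theta> v) (ys (\<theta> w)))" by (simp only: pct_antiunitary adj)
  also have "\<dots> = B (\<theta> (\<theta> v)) (\<theta> (ys (\<theta> w)))" by (simp only: pct_antiunitary)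
  finally show ?thesis by (simp add: pct_involution)
 qed
 have xcom: "x (\<phi> g v) = \<phi> g (x v)" if "\<phi> \<in> F" "g \<in> smooth" "supp g \<subseteq> upper" for \<phi> g v
 proof -
  have "supp (\<lambda>z. cnj (g (circle_inv z))) \<subseteq> circle_inv ` supp g"
  proof (rule supp_subset_closed)
   have "continuous_on (supp g) circle_inv"
    unfolding continuous_on_circle_iff of_circle_inv_cnj by (intro continuous_intros continuous_of_circle)
   then show "closed (circle_inv ` supp g)" by (intro compact_imp_closed compact_continuous_image compact_supp)
   fix z assume "cnj (g (circle_inv z)) \<noteq> 0"
   then have "circle_inv z \<in> supp g" using not_supp_zero[of "circle_inv z" g] by auto
   then show "z \<in> circle_inv ` supp g" by (rule rev_image_eqI) simp
  qed
  also have "\<dots> \<subseteq> lower" using that(3) circle_inv_upper by blast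
  finally have sl: "supp (\<lambda>z. cnj (g (circle_inv z))) \<subseteq> lower" .
  have "x (\<phi> g v) = \<theta> (y (pr \<phi> (\<lambda>z. cnj (g (circle_inv z))) (\<theta> v)))"
   by (simp add: x_def pct_field_eq[OF that(2)])
  also have "\<dots> = \<theta> (pr \<phi> (\<lambda>z. cnj (g (circle_inv z))) (y (\<theta> v)))"
   by (simp add: com[OF pr_F[OF that(1)] smooth_ci[OF that(2)] sl])
  also have "\<dots> = \<phi> g (x v)" by (simp add: pr_eq[OF smooth_ci[OF that(2)]] pct_involution x_def)
  finally show ?thesis .
 qed
 have xup: "x (opl (up us) v) = opl (up us) (x v)" if "set us \<subseteq> ET" for us v using that
 proof (induction us)
  case (Cons u us)
  obtain \<phi> \<tau> where u: "u = (\<phi>, \<tau>)" by (cases u)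
  have \<phi>: "\<phi> \<in> F" "ent \<tau>" "set us \<subseteq> ET" using Cons.prems by (auto simp: u ET_def)
  have "x (\<phi> (he (-1) \<tau>) w) = \<phi> (he (-1) \<tau>) (x w)" for w
   using he_support by (intro commute_upper_closed[OF \<phi>(1) smooth_he[OF \<phi>(2)] _ xadj xcom[OF \<phi>(1)]]) (auto intro: less_imp_le)
  then show ?case using Cons.IH[OF \<phi>(3)] by (simp add: u)
 qed simp
 let ?ts = "sh (\<i> * of_real pi) ts"
 have ts': "set ?ts \<subseteq> ET" by (rule sh_ET[OF ts])
 have sg: "sgl ?ts = sgl ts" by (induction ts) auto
 have "B (opl (up ts) \<Omega>) (y \<Omega>) = sgl ts * B \<Omega> (\<theta> (opl (up ?ts) (\<theta> (y \<Omega>))))"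
  unfolding up_dn[OF ts] by (simp add: dn_adjoint[OF ts'] sg)
 also have "\<theta> (y \<Omega>) = x \<Omega>" by (simp add: x_def pct_vacuum)
 also have "opl (up ?ts) (x \<Omega>) = x (opl (up ?ts) \<Omega>)" by (simp add: xup[OF ts'])
 also have "B \<Omega> (\<theta> (x (opl (up ?ts) \<Omega>))) = B (x (opl (up ?ts) \<Omega>)) \<Omega>"
  using pct_form[of \<Omega> "x (opl (up ?ts) \<Omega>)"] by (simp add: pct_vacuum)
 also have "\<dots> = B (opl (up ?ts) \<Omega>) (\<theta> (ys \<Omega>))" by (simp add: xadj pct_vacuum)
 finally show ?thesis .
qed

text \<open>Here the fields commute with \<open>xs\<close> itself, and taking their adjoint produces
  the list \<open>dn ts\<close>. Reading \<open>up_dn\<close> backwards to return to an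
  \<open>up\<close> list gives the shift the opposite sign.\<close>

lemma upper_commutant_relation:
 assumes ts: "set ts \<subseteq> ET" and adj: "\<And>v w. B (x v) w = B v (xs w)"
  and com: "\<And>\<phi> f v. \<phi> \<in> F \<Longrightarrow> f \<in> smooth \<Longrightarrow> supp f \<subseteq> upper \<Longrightarrow> x (\<phi> f v) = \<phi> f (x v)"
 shows "B (opl (up ts) \<Omega>) (x \<Omega>) = sgl ts * B (opl (up (sh (- (\<i> * of_real pi)) ts)) \<Omega>) (\<theta> (xs \<Omega>))"
proof -
 have "loc upper x xs" using adj com by (simp add: loc_def)
 from loc_adjoint[OF this] have adj': "\<And>v w. B (xs v) w = B v (x w)"
  and com': "\<And>\<phi> f v. \<phi> \<in> F \<Longrightarrow> f \<in> smooth \<Longrightarrow> supp f \<subseteq> upper \<Longrightarrow> xs (\<phi> f v) = \<phi> f (xs v)"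
  by (simp_all add: loc_def)
 have xup: "xs (opl (up us) v) = opl (up us) (xs v)" if "set us \<subseteq> ET" for us v using that
 proof (induction us)
  case (Cons u us)
  obtain \<phi> \<tau> where u: "u = (\<phi>, \<tau>)" by (cases u)
  have \<phi>: "\<phi> \<in> F" "ent \<tau>" "set us \<subseteq> ET" using Cons.prems by (auto simp: u ET_def)
  have "xs (\<phi> (he (-1) \<tau>) w) = \<phi> (he (-1) \<tau>) (xs w)" for w
   using he_support by (intro commute_upper_closed[OF \<phi>(1) smooth_he[OF \<phi>(2)] _ adj' com'[OF \<phi>(1)]]) (auto intro: less_imp_le)
  then show ?case using Cons.IH[OF \<phi>(3)] by (simp add: u)
 qed simp
 let ?ts = "sh (- (\<i> * of_real pi)) ts"
 have ts': "set ?ts \<subseteq> ET" by (rule sh_ET[OF ts])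
 have ss: "sh (\<i> * of_real pi) ?ts = ts" by (induction ts) (auto simp: shift_def)
 have "B (opl (up ts) \<Omega>) (x \<Omega>) = B (opl (up ts) (xs \<Omega>)) \<Omega>"
  by (simp add: adj'[symmetric] xup[OF ts])
 also have "\<dots> = sgl ts * B (xs \<Omega>) (\<theta> (opl (dn ts) \<Omega>))"
  by (simp add: up_adjoint[OF ts] pct_vacuum)
 also have "opl (dn ts) \<Omega> = opl (up ?ts) \<Omega>" using up_dn[OF ts'] by (simp add: ss)
 also have "B (xs \<Omega>) (\<theta> (opl (up ?ts) \<Omega>)) = B (opl (up ?ts) \<Omega>) (\<theta> (xs \<Omega>))" by (rule pct_form)
 finally show ?thesis .
qed

end

section \<open>Analytic continuation of dilation orbits\<close>

lemma ent_holomorphic: "ent \<tau> \<Longrightarrow> \<tau> holomorphic_on A"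
 using holomorphic_on_subset by (auto simp: ent_def)

lemma ent_deriv: assumes "ent \<tau>" shows "ent (deriv \<tau>)"
 unfolding ent_def
proof (intro conjI allI)
 show "deriv \<tau> holomorphic_on UNIV" by (rule holomorphic_deriv[OF ent_holomorphic[OF assms] open_UNIV])
 fix K R
 obtain C where C: "C \<ge> 0" "\<And>\<zeta>. \<bar>Im \<zeta>\<bar> \<le> R + 1 \<Longrightarrow> norm (\<tau> \<zeta>) \<le> C * exp (- \<bar>K\<bar> * \<bar>Re \<zeta>\<bar>)"
  using entD[OF assms] by metis
 have "norm (deriv \<tau> \<zeta>) \<le> (exp \<bar>K\<bar> * C) * exp (- K * \<bar>Re \<zeta>\<bar>)" if "\<bar>Im \<zeta>\<bar> \<le> R" for \<zeta>
 proof -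
  have "norm (deriv \<tau> \<zeta>) \<le> (exp \<bar>K\<bar> * C) * exp (- \<bar>K\<bar> * \<bar>Re \<zeta>\<bar>)"
   using cauchy_strip[of \<tau> R C "\<bar>K\<bar>" \<zeta> 1] C that ent_holomorphic[OF assms] by simp
  also have "\<dots> \<le> (exp \<bar>K\<bar> * C) * exp (- K * \<bar>Re \<zeta>\<bar>)"
   using C(1) by (intro mult_left_mono) (auto intro: mult_right_mono)
  finally show ?thesis .
 qed
 then show "\<exists>C. \<forall>\<zeta>. \<bar>Im \<zeta>\<bar> \<le> R \<longrightarrow> norm (deriv \<tau> \<zeta>) \<le> C * exp (- K * \<bar>Re \<zeta>\<bar>)" by blast
qed

lemma ent_uminus: "ent \<tau> \<Longrightarrow> ent (\<lambda>\<zeta>. - \<tau> \<zeta>)"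
 using ent_cmult[of \<tau> "-1"] by simp

lemma ent_translate': "ent \<tau> \<Longrightarrow> ent (\<lambda>\<zeta>. \<tau> (\<zeta> - c))"
 using ent_translate[of \<tau> "- c"] by simp

lemma ent_scale: assumes "ent \<tau>" "a > 0" shows "ent (\<lambda>\<zeta>. \<tau> (of_real a * \<zeta>))"
 unfolding ent_def
proof (intro conjI allI)
 have "(\<lambda>\<zeta>. of_real a * \<zeta>) holomorphic_on UNIV" by (intro holomorphic_intros)
 from holomorphic_on_compose_gen[OF this ent_holomorphic[OF assms(1), of UNIV]]
 show "(\<lambda>\<zeta>. \<tau> (of_real a * \<zeta>)) holomorphic_on UNIV" by (simp add: o_def)
 fix K R
 obtain C where C: "C \<ge> 0" "\<And>\<zeta>. \<bar>Im \<zeta>\<bar> \<le> a * R \<Longrightarrow> norm (\<tau> \<zeta>) \<le> C * exp (- (K / a) * \<bar>Re \<zeta>\<bar>)"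
  using entD[OF assms(1)] by metis
 have "norm (\<tau> (of_real a * \<zeta>)) \<le> C * exp (- K * \<bar>Re \<zeta>\<bar>)" if "\<bar>Im \<zeta>\<bar> \<le> R" for \<zeta>
  using C(2)[of "of_real a * \<zeta>"] assms(2) that by (simp add: abs_mult)
 then show "\<exists>C. \<forall>\<zeta>. \<bar>Im \<zeta>\<bar> \<le> R \<longrightarrow> norm (\<tau> (of_real a * \<zeta>)) \<le> C * exp (- K * \<bar>Re \<zeta>\<bar>)" by blast
qed

lemma exp_shift_bound:
 fixes K x c :: real assumes "K \<ge> 0" shows "exp (- K * \<bar>x - c\<bar>) \<le> exp (K * \<bar>c\<bar>) * exp (- K * \<bar>x\<bar>)"
proof -
 have "K * \<bar>x\<bar> \<le> K * (\<bar>x - c\<bar> + \<bar>c\<bar>)" using assms by (intro mult_left_mono) auto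
 then show ?thesis by (simp add: algebra_simps flip: exp_add)
qed

text \<open>The imaginary part of \<open>t\<close> is absorbed by a wider strip; the real part
  displaces the exponential weight, which costs \<open>exp (K * \<bar>Re t\<bar>)\<close>.\<close>

lemma he_translate_bound:
 assumes "ent \<kappa>"
 shows "\<exists>C\<ge>0. \<exists>K\<ge>0. \<forall>t. \<bar>Im t\<bar> \<le> R \<longrightarrow> C_norm N (he m (\<lambda>\<zeta>. \<kappa> (\<zeta> - t))) \<le> C * exp (K * \<bar>Re t\<bar>)"
proof -
 obtain C K where CK: "C \<ge> 0" "K \<ge> 0" "\<And>\<tau> P. ent \<tau> \<Longrightarrow> P \<ge> 0 \<Longrightarrow> (\<And>\<zeta>. \<bar>Im \<zeta>\<bar> \<le> 1 \<Longrightarrow> norm (\<tau> \<zeta>) \<le> P * exp (- K * \<bar>Re \<zeta>\<bar>)) \<Longrightarrow>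
   C_norm N (he m \<tau>) \<le> C * P" using he_norm_bound[of N m] by metis
 obtain P where P: "P \<ge> 0" "\<And>\<zeta>. \<bar>Im \<zeta>\<bar> \<le> R + 1 \<Longrightarrow> norm (\<kappa> \<zeta>) \<le> P * exp (- K * \<bar>Re \<zeta>\<bar>)"
  using entD[OF assms] by metis
 have "C_norm N (he m (\<lambda>\<zeta>. \<kappa> (\<zeta> - t))) \<le> C * (P * exp (K * \<bar>Re t\<bar>))" if t: "\<bar>Im t\<bar> \<le> R" for t
 proof (rule CK(3)[OF ent_translate'[OF assms]])
  fix \<zeta> assume z: "\<bar>Im \<zeta>\<bar> \<le> 1"
  have "norm (\<kappa> (\<zeta> - t)) \<le> P * exp (- K * \<bar>Re \<zeta> - Re t\<bar>)" using P(2)[of "\<zeta> - t"] t z by simp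
  also have "\<dots> \<le> P * (exp (K * \<bar>Re t\<bar>) * exp (- K * \<bar>Re \<zeta>\<bar>))"
   by (intro mult_left_mono exp_shift_bound CK P)
  finally show "norm (\<kappa> (\<zeta> - t)) \<le> P * exp (K * \<bar>Re t\<bar>) * exp (- K * \<bar>Re \<zeta>\<bar>)" by (simp only: mult.assoc)
 qed (use P in simp)
 then show ?thesis using CK P by (intro exI[of _ "C * P"] conjI exI[of _ K]) (auto simp: mult.assoc)
qed

text \<open>The error of the difference quotient is itself a rapidly decreasing entire function, of
  the order of \<open>h\<close> by Taylor's formula in every exponential weight;
  \<open>he_norm_bound\<close> converts this into norms.\<close>

lemma he_translate_derivative:
 assumes "ent \<kappa>"
 shows "((\<lambda>h. C_norm N (\<lambda>z. inverse h * (he m (\<lambda>\<zeta>. \<kappa> (\<zeta> - (t + h))) z - he m (\<lambda>\<zeta>. \<kappa> (\<zeta> - t)) z)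
   - he m (\<lambda>\<zeta>. - deriv \<kappa> (\<zeta> - t)) z)) \<longlongrightarrow> 0) (at 0)"
proof -
 obtain C K where CK: "C \<ge> 0" "K \<ge> 0" "\<And>\<tau> P. ent \<tau> \<Longrightarrow> P \<ge> 0 \<Longrightarrow> (\<And>\<zeta>. \<bar>Im \<zeta>\<bar> \<le> 1 \<Longrightarrow> norm (\<tau> \<zeta>) \<le> P * exp (- K * \<bar>Re \<zeta>\<bar>)) \<Longrightarrow>
   C_norm N (he m \<tau>) \<le> C * P" using he_norm_bound[of N m] by metis
 \<comment> \<open>Half width beyond \<open>\<bar>Im t\<bar>\<close>: 1 for the strip in
   \<open>he_norm_bound\<close>, 1 for \<open>cmod h \<le> 1\<close>, and 1 for the Cauchy estimate
   of the second derivative.\<close>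
 obtain P where P: "P \<ge> 0" "\<And>\<zeta>. \<bar>Im \<zeta>\<bar> \<le> (\<bar>Im t\<bar> + 2) + 1 \<Longrightarrow> norm (\<kappa> \<zeta>) \<le> P * exp (- K * \<bar>Re \<zeta>\<bar>)"
  using entD[OF assms] by metis
 define M where "M = fact 2 * exp K * P * exp (K * (\<bar>Re t\<bar> + 1))"
 have M: "M \<ge> 0" using P by (simp add: M_def)
 define \<sigma> where "\<sigma> h \<zeta> = inverse h * (\<kappa> (\<zeta> - (t + h)) + - \<kappa> (\<zeta> - t)) + deriv \<kappa> (\<zeta> - t)" for h \<zeta>
 have e\<sigma>: "ent (\<sigma> h)" for h unfolding \<sigma>_def[abs_def]
  by (intro ent_add ent_cmult ent_uminus ent_translate' ent_deriv assms)
 have eq: "(\<lambda>z. inverse h * (he m (\<lambda>\<zeta>. \<kappa> (\<zeta> - (t + h))) z - he m (\<lambda>\<zeta>. \<kappa> (\<zeta> - t)) z)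
   - he m (\<lambda>\<zeta>. - deriv \<kappa> (\<zeta> - t)) z) = he m (\<sigma> h)" for h
  by (auto simp: fun_eq_iff he_def hf_def \<sigma>_def algebra_simps)
 have bound: "norm (\<sigma> h \<zeta>) \<le> cmod h * M * exp (- K * \<bar>Re \<zeta>\<bar>)" if h: "h \<noteq> 0" "cmod h \<le> 1" and z: "\<bar>Im \<zeta>\<bar> \<le> 1" for h \<zeta>
 proof -
  define w where "w = \<zeta> - t"
  let ?f = "\<lambda>i. (deriv ^^ i) \<kappa>"
  have T: "cmod (?f 0 (w - h) - (\<Sum>i\<le>1. ?f i w * ((w - h) - w) ^ i / (fact i))) \<le> (M * exp (- K * \<bar>Re \<zeta>\<bar>)) * cmod ((w - h) - w) ^ Suc 1 / fact 1"
  proof (rule complex_Taylor[of "cball w 1"])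
   fix i :: nat and x assume "x \<in> cball w 1"
   have "(?f i has_field_derivative deriv (?f i) x) (at x)"
    by (rule holomorphic_derivI[OF holomorphic_higher_deriv[OF ent_holomorphic[OF assms] open_UNIV] open_UNIV]) simp
   then show "(?f i has_field_derivative ?f (Suc i) x) (at x within cball w 1)"
    by (simp add: has_field_derivative_at_within)
  next
   fix x assume x: "x \<in> cball w 1"
   have "\<bar>Re x - Re w\<bar> \<le> 1" "\<bar>Im x - Im w\<bar> \<le> 1"
    using x abs_Re_le_cmod[of "x - w"] abs_Im_le_cmod[of "x - w"] by (auto simp: dist_norm norm_minus_commute)
   then have i: "\<bar>Im x\<bar> \<le> \<bar>Im t\<bar> + 2" and r: "\<bar>Re \<zeta>\<bar> \<le> \<bar>Re x\<bar> + (\<bar>Re t\<bar> + 1)" using z by (auto simp: w_def)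
   have "cmod (?f (Suc 1) x) \<le> fact 2 * exp K * P * exp (- K * \<bar>Re x\<bar>)"
    using cauchy_strip[OF ent_holomorphic[OF assms] P(2) CK(2) i P(1), of 2] by (simp add: numeral_2_eq_2)
   also have "\<dots> \<le> fact 2 * exp K * P * (exp (K * (\<bar>Re t\<bar> + 1)) * exp (- K * \<bar>Re \<zeta>\<bar>))"
   proof (rule mult_left_mono)
    have "K * \<bar>Re \<zeta>\<bar> \<le> K * (\<bar>Re x\<bar> + (\<bar>Re t\<bar> + 1))" using r CK(2) by (rule mult_left_mono)
    then show "exp (- K * \<bar>Re x\<bar>) \<le> exp (K * (\<bar>Re t\<bar> + 1)) * exp (- K * \<bar>Re \<zeta>\<bar>)"
     by (simp add: algebra_simps flip: exp_add)
   qed (use P in simp)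
   finally show "cmod (?f (Suc 1) x) \<le> M * exp (- K * \<bar>Re \<zeta>\<bar>)" by (simp only: M_def mult.assoc)
  qed (use h in \<open>auto simp: dist_norm\<close>)
  then have "cmod (\<kappa> (w - h) - \<kappa> w + h * deriv \<kappa> w) \<le> M * exp (- K * \<bar>Re \<zeta>\<bar>) * (cmod h * cmod h)"
   by (simp add: algebra_simps power2_eq_square)
  then have "cmod (inverse h) * cmod (\<kappa> (w - h) - \<kappa> w + h * deriv \<kappa> w) \<le> cmod (inverse h) * (M * exp (- K * \<bar>Re \<zeta>\<bar>) * (cmod h * cmod h))"
   by (rule mult_left_mono) simp
  also have "\<dots> = cmod h * M * exp (- K * \<bar>Re \<zeta>\<bar>)" using h by (simp add: norm_inverse)
  also have "cmod (inverse h) * cmod (\<kappa> (w - h) - \<kappa> w + h * deriv \<kappa> w) = cmod (\<sigma> h \<zeta>)"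
  proof -
   have e: "\<zeta> - (t + h) = w - h" by (simp add: w_def)
   have "inverse h * (\<kappa> (w - h) - \<kappa> w + h * deriv \<kappa> w) = inverse h * (\<kappa> (w - h) - \<kappa> w) + deriv \<kappa> w"
    by (simp only: distrib_left mult.assoc[symmetric] left_inverse[OF h(1)] mult_1_left)
   then show ?thesis by (simp add: \<sigma>_def e w_def[symmetric] flip: norm_mult)
  qed
  finally show ?thesis .
 qed
 have "((\<lambda>h. C_norm N (he m (\<sigma> h))) \<longlongrightarrow> 0) (at 0)"
 proof (rule Lim_null_comparison)
  show "\<forall>\<^sub>F h in at 0. norm (C_norm N (he m (\<sigma> h))) \<le> C * (cmod h * M)"
   unfolding eventually_at
  proof (intro exI[of _ 1] conjI ballI impI)
   fix h :: complex assume "h \<noteq> 0 \<and> dist h 0 < 1"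
   then have h: "h \<noteq> 0" "cmod h \<le> 1" by auto
   have "C_norm N (he m (\<sigma> h)) \<le> C * (cmod h * M)"
    by (rule CK(3)[OF e\<sigma>]) (use M bound[OF h] in auto)
   then show "norm (C_norm N (he m (\<sigma> h))) \<le> C * (cmod h * M)"
    using C_norm_nonneg[OF smooth_he[OF e\<sigma>]] by simp
  qed simp
  show "((\<lambda>h. C * (cmod h * M)) \<longlongrightarrow> 0) (at 0)" by (rule tendsto_eq_intros refl | simp)+
 qed
 then show ?thesis unfolding eq .
qed

section \<open>Differentiability of multilinear expressions in a parameter\<close>

context wightman_cft
begin

lemma Lf_multi_tendsto:
 assumes l: "Lf l" and \<phi>s: "set \<phi>s \<subseteq> F"
  and L: "\<And>h. length (L h) = length \<phi>s" "\<And>h. set (L h) \<subseteq> smooth"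
  and L0: "length L0 = length \<phi>s" "set L0 \<subseteq> smooth"
  and lim: "\<And>i N. i < length \<phi>s \<Longrightarrow> ((\<lambda>h. C_norm N (\<lambda>z. (L h ! i) z - (L0 ! i) z)) \<longlongrightarrow> 0) Fl"
 shows "((\<lambda>h. l (opl (zip \<phi>s (L h)) \<Omega>)) \<longlongrightarrow> l (opl (zip \<phi>s L0) \<Omega>)) Fl"
 by (rule LIM_zero_cancel, rule Lf_multi_diff_tendsto[OF l \<phi>s L L0]) (use lim in auto)

lemma opl_slot_scale:
 "length as < length \<phi>s \<Longrightarrow> set \<phi>s \<subseteq> F \<Longrightarrow> set (as @ f # bs) \<subseteq> smooth \<Longrightarrow>
  opl (zip \<phi>s (as @ (\<lambda>z. c * f z) # bs)) v = s c (opl (zip \<phi>s (as @ f # bs)) v)"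
proof (induction as arbitrary: \<phi>s)
 case Nil
 then obtain \<phi> \<psi>s where "\<phi>s = \<phi> # \<psi>s" by (cases \<phi>s) auto
 then show ?case using Nil by (simp add: field_fscale)
next
 case (Cons a as)
 then obtain \<phi> \<psi>s where "\<phi>s = \<phi> # \<psi>s" by (cases \<phi>s) auto
 then show ?case using Cons by (simp add: field_scale)
qed

text \<open>The product rule by telescoping: in the \<open>i\<close>-th term the earlier slots are
  frozen at \<open>t\<close>, the slot \<open>i\<close> holds the difference quotient, and the later
  slots at \<open>t + h\<close> tend to their values at \<open>t\<close>.\<close>

lemma Lf_multi_derivative:
 assumes l: "Lf l" and \<phi>s: "set \<phi>s \<subseteq> F"
  and f: "\<And>t. length (f t) = length \<phi>s" "\<And>t. set (f t) \<subseteq> smooth"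
  and D: "length D = length \<phi>s" "set D \<subseteq> smooth"
  and lim: "\<And>i N. i < length \<phi>s \<Longrightarrow> ((\<lambda>h. C_norm N (\<lambda>z. inverse h * ((f (t + h) ! i) z - (f t ! i) z) - (D ! i) z)) \<longlongrightarrow> 0) (at 0)"
 shows "(\<lambda>t. l (opl (zip \<phi>s (f t)) \<Omega>)) field_differentiable (at (t :: complex))"
proof -
 let ?G = "\<lambda>t. l (opl (zip \<phi>s (f t)) \<Omega>)"
 have sm: "f u ! i \<in> smooth" "D ! i \<in> smooth" if "i < length \<phi>s" for u i
  using f D that by (metis nth_mem subsetD)+
 have cont: "((\<lambda>h. C_norm N (\<lambda>z. (f (t + h) ! i) z - (f t ! i) z)) \<longlongrightarrow> 0) (at 0)" if i: "i < length \<phi>s" for i N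
 proof (rule Lim_null_comparison)
  let ?Q = "\<lambda>h z. inverse h * ((f (t + h) ! i) z - (f t ! i) z) - (D ! i) z"
  have sQ: "?Q h \<in> smooth" for h by (intro smooth_diff smooth_cmult sm i)
  show "\<forall>\<^sub>F h in at 0. norm (C_norm N (\<lambda>z. (f (t + h) ! i) z - (f t ! i) z)) \<le> cmod h * (C_norm N (?Q h) + C_norm N (D ! i))"
   unfolding eventually_at
  proof (intro exI[of _ 1] conjI ballI impI)
   fix h :: complex assume "h \<noteq> 0 \<and> dist h 0 < 1"
   then have h: "h \<noteq> 0" by simp
   have "(\<lambda>z. (f (t + h) ! i) z - (f t ! i) z) = (\<lambda>z. h * (?Q h z + (D ! i) z))" using h by (simp add: fun_eq_iff)
   then have "C_norm N (\<lambda>z. (f (t + h) ! i) z - (f t ! i) z) = cmod h * C_norm N (\<lambda>z. ?Q h z + (D ! i) z)"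
    using C_norm_cmult[OF smooth_add[OF sQ sm(2)[OF i]], of N h h] by (simp only:)
   also have "\<dots> \<le> cmod h * (C_norm N (?Q h) + C_norm N (D ! i))"
    by (intro mult_left_mono C_norm_add sQ sm i) simp
   finally show "norm (C_norm N (\<lambda>z. (f (t + h) ! i) z - (f t ! i) z)) \<le> cmod h * (C_norm N (?Q h) + C_norm N (D ! i))"
    using C_norm_nonneg[OF smooth_diff[OF sm(1)[OF i, of "t + h"] sm(1)[OF i, of t]]] by simp
  qed simp
  have "((\<lambda>h. cmod h * (C_norm N (?Q h) + C_norm N (D ! i))) \<longlongrightarrow> cmod 0 * (0 + C_norm N (D ! i))) (at 0)"
   by (intro tendsto_mult tendsto_add tendsto_const tendsto_norm tendsto_ident_at lim i)
  then show "((\<lambda>h. cmod h * (C_norm N (?Q h) + C_norm N (D ! i))) \<longlongrightarrow> 0) (at 0)" by simp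
 qed
 define L where "L i h = take i (f t) @ (\<lambda>z. inverse h * ((f (t + h) ! i) z - (f t ! i) z)) # drop (Suc i) (f (t + h))" for i h
 define L0 where "L0 i = take i (f t) @ (D ! i) # drop (Suc i) (f t)" for i
 have parts: "set (take i (f u)) \<subseteq> smooth" "set (drop i (f u)) \<subseteq> smooth" for i u
  using f(2)[of u] set_take_subset[of i "f u"] set_drop_subset[of i "f u"] by blast+
 have quot: "(?G (t + h) - ?G t) / h = (\<Sum>i<length \<phi>s. l (opl (zip \<phi>s (L i h)) \<Omega>))" for h
 proof -
  have "l (opl (zip \<phi>s (L i h)) \<Omega>) = inverse h * l (opl (zip \<phi>s (take i (f t) @ (\<lambda>z. (f (t + h) ! i) z - (f t ! i) z) # drop (Suc i) (f (t + h)))) \<Omega>)"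
   if i: "i < length \<phi>s" for i
  proof -
   have "opl (zip \<phi>s (L i h)) \<Omega> = s (inverse h) (opl (zip \<phi>s (take i (f t) @ (\<lambda>z. (f (t + h) ! i) z - (f t ! i) z) # drop (Suc i) (f (t + h)))) \<Omega>)"
    unfolding L_def using i f(1) parts sm[OF i] by (intro opl_slot_scale \<phi>s) (auto intro: smooth_diff)
   then show ?thesis by (simp add: lin_scale[OF Lf_lin[OF l]])
  qed
  then show ?thesis unfolding opl_telescope[OF f(1) f(1) \<phi>s f(2) f(2) Lf_lin[OF l]]
   by (simp add: sum_distrib_left divide_inverse sum_distrib_right mult.commute)
 qed
 have "((\<lambda>h. \<Sum>i<length \<phi>s. l (opl (zip \<phi>s (L i h)) \<Omega>)) \<longlongrightarrow> (\<Sum>i<length \<phi>s. l (opl (zip \<phi>s (L0 i)) \<Omega>))) (at 0)"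
 proof (rule tendsto_sum)
  fix i assume "i \<in> {..<length \<phi>s}"
  then have i: "i < length \<phi>s" by simp
  show "((\<lambda>h. l (opl (zip \<phi>s (L i h)) \<Omega>)) \<longlongrightarrow> l (opl (zip \<phi>s (L0 i)) \<Omega>)) (at 0)"
  proof (rule Lf_multi_tendsto[OF l \<phi>s])
   show "length (L i h) = length \<phi>s" for h using i f(1) by (simp add: L_def)
   show "set (L i h) \<subseteq> smooth" for h
    unfolding L_def using parts smooth_cmult[OF smooth_diff[OF sm(1)[OF i] sm(1)[OF i]]] by simp
   show "length (L0 i) = length \<phi>s" using i f(1) by (simp add: L0_def)
   show "set (L0 i) \<subseteq> smooth" unfolding L0_def using parts sm[OF i] by auto
   fix j N assume j: "j < length \<phi>s"
   consider "j < i" | "j = i" | "j > i" by linarith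
   then show "((\<lambda>h. C_norm N (\<lambda>z. (L i h ! j) z - (L0 i ! j) z)) \<longlongrightarrow> 0) (at 0)"
   proof cases
    case 1
    then have "L i h ! j = f t ! j" "L0 i ! j = f t ! j" for h
     using i j f(1) by (auto simp: L_def L0_def nth_append)
    then show ?thesis by simp
   next
    case 2
    then have "L i h ! j = (\<lambda>z. inverse h * ((f (t + h) ! i) z - (f t ! i) z))" "L0 i ! j = D ! i" for h
     using i j f(1) by (auto simp: L_def L0_def nth_append)
    then show ?thesis using lim[OF i] by simp
   next
    case 3
    then obtain k where k: "j = Suc (i + k)" using less_iff_Suc_add by auto
    have "L i h ! j = f (t + h) ! j" "L0 i ! j = f t ! j" for h
     using i j f(1) unfolding k by (simp_all add: L_def L0_def nth_append)
    then show ?thesis using cont[OF j] by simp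
   qed
  qed
 qed
 then have "((\<lambda>h. (?G (t + h) - ?G t) / h) \<longlongrightarrow> (\<Sum>i<length \<phi>s. l (opl (zip \<phi>s (L0 i)) \<Omega>))) (at 0)"
  by (simp only: quot)
 then show ?thesis unfolding field_differentiable_def DERIV_def by blast
qed

end

section \<open>Modular relations for smeared dilation orbits\<close>

lemma supp_beta:
 assumes \<gamma>: "\<gamma> \<in> Mob" shows "supp (beta d \<gamma> f) \<subseteq> \<gamma> ` supp f"
proof (rule supp_subset_closed)
 obtain a b where ab: "su a b" "\<gamma> = mob a b" using \<gamma> Mob_iff by blast
 have "continuous_on (supp f) \<gamma>" unfolding continuous_on_circle_iff ab(2) of_circle_mob[OF ab(1)]
  using mob_den_nonzero[OF ab(1)] by (intro continuous_intros continuous_of_circle) auto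
 then show "closed (\<gamma> ` supp f)" by (intro compact_imp_closed compact_continuous_image compact_supp)
 fix z assume "beta d \<gamma> f z \<noteq> 0"
 then have "inv \<gamma> z \<in> supp f" using not_supp_zero[of "inv \<gamma> z" f] by (auto simp: beta_def)
 moreover have "z = \<gamma> (inv \<gamma> z)" using Mob_inv(2)[OF \<gamma>] by (simp add: fun_eq_iff)
 ultimately show "z \<in> \<gamma> ` supp f" by blast
qed

lemma gauss_delta:
 fixes f :: "real \<Rightarrow> complex"
 assumes cont: "continuous_on UNIV f" and b: "\<And>t. norm (f t) \<le> C * exp (K * \<bar>t\<bar>)" and K: "K \<ge> 0"
  and z: "\<And>n::nat. n > 0 \<Longrightarrow> (LINT t|lborel. exp (- (of_real (real n) * of_real t)\<^sup>2) * f t) = 0"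
 shows "f 0 = 0"
proof -
 have C: "C \<ge> 0" using order_trans[OF norm_ge_zero b[of 0]] by simp
 obtain P where P: "P \<ge> 0" "\<And>\<zeta>. \<bar>Im \<zeta>\<bar> \<le> 0 \<Longrightarrow> norm (exp (- \<zeta>\<^sup>2) :: complex) \<le> P * exp (- (K + 1) * \<bar>Re \<zeta>\<bar>)"
  using entD[OF ent_gauss] by metis
 have P': "norm (exp (- (of_real w)\<^sup>2) :: complex) \<le> P * exp (- (K + 1) * \<bar>w\<bar>)" for w using P(2)[of "of_real w"] by simp
 let ?g = "\<lambda>w::real. exp (- (of_real w)\<^sup>2) :: complex"
 have "(\<lambda>n. LINT w|lborel. ?g w * f (w / real (Suc n))) \<longlonglongrightarrow> (LINT w|lborel. ?g w * f 0)"
 proof (rule integral_dominated_convergence)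
  have m: "continuous_on UNIV (\<lambda>w. ?g w * f (w / c))" if "c \<noteq> 0" for c
   using that by (intro continuous_intros continuous_on_compose2[OF cont]) auto
  show "(\<lambda>w. ?g w * f (w / real (Suc n))) \<in> borel_measurable lborel" for n
   using borel_measurable_continuous_onI[OF m[of "real (Suc n)"]] by simp
  have "continuous_on UNIV (\<lambda>w. ?g w * f 0)" by (intro continuous_intros)
  from borel_measurable_continuous_onI[OF this] show "(\<lambda>w. ?g w * f 0) \<in> borel_measurable lborel" by simp
  show "integrable lborel (\<lambda>w::real. P * C * exp (- \<bar>w\<bar>))" by (intro integrable_mult_right integrable_exp_abs)
  show "AE w in lborel. (\<lambda>n. ?g w * f (w / real (Suc n))) \<longlonglongrightarrow> ?g w * f 0"
  proof (rule AE_I2)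
   fix w :: real
   have "(\<lambda>n. w * (1 / real (Suc n))) \<longlonglongrightarrow> w * 0"
    using LIMSEQ_inverse_real_of_nat by (intro tendsto_mult tendsto_const) (simp add: inverse_eq_divide)
   then have "(\<lambda>n. w / real (Suc n)) \<longlonglongrightarrow> 0" by simp
   from continuous_on_tendsto_compose[OF cont this] show "(\<lambda>n. ?g w * f (w / real (Suc n))) \<longlonglongrightarrow> ?g w * f 0"
    by (intro tendsto_mult tendsto_const) auto
  qed
  show "AE w in lborel. norm (?g w * f (w / real (Suc n))) \<le> P * C * exp (- \<bar>w\<bar>)" for n
  proof (rule AE_I2)
   fix w :: real
   have "norm (f (w / real (Suc n))) \<le> C * exp (K * \<bar>w / real (Suc n)\<bar>)" by (rule b)
   also have "\<dots> \<le> C * exp (K * \<bar>w\<bar>)"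
   proof -
    have "\<bar>w / real (Suc n)\<bar> \<le> \<bar>w\<bar>" by (simp add: abs_div divide_le_eq mult_le_cancel_left1)
    from mult_left_mono[OF this K] have "exp (K * \<bar>w / real (Suc n)\<bar>) \<le> exp (K * \<bar>w\<bar>)" by simp
    then show ?thesis using C by (rule mult_left_mono)
   qed
   finally have "norm (?g w * f (w / real (Suc n))) \<le> (P * exp (- (K + 1) * \<bar>w\<bar>)) * (C * exp (K * \<bar>w\<bar>))"
    unfolding norm_mult using P P' by (intro mult_mono) auto
   also have "\<dots> = P * C * (exp (- (K + 1) * \<bar>w\<bar>) * exp (K * \<bar>w\<bar>))" by simp
   also have "exp (- (K + 1) * \<bar>w\<bar>) * exp (K * \<bar>w\<bar>) = exp (- \<bar>w\<bar>)"
    by (simp add: algebra_simps flip: exp_add)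
   finally show "norm (?g w * f (w / real (Suc n))) \<le> P * C * exp (- \<bar>w\<bar>)" .
  qed
 qed
 moreover have "(LINT w|lborel. ?g w * f (w / real (Suc n))) = 0" for n
 proof -
  have "0 = (LINT t|lborel. exp (- (of_real (real (Suc n)) * of_real t)\<^sup>2) * f t)" using z[of "Suc n"] by (simp del: of_nat_Suc)
  also have "\<dots> = \<bar>1 / real (Suc n)\<bar> *\<^sub>R (LINT w|lborel. exp (- (of_real (real (Suc n)) * of_real (0 + (1 / real (Suc n)) * w))\<^sup>2) * f (0 + (1 / real (Suc n)) * w))"
   by (rule lborel_integral_real_affine) simp
  also have "\<dots> = \<bar>1 / real (Suc n)\<bar> *\<^sub>R (LINT w|lborel. ?g w * f (w / real (Suc n)))"
  proof -
   have "of_real (real (Suc n)) * of_real (0 + (1 / real (Suc n)) * w) = (of_real w :: complex)" for w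
    by (simp del: of_nat_Suc flip: of_real_mult)
   then show ?thesis by (simp del: of_nat_Suc)
  qed
  finally show ?thesis by (simp del: of_nat_Suc)
 qed
 ultimately have "(\<lambda>n::nat. 0) \<longlonglongrightarrow> (LINT w|lborel. ?g w * f 0)" by simp
 then have "(LINT w|lborel. ?g w * f 0) = 0" by (simp add: LIMSEQ_const_iff)
 moreover have "(LINT w|lborel. ?g w * f 0) = (LINT w|lborel. ?g w) * f 0" by simp
 moreover have "(LINT w|lborel. ?g w) = of_real (sqrt pi)"
 proof -
  have "has_bochner_integral lborel (\<lambda>x::real. exp (- x\<^sup>2)) (2 *\<^sub>R (sqrt pi / 2))"
   using gaussian_moment_0 by (rule has_bochner_integral_even_function) simp
  then have "(LINT x|lborel. exp (- (x::real)\<^sup>2)) = sqrt pi" by (simp add: has_bochner_integral_integral_eq)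
  then have "(LINT w|lborel. complex_of_real (exp (- (w::real)\<^sup>2))) = of_real (sqrt pi)"
   by (simp only: integral_complex_of_real)
  moreover have "?g w = of_real (exp (- w\<^sup>2))" for w by (simp flip: exp_of_real)
  ultimately show ?thesis by simp
 qed
 ultimately show ?thesis by simp
qed

section \<open>Dilation orbits: growth, continuity and smearing\<close>

context wightman_cft
begin

lemma Lf_diff: assumes "Lf l" "Lf l'" shows "Lf (\<lambda>v. l v - l' v)"
 unfolding Lf_def
proof (intro conjI allI impI)
 show "lin (\<lambda>v. l v - l' v)" using Lf_lin[OF assms(1)] Lf_lin[OF assms(2)] by (simp add: lin_def algebra_simps)
 fix \<phi>s assume \<phi>s: "set \<phi>s \<subseteq> F"
 from LfD[OF assms(1) \<phi>s] obtain C N where C: "C \<ge> 0" "\<And>fs. length fs = length \<phi>s \<Longrightarrow> set fs \<subseteq> smooth \<Longrightarrow>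
   norm (l (opl (zip \<phi>s fs) \<Omega>)) \<le> C * C_prod N fs" by blast
 from LfD[OF assms(2) \<phi>s] obtain C' N' where C': "C' \<ge> 0" "\<And>fs. length fs = length \<phi>s \<Longrightarrow> set fs \<subseteq> smooth \<Longrightarrow>
   norm (l' (opl (zip \<phi>s fs) \<Omega>)) \<le> C' * prod_list (map (C_norm N') fs)" by blast
 have "norm (l (opl (zip \<phi>s fs) \<Omega>) - l' (opl (zip \<phi>s fs) \<Omega>)) \<le> (C + C') * prod_list (map (C_norm (max N N')) fs)"
  if fs: "length fs = length \<phi>s" "set fs \<subseteq> smooth" for fs
 proof -
  have "norm (l (opl (zip \<phi>s fs) \<Omega>) - l' (opl (zip \<phi>s fs) \<Omega>)) \<le> C * C_prod N fs + C' * prod_list (map (C_norm N') fs)"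
   by (rule order_trans[OF norm_triangle_ineq4 add_mono[OF C(2)[OF fs] C'(2)[OF fs]]])
  also have "\<dots> \<le> C * prod_list (map (C_norm (max N N')) fs) + C' * prod_list (map (C_norm (max N N')) fs)"
   using C C' fs by (intro add_mono mult_left_mono C_norm_list_mono) auto
  finally show ?thesis by (simp add: distrib_right)
 qed
 then show "\<exists>C\<ge>0. \<exists>N. \<forall>fs. length fs = length \<phi>s \<longrightarrow> set fs \<subseteq> smooth \<longrightarrow>
   norm (l (opl (zip \<phi>s fs) \<Omega>) - l' (opl (zip \<phi>s fs) \<Omega>)) \<le> C * C_prod N fs"
  using C(1) C'(1) by (intro exI[of _ "C + C'"] conjI exI[of _ "max N N'"]) auto
qed

lemma dil_C_norm_bound:
 "\<exists>C\<ge>0. \<exists>K\<ge>0. \<forall>f\<in>smooth. \<forall>t. C_norm N (beta d (dil t) f) \<le> C * exp (K * \<bar>t\<bar>) * C_norm N f"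
proof -
 obtain C K where C: "C \<ge> 0" "\<And>a b f. f \<in> smooth \<Longrightarrow> su a b \<Longrightarrow>
   C_norm N (pb a b (int d - 1) f) \<le> C * (cmod a + cmod b) ^ K * C_norm N f"
  using pb_bound[of N "int d - 1"] by metis
 have "C_norm N (beta d (dil t) f) \<le> C * exp (real K * \<bar>t\<bar>) * C_norm N f" if f: "f \<in> smooth" for f t
 proof -
  \<comment> \<open>This is \<open>cmod a + cmod b\<close> for a dilation, so the polynomial
    estimate \<open>pb_bound\<close> becomes exponential in \<open>t\<close>.\<close>
  have "cosh (t / 2) + \<bar>sinh (t / 2)\<bar> = exp (\<bar>t\<bar> / 2)"
  proof (cases "t \<ge> 0")
   case True
   then show ?thesis by (simp add: cosh_plus_sinh)
  next
   case False
   then show ?thesis using cosh_minus_sinh[of "t / 2"] by simp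
  qed
  also have "exp (\<bar>t\<bar> / 2) \<le> exp \<bar>t\<bar>" by simp
  finally have "(cmod (of_real (cosh (t / 2))) + cmod (of_real (sinh (t / 2)))) ^ K \<le> exp \<bar>t\<bar> ^ K"
   by (intro power_mono) auto
  also have "\<dots> = exp (real K * \<bar>t\<bar>)" by (simp add: exp_of_nat_mult)
  finally have "C * (cmod (of_real (cosh (t / 2))) + cmod (of_real (sinh (t / 2)))) ^ K * C_norm N f \<le> C * exp (real K * \<bar>t\<bar>) * C_norm N f"
   using C(1) f by (intro mult_right_mono mult_left_mono C_norm_nonneg)
  then show ?thesis using C(2)[OF f su_dil'[of t]] unfolding beta_dil_eq by linarith
 qed
 then show ?thesis using C(1) by (intro exI[of _ C] conjI exI[of _ "real K"]) auto
qed

lemma dil_list_bound: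
 "\<exists>C\<ge>0. \<exists>K\<ge>0. \<forall>fs t. length fs = length \<phi>s \<longrightarrow> set fs \<subseteq> smooth \<longrightarrow>
   C_prod N (map (\<lambda>(\<phi>, f). beta (cdim \<phi>) (dil t) f) (zip \<phi>s fs)) \<le> C * exp (K * \<bar>t\<bar>) * C_prod N fs"
proof (induction \<phi>s)
 case Nil
 show ?case by (intro exI[of _ 1] conjI exI[of _ 0]) auto
next
 case (Cons \<phi> \<phi>s)
 then obtain C K where C: "C \<ge> 0" "K \<ge> 0" and b: "\<And>fs t. length fs = length \<phi>s \<Longrightarrow> set fs \<subseteq> smooth \<Longrightarrow>
   C_prod N (map (\<lambda>(\<phi>, f). beta (cdim \<phi>) (dil t) f) (zip \<phi>s fs)) \<le> C * exp (K * \<bar>t\<bar>) * C_prod N fs" by blast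
 obtain C' K' where C': "C' \<ge> 0" "K' \<ge> 0" and b': "\<And>f t. f\<in>smooth \<Longrightarrow> C_norm N (beta (cdim \<phi>) (dil t) f) \<le> C' * exp (K' * \<bar>t\<bar>) * C_norm N f"
  using dil_C_norm_bound[of N "cdim \<phi>"] by blast
 have "C_prod N (map (\<lambda>(\<phi>, f). beta (cdim \<phi>) (dil t) f) (zip (\<phi> # \<phi>s) fs)) \<le> C' * C * exp ((K' + K) * \<bar>t\<bar>) * C_prod N fs"
  if fs: "length fs = length (\<phi> # \<phi>s)" "set fs \<subseteq> smooth" for fs t
 proof -
  obtain f gs where f: "fs = f # gs" using fs(1) by (cases fs) auto
  have g: "length gs = length \<phi>s" "set gs \<subseteq> smooth" "f \<in> smooth" using fs by (auto simp: f)
  have "set (map (\<lambda>(\<phi>, f). beta (cdim \<phi>) (dil t) f) (zip \<phi>s gs)) \<subseteq> smooth"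
   using g by (auto dest!: set_zip_rightD intro!: smooth_beta dil_Mob)
  from C_norm_list_nonneg[OF this]
  have "C_norm N (beta (cdim \<phi>) (dil t) f) * C_prod N (map (\<lambda>(\<phi>, f). beta (cdim \<phi>) (dil t) f) (zip \<phi>s gs))
    \<le> (C' * exp (K' * \<bar>t\<bar>) * C_norm N f) * (C * exp (K * \<bar>t\<bar>) * C_prod N gs)"
   using C' C_norm_nonneg[OF g(3)] by (intro mult_mono b b' g) auto
  also have "\<dots> = C' * C * (exp (K' * \<bar>t\<bar>) * exp (K * \<bar>t\<bar>)) * (C_norm N f * C_prod N gs)" by (simp only: mult_ac)
  finally show ?thesis by (simp add: f distrib_right exp_add)
 qed
 then show ?case using C C' by (intro exI[of _ "C' * C"] conjI exI[of _ "K' + K"]) auto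
qed

lemma dil_zip: "map (bl \<gamma>) (zip \<phi>s fs) = zip \<phi>s (map (\<lambda>(\<phi>, f). beta (cdim \<phi>) \<gamma> f) (zip \<phi>s fs))"
proof (induction \<phi>s arbitrary: fs)
 case (Cons \<phi> \<phi>s)
 then show ?case by (cases fs) (auto simp: bl_def)
qed simp

lemma dil_orbit_bound:
 assumes l: "Lf l" and \<phi>s: "set \<phi>s \<subseteq> F"
 shows "\<exists>C\<ge>0. \<exists>K\<ge>0. \<exists>N. \<forall>fs t. length fs = length \<phi>s \<longrightarrow> set fs \<subseteq> smooth \<longrightarrow>
   norm (l (U (dil t) (opl (zip \<phi>s fs) \<Omega>))) \<le> C * exp (K * \<bar>t\<bar>) * C_prod N fs"
proof -
 from LfD[OF l \<phi>s] obtain C N where C: "C \<ge> 0" "\<And>fs. length fs = length \<phi>s \<Longrightarrow> set fs \<subseteq> smooth \<Longrightarrow>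
   norm (l (opl (zip \<phi>s fs) \<Omega>)) \<le> C * C_prod N fs" by blast
 obtain C' K where C': "C' \<ge> 0" "K \<ge> 0" "\<And>fs t. length fs = length \<phi>s \<Longrightarrow> set fs \<subseteq> smooth \<Longrightarrow>
   C_prod N (map (\<lambda>(\<phi>, f). beta (cdim \<phi>) (dil t) f) (zip \<phi>s fs)) \<le> C' * exp (K * \<bar>t\<bar>) * C_prod N fs"
  using dil_list_bound[of \<phi>s N] by blast
 have "norm (l (U (dil t) (opl (zip \<phi>s fs) \<Omega>))) \<le> C * C' * exp (K * \<bar>t\<bar>) * C_prod N fs"
  if fs: "length fs = length \<phi>s" "set fs \<subseteq> smooth" for fs t
 proof -
  let ?gs = "map (\<lambda>(\<phi>, f). beta (cdim \<phi>) (dil t) f) (zip \<phi>s fs)"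
  have g: "length ?gs = length \<phi>s" "set ?gs \<subseteq> smooth"
   using fs by (auto dest!: set_zip_rightD intro!: smooth_beta dil_Mob)
  have "norm (l (opl (zip \<phi>s ?gs) \<Omega>)) \<le> C * (C' * exp (K * \<bar>t\<bar>) * C_prod N fs)"
   by (rule order_trans[OF C(2)[OF g] mult_left_mono[OF C'(3)[OF fs] C(1)]])
  then show ?thesis by (simp add: U_opl_vacuum[OF dil_Mob set_zip_FS[OF \<phi>s fs(2)]] dil_zip mult.assoc)
 qed
 then show ?thesis using C C' by (intro exI[of _ "C * C'"] conjI exI[of _ K] exI[of _ N]) auto
qed

lemma dil_orbit_exp:
 assumes l: "Lf l" shows "\<exists>C\<ge>0. \<exists>K\<ge>0. \<forall>t. norm (l (U (dil t) v)) \<le> C * exp (K * \<bar>t\<bar>)"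
proof (induction v rule: D_induct)
 case (add u v)
 then obtain C K C' K' where C: "C \<ge> 0" "K \<ge> 0" "\<And>t. norm (l (U (dil t) u)) \<le> C * exp (K * \<bar>t\<bar>)"
  and C': "C' \<ge> 0" "K' \<ge> 0" "\<And>t. norm (l (U (dil t) v)) \<le> C' * exp (K' * \<bar>t\<bar>)" by blast
 have "norm (l (U (dil t) (u + v))) \<le> (C + C') * exp (max K K' * \<bar>t\<bar>)" for t
 proof -
  have "norm (l (U (dil t) u) + l (U (dil t) v)) \<le> C * exp (K * \<bar>t\<bar>) + C' * exp (K' * \<bar>t\<bar>)"
   by (rule order_trans[OF norm_triangle_ineq add_mono[OF C(3) C'(3)]])
  also have "\<dots> \<le> C * exp (max K K' * \<bar>t\<bar>) + C' * exp (max K K' * \<bar>t\<bar>)"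
   using C C' by (intro add_mono mult_left_mono) (auto intro: mult_right_mono)
  finally show ?thesis by (simp add: U_linear[OF dil_Mob] lin_add[OF Lf_lin[OF l]] distrib_right)
 qed
 then show ?case using C C' by (intro exI[of _ "C + C'"] conjI exI[of _ "max K K'"]) auto
next
 case (scale c v)
 then obtain C K where C: "C \<ge> 0" "K \<ge> 0" "\<And>t. norm (l (U (dil t) v)) \<le> C * exp (K * \<bar>t\<bar>)" by blast
 then show ?case by (intro exI[of _ "cmod c * C"] conjI exI[of _ K])
   (auto simp: U_linear[OF dil_Mob] lin_scale[OF Lf_lin[OF l]] norm_mult mult.assoc intro: mult_left_mono)
next
 case (opl xs)
 then obtain \<phi>s fs where xs: "xs = zip \<phi>s fs" "length fs = length \<phi>s" "set \<phi>s \<subseteq> F" "set fs \<subseteq> smooth"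
  by (rule FS_unzip)
 obtain C K N where C: "C \<ge> 0" "K \<ge> 0" and b: "\<And>fs t. length fs = length \<phi>s \<Longrightarrow> set fs \<subseteq> smooth \<Longrightarrow>
   norm (l (U (dil t) (opl (zip \<phi>s fs) \<Omega>))) \<le> C * exp (K * \<bar>t\<bar>) * C_prod N fs"
  using dil_orbit_bound[OF l xs(3)] by blast
 have "norm (l (U (dil t) (opl xs \<Omega>))) \<le> C * C_prod N fs * exp (K * \<bar>t\<bar>)" for t
  using b[OF xs(2,4), of t] by (simp add: xs(1) mult_ac)
 then show ?case using C C_norm_list_nonneg[OF xs(4), of N]
  by (intro exI[of _ "C * C_prod N fs"] conjI exI[of _ K]) auto
qed

lemma dil_orbit_continuous:
 assumes l: "Lf l" shows "continuous_on UNIV (\<lambda>t. l (U (dil t) v))"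
proof (induction v rule: D_induct)
 case (add u v)
 then show ?case by (simp add: U_linear[OF dil_Mob] lin_add[OF Lf_lin[OF l]] continuous_on_add)
next
 case (scale c v)
 then show ?case by (simp add: U_linear[OF dil_Mob] lin_scale[OF Lf_lin[OF l]] continuous_on_mult_left)
next
 case (opl xs)
 then obtain \<phi>s fs where xs: "xs = zip \<phi>s fs" "length fs = length \<phi>s" "set \<phi>s \<subseteq> F" "set fs \<subseteq> smooth"
  by (rule FS_unzip)
 let ?L = "\<lambda>t. map (\<lambda>(\<phi>, f). beta (cdim \<phi>) (dil t) f) (zip \<phi>s fs)"
 have L: "length (?L t) = length \<phi>s" "set (?L t) \<subseteq> smooth" for t
  using xs by (auto dest!: set_zip_rightD intro!: smooth_beta dil_Mob)
 have "((\<lambda>u. l (opl (zip \<phi>s (?L u)) \<Omega>)) \<longlongrightarrow> l (opl (zip \<phi>s (?L t)) \<Omega>)) (at t)" for t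
 proof (rule Lf_multi_tendsto[OF l xs(3) L L])
  fix i N assume i: "i < length \<phi>s"
  then have f: "fs ! i \<in> smooth" using xs by (metis nth_mem subsetD)
  have "((\<lambda>u. C_norm N (\<lambda>z. pb (of_real (cosh (u / 2))) (of_real (sinh (u / 2))) (int (cdim (\<phi>s ! i)) - 1) (fs ! i) z -
    pb (of_real (cosh (t / 2))) (of_real (sinh (t / 2))) (int (cdim (\<phi>s ! i)) - 1) (fs ! i) z)) \<longlongrightarrow> 0) (at t)"
   by (rule pb_tendsto) (auto intro!: su_dil' tendsto_intros f)
  then show "((\<lambda>u. C_norm N (\<lambda>z. (?L u ! i) z - (?L t ! i) z)) \<longlongrightarrow> 0) (at t)"
   using i xs(2) by (simp add: beta_dil_eq)
 qed
 then show ?case by (simp add: continuous_on_def xs(1) U_opl_vacuum[OF dil_Mob set_zip_FS[OF xs(3,4)]] dil_zip)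
qed

text \<open>The functional is smeared, not the vector: all integrals are scalar, and no integral
  with values in the domain has to be formed.\<close>

definition smear :: "(complex \<Rightarrow> complex) \<Rightarrow> ('v \<Rightarrow> complex) \<Rightarrow> 'v \<Rightarrow> complex"
 where "smear g l v = (LINT t|lborel. g (of_real t) * l (U (dil t) v))"

lemma smear_integrable:
 assumes g: "ent g" and l: "Lf l" shows "integrable lborel (\<lambda>t. g (of_real t) * l (U (dil t) v))"
proof -
 obtain C K where C: "C \<ge> 0" "K \<ge> 0" "\<And>t. norm (l (U (dil t) v)) \<le> C * exp (K * \<bar>t\<bar>)" using dil_orbit_exp[OF l] by blast
 obtain P where P: "P \<ge> 0" "\<And>\<zeta>. \<bar>Im \<zeta>\<bar> \<le> 0 \<Longrightarrow> norm (g \<zeta>) \<le> P * exp (- (K + 1) * \<bar>Re \<zeta>\<bar>)"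
  using entD[OF g] by metis
 show ?thesis
 proof (rule integrable_exp_bound)
  show "continuous_on UNIV (\<lambda>t. g (of_real t) * l (U (dil t) v))"
   by (intro continuous_intros dil_orbit_continuous l continuous_on_compose2[OF holomorphic_on_imp_continuous_on[OF ent_holomorphic[OF g, of UNIV]]]) auto
  fix t
  have "norm (g (of_real t) * l (U (dil t) v)) \<le> (P * exp (- (K + 1) * \<bar>t\<bar>)) * (C * exp (K * \<bar>t\<bar>))"
   unfolding norm_mult using P(2)[of "of_real t"] P(1) C by (intro mult_mono) auto
  also have "\<dots> = P * C * (exp (- (K + 1) * \<bar>t\<bar>) * exp (K * \<bar>t\<bar>))" by simp
  also have "exp (- (K + 1) * \<bar>t\<bar>) * exp (K * \<bar>t\<bar>) = exp (- \<bar>t\<bar>)" by (simp add: algebra_simps flip: exp_add)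
  finally show "norm (g (of_real t) * l (U (dil t) v)) \<le> P * C * exp (- \<bar>t\<bar>)" .
 qed
qed

lemma Lf_smear:
 assumes g: "ent g" and l: "Lf l" shows "Lf (smear g l)"
 unfolding Lf_def
proof (intro conjI allI impI)
 note int = smear_integrable[OF g l]
 have "(LINT t|lborel. g (of_real t) * (c * l (U (dil t) v))) = c * (LINT t|lborel. g (of_real t) * l (U (dil t) v))" for c v
  unfolding mult.left_commute[of _ c] by (rule integral_mult_right_zero)
 then show "lin (smear g l)"
  using int by (simp add: lin_def smear_def U_linear[OF dil_Mob] lin_add[OF Lf_lin[OF l]] lin_scale[OF Lf_lin[OF l]] distrib_left)
 fix \<phi>s assume \<phi>s: "set \<phi>s \<subseteq> F"
 obtain C K N where C: "C \<ge> 0" "K \<ge> 0" and b: "\<And>fs t. length fs = length \<phi>s \<Longrightarrow> set fs \<subseteq> smooth \<Longrightarrow>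
   norm (l (U (dil t) (opl (zip \<phi>s fs) \<Omega>))) \<le> C * exp (K * \<bar>t\<bar>) * C_prod N fs"
  using dil_orbit_bound[OF l \<phi>s] by blast
 obtain P where P: "P \<ge> 0" "\<And>\<zeta>. \<bar>Im \<zeta>\<bar> \<le> 0 \<Longrightarrow> norm (g \<zeta>) \<le> P * exp (- (K + 1) * \<bar>Re \<zeta>\<bar>)"
  using entD[OF g] by metis
 let ?E = "LINT t|lborel. exp (- \<bar>t :: real\<bar>)"
 have E: "?E \<ge> 0" by simp
 have "norm (smear g l (opl (zip \<phi>s fs) \<Omega>)) \<le> P * C * ?E * C_prod N fs"
  if fs: "length fs = length \<phi>s" "set fs \<subseteq> smooth" for fs
 proof -
  let ?p = "C_prod N fs"
  have p: "?p \<ge> 0" by (rule C_norm_list_nonneg[OF fs(2)])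
  have "norm (smear g l (opl (zip \<phi>s fs) \<Omega>)) \<le> (LINT t|lborel. (P * C * ?p) * exp (- \<bar>t\<bar>))"
   unfolding smear_def
  proof (rule Bochner_Integration.integral_norm_bound_integral[OF int])
   show "integrable lborel (\<lambda>t. (P * C * ?p) * exp (- \<bar>t\<bar>))" by (intro integrable_mult_right integrable_exp_abs)
   fix t
   have "norm (g (of_real t) * l (U (dil t) (opl (zip \<phi>s fs) \<Omega>))) \<le> (P * exp (- (K + 1) * \<bar>t\<bar>)) * (C * exp (K * \<bar>t\<bar>) * ?p)"
    unfolding norm_mult using P(2)[of "of_real t"] P(1) b[OF fs] by (intro mult_mono) auto
   also have "\<dots> = P * C * ?p * (exp (- (K + 1) * \<bar>t\<bar>) * exp (K * \<bar>t\<bar>))" by simp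
   also have "exp (- (K + 1) * \<bar>t\<bar>) * exp (K * \<bar>t\<bar>) = exp (- \<bar>t\<bar>)" by (simp add: algebra_simps flip: exp_add)
   finally show "norm (g (of_real t) * l (U (dil t) (opl (zip \<phi>s fs) \<Omega>))) \<le> (P * C * ?p) * exp (- \<bar>t\<bar>)" .
  qed
  then show ?thesis by (simp add: mult_ac)
 qed
 then show "\<exists>C\<ge>0. \<exists>N. \<forall>fs. length fs = length \<phi>s \<longrightarrow> set fs \<subseteq> smooth \<longrightarrow>
   norm (smear g l (opl (zip \<phi>s fs) \<Omega>)) \<le> C * C_prod N fs"
  using P(1) C(1) E by (intro exI[of _ "P * C * ?E"] conjI exI[of _ N]) auto
qed

end

text \<open>On the half circle \<open>cosh (xc z) = 1 / Im z\<close>, so \<open>d\<close> such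
  factors lower the weight \<open>d - 1\<close> to -1. At weight \<open>d - 1\<close> the dilations
  act by pure translation.\<close>

lemma he_cosh: "he (int d - 1) (\<lambda>\<zeta>. cosh \<zeta> ^ d * \<tau> \<zeta>) = he (-1) \<tau>"
proof
 fix z
 show "he (int d - 1) (\<lambda>\<zeta>. cosh \<zeta> ^ d * \<tau> \<zeta>) z = he (-1) \<tau> z"
 proof (cases "Im (of_circle z) > 0")
  case True
  let ?y = "complex_of_real (Im (of_circle z))"
  have "cosh (complex_of_real (xc z)) = inverse ?y" using arg_cong[OF cosh_xc[OF True], of complex_of_real]
   by (simp add: cosh_field_def inverse_eq_divide exp_of_real flip: of_real_minus)
  moreover have "?y powi (int d - 1) * (inverse ?y ^ d * w) = inverse ?y * w" for w
   using True by (simp add: power_int_diff power_inverse field_simps)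
  ultimately show ?thesis using True by (simp add: he_def hf_def power_int_minus)
 qed (simp add: he_def hf_def)
qed

text \<open>For \<open>p = \<i> * pi\<close> the upward shift \<open>contour_shift\<close> is
  applied to the translate of \<open>H\<close> by \<open>p\<close>, for the other sign to
  \<open>H\<close> itself.\<close>

lemma contour_shift_entire:
 assumes hol: "H holomorphic_on UNIV" and p: "p = \<i> * of_real pi \<or> p = - (\<i> * of_real pi)"
  and b: "\<And>\<zeta>. \<bar>Im \<zeta>\<bar> \<le> pi \<Longrightarrow> norm (H \<zeta>) \<le> C * exp (- \<bar>Re \<zeta>\<bar>)"
 shows "(LINT x|lborel. H (of_real x - p)) = (LINT x|lborel. H (of_real x))"
 using p
proof
 assume p: "p = \<i> * of_real pi"
 have "(\<lambda>\<zeta>. H (\<zeta> - p)) holomorphic_on {\<zeta>. - 1 < Im \<zeta> \<and> Im \<zeta> < pi + 1}"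
  by (rule holomorphic_on_compose_gen[OF _ hol, unfolded o_def]) (auto intro!: holomorphic_intros)
 moreover have "norm (H (\<zeta> - p)) \<le> C * exp (- \<bar>Re \<zeta>\<bar>)" if "0 \<le> Im \<zeta>" "Im \<zeta> \<le> pi" for \<zeta>
  using b[of "\<zeta> - p"] that by (simp add: p)
 ultimately have "(LINT x|lborel. H (of_real x - p)) = (LINT x|lborel. H (of_real x + \<i> * of_real pi - p))"
  by (rule contour_shift)
 then show ?thesis by (simp add: p)
next
 assume p: "p = - (\<i> * of_real pi)"
 have "H holomorphic_on {\<zeta>. - 1 < Im \<zeta> \<and> Im \<zeta> < pi + 1}" using hol by (rule holomorphic_on_subset) simp
 from contour_shift[OF this, of C] show ?thesis using b by (simp add: p)
qed

section \<open>Complexified dilation orbits and transfer of the shift to the kernel\<close>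

context involutive_wightman_cft
begin

text \<open>The test functions of the dilated product \<open>up ts\<close>, with the dilation
  parameter replaced by a complex number; \<open>U_dil_up\<close> is the real case.\<close>

definition cv :: "('v distribution \<times> (complex \<Rightarrow> complex)) list \<Rightarrow> complex \<Rightarrow> ('v distribution \<times> (circle \<Rightarrow> complex)) list"
 where "cv ts t = map (\<lambda>(\<phi>, \<tau>). (\<phi>, he (int (cdim \<phi>) - 1) (\<lambda>\<zeta>. cosh (\<zeta> - t) ^ cdim \<phi> * \<tau> (\<zeta> - t)))) ts"

lemma cv_simps [simp]: "cv [] t = []"
 "cv ((\<phi>, \<tau>) # ts) t = (\<phi>, he (int (cdim \<phi>) - 1) (\<lambda>\<zeta>. cosh (\<zeta> - t) ^ cdim \<phi> * \<tau> (\<zeta> - t))) # cv ts t"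
 by (simp_all add: cv_def)

lemma smooth_cv: "ent \<tau> \<Longrightarrow> he m (\<lambda>\<zeta>. cosh (\<zeta> - t) ^ d * \<tau> (\<zeta> - t)) \<in> smooth"
 by (rule smooth_he[OF ent_translate'[OF ent_mult_cosh_power]])

lemma cv_FS: "set ts \<subseteq> ET \<Longrightarrow> set (cv ts t) \<subseteq> FS"
 by (auto simp: cv_def ET_def FS_def smooth_cv)

lemma U_dil_up:
 assumes ts: "set ts \<subseteq> ET" shows "U (dil u) (opl (up ts) \<Omega>) = opl (cv ts (of_real u)) \<Omega>"
proof -
 have "beta d (dil u) (he (-1) \<tau>) = he (int d - 1) (\<lambda>\<zeta>. cosh (\<zeta> - of_real u) ^ d * \<tau> (\<zeta> - of_real u))" for d \<tau>
  using beta_dil_he[of d u "\<lambda>\<zeta>. cosh \<zeta> ^ d * \<tau> \<zeta>"] by (simp add: he_cosh)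
 then have "map (bl (dil u)) (up ts) = cv ts (of_real u)" by (simp add: up_def cv_def bl_def split: prod.splits)
 then show ?thesis by (simp add: U_opl_vacuum[OF dil_Mob up_FS[OF ts]])
qed

text \<open>For both values of \<open>p\<close> the function cosh changes sign under translation by
  \<open>p\<close>. The factor \<open>cosh ^ d\<close> thus yields \<open>(- 1) ^ d\<close> for each
  field, the sign that also arises from adjoints.\<close>

lemma cv_shift:
 assumes ts: "set ts \<subseteq> ET" and p: "p = \<i> * of_real pi \<or> p = - (\<i> * of_real pi)"
 shows "opl (cv ts (t - p)) v = s (sgl ts) (opl (cv (sh p ts) t) v)"
 using ts
proof (induction ts)
 case (Cons x ts)
 obtain \<phi> \<tau> where x: "x = (\<phi>, \<tau>)" by (cases x)
 have \<phi>: "\<phi> \<in> F" "ent \<tau>" "set ts \<subseteq> ET" using Cons.prems by (auto simp: x ET_def)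
 let ?d = "cdim \<phi>" and ?h = "\<lambda>t \<tau>. he (int (cdim \<phi>) - 1) (\<lambda>\<zeta>. cosh (\<zeta> - t) ^ cdim \<phi> * \<tau> (\<zeta> - t))"
 have c: "cosh (\<zeta> - (t - p)) ^ ?d = (- 1) ^ ?d * cosh (\<zeta> - t) ^ ?d" for \<zeta>
 proof -
  have "cosh p = -1" "sinh p = 0" using p by (auto simp: cosh_field_def sinh_field_def exp_minus exp_pi_i')
  moreover have "\<zeta> - (t - p) = (\<zeta> - t) + p" by simp
  ultimately have "cosh (\<zeta> - (t - p)) = - cosh (\<zeta> - t)" by (simp only: cosh_add) simp
  then show ?thesis by (simp only: power_minus[of "cosh (\<zeta> - t)"])
 qed
 have "?h (t - p) \<tau> = (\<lambda>z. (- 1) ^ ?d * ?h t (shift p \<tau>) z)"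
 proof -
  have "shift p \<tau> (\<zeta> - t) = \<tau> (\<zeta> - (t - p))" for \<zeta> by (simp add: shift_def diff_diff_eq2 diff_add_eq)
  then show ?thesis by (simp add: c he_def hf_def fun_eq_iff)
 qed
 then have "\<phi> (?h (t - p) \<tau>) w = s ((- 1) ^ ?d) (\<phi> (?h t (shift p \<tau>)) w)" for w
  using field_fscale[OF \<phi>(1) smooth_cv[OF ent_shift[OF \<phi>(2)]]] by simp
 then show ?case using Cons.IH[OF \<phi>(3)] 
  by (simp add: x field_scale[OF \<phi>(1) smooth_cv[OF ent_shift[OF \<phi>(2)]]])
qed simp

lemma cv_zip: "cv ts t = zip (map fst ts) (map snd (cv ts t))"
 by (induction ts) auto

lemma cv_holomorphic:
 assumes l: "Lf l" and ts: "set ts \<subseteq> ET" shows "(\<lambda>t. l (opl (cv ts t) \<Omega>)) holomorphic_on UNIV"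
 unfolding holomorphic_on_def
proof (rule ballI)
 fix t
 have F: "set (map fst ts) \<subseteq> F" using ts by (auto simp: ET_def)
 let ?\<kappa> = "\<lambda>i. (\<lambda>\<zeta>. cosh \<zeta> ^ cdim (fst (ts ! i)) * snd (ts ! i) \<zeta>)"
 let ?D = "map (\<lambda>(\<phi>, \<tau>). he (int (cdim \<phi>) - 1) (\<lambda>\<zeta>. - deriv (\<lambda>\<zeta>. cosh \<zeta> ^ cdim \<phi> * \<tau> \<zeta>) (\<zeta> - t))) ts"
 have "(\<lambda>t. l (opl (zip (map fst ts) (map snd (cv ts t))) \<Omega>)) field_differentiable (at t)"
 proof (rule Lf_multi_derivative[OF l F, where D = ?D])
  show "set (map snd (cv ts t)) \<subseteq> smooth" for t using cv_FS[OF ts, of t] by (auto simp: FS_def)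
  show "set ?D \<subseteq> smooth"
   using ts by (auto simp: ET_def intro!: smooth_he ent_translate' ent_uminus ent_deriv ent_mult_cosh_power)
  fix i N assume i: "i < length (map fst ts)"
  then have "ts ! i \<in> ET" using ts by (auto dest: nth_mem)
  then have e: "ent (?\<kappa> i)" by (auto simp: ET_def case_prod_beta intro: ent_mult_cosh_power)
  show "((\<lambda>h. C_norm N (\<lambda>z. inverse h * ((map snd (cv ts (t + h)) ! i) z - (map snd (cv ts t) ! i) z) - (?D ! i) z)) \<longlongrightarrow> 0) (at 0)"
   using he_translate_derivative[OF e, of N "int (cdim (fst (ts ! i))) - 1" t] i
   by (simp add: cv_def case_prod_beta)
 qed (simp_all add: cv_def)
 then show "(\<lambda>t. l (opl (cv ts t) \<Omega>)) field_differentiable (at t within UNIV)" by (simp flip: cv_zip)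
qed

lemma cv_list_bound:
 "set ts \<subseteq> ET \<Longrightarrow> \<exists>C\<ge>0. \<exists>K\<ge>0. \<forall>t. \<bar>Im t\<bar> \<le> R \<longrightarrow> C_prod N (map snd (cv ts t)) \<le> C * exp (K * \<bar>Re t\<bar>)"
proof (induction ts)
 case Nil
 show ?case by (intro exI[of _ 1] conjI exI[of _ 0]) auto
next
 case (Cons x ts)
 obtain \<phi> \<tau> where x: "x = (\<phi>, \<tau>)" by (cases x)
 have \<phi>: "\<phi> \<in> F" "ent \<tau>" "set ts \<subseteq> ET" using Cons.prems by (auto simp: x ET_def)
 from Cons.IH[OF \<phi>(3)] obtain C K where C: "C \<ge> 0" "K \<ge> 0" "\<And>t. \<bar>Im t\<bar> \<le> R \<Longrightarrow> C_prod N (map snd (cv ts t)) \<le> C * exp (K * \<bar>Re t\<bar>)"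
  by blast
 let ?h = "\<lambda>t. he (int (cdim \<phi>) - 1) (\<lambda>\<zeta>. cosh (\<zeta> - t) ^ cdim \<phi> * \<tau> (\<zeta> - t))"
 obtain C' K' where C': "C' \<ge> 0" "K' \<ge> 0" "\<And>t. \<bar>Im t\<bar> \<le> R \<Longrightarrow> C_norm N (?h t) \<le> C' * exp (K' * \<bar>Re t\<bar>)"
  using he_translate_bound[OF ent_mult_cosh_power[OF \<phi>(2)], of R N] by blast
 have "C_prod N (map snd (cv (x # ts) t)) \<le> C' * C * exp ((K' + K) * \<bar>Re t\<bar>)" if t: "\<bar>Im t\<bar> \<le> R" for t
 proof -
  have "set (map snd (cv ts t)) \<subseteq> smooth" using cv_FS[OF \<phi>(3), of t] by (auto simp: FS_def)
  from C_norm_list_nonneg[OF this]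
  have "C_norm N (?h t) * C_prod N (map snd (cv ts t)) \<le> (C' * exp (K' * \<bar>Re t\<bar>)) * (C * exp (K * \<bar>Re t\<bar>))"
   using C' by (intro mult_mono C(3) C'(3) t) auto
  also have "\<dots> = C' * C * (exp (K' * \<bar>Re t\<bar>) * exp (K * \<bar>Re t\<bar>))" by simp
  finally show ?thesis by (simp add: x distrib_right exp_add)
 qed
 then show ?case using C C' by (intro exI[of _ "C' * C"] conjI exI[of _ "K' + K"]) auto
qed

lemma cv_bound:
 assumes l: "Lf l" and ts: "set ts \<subseteq> ET"
 shows "\<exists>C\<ge>0. \<exists>K\<ge>0. \<forall>t. \<bar>Im t\<bar> \<le> R \<longrightarrow> norm (l (opl (cv ts t) \<Omega>)) \<le> C * exp (K * \<bar>Re t\<bar>)"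
proof -
 have F: "set (map fst ts) \<subseteq> F" using ts by (auto simp: ET_def)
 from LfD[OF l F] obtain C N where C: "C \<ge> 0" "\<And>fs. length fs = length (map fst ts) \<Longrightarrow> set fs \<subseteq> smooth \<Longrightarrow>
   norm (l (opl (zip (map fst ts) fs) \<Omega>)) \<le> C * C_prod N fs" by blast
 obtain C' K where C': "C' \<ge> 0" "K \<ge> 0" "\<And>t. \<bar>Im t\<bar> \<le> R \<Longrightarrow> C_prod N (map snd (cv ts t)) \<le> C' * exp (K * \<bar>Re t\<bar>)"
  using cv_list_bound[OF ts, of R N] by blast
 have "norm (l (opl (cv ts t) \<Omega>)) \<le> C * C' * exp (K * \<bar>Re t\<bar>)" if t: "\<bar>Im t\<bar> \<le> R" for t
 proof -
  have "set (map snd (cv ts t)) \<subseteq> smooth" using cv_FS[OF ts, of t] by (auto simp: FS_def)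
  then have "norm (l (opl (zip (map fst ts) (map snd (cv ts t))) \<Omega>)) \<le> C * C_prod N (map snd (cv ts t))"
   by (intro C(2)) (auto simp: cv_def)
  also have "\<dots> \<le> C * (C' * exp (K * \<bar>Re t\<bar>))" by (intro mult_left_mono C'(3) t C(1))
  finally show ?thesis by (simp add: mult.assoc flip: cv_zip)
 qed
 then show ?thesis using C(1) C' by (intro exI[of _ "C * C'"] conjI exI[of _ K]) auto
qed

text \<open>Reeh-Schlieder on the upper half circle, the slots being replaced one after the other by
  limits of entire test functions from \<open>upper_density\<close>.\<close>

lemma upper_cyclic:
 assumes "Lf l" "\<And>ts. set ts \<subseteq> ET \<Longrightarrow> l (opl (up ts) \<Omega>) = 0" shows "l v = 0"
proof (rule reeh_schlieder[OF open_upper _ assms(1)])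
 have "circ (pi / 2) \<in> upper" by (simp add: upper_def)
 then show "upper \<noteq> {}" by blast
 show "l (opl xs \<Omega>) = 0" if "set xs \<subseteq> supported upper" for xs using that assms
 proof (induction xs arbitrary: l)
  case Nil
  then show ?case using Nil(3)[of "[]"] by simp
 next
  case (Cons x xs)
  obtain \<phi> f where x: "x = (\<phi>, f)" by (cases x)
  have \<phi>: "\<phi> \<in> F" "f \<in> smooth" "supp f \<subseteq> upper" "set xs \<subseteq> supported upper"
   using Cons.prems(1) by (auto simp: x supported_def)
  obtain \<tau> where \<tau>: "\<And>n. ent (\<tau> n)" "\<And>N. (\<lambda>n::nat. C_norm N (\<lambda>z. he (-1) (\<tau> n) z - f z)) \<longlonglongrightarrow> 0"
   by (rule upper_density[OF \<phi>(2,3)]) blast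
  have "l (\<phi> (he (-1) (\<tau> n)) (opl xs \<Omega>)) = 0" for n
  proof (rule Cons.IH[OF \<phi>(4) Lf_field[OF Cons.prems(2) \<phi>(1) smooth_he[OF \<tau>(1)]]])
   fix ts assume "set ts \<subseteq> ET"
   then have "set ((\<phi>, \<tau> n) # ts) \<subseteq> ET" using \<phi>(1) \<tau>(1) by (simp add: ET_def)
   from Cons.prems(3)[OF this] show "l (\<phi> (he (-1) (\<tau> n)) (opl (up ts) \<Omega>)) = 0" by simp
  qed
  then have "(\<lambda>n::nat. 0) \<longlonglongrightarrow> l (\<phi> f (opl xs \<Omega>))"
   using Lf_tendsto[OF Cons.prems(2) \<phi>(1) smooth_he[OF \<tau>(1)] \<phi>(2) \<tau>(2), of "opl xs \<Omega>"] by simp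
  then show ?case by (simp add: x LIMSEQ_const_iff)
 qed
qed

text \<open>On \<open>opl (up ts) \<Omega>\<close> the relation \<open>rel\<close> and
  \<open>cv_shift\<close> exhibit the left integrand at \<open>x\<close> as the entire function
  \<open>?H\<close> at \<open>x - p\<close>; the sign \<open>sgl ts\<close> occurs twice and
  cancels. Moving the contour by \<open>p\<close> gives the right side, and
  \<open>upper_cyclic\<close> extends the equality to all vectors.\<close>

lemma smear_relation:
 assumes p: "p = \<i> * of_real pi \<or> p = - (\<i> * of_real pi)" and l: "Lf l" "Lf l'" and g: "ent g"
  and rel: "\<And>ts u. set ts \<subseteq> ET \<Longrightarrow> l (U (dil u) (opl (up ts) \<Omega>)) = sgl ts * l' (U (dil u) (opl (up (sh p ts)) \<Omega>))"
 shows "smear g l v = smear (shift p g) l' v"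
proof -
 have "smear g l v - smear (shift p g) l' v = 0"
 proof (rule upper_cyclic[OF Lf_diff[OF Lf_smear[OF g l(1)] Lf_smear[OF ent_shift[OF g] l(2)]]])
  fix ts assume ts: "set ts \<subseteq> ET"
  let ?H = "\<lambda>\<zeta>. g (\<zeta> + p) * l' (opl (cv ts \<zeta>) \<Omega>)"
  obtain C K where C: "C \<ge> 0" "K \<ge> 0" "\<And>t. \<bar>Im t\<bar> \<le> pi \<Longrightarrow> norm (l' (opl (cv ts t) \<Omega>)) \<le> C * exp (K * \<bar>Re t\<bar>)"
   using cv_bound[OF l(2) ts, of pi] by blast
  obtain P where P: "P \<ge> 0" "\<And>\<zeta>. \<bar>Im \<zeta>\<bar> \<le> pi \<Longrightarrow> norm (g (\<zeta> + p)) \<le> P * exp (- (K + 1) * \<bar>Re \<zeta>\<bar>)"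
   using entD[OF ent_translate[OF g, of p]] by metis
  have sh: "(LINT x|lborel. ?H (of_real x - p)) = (LINT x|lborel. ?H (of_real x))"
  proof (rule contour_shift_entire[OF _ p])
   show "?H holomorphic_on UNIV" by (intro holomorphic_intros cv_holomorphic l ts ent_holomorphic ent_translate g)
   fix \<zeta> :: complex assume \<zeta>: "\<bar>Im \<zeta>\<bar> \<le> pi"
   have "norm (?H \<zeta>) \<le> (P * exp (- (K + 1) * \<bar>Re \<zeta>\<bar>)) * (C * exp (K * \<bar>Re \<zeta>\<bar>))"
    unfolding norm_mult using P(1) by (intro mult_mono P(2) C(3) \<zeta>) auto
   also have "\<dots> = P * C * (exp (- (K + 1) * \<bar>Re \<zeta>\<bar>) * exp (K * \<bar>Re \<zeta>\<bar>))" by simp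
   also have "exp (- (K + 1) * \<bar>Re \<zeta>\<bar>) * exp (K * \<bar>Re \<zeta>\<bar>) = exp (- \<bar>Re \<zeta>\<bar>)"
    by (simp add: algebra_simps flip: exp_add)
   finally show "norm (?H \<zeta>) \<le> P * C * exp (- \<bar>Re \<zeta>\<bar>)" .
  qed
  have k: "g (of_real x) * l (opl (cv ts (of_real x)) \<Omega>) = ?H (of_real x - p)" for x
   using rel[OF ts, of x] unfolding U_dil_up[OF ts] U_dil_up[OF sh_ET[OF ts]] cv_shift[OF ts p]
   by (simp add: lin_scale[OF Lf_lin[OF l(2)]])
  show "smear g l (opl (up ts) \<Omega>) - smear (shift p g) l' (opl (up ts) \<Omega>) = 0"
   unfolding smear_def shift_def U_dil_up[OF ts] k by (simp only: sh diff_self)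
 qed
 then show ?thesis by simp
qed

lemma loc_U:
 assumes \<gamma>: "\<gamma> \<in> Mob" and y: "loc (inv \<gamma> ` I) y ys"
 shows "loc I (\<lambda>v. U \<gamma> (y (U (inv \<gamma>) v))) (\<lambda>v. U \<gamma> (ys (U (inv \<gamma>) v)))"
 unfolding loc_def
proof (intro conjI allI ballI impI)
 note m = Mob_inv[OF \<gamma>]
 have ii: "inv (inv \<gamma>) = \<gamma>" using inv_inv_eq[OF m(4)] .
 have adj: "B (y v) w = B v (ys w)" for v w using y by (simp add: loc_def)
 show "B (U \<gamma> (y (U (inv \<gamma>) v))) w = B v (U \<gamma> (ys (U (inv \<gamma>) w)))" for v w
  using U_form[OF m(1), of v] by (simp add: U_form[OF \<gamma>] adj ii)
 fix \<phi> f v assume \<phi>: "\<phi> \<in> F" "f \<in> smooth" "supp f \<subseteq> I"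
 let ?f = "beta (cdim \<phi>) (inv \<gamma>) f"
 have s: "supp ?f \<subseteq> inv \<gamma> ` I" using supp_beta[OF m(1), of "cdim \<phi>" f] \<phi>(3) by blast
 have e: "U (inv \<gamma>) (\<phi> f w) = \<phi> ?f (U (inv \<gamma>) w)" for w by (rule U_field[OF m(1) \<phi>(1,2)])
 have "y (\<phi> ?f w) = \<phi> ?f (y w)" for w
  using y \<phi>(1) s smooth_beta[OF m(1) \<phi>(2)] by (simp add: loc_def)
 moreover have "U \<gamma> (\<phi> ?f w) = \<phi> f (U \<gamma> w)" for w
  using e[of "U \<gamma> w"] U_inv[OF \<gamma>] by metis
 ultimately show "U \<gamma> (y (U (inv \<gamma>) (\<phi> f v))) = \<phi> f (U \<gamma> (y (U (inv \<gamma>) v)))" by (simp add: e)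
qed

lemma dil_upper_image: "dil t ` upper = upper" "dil t ` lower = lower"
proof -
 have "dil t (dil (- t) z) = z" for z by (simp add: dil_dil dil_0)
 moreover have "Im (of_circle (dil t z)) < 0 \<longleftrightarrow> Im (of_circle z) < 0" for t z
  using dil_upper(1)[of t z] dil_upper(2)[of t z] by (simp add: divide_less_0_iff)
 ultimately show "dil t ` upper = upper" "dil t ` lower = lower"
  using dil_Im_pos by (auto simp: upper_def lower_def image_iff) metis+
qed

text \<open>The half circles are invariant under dilations, so \<open>rel\<close> applies to
  \<open>y\<close> conjugated by \<open>U (dil (- u))\<close>. Moving the dilation across the form,
  and past \<open>\<theta>\<close> by \<open>pct_dil\<close>, gives the relation along the
  orbit.\<close>

lemma orbit_relation:
 assumes I: "I = upper \<or> I = lower" and y: "loc I y ys"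
  and rel: "\<And>y ys. loc I y ys \<Longrightarrow> B a (y \<Omega>) = c * B b (\<theta> (ys \<Omega>))"
 shows "B (U (dil u) a) (y \<Omega>) = c * B (U (dil u) b) (\<theta> (ys \<Omega>))"
proof -
 have J: "inv (dil (- u)) ` I = I" unfolding inv_dil using I by (elim disjE) (simp_all add: dil_upper_image)
 have "loc I (\<lambda>v. U (dil (- u)) (y (U (dil u) v))) (\<lambda>v. U (dil (- u)) (ys (U (dil u) v)))"
  using loc_U[OF dil_Mob, of "- u" I y ys] y unfolding J by (simp add: inv_dil)
 from rel[OF this] show ?thesis by (simp add: U_form[OF dil_Mob] inv_dil vacuum_invariant[OF dil_Mob] pct_dil)
qed

text \<open>The relations for \<open>y\<close> and for \<open>x\<close> shift the contour in opposite directions, so that in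
 the combination below the shifts cancel.\<close>

lemma modular_exchange:
 assumes y: "loc lower y ys" and x: "loc upper x xs"
 shows "B (y \<Omega>) (x \<Omega>) = B (xs \<Omega>) (ys \<Omega>)"
proof -
 let ?p = "\<i> * of_real pi"
 define l where "l w = (\<lambda>v. B v w)" for w
 have Ll: "Lf (l w)" for w unfolding l_def by (rule Lf_B)
 have Y: "smear g (l (y \<Omega>)) v = smear (shift ?p g) (l (\<theta> (ys \<Omega>))) v" if g: "ent g" for g v
 proof (rule smear_relation[OF disjI1[OF refl] Ll Ll g])
  fix ts u assume ts: "set ts \<subseteq> ET"
  show "l (y \<Omega>) (U (dil u) (opl (up ts) \<Omega>)) = sgl ts * l (\<theta> (ys \<Omega>)) (U (dil u) (opl (up (sh ?p ts)) \<Omega>))"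
   unfolding l_def
  proof (rule orbit_relation[OF disjI2[OF refl] y])
   fix y ys assume "loc lower y ys"
   then show "B (opl (up ts) \<Omega>) (y \<Omega>) = sgl ts * B (opl (up (sh ?p ts)) \<Omega>) (\<theta> (ys \<Omega>))"
    by (intro lower_commutant_relation[OF ts]) (auto simp: loc_def)
  qed
 qed
 have X: "smear g (l (x \<Omega>)) v = smear (shift (- ?p) g) (l (\<theta> (xs \<Omega>))) v" if g: "ent g" for g v
 proof (rule smear_relation[OF disjI2[OF refl] Ll Ll g])
  fix ts u assume ts: "set ts \<subseteq> ET"
  show "l (x \<Omega>) (U (dil u) (opl (up ts) \<Omega>)) = sgl ts * l (\<theta> (xs \<Omega>)) (U (dil u) (opl (up (sh (- ?p) ts)) \<Omega>))"
   unfolding l_def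
  proof (rule orbit_relation[OF disjI1[OF refl] x])
   fix x xs assume "loc upper x xs"
   then show "B (opl (up ts) \<Omega>) (x \<Omega>) = sgl ts * B (opl (up (sh (- ?p) ts)) \<Omega>) (\<theta> (xs \<Omega>))"
    by (intro upper_commutant_relation[OF ts]) (auto simp: loc_def)
  qed
 qed
 define \<delta> where "\<delta> t = B (U (dil t) (y \<Omega>)) (x \<Omega>) - B (U (dil t) (xs \<Omega>)) (ys \<Omega>)" for t
 have zero: "(LINT t|lborel. exp (- (of_real (real n) * of_real t)\<^sup>2) * \<delta> t) = 0" if n: "n > 0" for n :: nat
 proof -
  define g :: "complex \<Rightarrow> complex" where "g \<zeta> = exp (- (of_real (real n) * \<zeta>)\<^sup>2)" for \<zeta>
  have g: "ent g" unfolding g_def using ent_scale[OF ent_gauss, of "real n"] n by simp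
  define k where "k = shift (- ?p) g"
  have k: "ent k" unfolding k_def by (rule ent_shift[OF g])
  have kk: "shift ?p k = g" by (simp add: k_def shift_def)
  \<comment> \<open>The Gaussian is even and real on the line, so its shift by
    \<open>- (\<i> * pi)\<close> is conjugated when \<open>t\<close> is replaced by
    \<open>- t\<close>.\<close>
  have kr: "k (of_real (- t)) = cnj (k (of_real t))" for t
   by (simp add: k_def shift_def g_def exp_cnj power2_eq_square algebra_simps)
  have gr: "cnj (g (of_real t)) = g (of_real t)" for t by (simp add: g_def exp_cnj)
  have "smear g (l (x \<Omega>)) (y \<Omega>) = (LINT t|lborel. k (of_real t) * B (U (dil t) (y \<Omega>)) (\<theta> (xs \<Omega>)))"
   unfolding X[OF g] by (simp add: smear_def k_def l_def)
  \<comment> \<open>Reversing \<open>t\<close> prepares the exchange of the two arguments of the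
    form: the integral becomes the conjugate of a smeared functional belonging to
    \<open>y \<Omega>\<close>, to which \<open>Y\<close> applies with the kernel
    \<open>k\<close>.\<close>
  also have "\<dots> = (LINT t|lborel. k (of_real (- t)) * B (U (dil (- t)) (y \<Omega>)) (\<theta> (xs \<Omega>)))"
   using lborel_integral_real_affine[of "-1" "\<lambda>t. k (of_real t) * B (U (dil t) (y \<Omega>)) (\<theta> (xs \<Omega>))" 0] by simp
  also have "\<dots> = (LINT t|lborel. cnj (k (of_real t) * l (y \<Omega>) (U (dil t) (\<theta> (xs \<Omega>)))))"
  proof (rule Bochner_Integration.integral_cong[OF refl])
   fix t
   have "B (U (dil (- t)) (y \<Omega>)) (\<theta> (xs \<Omega>)) = cnj (B (U (dil t) (\<theta> (xs \<Omega>))) (y \<Omega>))"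
    using form_hermitian[of "U (dil t) (\<theta> (xs \<Omega>))" "y \<Omega>"] by (simp add: U_form[OF dil_Mob] inv_dil)
   then show "k (of_real (- t)) * B (U (dil (- t)) (y \<Omega>)) (\<theta> (xs \<Omega>)) = cnj (k (of_real t) * l (y \<Omega>) (U (dil t) (\<theta> (xs \<Omega>))))"
    unfolding kr by (simp add: l_def)
  qed
  also have "\<dots> = cnj (smear k (l (y \<Omega>)) (\<theta> (xs \<Omega>)))" unfolding smear_def by (rule Bochner_Integration.integral_cnj)
  also have "\<dots> = cnj (smear g (l (\<theta> (ys \<Omega>))) (\<theta> (xs \<Omega>)))" unfolding Y[OF k] kk ..
  also have "\<dots> = (LINT t|lborel. cnj (g (of_real t) * B (U (dil t) (\<theta> (xs \<Omega>))) (\<theta> (ys \<Omega>))))"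
   unfolding smear_def l_def by (rule Bochner_Integration.integral_cnj[symmetric])
  \<comment> \<open>\<open>\<theta>\<close> commutes with the dilations and is antiunitary, so both
    occurrences of \<open>\<theta>\<close> disappear together with the conjugation.\<close>
  also have "\<dots> = smear g (l (ys \<Omega>)) (xs \<Omega>)"
   unfolding pct_dil[symmetric] pct_antiunitary by (simp add: smear_def l_def gr)
  finally have "smear g (l (x \<Omega>)) (y \<Omega>) = smear g (l (ys \<Omega>)) (xs \<Omega>)" .
  moreover have "(LINT t|lborel. g (of_real t) * \<delta> t) = smear g (l (x \<Omega>)) (y \<Omega>) - smear g (l (ys \<Omega>)) (xs \<Omega>)"
   using smear_integrable[OF g Ll] by (simp add: smear_def \<delta>_def l_def right_diff_distrib)
  ultimately show ?thesis by (simp add: g_def)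
 qed
 obtain C K where C: "C \<ge> 0" "K \<ge> 0" "\<And>t. norm (B (U (dil t) (y \<Omega>)) (x \<Omega>)) \<le> C * exp (K * \<bar>t\<bar>)"
  using dil_orbit_exp[OF Lf_B] by blast
 obtain C' K' where C': "C' \<ge> 0" "K' \<ge> 0" "\<And>t. norm (B (U (dil t) (xs \<Omega>)) (ys \<Omega>)) \<le> C' * exp (K' * \<bar>t\<bar>)"
  using dil_orbit_exp[OF Lf_B] by blast
 have "\<delta> 0 = 0"
 proof (rule gauss_delta[OF _ _ _ zero])
  show "continuous_on UNIV \<delta>" unfolding \<delta>_def[abs_def] by (intro continuous_intros dil_orbit_continuous Lf_B)
  show "norm (\<delta> t) \<le> (C + C') * exp (max K K' * \<bar>t\<bar>)" for t
  proof -
   have "norm (\<delta> t) \<le> C * exp (K * \<bar>t\<bar>) + C' * exp (K' * \<bar>t\<bar>)"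
    unfolding \<delta>_def by (rule order_trans[OF norm_triangle_ineq4 add_mono[OF C(3) C'(3)]])
   also have "\<dots> \<le> C * exp (max K K' * \<bar>t\<bar>) + C' * exp (max K K' * \<bar>t\<bar>)"
    using C C' by (intro add_mono mult_left_mono) (auto intro: mult_right_mono)
   finally show ?thesis by (simp add: distrib_right)
  qed
 qed (use C in auto)
 then show ?thesis by (simp add: \<delta>_def dil_0 U_id)
qed

end

section \<open>Intervals of the circle\<close>

lemma su_continuous_mob: "su a b \<Longrightarrow> continuous_on A (mob a b)"
 unfolding continuous_on_circle_iff
 using mob_den_nonzero by (auto simp: of_circle_mob intro!: continuous_intros continuous_of_circle)

lemma Mob_open_image:
 assumes "\<gamma> \<in> Mob" "open A" shows "open (\<gamma> ` A)"
proof -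
 obtain a b where ab: "su a b" "inv \<gamma> = mob a b" using Mob_inv(1)[OF assms(1)] Mob_iff by blast
 have "\<gamma> ` A = inv \<gamma> -` A" using bij_image_Collect_eq[OF Mob_inv(4)[OF assms(1)], of "\<lambda>z. z \<in> A"] by (simp add: vimage_def)
 then show ?thesis using open_vimage[OF assms(2), of "inv \<gamma>"] su_continuous_mob[OF ab(1)] by (simp add: ab(2))
qed

lemma compl_interval_Mob:
 assumes \<gamma>: "\<gamma> \<in> Mob" shows "compl_interval (\<gamma> ` I) = \<gamma> ` compl_interval I"
proof -
 have sub: "\<delta> ` compl_interval A \<subseteq> compl_interval (\<delta> ` A)" if \<delta>: "\<delta> \<in> Mob" for \<delta> A
  unfolding compl_interval_def
 proof (rule interior_maximal)
  show "\<delta> ` interior (- A) \<subseteq> - \<delta> ` A"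
   using interior_subset[of "- A"] bij_image_Compl_eq[OF Mob_inv(4)[OF \<delta>], of A] by blast
  show "open (\<delta> ` interior (- A))" by (rule Mob_open_image[OF \<delta> open_interior])
 qed
 note m = Mob_inv[OF \<gamma>]
 have "inv \<gamma> ` compl_interval (\<gamma> ` I) \<subseteq> compl_interval (inv \<gamma> ` \<gamma> ` I)" by (rule sub[OF m(1)])
 then have "inv \<gamma> ` compl_interval (\<gamma> ` I) \<subseteq> compl_interval I" by (simp add: image_comp m(3))
 then have "\<gamma> ` inv \<gamma> ` compl_interval (\<gamma> ` I) \<subseteq> \<gamma> ` compl_interval I" by blast
 then have "compl_interval (\<gamma> ` I) \<subseteq> \<gamma> ` compl_interval I" by (simp add: image_comp m(2))
 then show ?thesis using sub[OF \<gamma>] by blast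
qed

lemma Im_rot: "Im (of_circle (rot t z)) = sin t * Re (of_circle z) + cos t * Im (of_circle z)"
proof -
 have "of_circle (rot t z) = cis t * of_circle z"
  unfolding rot_def using of_circle[of z] by (intro Circle_inverse) (simp add: norm_mult)
 then show ?thesis by simp
qed

text \<open>Only the points 1 and -1 are in question: arbitrarily small rotations carry them into
  \<open>upper\<close>, so they are not interior to its complement.\<close>

lemma compl_interval_upper: "compl_interval upper = lower"
proof (rule antisym)
 show "lower \<subseteq> compl_interval upper"
  unfolding compl_interval_def by (intro interior_maximal open_lower) (auto simp: upper_def lower_def)
 show "compl_interval upper \<subseteq> lower"
 proof
  fix z assume z: "z \<in> compl_interval upper"
  then have le: "Im (of_circle z) \<le> 0" using interior_subset by (fastforce simp: compl_interval_def upper_def)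
  have "Im (of_circle z) \<noteq> 0"
  proof
   assume i: "Im (of_circle z) = 0"
   obtain e where e: "e > 0" "ball z e \<subseteq> - upper"
    using z open_contains_ball[of "interior (- upper)"] interior_subset unfolding compl_interval_def by blast
   let ?x = "Re (of_circle z)"
   have x: "?x\<^sup>2 = 1" using Re_Im_circle[of z] i by simp
   define t where "t = min 1 (e / 2)"
   have t: "0 < t" "t < e" "t < pi" using e pi_gt3 by (auto simp: t_def)
   have "\<bar>?x\<bar> = 1" using x by (metis abs_1 abs_square_eq_1)
   \<comment> \<open>The angle carries the sign of \<open>?x\<close>, which is 1 or -1, so that both
     end points move upwards.\<close>
   then have "dist z (rot (t * ?x) z) < e" using dist_rot_le[of "t * ?x" z] t by (simp add: abs_mult dist_commute)
   then have "rot (t * ?x) z \<notin> upper" using e(2) by auto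
   moreover have "Im (of_circle (rot (t * ?x) z)) = sin t"
   proof -
    have "?x = 1 \<or> ?x = -1" using x power2_eq_1_iff by blast
    then show ?thesis by (auto simp: Im_rot i)
   qed
   ultimately show False using sin_gt_zero[OF t(1,3)] by (simp add: upper_def)
  qed
  then show "z \<in> lower" using le by (simp add: lower_def)
 qed
qed

lemma ctr_upper_image: "ctr r ` upper = {z. tanh (2 * r) < Im (of_circle z)}"
proof -
 have "ctr (- r) z \<in> upper \<longleftrightarrow> tanh (2 * r) < Im (of_circle z)" for z
 proof -
  have y: "\<bar>Im (of_circle z)\<bar> \<le> 1" using abs_Im_le_cmod[of "of_circle z"] of_circle[of z] by simp
  have "\<bar>sinh (2 * r)\<bar> < cosh (2 * r)"
   using sinh_less_cosh_real[of "2 * r"] sinh_less_cosh_real[of "- (2 * r)"] by (simp add: abs_less_iff)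
  moreover have "\<bar>sinh (2 * r) * Im (of_circle z)\<bar> \<le> \<bar>sinh (2 * r)\<bar> * 1" unfolding abs_mult using y by (intro mult_left_mono) auto
  ultimately have "cosh (2 * r) - sinh (2 * r) * Im (of_circle z) > 0" by linarith
  moreover have "Im (of_circle (ctr (- r) z)) = (cosh (2 * r) * Im (of_circle z) - sinh (2 * r)) / (cosh (2 * r) - sinh (2 * r) * Im (of_circle z))"
   using Im_ctr[of "- r" z] by simp
  ultimately have "0 < Im (of_circle (ctr (- r) z)) \<longleftrightarrow> sinh (2 * r) < cosh (2 * r) * Im (of_circle z)"
   by (simp add: zero_less_divide_iff)
  then show ?thesis by (simp add: upper_def tanh_def divide_less_eq mult.commute)
 qed
 moreover have "ctr r ` upper = {z. ctr (- r) z \<in> upper}"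
  using ctr_ctr[of r] ctr_ctr[of "- r"] by (auto simp: image_iff) metis
 ultimately show ?thesis by simp
qed

text \<open>Away from -1 the argument is a continuous coordinate, in which the interval is an open
  interval of angles. Rotating its midpoint to \<open>\<i>\<close> lets the height alone decide
  membership.\<close>

lemma interval_without_minus_one:
 assumes I: "interval I" "circ pi \<notin> closure I"
 obtains t c where "-1 < c" "c < 1" "rot t ` I = {z. c < Im (of_circle z)}"
proof -
 let ?A = "\<lambda>z. Arg (of_circle z)"
 let ?S = "?A ` I"
 have cA: "circ (?A z) = z" for z
  using of_circle[of z] by (intro circle_eqI) (simp add: cis_Arg_unique[OF _ _ _] rcis_cmod_Arg[of "of_circle z", unfolded rcis_def, simplified])
 have cinv: "circ t = circ pi" if "cis t = -1" for t using that by (intro circle_eqI) simp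
 \<comment> \<open>A whole neighbourhood of -1 is missed: \<open>Arg\<close> is then continuous on
   \<open>I\<close>, and its values stay below \<open>pi\<close> by the fixed amount
   \<open>e\<close>.\<close>
 obtain e where e: "e > 0" "\<And>t. \<bar>t - pi\<bar> < e \<Longrightarrow> circ t \<notin> I"
 proof -
  have "continuous_on UNIV circ" unfolding continuous_on_circle_iff by (auto intro!: continuous_intros)
  from open_vimage[OF _ this, of "- closure I"] have "open (circ -` (- closure I))" by auto
  then obtain e where "e > 0" "ball pi e \<subseteq> circ -` (- closure I)" using I(2) open_contains_ball by blast
  then show ?thesis using closure_subset[of I] by (intro that[of e]) (auto simp: dist_real_def abs_minus_commute subset_iff)
 qed
 have S: "circ t \<in> I \<and> - pi < t \<and> t \<le> pi - e" if tS: "t \<in> ?S" for t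
 proof -
  obtain z where z: "z \<in> I" "t = ?A z" using tS by blast
  have t: "- pi < t" "t \<le> pi" using Arg_bounded[of "of_circle z"] z by auto
  have "circ t \<in> I" using z cA by simp
  moreover have "t \<le> pi - e" using e(2)[of t] t \<open>circ t \<in> I\<close> by force
  ultimately show ?thesis using t by simp
 qed
 have S': "t \<in> ?S" if "circ t \<in> I" "- pi < t" "t \<le> pi" for t
 proof -
  have "?A (circ t) = t" using that Arg_cis[of t] by simp
  then show ?thesis using that(1) by (metis imageI)
 qed
 have conn: "connected ?S"
 proof (rule connected_continuous_image)
  show "connected I" using I(1) by (simp add: interval_def)
  show "continuous_on I ?A"
  proof (rule continuous_at_imp_continuous_on, rule ballI)
   fix z assume z: "z \<in> I"
   have "of_circle z \<notin> \<real>\<^sub>\<le>\<^sub>0"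
   proof
    assume n: "of_circle z \<in> \<real>\<^sub>\<le>\<^sub>0"
    then have "Im (of_circle z) = 0" "Re (of_circle z) \<le> 0" by (auto simp: complex_nonpos_Reals_iff)
    then have "of_circle z = -1" using Re_Im_circle[of z] by (auto simp: complex_eq_iff power2_eq_1_iff)
    then have "z = circ pi" by (intro circle_eqI) simp
    then show False using e(2)[of pi] e(1) z by simp
   qed
   then have "isCont Arg (of_circle z)" by (rule continuous_at_Arg)
   moreover have "isCont of_circle z" using continuous_of_circle[of UNIV] by (simp add: continuous_on_eq_continuous_at)
   ultimately show "isCont ?A z" by (rule isCont_o2[rotated])
  qed
 qed
 define \<alpha> \<beta> where "\<alpha> = Inf ?S" and "\<beta> = Sup ?S"
 have ne: "?S \<noteq> {}" using I(1) by (auto simp: interval_def)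
 have bb: "bdd_below ?S" "bdd_above ?S" unfolding bdd_below_def bdd_above_def using S less_imp_le by blast+
 have ab: "- pi \<le> \<alpha>" "\<beta> \<le> pi - e"
  unfolding \<alpha>_def \<beta>_def using S less_imp_le by (blast intro: cInf_greatest[OF ne] cSup_least[OF ne])+
 have openS: "\<exists>d>0. \<forall>u. \<bar>u - t\<bar> < d \<longrightarrow> u \<in> ?S" if t: "t \<in> ?S" for t
 proof -
  have "continuous_on UNIV circ" unfolding continuous_on_circle_iff by (auto intro!: continuous_intros)
  from open_vimage[OF _ this, of I] I(1) have "open (circ -` I)" by (auto simp: interval_def)
  then obtain d where d: "d > 0" "ball t d \<subseteq> circ -` I" using S[OF t] open_contains_ball by blast
  show ?thesis
  proof (intro exI[of _ "min d (min (pi - t) (t + pi))"] conjI allI impI)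
   show "0 < min d (min (pi - t) (t + pi))" using d S[OF t] e by auto
   fix u assume u: "\<bar>u - t\<bar> < min d (min (pi - t) (t + pi))"
   then have "circ u \<in> I" using d(2) by (auto simp: dist_real_def subset_iff abs_minus_commute)
   then show "u \<in> ?S" using u by (intro S') auto
  qed
 qed
 have Seq: "?S = {\<alpha><..<\<beta>}"
 proof (intro equalityI subsetI)
  fix t assume t: "t \<in> ?S"
  obtain d where d: "d > 0" "\<And>u. \<bar>u - t\<bar> < d \<Longrightarrow> u \<in> ?S" using openS[OF t] by blast
  have "t - d / 2 \<in> ?S" "t + d / 2 \<in> ?S" using d by auto
  then have "\<alpha> \<le> t - d / 2" "t + d / 2 \<le> \<beta>" unfolding \<alpha>_def \<beta>_def by (auto intro!: cInf_lower cSup_upper bb)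
  then show "t \<in> {\<alpha><..<\<beta>}" using d(1) by auto
 next
  fix t assume "t \<in> {\<alpha><..<\<beta>}"
  then have "Inf ?S < t" "t < Sup ?S" by (auto simp: \<alpha>_def \<beta>_def)
  then obtain u v where "u \<in> ?S" "u < t" "v \<in> ?S" "t < v" using cInf_lessD[OF ne] less_cSupD[OF ne] by metis
  then show "t \<in> ?S" using conn connectedD_interval[of ?S u v t] by auto
 qed
 have lt: "\<alpha> < \<beta>" using ne Seq by auto
 \<comment> \<open>Midpoint and half length of the interval of angles; the bound on the height will
   be \<open>cos h\<close>.\<close>
 define m h where "m = (\<alpha> + \<beta>) / 2" and "h = (\<beta> - \<alpha>) / 2"
 have h: "0 < h" "h < pi" using lt ab e by (auto simp: h_def)
 have mh: "\<alpha> = m - h" "\<beta> = m + h" by (auto simp: m_def h_def field_simps)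
 have rotc: "Im (of_circle (rot (pi / 2 - m) (circ (m + u)))) = cos u" for u
 proof -
  have "Im (of_circle (rot (pi / 2 - m) (circ (m + u)))) = sin ((pi / 2 - m) + (m + u))"
   by (simp only: Im_rot of_circle_circ cis.sel sin_add[of "pi / 2 - m"])
  also have "(pi / 2 - m) + (m + u) = pi / 2 + u" by simp
  finally show ?thesis by (simp add: sin_add)
 qed
 have mem: "z \<in> I \<longleftrightarrow> cos h < Im (of_circle (rot (pi / 2 - m) z))" for z
 proof
  assume "z \<in> I"
  then have "?A z \<in> {\<alpha><..<\<beta>}" using Seq by blast
  then have u: "\<bar>?A z - m\<bar> < h" by (auto simp: mh)
  have "cos h < cos \<bar>?A z - m\<bar>" using u h by (intro cos_monotone_0_pi) auto
  then show "cos h < Im (of_circle (rot (pi / 2 - m) z))" using rotc[of "?A z - m"] cA[of z] by simp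
 next
  assume c: "cos h < Im (of_circle (rot (pi / 2 - m) z))"
  define u where "u = ?A (rot (- m) z)"
  have u: "- pi < u" "u \<le> pi" using Arg_bounded by (auto simp: u_def)
  have "rot (- m) z = circ u" using cA by (simp add: u_def)
  then have "rot m (rot (- m) z) = rot m (circ u)" by simp
  moreover have "rot m (circ u) = circ (m + u)" by (simp add: rot_def circ_def Circle_inverse cis_mult)
  ultimately have z: "z = circ (m + u)" by simp
  have "cos h < cos \<bar>u\<bar>" using c rotc[of u] z by simp
  moreover have "\<bar>u\<bar> \<le> pi" using u by linarith
  ultimately have "\<bar>u\<bar> < h" using cos_monotone_0_pi_le[of h "\<bar>u\<bar>"] h by (cases "\<bar>u\<bar> < h") auto
  then have "m + u \<in> ?S" unfolding Seq mh by auto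
  then show "z \<in> I" using S z by simp
 qed
 have "rot (pi / 2 - m) ` I = {z. cos h < Im (of_circle z)}"
 proof (intro equalityI subsetI)
  fix z assume "z \<in> {z. cos h < Im (of_circle z)}"
  then have "rot (- (pi / 2 - m)) z \<in> I" unfolding mem by simp
  then show "z \<in> rot (pi / 2 - m) ` I" by (rule rev_image_eqI) simp
 qed (use mem in auto)
 moreover have "-1 < cos h" "cos h < 1" using cos_monotone_0_pi[of h pi] cos_monotone_0_pi[of 0 h] h by auto
 ultimately show ?thesis using that by blast
qed

lemma Mob_comp: "\<gamma> \<in> Mob \<Longrightarrow> \<delta> \<in> Mob \<Longrightarrow> \<gamma> \<circ> \<delta> \<in> Mob"
 unfolding Mob_iff using su_mob_comp by metis

lemma closure_rot: "closure (rot t ` I) \<subseteq> rot t ` closure I"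
proof (rule closure_minimal)
 show "rot t ` I \<subseteq> rot t ` closure I" using closure_subset by blast
 have "compact (closure I)" using compact_Int_closed[OF compact_circle, of "closure I"] by simp
 then show "closed (rot t ` closure I)" by (intro compact_imp_closed compact_continuous_image continuous_rot)
qed

lemma interval_rot:
 assumes "interval I" shows "interval (rot t ` I)"
proof -
 have c: "continuous_on A (rot u)" for u A by (rule continuous_rot)
 note closure_rot[of t I]
 moreover have "rot t ` closure I \<noteq> UNIV"
 proof
  assume u: "rot t ` closure I = UNIV"
  have "closure I = UNIV"
  proof (intro equalityI subsetI)
   fix z
   have "rot t z \<in> rot t ` closure I" by (simp add: u)
   then obtain w where "w \<in> closure I" "rot t z = rot t w" by blast
   then show "z \<in> closure I" by (metis add.left_inverse rot_0 rot_rot)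
  qed auto
  then show False using assms by (simp add: interval_def)
 qed
 ultimately show ?thesis
  using assms Mob_open_image[OF rot_Mob] connected_continuous_image[OF c] by (auto simp: interval_def)
qed

text \<open>A rotation moves a point outside the closure to -1, a second one makes the interval a
  cap around \<open>\<i>\<close>, and every such cap is the image of the upper half circle under
  some \<open>ctr r\<close>.\<close>

lemma interval_Mob_upper:
 assumes "interval I" obtains \<gamma> where "\<gamma> \<in> Mob" "I = \<gamma> ` upper"
proof -
 obtain p where p: "p \<notin> closure I" using assms by (auto simp: interval_def)
 obtain t0 where t0: "p = circ t0" using circ_surj by blast
 let ?J = "rot (pi - t0) ` I"
 have J: "interval ?J" by (rule interval_rot[OF assms])
 have "circ pi \<notin> closure ?J"
 proof
  assume c: "circ pi \<in> closure ?J"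
  then obtain w where w: "w \<in> closure I" "circ pi = rot (pi - t0) w" using closure_rot by blast
  have "cis (- (pi - t0)) * cis pi = cis t0" by (simp only: cis_mult) simp
  then have "rot (- (pi - t0)) (circ pi) = p" by (simp only: t0 rot_def of_circle_circ circ_def[of t0])
  moreover have "rot (- (pi - t0)) (circ pi) = w" unfolding w(2) by simp
  ultimately show False using p w(1) by simp
 qed
 from J this obtain t c where c: "-1 < c" "c < 1" "rot t ` ?J = {z. c < Im (of_circle z)}"
  by (rule interval_without_minus_one)
 \<comment> \<open>The solution of \<open>tanh (2 * r) = c\<close>.\<close>
 define r where "r = - ln ((1 - c) / (1 + c)) / 4"
 have "tanh (2 * r) = c"
 proof -
  have e: "exp (- 2 * (2 * r)) = (1 - c) / (1 + c)" using c by (simp add: r_def)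
  show ?thesis unfolding tanh_real_altdef e using c by (simp add: field_simps)
 qed
 then have e: "rot t ` ?J = ctr r ` upper" using c(3) ctr_upper_image[of r] by simp
 have "rot (- (t + (pi - t0))) ` rot t ` ?J = I" by (simp add: image_comp o_def)
 then have "I = (rot (- (t + (pi - t0))) \<circ> ctr r) ` upper" unfolding e by (simp add: image_comp)
 then show ?thesis using that Mob_comp[OF rot_Mob ctr_Mob] by blast
qed

section \<open>Haag duality\<close>

context wightman_cft
begin

lemma strong_add: "continuous_map (prod_topology \<T> \<T>) \<T> (\<lambda>(v, w). v + w)"
 and strong_scale: "continuous_map (prod_topology euclidean \<T>) \<T> (\<lambda>(c, v). s c v)"
 using strong_topology_finest(1)[of s F] by (simp_all add: locally_convex_topology_def)

lemma strong_map_add: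
 assumes "continuous_map X \<T> g" "continuous_map X \<T> h"
 shows "continuous_map X \<T> (\<lambda>v. g v + h v)"
 using continuous_map_compose[OF continuous_map_pairedI[OF assms] strong_add] by (simp add: o_def)

lemma strong_map_scale:
 assumes "continuous_map X \<T> h"
 shows "continuous_map X \<T> (\<lambda>v. s c (h v))"
proof -
 have "continuous_map X euclidean (\<lambda>v. c)" by simp
 from continuous_map_compose[OF continuous_map_pairedI[OF this assms] strong_scale] show ?thesis by (simp add: o_def)
qed

text \<open>The topology pulled back along \<open>\<phi> f\<close> is one of those defining the strong topology.\<close>

lemma field_continuous:
 assumes \<phi>: "\<phi> \<in> F" and f: "f \<in> smooth"
 shows "continuous_map \<T> \<T> (\<phi> f)"
proof (rule continuous_map_into_strong_topology)
 fix T assume T: "locally_convex_topology s T" "fields_continuous F T"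
 let ?P = "pullback_topology UNIV (\<phi> f) T"
 have tT: "topspace T = UNIV" using T(1) by (simp add: locally_convex_topology_def)
 have into: "continuous_map X ?P h \<longleftrightarrow> continuous_map X T (\<lambda>v. \<phi> f (h v))" for X :: "'x topology" and h
  using continuous_map_pullback'[of X T "\<phi> f" h UNIV] continuous_map_compose[OF _ continuous_map_pullback[of T T id UNIV "\<phi> f"], of X h]
  by (auto simp: o_def)
 have from1: "continuous_map ?P T (\<phi> f)" using continuous_map_pullback[of T T id UNIV "\<phi> f"] by simp
 have "locally_convex_topology s ?P" unfolding locally_convex_topology_def
 proof (intro conjI allI impI)
  show "topspace ?P = UNIV" by (simp add: topspace_pullback_topology tT)
  have "continuous_map (prod_topology ?P ?P) (prod_topology T T) (\<lambda>(v, w). (\<phi> f v, \<phi> f w))"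
   by (rule continuous_map_prod_top[THEN iffD2]) (use from1 in blast)
  moreover have "continuous_map (prod_topology T T) T (\<lambda>(v, w). v + w)"
   using T(1) by (simp add: locally_convex_topology_def)
  ultimately have "continuous_map (prod_topology ?P ?P) T ((\<lambda>(v, w). v + w) \<circ> (\<lambda>(v, w). (\<phi> f v, \<phi> f w)))"
   by (rule continuous_map_compose)
  then show "continuous_map (prod_topology ?P ?P) ?P (\<lambda>(v, w). v + w)"
   unfolding into by (simp add: o_def case_prod_unfold field_add[OF \<phi> f])
  have "continuous_map (prod_topology euclidean ?P) (prod_topology euclidean T) (\<lambda>(c, v). (id c, \<phi> f v))"
   by (rule continuous_map_prod_top[THEN iffD2]) (use from1 continuous_map_id in blast)
  moreover have "continuous_map (prod_topology euclidean T) T (\<lambda>(c, v). s c v)"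
   using T(1) by (simp add: locally_convex_topology_def)
  ultimately have "continuous_map (prod_topology euclidean ?P) T ((\<lambda>(c, v). s c v) \<circ> (\<lambda>(c, v). (id c, \<phi> f v)))"
   by (rule continuous_map_compose)
  then show "continuous_map (prod_topology euclidean ?P) ?P (\<lambda>(c, v). s c v)"
   unfolding into by (simp add: o_def case_prod_unfold field_scale[OF \<phi> f])
  fix W assume "openin ?P W \<and> 0 \<in> W"
  then obtain W1 where W1: "openin T W1" "W = \<phi> f -` W1" "0 \<in> W1"
   using \<phi> f by (auto simp: openin_pullback_topology)
  then obtain V where V: "V \<subseteq> W1" "openin T V" "0 \<in> V"
   "\<forall>v\<in>V. \<forall>w\<in>V. \<forall>u\<in>{0..1::real}. s (of_real u) v + s (of_real (1 - u)) w \<in> V"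
   using T(1) unfolding locally_convex_topology_def by meson
  show "\<exists>V\<subseteq>W. openin ?P V \<and> 0 \<in> V \<and> (\<forall>v\<in>V. \<forall>w\<in>V. \<forall>u\<in>{0..1::real}. s (of_real u) v + s (of_real (1 - u)) w \<in> V)"
  proof (intro exI[of _ "\<phi> f -` V"] conjI)
   show "openin ?P (\<phi> f -` V)" using V(2) by (auto simp: openin_pullback_topology)
   show "\<forall>v\<in>\<phi> f -` V. \<forall>w\<in>\<phi> f -` V. \<forall>u\<in>{0..1::real}. s (of_real u) v + s (of_real (1 - u)) w \<in> \<phi> f -` V"
    using V(4) by (simp add: field_add[OF \<phi> f] field_scale[OF \<phi> f])
  qed (use V W1 \<phi> f in auto)
 qed
 moreover have "fields_continuous F ?P" unfolding fields_continuous_def into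
 proof (intro allI impI)
  fix \<phi>s v assume "set \<phi>s \<subseteq> F"
  then have "continuous_map (tuple_topology (length (\<phi> # \<phi>s))) T (\<lambda>fs. apply_fields (\<phi> # \<phi>s) fs v)"
   using T(2) \<phi> unfolding fields_continuous_def by (metis insert_subset list.set(2))
  \<comment> \<open>A product with \<open>\<phi> f\<close> in front is a product with one more slot,
    frozen at \<open>f\<close>; prepending a constant component to the tuple is continuous.\<close>
  moreover have "continuous_map (tuple_topology (length \<phi>s)) (tuple_topology (length (\<phi> # \<phi>s)))
   (\<lambda>fs. \<lambda>i\<in>{..<length (\<phi> # \<phi>s)}. case i of 0 \<Rightarrow> f | Suc j \<Rightarrow> fs j)" (is "continuous_map _ _ ?c")
   unfolding continuous_map_componentwise
  proof (intro conjI ballI)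
   fix i assume i: "i \<in> {..<length (\<phi> # \<phi>s)}"
   show "continuous_map (tuple_topology (length \<phi>s)) smooth_topology (\<lambda>fs. ?c fs i)"
    using i f by (cases i) (auto intro!: continuous_map_product_projection)
  qed auto
  ultimately have "continuous_map (tuple_topology (length \<phi>s)) T ((\<lambda>fs. apply_fields (\<phi> # \<phi>s) fs v) \<circ> ?c)"
   by (rule continuous_map_compose[rotated])
  moreover have "apply_fields (\<phi> # \<phi>s) (?c fs) v = \<phi> f (apply_fields \<phi>s fs v)" for fs
  proof -
   have "?c fs (Suc i) = fs i" if "i < length \<phi>s" for i using that by simp
   then have "map (?c fs) [0..<length (\<phi> # \<phi>s)] = f # map fs [0..<length \<phi>s]"
    by (simp only: list.size(4) map_upt_Suc plus_1_eq_Suc add_0_right add_Suc_right) auto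
   then show ?thesis by (simp add: apply_fields_opl del: upt_Suc)
  qed
  ultimately show "continuous_map (tuple_topology (length \<phi>s)) T (\<lambda>fs. \<phi> f (apply_fields \<phi>s fs v))"
   by (simp only: o_def)
 qed
 ultimately have "continuous_map \<T> ?P id"
  using strong_topology_finest(3) by (auto simp: continuous_map_def topspace_pullback_topology tT)
 then show "continuous_map \<T> T (\<phi> f)" by (simp add: into)
qed

lemma continuous_endos_closed:
 shows "id \<in> \<C>"
  and "x \<in> \<C> \<Longrightarrow> y \<in> \<C> \<Longrightarrow>
   (\<lambda>v. x v + y v) \<in> \<C>"
  and "x \<in> \<C> \<Longrightarrow> (\<lambda>v. s c (x v)) \<in> \<C>"
  and "x \<in> \<C> \<Longrightarrow> y \<in> \<C> \<Longrightarrow>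
   x \<circ> y \<in> \<C>" by (auto simp: continuous_endos_def linear_iff_fun scale_right_distrib mult.commute
   intro: strong_map_add strong_map_scale continuous_map_compose)

lemma local_algebra_mono: "x \<in> \<P> I \<Longrightarrow> I \<subseteq> J \<Longrightarrow> x \<in> \<P> J"
 by (induction rule: local_algebra.induct) (auto intro: local_algebra.intros)

lemma local_algebra_endos: "x \<in> \<P> I \<Longrightarrow> x \<in> \<C>"
proof (induction rule: local_algebra.induct)
 case (field \<phi> f)
 then show ?case using field_continuous field_linear by (simp add: continuous_endos_def)
qed (auto intro: continuous_endos_closed[unfolded id_def o_def])

lemma opl_local: "set xs \<subseteq> supported I \<Longrightarrow> opl xs \<in> \<P> I"
proof (induction xs)
 case Nil
 have "opl [] = (id :: 'v \<Rightarrow> 'v)" by auto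
 then show ?case by (simp only: local_algebra.unit)
next
 case (Cons x xs)
 obtain \<phi> f where x: "x = (\<phi>, f)" by (cases x)
 have "opl (x # xs) = \<phi> f \<circ> opl xs" by (auto simp: x)
 moreover have "\<phi> f \<in> \<P> I" using Cons.prems by (intro local_algebra.field) (auto simp: x supported_def)
 moreover have "opl xs \<in> \<P> I" using Cons by simp
 ultimately show ?case using local_algebra.mult by metis
qed

lemma local_cyclic:
 assumes "open I" "I \<noteq> {}" "Lf l" "\<And>a. a \<in> \<P> I \<Longrightarrow> l (a \<Omega>) = 0"
 shows "l v = 0"
 using reeh_schlieder[OF assms(1-3)] assms(4) opl_local by blast

lemma local_commute_intro:
 assumes z: "\<And>u v. z (u + v) = z u + z v" "\<And>c v. z (s c v) = s c (z v)"
  and com: "\<And>\<phi> f v. \<phi> \<in> F \<Longrightarrow> f \<in> smooth \<Longrightarrow> supp f \<subseteq> I \<Longrightarrow> z (\<phi> f v) = \<phi> f (z v)"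
  and x: "x \<in> \<P> I"
 shows "z (x v) = x (z v)"
 using x by (induction arbitrary: v rule: local_algebra.induct) (auto simp: z com)

lemma local_commute:
 assumes "I \<inter> J = {}" "x \<in> \<P> I" "y \<in> \<P> J"
 shows "x (y v) = y (x v)"
proof -
 have 1: "\<phi> f (x v) = x (\<phi> f v)" if "\<phi> \<in> F" "f \<in> smooth" "supp f \<subseteq> J" for \<phi> f v
 proof (rule local_commute_intro[OF _ _ _ assms(2)])
  fix \<psi> g v assume g: "\<psi> \<in> F" "g \<in> smooth" "supp g \<subseteq> I"
  then have "supp f \<inter> supp g = {}" using that(3) assms(1) by blast
  from locality[OF that(1) g(1) that(2) g(2) this] show "\<phi> f (\<psi> g v) = \<psi> g (\<phi> f v)" by (simp add: fun_eq_iff)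
 qed (auto simp: that field_add field_scale)
 have "x (u + w) = x u + x w" "x (s c w) = s c (x w)" for u w c
  using local_algebra_endos[OF assms(2)] by (auto simp: continuous_endos_def linear_iff_fun)
 then show ?thesis by (intro local_commute_intro[OF _ _ _ assms(3)]) (auto simp: 1)
qed

definition conj_U :: "(circle \<Rightarrow> circle) \<Rightarrow> ('v \<Rightarrow> 'v) \<Rightarrow> 'v \<Rightarrow> 'v"
 where "conj_U \<gamma> x = U \<gamma> \<circ> x \<circ> inv (U \<gamma>)"

lemma conj_U_apply: "\<gamma> \<in> Mob \<Longrightarrow> conj_U \<gamma> x v = U \<gamma> (x (U (inv \<gamma>) v))"
 by (simp add: conj_U_def U_inv)

lemma conj_U_comp: "\<gamma> \<in> Mob \<Longrightarrow> conj_U \<gamma> (x \<circ> y) = conj_U \<gamma> x \<circ> conj_U \<gamma> y"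
 by (simp add: fun_eq_iff conj_U_apply U_inv)

lemma conj_U_inverse:
 assumes "\<gamma> \<in> Mob" shows "conj_U \<gamma> (conj_U (inv \<gamma>) x) = x" "conj_U (inv \<gamma>) (conj_U \<gamma> x) = x"
proof -
 note m = Mob_inv[OF assms]
 have ii: "inv (inv \<gamma>) = \<gamma>" using inv_inv_eq[OF m(4)] .
 show "conj_U \<gamma> (conj_U (inv \<gamma>) x) = x" "conj_U (inv \<gamma>) (conj_U \<gamma> x) = x"
  using U_inv[OF assms] by (simp_all add: fun_eq_iff conj_U_apply assms m(1) ii)
qed

lemma conj_U_local:
 assumes \<gamma>: "\<gamma> \<in> Mob" and x: "x \<in> \<P> I"
 shows "conj_U \<gamma> x \<in> \<P> (\<gamma> ` I)"
 using x
proof (induction rule: local_algebra.induct)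
 case (field \<phi> f)
 have "conj_U \<gamma> (\<phi> f) = \<phi> (beta (cdim \<phi>) \<gamma> f)" unfolding conj_U_def by (rule covariance[OF \<gamma> field(1,2)])
 moreover have "supp (beta (cdim \<phi>) \<gamma> f) \<subseteq> \<gamma> ` I" using supp_beta[OF \<gamma>] field(3) by blast
 ultimately show ?case using local_algebra.field[OF field(1) smooth_beta[OF \<gamma> field(2)]] by simp
next
 case unit
 have "conj_U \<gamma> id = id" by (simp add: fun_eq_iff conj_U_apply[OF \<gamma>] U_inv[OF \<gamma>])
 then show ?case by (simp only: local_algebra.unit)
next
 case (add x y)
 have "conj_U \<gamma> (\<lambda>v. x v + y v) = (\<lambda>v. conj_U \<gamma> x v + conj_U \<gamma> y v)"
  by (simp add: fun_eq_iff conj_U_apply[OF \<gamma>] U_linear[OF \<gamma>])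
 then show ?case using local_algebra.add[OF add.IH] by simp
next
 case (scale x c)
 have "conj_U \<gamma> (\<lambda>v. s c (x v)) = (\<lambda>v. s c (conj_U \<gamma> x v))"
  by (simp add: fun_eq_iff conj_U_apply[OF \<gamma>] U_linear[OF \<gamma>])
 then show ?case using local_algebra.scale[OF scale.IH] by simp
next
 case (mult x y)
 then show ?case unfolding conj_U_comp[OF \<gamma>] by (intro local_algebra.mult)
qed

lemma conj_U_local_image:
 assumes \<gamma>: "\<gamma> \<in> Mob" shows "conj_U \<gamma> ` \<P> I = \<P> (\<gamma> ` I)"
proof (intro equalityI subsetI)
 note m = Mob_inv[OF \<gamma>]
 fix y assume "y \<in> \<P> (\<gamma> ` I)"
 from conj_U_local[OF m(1) this] have "conj_U (inv \<gamma>) y \<in> \<P> I" by (simp add: image_comp m(3))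
 then show "y \<in> conj_U \<gamma> ` \<P> I" by (rule rev_image_eqI) (simp add: conj_U_inverse[OF \<gamma>])
qed (use conj_U_local[OF \<gamma>] in blast)

end

context involutive_wightman_cft
begin

lemma is_adjoint_sym: "is_adjoint B x y \<Longrightarrow> is_adjoint B y x"
 unfolding is_adjoint_def by (metis form_hermitian)

lemma adjoint_linear:
 assumes "\<And>v w. B (x v) w = B v (y w)" shows "x (u + v) = x u + x v" "x (s c v) = s c (x v)"
 by (rule B_eqI, simp add: assms B_left)+

lemma local_algebra_adjoint:
 "x \<in> \<P> I \<Longrightarrow> \<exists>y\<in>\<P> I. is_adjoint B x y"
proof (induction rule: local_algebra.induct)
 case (field \<phi> f)
 have "supp (\<lambda>z. cnj (f z)) \<subseteq> I" using field(3) by (simp add: supp_def)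
 then have "(\<lambda>w. s ((- 1) ^ cdim \<phi>) (pr \<phi> (\<lambda>z. cnj (f z)) w)) \<in> \<P> I"
  by (intro local_algebra.scale local_algebra.field pr_F smooth_cnj field)
 moreover have "is_adjoint B (\<phi> f) (\<lambda>w. s ((- 1) ^ cdim \<phi>) (pr \<phi> (\<lambda>z. cnj (f z)) w))"
  by (simp add: is_adjoint_def field_adjoint field B_right)
 ultimately show ?case by blast
next
 case unit
 have "is_adjoint B id id" by (simp add: is_adjoint_def)
 then show ?case using local_algebra.unit by blast
next
 case (add x y)
 then obtain x' y' where "x' \<in> \<P> I" "is_adjoint B x x'" "y' \<in> \<P> I" "is_adjoint B y y'" by blast
 moreover from this have "is_adjoint B (\<lambda>v. x v + y v) (\<lambda>v. x' v + y' v)" by (simp add: is_adjoint_def B_left B_right)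
 ultimately show ?case using local_algebra.add by blast
next
 case (scale x c)
 then obtain x' where "x' \<in> \<P> I" "is_adjoint B x x'" by blast
 moreover from this have "is_adjoint B (\<lambda>v. s c (x v)) (\<lambda>v. s (cnj c) (x' v))" by (simp add: is_adjoint_def B_left B_right)
 ultimately show ?case using local_algebra.scale by blast
next
 case (mult x y)
 then obtain x' y' where "x' \<in> \<P> I" "is_adjoint B x x'" "y' \<in> \<P> I" "is_adjoint B y y'" by blast
 moreover from this have "is_adjoint B (x \<circ> y) (y' \<circ> x')" by (simp add: is_adjoint_def)
 ultimately show ?case using local_algebra.mult by blast
qed

lemma loc_commute:
 assumes x: "loc I x xs" and a: "a \<in> \<P> I" shows "x (a v) = a (x v)"
proof (rule local_commute_intro[OF _ _ _ a])
 have adj: "B (x v) w = B v (xs w)" for v w using x by (simp add: loc_def)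
 show "x (u + v) = x u + x v" "x (s c v) = s c (x v)" for u v c by (rule adjoint_linear[OF adj])+
qed (use x in \<open>simp add: loc_def\<close>)

text \<open>Operators of a disjoint region may be multiplied in. This supplies the variety of
  operators from which \<open>modular_exchange\<close>, a statement about the vacuum, draws its
  force.\<close>

lemma loc_mult:
 assumes x: "loc I x xs" and a: "a \<in> \<P> J" "is_adjoint B a as" and IJ: "J \<inter> I = {}"
 shows "loc I (\<lambda>v. x (a v)) (\<lambda>v. as (xs v))"
 unfolding loc_def
proof (intro conjI allI ballI impI)
 show "B (x (a v)) w = B v (as (xs w))" for v w using x a(2) by (simp add: loc_def is_adjoint_def)
 fix \<phi> f v assume \<phi>: "\<phi> \<in> F" "f \<in> smooth" "supp f \<subseteq> I"
 have "a (\<phi> f v) = \<phi> f (a v)" by (rule local_commute[OF IJ a(1) local_algebra.field[OF \<phi>]])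
 then show "x (a (\<phi> f v)) = \<phi> f (x (a v))" using x \<phi> by (simp add: loc_def)
qed

lemma upper_nonempty: "upper \<noteq> {}" and lower_nonempty: "lower \<noteq> {}"
proof -
 have "circ (pi / 2) \<in> upper" "circ (- (pi / 2)) \<in> lower" by (simp_all add: upper_def lower_def)
 then show "upper \<noteq> {}" "lower \<noteq> {}" by blast+
qed

lemma upper_lower_disjoint: "upper \<inter> lower = {}" "lower \<inter> upper = {}"
 by (auto simp: upper_def lower_def)

lemma commutants_commute:
 assumes y: "loc lower y ys" and x: "loc upper x xs"
 shows "ys (x v) = x (ys v)"
proof -
 have ys: "loc lower ys y" and xs: "loc upper xs x" using loc_adjoint x y by blast+
 have adjx: "B (xs v) w = B v (x w)" and adjy: "B (ys v) w = B v (y w)" for v w using xs ys by (simp_all add: loc_def)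
 have adjx': "B (x v) w = B v (xs w)" and adjy': "B (y v) w = B v (ys w)" for v w using x y by (simp_all add: loc_def)
 have vac: "ys (x (a \<Omega>)) = x (ys (a \<Omega>))" if a: "a \<in> \<P> lower" for a
 proof (rule B_eqI_right)
  fix w
  obtain as where as: "as \<in> \<P> lower" "is_adjoint B a as" using local_algebra_adjoint[OF a] by blast
  have "B w (ys (x (a \<Omega>))) - B w (x (ys (a \<Omega>))) = 0"
  proof (rule local_cyclic[OF open_upper upper_nonempty Lf_diff[OF Lf_B Lf_B]])
   fix b assume b: "b \<in> \<P> upper"
   obtain bs where bs: "bs \<in> \<P> upper" "is_adjoint B b bs" using local_algebra_adjoint[OF b] by blast
   have bs': "B u (bs v) = B (b u) v" and as': "B (as u) v = B u (a v)" for u v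
    using bs(2) is_adjoint_sym[OF as(2)] by (simp_all add: is_adjoint_def)
   have "B (b \<Omega>) (ys (x (a \<Omega>))) = B (y (b \<Omega>)) (x (a \<Omega>))" by (simp add: adjy')
   also have "\<dots> = B (as (xs \<Omega>)) (bs (ys \<Omega>))"
    by (rule modular_exchange[OF loc_mult[OF y b bs(2) upper_lower_disjoint(1)] loc_mult[OF x a as(2) upper_lower_disjoint(2)]])
   also have "\<dots> = B (as (b (xs \<Omega>))) (ys \<Omega>)"
    by (simp add: bs' local_commute[OF upper_lower_disjoint(1) b as(1)])
   also have "\<dots> = B (xs (b \<Omega>)) (ys (a \<Omega>))"
    by (simp add: as' loc_commute[OF xs b] loc_commute[OF ys a])
   also have "\<dots> = B (b \<Omega>) (x (ys (a \<Omega>)))" by (rule adjx)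
   finally show "B (b \<Omega>) (ys (x (a \<Omega>))) - B (b \<Omega>) (x (ys (a \<Omega>))) = 0" by simp
  qed
  then show "B w (ys (x (a \<Omega>))) = B w (x (ys (a \<Omega>)))" by simp
 qed
 show ?thesis
 proof (rule B_eqI)
  fix w
  \<comment> \<open>The operators are moved to the second argument by their adjoints, so that the
    difference is visibly a functional of \<open>v\<close> in \<open>Lf\<close> and cyclicity below
    extends \<open>vac\<close> from the vectors \<open>a \<Omega>\<close> to all
    \<open>v\<close>.\<close>
  have "B v (xs (y w)) - B v (y (xs w)) = 0" for v
  proof (rule local_cyclic[OF open_lower lower_nonempty Lf_diff[OF Lf_B Lf_B]])
   fix a assume "a \<in> \<P> lower"
   from arg_cong[OF vac[OF this], of "\<lambda>u. B u w"]
   show "B (a \<Omega>) (xs (y w)) - B (a \<Omega>) (y (xs w)) = 0" by (simp add: adjx' adjy)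
  qed
  then show "B (ys (x v)) w = B (x (ys v)) w" by (simp add: adjx' adjy)
 qed
qed

section \<open>Commutants, their covariance and duality\<close>

abbreviation EE :: "('v \<Rightarrow> 'v) set"
 where "EE \<equiv> star_endos s \<T> B"

abbreviation Q :: "circle set \<Rightarrow> ('v \<Rightarrow> 'v) set"
 where "Q \<equiv> bicommutant_net s F B"

lemma Q_eq: "Q I = commutant EE (commutant EE (\<P> I))"
 by (simp add: bicommutant_net_def Let_def)

lemma local_EE: "\<P> I \<subseteq> EE"
 using local_algebra_endos local_algebra_adjoint unfolding star_endos_def by blast

lemma commutant_antimono: "X \<subseteq> Y \<Longrightarrow> commutant E Y \<subseteq> commutant E X"
 by (auto simp: commutant_def)

lemma commutant_subset: "commutant E X \<subseteq> E"
 by (auto simp: commutant_def)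

lemma bicommutant_incl: "X \<subseteq> E \<Longrightarrow> X \<subseteq> commutant E (commutant E X)"
 by (auto simp: commutant_def)

lemma commutant_triple: "X \<subseteq> E \<Longrightarrow> commutant E (commutant E (commutant E X)) = commutant E X"
 using commutant_antimono[OF bicommutant_incl[of X E]] bicommutant_incl[OF commutant_subset[of E X]] by blast

text \<open>If \<open>x\<close> commutes with the adjoint of \<open>z\<close>, then the adjoint of
  \<open>x\<close> commutes with \<open>z\<close>; a set closed under adjoints therefore has a
  commutant closed under adjoints.\<close>

lemma star_commutant:
 assumes X: "\<And>x. x \<in> X \<Longrightarrow> \<exists>y\<in>X. is_adjoint B x y"
 shows "unital_star_subalgebra s \<T> B (commutant EE X)"
 unfolding unital_star_subalgebra_def
proof (intro conjI ballI allI)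
 let ?C = "\<C>"
 have EI: "x \<in> EE" if "x \<in> ?C" "y \<in> ?C" "is_adjoint B x y" for x y using that by (auto simp: star_endos_def)
 have ED: "\<exists>y. y \<in> ?C \<and> is_adjoint B x y \<and> x \<in> ?C" if "x \<in> EE" for x using that by (auto simp: star_endos_def)
 have lin: "y (u + v) = y u + y v" "y (s c v) = s c (y v)" if "y \<in> X" for y u v c
  using X[OF that] adjoint_linear[of y] unfolding is_adjoint_def by blast+
 show "commutant EE X \<subseteq> EE" by (rule commutant_subset)
 have "is_adjoint B id id" by (simp add: is_adjoint_def)
 from EI[OF continuous_endos_closed(1) continuous_endos_closed(1) this] show "id \<in> commutant EE X" by (simp add: commutant_def)
 fix x assume x: "x \<in> commutant EE X"
 then obtain x' where x': "x' \<in> ?C" "is_adjoint B x x'" "x \<in> ?C" using ED by (auto simp: commutant_def)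
 have cx: "x (z v) = z (x v)" if "z \<in> X" for z v using x that by (auto simp: commutant_def fun_eq_iff)
 {
  fix c
  have "is_adjoint B (\<lambda>v. s c (x v)) (\<lambda>v. s (cnj c) (x' v))" using x' by (simp add: is_adjoint_def B_left B_right)
  from EI[OF continuous_endos_closed(3)[OF x'(3)] continuous_endos_closed(3)[OF x'(1)] this]
  show "(\<lambda>v. s c (x v)) \<in> commutant EE X" by (simp add: commutant_def fun_eq_iff cx lin)
 }
 {
  fix y assume y: "y \<in> commutant EE X"
  then obtain y' where y': "y' \<in> ?C" "is_adjoint B y y'" "y \<in> ?C" using ED by (auto simp: commutant_def)
  have cy: "y (z v) = z (y v)" if "z \<in> X" for z v using y that by (auto simp: commutant_def fun_eq_iff)
  have "is_adjoint B (\<lambda>v. x v + y v) (\<lambda>v. x' v + y' v)" using x' y' by (simp add: is_adjoint_def B_left B_right)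
  from EI[OF continuous_endos_closed(2)[OF x'(3) y'(3)] continuous_endos_closed(2)[OF x'(1) y'(1)] this]
  show "(\<lambda>v. x v + y v) \<in> commutant EE X" by (simp add: commutant_def fun_eq_iff cx cy lin)
  have "is_adjoint B (x \<circ> y) (y' \<circ> x')" using x' y' by (simp add: is_adjoint_def)
  from EI[OF continuous_endos_closed(4)[OF x'(3) y'(3)] continuous_endos_closed(4)[OF y'(1) x'(1)] this]
  show "x \<circ> y \<in> commutant EE X" by (simp add: commutant_def fun_eq_iff cx cy)
 }
 have "x' \<in> commutant EE X" unfolding commutant_def
 proof (intro CollectI conjI ballI)
  show "x' \<in> EE" by (rule EI[OF x'(1,3) is_adjoint_sym[OF x'(2)]])
  fix z assume "z \<in> X"
  then obtain z' where z': "z' \<in> X" "is_adjoint B z z'" using X by blast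
  have "B w (x' (z v)) = B w (z (x' v))" for v w
   using x'(2) is_adjoint_sym[OF z'(2)] cx[OF z'(1)] unfolding is_adjoint_def by metis
  then show "x' \<circ> z = z \<circ> x'" by (simp add: fun_eq_iff B_eqI_right)
 qed
 then show "\<exists>y\<in>commutant EE X. is_adjoint B x y" using x'(2) by blast
qed

lemma Q_star_algebra: "unital_star_subalgebra s \<T> B (Q I)"
 unfolding Q_eq
proof (rule star_commutant)
 have "unital_star_subalgebra s \<T> B (commutant EE (\<P> I))" by (rule star_commutant) (rule local_algebra_adjoint)
 then show "x \<in> commutant EE (\<P> I) \<Longrightarrow> \<exists>y\<in>commutant EE (\<P> I). is_adjoint B x y" for x
  by (simp add: unital_star_subalgebra_def)
qed

lemma Q_mono: "I \<subseteq> J \<Longrightarrow> Q I \<subseteq> Q J"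
 unfolding Q_eq using local_algebra_mono by (intro commutant_antimono) blast

lemma conj_U_EE:
 assumes \<gamma>: "\<gamma> \<in> Mob" and x: "x \<in> EE" shows "conj_U \<gamma> x \<in> EE"
proof -
 let ?C = "\<C>"
 note m = Mob_inv[OF \<gamma>]
 have ii: "inv (inv \<gamma>) = \<gamma>" using inv_inv_eq[OF m(4)] .
 have c: "conj_U \<gamma> y \<in> ?C" if "y \<in> ?C" for y
  unfolding conj_U_def U_inv(3)[OF \<gamma>] by (intro continuous_endos_closed(4) U_endo \<gamma> m that)
 obtain y where y: "y \<in> ?C" "is_adjoint B x y" "x \<in> ?C" using x by (auto simp: star_endos_def)
 have "is_adjoint B (conj_U \<gamma> x) (conj_U \<gamma> y)"
  using y(2) by (simp add: is_adjoint_def conj_U_apply[OF \<gamma>] U_form[OF \<gamma>] U_form[OF m(1)] ii)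
 then show ?thesis using c y by (auto simp: star_endos_def)
qed

lemma conj_U_commutant:
 assumes \<gamma>: "\<gamma> \<in> Mob" shows "conj_U \<gamma> ` commutant EE X = commutant EE (conj_U \<gamma> ` X)"
proof -
 have sub: "conj_U \<delta> ` commutant EE Y \<subseteq> commutant EE (conj_U \<delta> ` Y)" if \<delta>: "\<delta> \<in> Mob" for \<delta> Y
  using conj_U_EE[OF \<delta>] by (auto simp: commutant_def conj_U_comp[OF \<delta>, symmetric])
 have "conj_U (inv \<gamma>) ` commutant EE (conj_U \<gamma> ` X) \<subseteq> commutant EE X"
  using sub[OF Mob_inv(1)[OF \<gamma>], of "conj_U \<gamma> ` X"] by (simp add: image_comp o_def conj_U_inverse[OF \<gamma>])
 then have "conj_U \<gamma> ` conj_U (inv \<gamma>) ` commutant EE (conj_U \<gamma> ` X) \<subseteq> conj_U \<gamma> ` commutant EE X" by (rule image_mono)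
 then show ?thesis using sub[OF \<gamma>, of X] by (simp add: image_comp o_def conj_U_inverse[OF \<gamma>] subset_antisym)
qed

lemma Q_covariant: "\<gamma> \<in> Mob \<Longrightarrow> conj_U \<gamma> ` Q I = Q (\<gamma> ` I)"
 by (simp add: Q_eq conj_U_commutant conj_U_local_image)

lemma commutant_loc:
 assumes "x \<in> commutant EE (\<P> I)" obtains xs where "loc I x xs"
proof -
 obtain xs where "is_adjoint B x xs" using assms by (auto simp: commutant_def star_endos_def)
 moreover have "x (\<phi> f v) = \<phi> f (x v)" if "\<phi> \<in> F" "f \<in> smooth" "supp f \<subseteq> I" for \<phi> f v
  using assms local_algebra.field[OF that] by (auto simp: commutant_def fun_eq_iff)
 ultimately show ?thesis using that[of xs] by (simp add: loc_def is_adjoint_def)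
qed

text \<open>One inclusion is \<open>commutants_commute\<close> for the two half circles, the other
  is locality.\<close>

lemma haag_upper: "commutant EE (\<P> upper) = Q lower"
proof (rule antisym)
 show "commutant EE (\<P> upper) \<subseteq> Q lower"
 proof
  fix x assume x: "x \<in> commutant EE (\<P> upper)"
  obtain xs where xs: "loc upper x xs" by (rule commutant_loc[OF x])
  have "x \<circ> y = y \<circ> x" if y: "y \<in> commutant EE (\<P> lower)" for y
  proof -
   obtain ys where "loc lower y ys" by (rule commutant_loc[OF y])
   then have "y (x v) = x (y v)" for v by (rule commutants_commute[OF loc_adjoint xs])
   then show ?thesis by (simp add: fun_eq_iff)
  qed
  then show "x \<in> Q lower" using x by (auto simp: Q_eq commutant_def)
 qed
 have "\<P> upper \<subseteq> commutant EE (\<P> lower)"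
  using local_EE local_commute[OF upper_lower_disjoint(1)] by (auto simp: commutant_def fun_eq_iff)
 then show "Q lower \<subseteq> commutant EE (\<P> upper)" unfolding Q_eq by (rule commutant_antimono)
qed

lemma haag_local:
 assumes "interval I" shows "commutant EE (\<P> I) = Q (compl_interval I)"
proof -
 obtain \<gamma> where \<gamma>: "\<gamma> \<in> Mob" "I = \<gamma> ` upper" by (rule interval_Mob_upper[OF assms])
 have "commutant EE (\<P> I) = conj_U \<gamma> ` commutant EE (\<P> upper)"
  by (simp add: \<gamma>(2) conj_U_local_image[OF \<gamma>(1), symmetric] conj_U_commutant[OF \<gamma>(1)])
 also have "\<dots> = Q (\<gamma> ` lower)" by (simp add: haag_upper Q_covariant[OF \<gamma>(1)])
 also have "\<gamma> ` lower = compl_interval I" by (simp add: \<gamma>(2) compl_interval_Mob[OF \<gamma>(1)] compl_interval_upper)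
 finally show ?thesis .
qed

lemma haag_Q: "interval I \<Longrightarrow> commutant EE (Q I) = Q (compl_interval I)"
 unfolding Q_eq[of I] commutant_triple[OF local_EE] by (rule haag_local)

end

section \<open>Separation by continuous functionals\<close>

locale complex_vector_space = vector_space s for s :: "complex \<Rightarrow> 'v::ab_group_add \<Rightarrow> 'v"
begin

text \<open>Homogeneity is demanded as an inequality for positive factors; using it for a factor and
  its inverse gives equality, \<open>sublinear_scale\<close>.\<close>

definition sublinear :: "('v \<Rightarrow> real) \<Rightarrow> bool"
 where "sublinear p \<longleftrightarrow> (\<forall>u v. p (u + v) \<le> p u + p v) \<and> (\<forall>r>0. \<forall>u. p (s (of_real r) u) \<le> r * p u)"

lemma sublinear_add: "sublinear p \<Longrightarrow> p (u + v) \<le> p u + p v"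
 by (simp add: sublinear_def)

lemma sublinear_zero: "sublinear p \<Longrightarrow> p 0 = 0"
proof -
 assume p: "sublinear p"
 have s: "p (s (of_real r) 0) \<le> r * p 0" if "r > 0" for r using p that unfolding sublinear_def by blast
 show ?thesis using s[of 2] s[of "1/2"] by simp
qed

lemma sublinear_scale: "sublinear p \<Longrightarrow> r > 0 \<Longrightarrow> p (s (of_real r) u) = r * p u"
proof -
 assume p: "sublinear p" and r: "r > 0"
 have "p (s (of_real (1 / r)) (s (of_real r) u)) \<le> 1 / r * p (s (of_real r) u)"
  using p r unfolding sublinear_def by (meson zero_less_divide_1_iff)
 moreover have "s (of_real (1 / r)) (s (of_real r) u) = u" using r by simp
 ultimately have "r * p u \<le> p (s (of_real r) u)" using r by (simp add: field_simps)
 then show ?thesis using p r unfolding sublinear_def by (meson antisym)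
qed

lemma sublinear_scale0: "sublinear p \<Longrightarrow> r \<ge> 0 \<Longrightarrow> p (s (of_real r) u) = r * p u"
 using sublinear_scale[of p r u] sublinear_zero[of p] by (cases "r = 0") auto

lemma sublinear_neg: "sublinear p \<Longrightarrow> - p (- u) \<le> p u"
 using sublinear_add[of p u "- u"] sublinear_zero[of p] by simp

text \<open>The infimum of \<open>p (u + t x) - t p x\<close> over \<open>t \<ge> 0\<close> lowers
  \<open>p\<close> as far as the direction \<open>x\<close> allows while staying sublinear;
  \<open>t = 1\<close> at the vector \<open>- x\<close> gives the last bound.\<close>

lemma sublinear_reduce:
 assumes p: "sublinear p"
 obtains p' where "sublinear p'" "\<And>u. p' u \<le> p u" "p' (- x) \<le> - p x"
proof -
 let ?h = "\<lambda>u t. p (u + s (of_real t) x) - t * p x"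
 define p' where "p' u = Inf (?h u ` {0..})" for u
 have low: "- p (- u) \<le> ?h u t" if "t \<ge> 0" for u t
  using sublinear_add[OF p, of "u + s (of_real t) x" "- u"] sublinear_scale0[OF p that, of x] by simp
 have le: "p' u \<le> ?h u t" if "t \<ge> 0" for u t
  unfolding p'_def using that low by (intro cInf_lower bdd_belowI2) auto
 have ge: "c \<le> p' u" if "\<And>t. t \<ge> 0 \<Longrightarrow> c \<le> ?h u t" for u c
  unfolding p'_def using that by (intro cInf_greatest) auto
 have "sublinear p'" unfolding sublinear_def
 proof (intro conjI allI impI)
  fix u v
  have "p' (u + v) - p' u \<le> p' v"
  proof (rule ge)
   fix t :: real assume t: "t \<ge> 0"
   have "p' (u + v) - ?h v t \<le> p' u"
   proof (rule ge)
    fix r :: real assume r: "r \<ge> 0"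
    have e: "u + v + s (of_real (r + t)) x = (u + s (of_real r) x) + (v + s (of_real t) x)"
     by (simp add: scale_left_distrib)
    have "p' (u + v) \<le> ?h (u + v) (r + t)" using r t by (intro le) simp
    from this[unfolded e distrib_right] show "p' (u + v) - ?h v t \<le> ?h u r"
     using sublinear_add[OF p, of "u + s (of_real r) x" "v + s (of_real t) x"] by linarith
   qed
   then show "p' (u + v) - p' u \<le> ?h v t" by simp
  qed
  then show "p' (u + v) \<le> p' u + p' v" by simp
 next
  fix r :: real and u assume r: "r > 0"
  have "p' (s (of_real r) u) / r \<le> p' u"
  proof (rule ge)
   fix t :: real assume t: "t \<ge> 0"
   have "p' (s (of_real r) u) \<le> ?h (s (of_real r) u) (r * t)" using r t by (intro le) simp
   moreover have "s (of_real r) u + s (of_real (r * t)) x = s (of_real r) (u + s (of_real t) x)"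
    by (simp add: scale_right_distrib)
   ultimately have "p' (s (of_real r) u) \<le> r * ?h u t"
    using sublinear_scale[OF p r, of "u + s (of_real t) x"] by (simp add: right_diff_distrib)
   then show "p' (s (of_real r) u) / r \<le> ?h u t" using r by (simp add: divide_le_eq mult.commute)
  qed
  then show "p' (s (of_real r) u) \<le> r * p' u" using r by (simp add: divide_le_eq mult.commute)
 qed
 moreover have "p' u \<le> p u" for u using le[of 0 u] by simp
 moreover have "p' (- x) \<le> - p x" using le[of 1 "- x"] sublinear_zero[OF p] by simp
 ultimately show ?thesis by (rule that)
qed

text \<open>Zorn's lemma downwards. The pointwise infimum of a chain is finite because every member
  is at least \<open>- q (- u)\<close> at \<open>u\<close>.\<close>

lemma minimal_sublinear:
 assumes q: "sublinear q"
 obtains p where "sublinear p" "p \<le> q" "\<And>p'. sublinear p' \<Longrightarrow> p' \<le> p \<Longrightarrow> p' = p"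
proof -
 define A where "A = {p. sublinear p \<and> p \<le> q}"
 let ?P = "\<lambda>a b :: 'v \<Rightarrow> real. b \<le> a"
 have "\<exists>m\<in>A. \<forall>a\<in>A. ?P m a \<longrightarrow> a = m"
 proof (rule predicate_Zorn)
  show "partial_order_on A (relation_of ?P A)" by (rule partial_order_on_relation_ofI) auto
  fix C assume "C \<in> Chains (relation_of ?P A)"
  then have C: "C \<subseteq> A" "\<And>a b. a \<in> C \<Longrightarrow> b \<in> C \<Longrightarrow> a \<le> b \<or> b \<le> a"
   by (auto simp: Chains_def relation_of_def)
  show "\<exists>u\<in>A. \<forall>a\<in>C. u \<le> a"
  proof (cases "C = {}")
   case True
   then show ?thesis using q by (auto simp: A_def)
  next
   case False
   have sub: "sublinear a" "a u \<le> q u" if "a \<in> C" for a u using C(1) that by (auto simp: A_def le_fun_def)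
   define m where "m u = (INF p\<in>C. p u)" for u
   have le: "m u \<le> a u" if "a \<in> C" for a u unfolding m_def
   proof (rule cINF_lower[OF _ that])
    show "bdd_below ((\<lambda>p. p u) ` C)"
    proof (rule bdd_belowI2)
     fix p assume p: "p \<in> C"
     show "- q (- u) \<le> p u" using sublinear_neg[OF sub(1)[OF p], of u] sub(2)[OF p, of "- u"] by linarith
    qed
   qed
   have ge: "c \<le> m u" if "\<And>a. a \<in> C \<Longrightarrow> c \<le> a u" for c u
    unfolding m_def using False that by (intro cINF_greatest) auto
   have "sublinear m" unfolding sublinear_def
   proof (intro conjI allI impI)
    fix u v
    have "m (u + v) - m u \<le> m v"
    proof (rule ge)
     fix b assume b: "b \<in> C"
     have "m (u + v) - b v \<le> m u"
     proof (rule ge)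
      fix a assume a: "a \<in> C"
      \<comment> \<open>The chain supplies one member below both \<open>a\<close> and
        \<open>b\<close>; its subadditivity yields that of the infimum.\<close>
      obtain c where c: "c \<in> C" "c \<le> a" "c \<le> b" using C(2)[OF a b] a b by auto
      have "m (u + v) \<le> c u + c v" using le[OF c(1), of "u + v"] sublinear_add[OF sub(1)[OF c(1)], of u v] by linarith
      then show "m (u + v) - b v \<le> a u" using le_funD[OF c(2), of u] le_funD[OF c(3), of v] by linarith
     qed
     then show "m (u + v) - m u \<le> b v" by simp
    qed
    then show "m (u + v) \<le> m u + m v" by simp
   next
    fix r :: real and u assume r: "r > 0"
    have "m (s (of_real r) u) / r \<le> m u"
    proof (rule ge)
     fix a assume a: "a \<in> C"
     have "m (s (of_real r) u) \<le> r * a u" using le[OF a, of "s (of_real r) u"] sublinear_scale[OF sub(1)[OF a] r] by simp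
     then show "m (s (of_real r) u) / r \<le> a u" using r by (simp add: divide_le_eq mult.commute)
    qed
    then show "m (s (of_real r) u) \<le> r * m u" using r by (simp add: divide_le_eq mult.commute)
   qed
   moreover have "m \<le> q"
   proof -
    obtain a where a: "a \<in> C" using False by blast
    show ?thesis using order_trans[OF le[OF a] sub(2)[OF a]] by (simp add: le_fun_def)
   qed
   ultimately have "m \<in> A" by (simp add: A_def)
   then show ?thesis using le by (auto simp: le_fun_def)
  qed
 qed
 then obtain m where m: "m \<in> A" "\<And>a. a \<in> A \<Longrightarrow> a \<le> m \<Longrightarrow> a = m" by blast
 show ?thesis
 proof (rule that[of m])
  show "p' = m" if p': "sublinear p'" "p' \<le> m" for p' using m p' by (auto simp: A_def)
 qed (use m(1) in \<open>auto simp: A_def\<close>)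
qed

text \<open>A minimal sublinear functional is linear, since reducing it changes nothing.\<close>

lemma hahn_banach:
 assumes q: "sublinear q"
 obtains l where "\<And>u w. l (u + w) = l u + l w" "\<And>r u. l (s (of_real r) u) = r * l u"
  "\<And>u. l u \<le> q u" "q v \<le> l v"
proof -
 \<comment> \<open>Reducing first along \<open>v\<close> forces every linear functional below
   \<open>q'\<close> to take at least the value \<open>q v\<close> at \<open>v\<close>.\<close>
 obtain q' where q': "sublinear q'" "\<And>u. q' u \<le> q u" "q' (- v) \<le> - q v" by (rule sublinear_reduce[OF q, of v], rule that)
 obtain m where m: "sublinear m" "m \<le> q'" "\<And>p'. sublinear p' \<Longrightarrow> p' \<le> m \<Longrightarrow> p' = m" by (rule minimal_sublinear[OF q'(1)], rule that)
 have neg: "m (- x) = - m x" for x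
 proof -
  obtain p where p: "sublinear p" "\<And>u. p u \<le> m u" "p (- x) \<le> - m x" by (rule sublinear_reduce[OF m(1), of x], rule that)
  have "p = m" using p by (intro m(3)) (auto simp: le_fun_def)
  then show ?thesis using p(3) sublinear_neg[OF m(1), of x] by simp
 qed
 show ?thesis
 proof (rule that[of m])
  show "m (u + w) = m u + m w" for u w
   using sublinear_add[OF m(1), of u w] sublinear_add[OF m(1), of "- u" "- w"] neg[of "u + w"] neg[of u] neg[of w] by simp
  show "m (s (of_real r) u) = r * m u" for r u
  proof (cases "r \<ge> 0")
   case True
   then show ?thesis by (rule sublinear_scale0[OF m(1)])
  next
   case False
   then have "m (s (of_real (- r)) u) = - r * m u" by (intro sublinear_scale0[OF m(1)]) simp
   then show ?thesis using neg[of "s (of_real r) u"] by simp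
  qed
  show "m u \<le> q u" for u using m(2) q'(2) by (meson le_funD order_trans)
  show "q v \<le> m v" using le_funD[OF m(2), of "- v"] q'(3) neg[of v] by simp
 qed
qed

text \<open>The Minkowski gauge of \<open>V + M\<close>: adding the subspace \<open>M\<close> pushes
  the gauge on \<open>M\<close> down to 0, and \<open>v\<close> outside \<open>V + M\<close> keeps
  it at least 1 at \<open>v\<close>.\<close>

lemma gauge_functional:
 assumes V: "0 \<in> V" "\<And>u. \<exists>t>0. s (of_real (1 / t)) u \<in> V"
  and conv: "\<And>u w r. u \<in> V \<Longrightarrow> w \<in> V \<Longrightarrow> r \<in> {0..1} \<Longrightarrow> s (of_real r) u + s (of_real (1 - r)) w \<in> V"
  and M: "0 \<in> M" "\<And>u w. u \<in> M \<Longrightarrow> w \<in> M \<Longrightarrow> u + w \<in> M" "\<And>c u. u \<in> M \<Longrightarrow> s c u \<in> M"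
  and v: "\<And>w m. w \<in> V \<Longrightarrow> m \<in> M \<Longrightarrow> v \<noteq> w + m"
 obtains q where "sublinear q" "\<And>u. u \<in> V \<Longrightarrow> q u \<le> 1" "\<And>u. u \<in> M \<Longrightarrow> q u \<le> 0" "1 \<le> q v"
proof -
 define G where "G u = {t. t > 0 \<and> (\<exists>w\<in>V. \<exists>m\<in>M. u = s (of_real t) w + m)}" for u
 define q where "q u = Inf (G u)" for u
 have ne: "G u \<noteq> {}" for u
 proof -
  obtain t where t: "t > 0" "s (of_real (1 / t)) u \<in> V" using V(2) by blast
  have "u = s (of_real t) (s (of_real (1 / t)) u) + 0" using t(1) by simp
  then show ?thesis unfolding G_def using t M(1) by blast
 qed
 have le: "q u \<le> t" if "t \<in> G u" for u t
  unfolding q_def by (rule cInf_lower[OF that]) (auto simp: G_def intro!: bdd_belowI[of _ 0])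
 have ge: "c \<le> q u" if "\<And>t. t \<in> G u \<Longrightarrow> c \<le> t" for u c
  unfolding q_def using that ne by (intro cInf_greatest) auto
 have G_add: "t + r \<in> G (u + w)" if tr: "t \<in> G u" "r \<in> G w" for t r u w
 proof -
  obtain x m y n where x: "t > 0" "x \<in> V" "m \<in> M" "u = s (of_real t) x + m" and y: "r > 0" "y \<in> V" "n \<in> M" "w = s (of_real r) y + n"
   using tr by (auto simp: G_def)
  \<comment> \<open>The weights \<open>t / (t + r)\<close> and \<open>r / (t + r)\<close> are chosen
    so that \<open>?z\<close> scaled by \<open>t + r\<close> is the sum of the two scaled
    vectors.\<close>
  let ?z = "s (of_real (t / (t + r))) x + s (of_real (1 - t / (t + r))) y"
  have z: "?z \<in> V" using x y by (intro conv) auto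
  have a: "(t + r) * (t / (t + r)) = t" "(t + r) * (1 - t / (t + r)) = r" using x(1) y(1) by (auto simp: field_simps)
  have "s (of_real (t + r)) ?z = s (of_real t) x + s (of_real r) y"
   unfolding scale_right_distrib scale_scale of_real_mult[symmetric] a ..
  then have "u + w = s (of_real (t + r)) ?z + (m + n)" using x y by (simp add: algebra_simps)
  then show ?thesis unfolding G_def using x(1) y(1) z M(2)[OF x(3) y(3)] by auto
 qed
 have G_scale: "r * t \<in> G (s (of_real r) u)" if r: "r > 0" and t: "t \<in> G u" for r t u
 proof -
  obtain x m where x: "t > 0" "x \<in> V" "m \<in> M" "u = s (of_real t) x + m" using t by (auto simp: G_def)
  have "s (of_real r) u = s (of_real (r * t)) x + s (of_real r) m" by (simp add: x(4) scale_right_distrib)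
  then show ?thesis unfolding G_def using x r M(3)[OF x(3)] by auto
 qed
 have "sublinear q" unfolding sublinear_def
 proof (intro conjI allI impI)
  fix u w
  have "q (u + w) - q u \<le> q w"
  proof (rule ge)
   fix r assume r: "r \<in> G w"
   have "q (u + w) - r \<le> q u"
   proof (rule ge)
    fix t assume "t \<in> G u"
    from le[OF G_add[OF this r]] show "q (u + w) - r \<le> t" by simp
   qed
   then show "q (u + w) - q u \<le> r" by simp
  qed
  then show "q (u + w) \<le> q u + q w" by simp
 next
  fix r :: real and u assume r: "r > 0"
  have "q (s (of_real r) u) / r \<le> q u"
  proof (rule ge)
   fix t assume "t \<in> G u"
   from le[OF G_scale[OF r this]] show "q (s (of_real r) u) / r \<le> t" using r by (simp add: divide_le_eq mult.commute)
  qed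
  then show "q (s (of_real r) u) \<le> r * q u" using r by (simp add: divide_le_eq mult.commute)
 qed
 moreover have "q u \<le> 1" if "u \<in> V" for u
 proof (rule le)
  have "\<exists>w\<in>V. \<exists>m\<in>M. u = s (of_real 1) w + m"
   using that M(1) by (intro bexI[of _ u] bexI[of _ 0]) auto
  then show "1 \<in> G u" by (simp add: G_def)
 qed
 moreover have "q u \<le> 0" if "u \<in> M" for u
 proof (rule field_le_epsilon)
  fix e :: real assume e: "e > 0"
  have "u = s (of_real e) 0 + u" by simp
  then have "e \<in> G u" unfolding G_def using e that V(1) by blast
  then show "q u \<le> 0 + e" using le by simp
 qed
 moreover have "1 \<le> q v"
 proof (rule ge, rule ccontr)
  fix t assume t: "t \<in> G v" "\<not> 1 \<le> t"
  then obtain w m where w: "t > 0" "w \<in> V" "m \<in> M" "v = s (of_real t) w + m" by (auto simp: G_def)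
  have "s (of_real t) w + s (of_real (1 - t)) 0 \<in> V" using w t V(1) by (intro conv) auto
  then show False using v[of "s (of_real t) w" m] w by simp
 qed
 ultimately show ?thesis by (rule that)
qed

text \<open>The imaginary part of a complex linear functional is determined by its real part, since
  the value at \<open>s \<i> u\<close> must be \<open>\<i>\<close> times the value at
  \<open>u\<close>.\<close>

lemma complexify:
 assumes l: "\<And>u w. l (u + w) = l u + l w" "\<And>r u. l (s (of_real r) u) = r * l u"
 defines "k \<equiv> \<lambda>u. Complex (l u) (- l (s \<i> u))"
 shows "k (u + w) = k u + k w" "k (s c u) = c * k u"
proof -
 show "k (u + w) = k u + k w" by (simp add: k_def complex_eq_iff l scale_right_distrib)
 have e: "s c u = s (of_real (Re c)) u + s (of_real (Im c)) (s \<i> u)"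
  unfolding scale_scale scale_left_distrib[symmetric] by (rule arg_cong[where f = "\<lambda>c. s c u"]) (simp add: complex_eq_iff)
 have e1: "l (s c u) = Re c * l u + Im c * l (s \<i> u)" by (simp only: e l)
 have "s \<i> (s c u) = s (of_real (Re c)) (s \<i> u) + s (of_real (- Im c)) u"
  unfolding scale_scale scale_left_distrib[symmetric] by (rule arg_cong[where f = "\<lambda>c. s c u"]) (simp add: complex_eq_iff)
 then have e2: "l (s \<i> (s c u)) = Re c * l (s \<i> u) + - Im c * l u" by (simp only: l)
 show "k (s c u) = c * k u" unfolding k_def e1 e2 by (simp add: complex_eq_iff algebra_simps)
qed

end

section \<open>Separation of vectors from closures of subspaces\<close>

context wightman_cft
begin

lemma separation:
 assumes M: "0 \<in> M" "\<And>u w. u \<in> M \<Longrightarrow> w \<in> M \<Longrightarrow> u + w \<in> M" "\<And>c u. u \<in> M \<Longrightarrow> s c u \<in> M"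
  and v: "v \<notin> \<T> closure_of M"
 obtains l where "Lf l" "\<And>m. m \<in> M \<Longrightarrow> l m = 0" "l v \<noteq> 0"
proof -
 interpret cv: complex_vector_space s by unfold_locales
 let ?T = "\<T>"
 obtain W0 where W0: "openin ?T W0" "v \<in> W0" "W0 \<inter> M = {}" using v by (auto simp: in_closure_of)
 have idc: "continuous_map ?T ?T (\<lambda>w. w)" by simp
 have sc: "continuous_map ?T ?T (s c)" for c using strong_map_scale[OF idc, of c] by simp
 have pre: "openin ?T {w. h w \<in> W}" if "continuous_map ?T ?T h" "openin ?T W" for h W
  using openin_continuous_map_preimage[OF that] by simp
 \<comment> \<open>The aim is a convex \<open>V\<close> with \<open>v - w\<close> in
   \<open>W0\<close>, hence outside \<open>M\<close>, for all \<open>w\<close> in \<open>V\<close>: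
   then \<open>v\<close> is not in \<open>V + M\<close>.\<close>
 have "continuous_map ?T ?T (\<lambda>w. v + s (-1) w)" by (intro strong_map_add sc) simp
 from pre[OF this W0(1)] have W1: "openin ?T {w. v + s (-1) w \<in> W0}" .
 moreover have "0 \<in> {w. v + s (-1) w \<in> W0}" using W0(2) by simp
 ultimately obtain V where V: "V \<subseteq> {w. v + s (-1) w \<in> W0}" "openin ?T V" "0 \<in> V"
   "\<forall>u\<in>V. \<forall>w\<in>V. \<forall>r\<in>{0..1::real}. s (of_real r) u + s (of_real (1 - r)) w \<in> V"
  using strong_topology_finest(1)[of s F] unfolding locally_convex_topology_def by meson
 obtain q where q: "cv.sublinear q" "\<And>u. u \<in> V \<Longrightarrow> q u \<le> 1" "\<And>u. u \<in> M \<Longrightarrow> q u \<le> 0" "1 \<le> q v"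
 proof (rule cv.gauge_functional[OF V(3) _ _ M])
  fix u
  have "continuous_map euclidean ?T (\<lambda>c::complex. s c u)"
  proof -
   have "continuous_map euclidean (prod_topology euclidean ?T) (\<lambda>c::complex. (c, u))"
    by (intro continuous_map_pairedI) auto
   from continuous_map_compose[OF this strong_scale] show ?thesis by (simp add: o_def)
  qed
  from openin_continuous_map_preimage[OF this V(2)] have "open {c. s c u \<in> V}" by simp
  moreover have "0 \<in> {c. s c u \<in> V}" using V(3) by simp
  ultimately obtain e where e: "e > 0" "ball 0 e \<subseteq> {c. s c u \<in> V}" using open_contains_ball by blast
  have "complex_of_real (e / 2) \<in> ball 0 e" using e(1) by (simp del: of_real_divide)
  then have "of_real (e / 2) \<in> {c. s c u \<in> V}" using e(2) by blast
  then show "\<exists>t>0. s (of_real (1 / t)) u \<in> V" using e(1) by (intro exI[of _ "2 / e"]) simp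
 next
  show "v \<noteq> w + m" if wm: "w \<in> V" "m \<in> M" for w m
  proof
   assume "v = w + m"
   then have "v + s (-1) w = m" by simp
   then show False using V(1) W0(3) wm by blast
  qed
 qed (use V(4) in blast)+
 obtain l where l: "\<And>u w. l (u + w) = l u + l w" "\<And>r u. l (s (of_real r) u) = r * l u" "\<And>u. l u \<le> q u" "q v \<le> l v"
  by (rule cv.hahn_banach[OF q(1), of v], rule that)
 \<comment> \<open>The factor 1/2 normalises to the bound 1 of \<open>Lf_neighbourhood\<close>, as
   real and imaginary part are each bounded by 1.\<close>
 define k where "k u = (1 / 2) * Complex (l u) (- l (s \<i> u))" for u
 have neg: "l (s (-1) u) = - l u" for u using l(2)[of "-1" u] by simp
 have k: "lin k" unfolding lin_def k_def using cv.complexify[OF l(1,2)] by (simp add: distrib_left)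
 \<comment> \<open>On \<open>V\<close> the functional \<open>l\<close> is bounded from above only;
   the four multiples of \<open>u\<close> bound \<open>l u\<close> and \<open>l (s \<i> u)\<close>
   from both sides.\<close>
 let ?W = "{u. s 1 u \<in> V} \<inter> {u. s (-1) u \<in> V} \<inter> {u. s \<i> u \<in> V} \<inter> {u. s (-\<i>) u \<in> V}"
 have "Lf k"
 proof (rule Lf_neighbourhood[OF k])
  show "openin ?T ?W" by (intro openin_Int pre sc V(2))
  show "0 \<in> ?W" using V(3) by simp
  fix u assume u: "u \<in> ?W"
  have b: "l w \<le> 1" if "w \<in> V" for w using l(3)[of w] q(2)[OF that] by linarith
  have "\<bar>l u\<bar> \<le> 1" using b[of u] b[of "s (-1) u"] neg[of u] u by auto
  moreover have "\<bar>l (s \<i> u)\<bar> \<le> 1" using b[of "s \<i> u"] b[of "s (-\<i>) u"] neg[of "s \<i> u"] u by auto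
  ultimately have "norm (Complex (l u) (- l (s \<i> u))) \<le> 2"
   using cmod_le[of "Complex (l u) (- l (s \<i> u))"] by simp
  then show "norm (k u) \<le> 1" by (simp add: k_def norm_mult)
 qed
 moreover have "k m = 0" if m: "m \<in> M" for m
 proof -
  have "l w = 0" if w: "w \<in> M" for w
   using l(3)[of w] q(3)[OF w] l(3)[of "s (-1) w"] q(3)[OF M(3)[OF w, of "-1"]] neg[of w] by linarith
  then show ?thesis using m M(3)[OF m] by (simp add: k_def complex_eq_iff)
 qed
 moreover have "k v \<noteq> 0" using l(4) q(4) by (auto simp: k_def complex_eq_iff)
 ultimately show ?thesis by (rule that)
qed

end

section \<open>Density of the vacuum orbits and the axioms of the net\<close>

context involutive_wightman_cft
begin

text \<open>A vector outside the closure would be detected by a functional in \<open>Lf\<close> that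
  vanishes on the vacuum orbit of \<open>Q I\<close>, hence on that of \<open>\<P> I\<close>; by
  Reeh-Schlieder it is zero.\<close>

lemma Q_dense:
 assumes "interval I"
 shows "\<T> closure_of ((\<lambda>x. x \<Omega>) ` Q I) = UNIV"
proof (rule ccontr)
 let ?M = "(\<lambda>x. x \<Omega>) ` Q I"
 assume "\<T> closure_of ?M \<noteq> UNIV"
 then obtain v where v: "v \<notin> \<T> closure_of ?M" by blast
 have Q: "x \<in> Q I \<Longrightarrow> y \<in> Q I \<Longrightarrow> (\<lambda>v. x v + y v) \<in> Q I" "x \<in> Q I \<Longrightarrow> (\<lambda>v. s c (x v)) \<in> Q I" for x y c
  using Q_star_algebra[of I] by (simp_all add: unital_star_subalgebra_def)
 have inc: "\<P> I \<subseteq> Q I" unfolding Q_eq by (rule bicommutant_incl[OF local_EE])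
 have M1: "u + w \<in> ?M" if uw: "u \<in> ?M" "w \<in> ?M" for u w
 proof -
  obtain x y where "x \<in> Q I" "u = x \<Omega>" "y \<in> Q I" "w = y \<Omega>" using uw by blast
  then show ?thesis using Q(1)[of x y] by (intro rev_image_eqI[of "\<lambda>v. x v + y v"]) auto
 qed
 have M2: "s c u \<in> ?M" if u: "u \<in> ?M" for c u
 proof -
  obtain x where "x \<in> Q I" "u = x \<Omega>" using u by blast
  then show ?thesis using Q(2)[of x c] by (intro rev_image_eqI[of "\<lambda>v. s c (x v)"]) auto
 qed
 have "id \<in> Q I" using inc local_algebra.unit by blast
 then have "\<Omega> \<in> ?M" by (rule rev_image_eqI) simp
 from M2[OF this, of 0] have M0: "0 \<in> ?M" by simp
 obtain l where l: "Lf l" "\<And>m. m \<in> ?M \<Longrightarrow> l m = 0" "l v \<noteq> 0" by (rule separation[OF M0 M1 M2 v]) blast+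
 have "open I" "I \<noteq> {}" using assms by (auto simp: interval_def)
 from local_cyclic[OF this l(1)] have "l v = 0" using l(2) inc by blast
 then show False using l(3) by simp
qed

lemma Q_net: "mobius_covariant_net s \<T> B U \<Omega> Q"
 unfolding mobius_covariant_net_def
proof (intro conjI allI impI ballI)
 fix I \<gamma> assume "\<gamma> \<in> Mob"
 then show "(\<lambda>x. U \<gamma> \<circ> x \<circ> inv (U \<gamma>)) ` Q I = Q (\<gamma> ` I)"
  using Q_covariant[of \<gamma> I] by (simp add: conj_U_def[abs_def])
next
 fix I x y assume I: "interval I" and x: "x \<in> Q I" and y: "y \<in> Q (compl_interval I)"
 have "y \<in> commutant EE (Q I)" using y haag_Q[OF I] by simp
 then show "x \<circ> y = y \<circ> x" using x by (auto simp: commutant_def)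
qed (use Q_star_algebra Q_mono Q_dense vacuum_invariant in auto)

end

theorem theorem4:
  fixes s :: "complex \<Rightarrow> 'v::ab_group_add \<Rightarrow> 'v"
    and F :: "'v distribution set"
    and cdim :: "'v distribution \<Rightarrow> nat"
    and U :: "(circle \<Rightarrow> circle) \<Rightarrow> 'v \<Rightarrow> 'v"
    and \<Omega> :: 'v
    and B :: "'v \<Rightarrow> 'v \<Rightarrow> complex"
    and \<theta> :: "'v \<Rightarrow> 'v"
  assumes "involutive_wightman_cft s F cdim U \<Omega> B \<theta>"
  shows "mobius_covariant_net s (strong_topology s F) B U \<Omega> (bicommutant_net s F B) \<and>
    haag_dual s (strong_topology s F) B (bicommutant_net s F B)"
proof -
  interpret involutive_wightman_cft s F cdim U \<Omega> B \<theta> by (rule assms)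
  show ?thesis using Q_net haag_Q by (simp add: haag_dual_def)
qed

end
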